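(* Let $A$ be a commutative ring, let $\mathfrak{a}$ be a weakly proregular ideal in $A$, and define the rings $\widehat{A} := \Lambda_{\mathfrak a}(A)$ and $A_0 := A/\mathfrak{a}$. Let $M$ be a derived $\mathfrak{a}$-adically complete complex of $A$-modules, with $\operatorname{sup}(\operatorname{H}(M)) = i_0$ for some $i_0 \in \mathbb{Z}$. Suppose there is a number $r \in \mathbb{N}$ such that $\operatorname{H}^{i_0}(A_0 \otimes^{\mathrm{L}}_A M)$ is generated by $\leq r$ elements as an $A_0$-module. Then $\operatorname{H}^{i_0}(M)$ is generated by $\leq r$ elements as an $\widehat{A}$-module.
   Context: All rings are commutative. $\mathbb{N}$ includes $0$. $\mathsf{D}(A)$ is the (unbounded) derived category of $A$-modules. For a graded module $M=\bigoplus_i M^i$, $\operatorname{sup}(M):=\sup\{i\in\mathbb{Z}\mid M^i\ne 0\}$. Weak proregularity: for $a \in A$ let $\operatorname{K}(A;a)$ be the Koszul complex $0 \to A \xrightarrow{a\cdot(-)} A \to 0$ concentrated in degrees $-1$ and $0$. For a finite sequence $\boldsymbol{a}=(a_1,\ldots,a_p)$ in $A$, $p \ge 1$, let $\operatorname{K}(A;\boldsymbol{a}) := \operatorname{K}(A;a_1)\otimes_A\cdots\otimes_A \operatorname{K}(A;a_p)$, and $\boldsymbol{a}^j := (a_1^j,\ldots,a_p^j)$. For $j_1\ge j_0\ge 1$ there is a homomorphism of complexes $\operatorname{K}(A;\boldsymbol{a}^{j_1})\to \operatorname{K}(A;\boldsymbol{a}^{j_0})$, the tensor product over $i$ of the homomorphisms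 $\operatorname{K}(A;a_i^{j_1})\to \operatorname{K}(A;a_i^{j_0})$ that are the identity in degree $0$ and multiplication by $a_i^{j_1-j_0}$ in degree $-1$. An inverse system of modules $\{N_j\}$ is pro-zero if for every $j_0$ there is $j_1\ge j_0$ such that $N_{j_1}\to N_{j_0}$ is zero. The sequence $\boldsymbol{a}$ is weakly proregular if for every $i\le -1$ the inverse system $\{\operatorname{H}^i(\operatorname{K}(A;\boldsymbol{a}^j))\}_{j\ge 1}$ is pro-zero. An ideal is weakly proregular if it is generated by some (finite) weakly proregular sequence. Completion: $\Lambda_{\mathfrak a}(M) := \lim_{\leftarrow k} (A/\mathfrak{a}^{k+1})\otimes_A M$ for an $A$-module $M$, with canonical homomorphism $\tau_M:M\to\Lambda_{\mathfrak a}(M)$, both extended degreewise to complexes; a module $M$ is $\mathfrak{a}$-adically complete if $\tau_M$ is an isomorphism, in which case it has a unique $\widehat{A}$-module structure extending its $A$-module structure. $\mathrm{L}\Lambda_{\mathfrak a}:\mathsf{D}(A)\to\mathsf{D}(A)$ is the left derived functor, computed by K-flat resolutions; there is a functorial morphism $\tau^{\mathrm L}_M : M\to\mathrm{L}\Lambda_{\mathfrak a}(M)$ in $\mathsf{D}(A)$: for a quasi-isomorphism $\rho:Q\to M$ from a K-flat complex $Q$, $\mathrm{L}\Lambda_{\mathfrak a}(M)\cong\Lambda_{\mathfrak a}(Q)$ and $\tau^{\mathrm L}_M$ is $\tau_Q\circ\rho^{-1}$. $M\in\mathsf{D}(A)$ is derived $\mathfrak{a}$-adically complete if $\tau^{\mathrm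 L}_M$ is an isomorphism. The $\widehat{A}$-module structure on $\operatorname{H}^i(M)$: for a derived $\mathfrak{a}$-adically complete complex $M$, there is an isomorphism $M\cong P$ in $\mathsf{D}(A)$ with $P=\Lambda_{\mathfrak a}(P')$ and $P'$ a semi-free complex of $A$-modules (one having a filtration by subcomplexes $0=F_{-1}\subseteq F_0\subseteq\cdots$ with union $P'$ and each $F_j/F_{j-1}$ a complex of free modules with zero differential); since $P$ is a complex of $\widehat{A}$-modules, $\operatorname{H}^i(M)\cong\operatorname{H}^i(P)$ is an $\widehat{A}$-module. *)

theory Defs
  imports "HOL-Algebra.Module" "HOL-Algebra.QuotRing" "HOL-Algebra.Ideal_Product"
    "HOL-Library.Extended_Real"
begin

section \<open>Modules\<close>

text \<open>The record of modules in the library extends the record of rings; its multiplication and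
  unit are irrelevant and left undefined.\<close>

definition module_of :: "'m set \<Rightarrow> ('m \<Rightarrow> 'm \<Rightarrow> 'm) \<Rightarrow> 'm \<Rightarrow> ('a \<Rightarrow> 'm \<Rightarrow> 'm) \<Rightarrow> ('a, 'm) module"
  where "module_of S pls zr scl =
    \<lparr>carrier = S, monoid.mult = undefined, one = undefined, ring.zero = zr, ring.add = pls, module.smult = scl\<rparr>"

definition mod_hom :: "'a ring \<Rightarrow> ('a, 'm) module \<Rightarrow> ('a, 'n) module \<Rightarrow> ('m \<Rightarrow> 'n) set"
  where "mod_hom R M N = {f. f \<in> carrier M \<rightarrow> carrier N \<and>
    (\<forall>x\<in>carrier M. \<forall>y\<in>carrier M. f (x \<oplus>\<^bsub>M\<^esub> y) = f x \<oplus>\<^bsub>N\<^esub> f y) \<and>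
    (\<forall>r\<in>carrier R. \<forall>x\<in>carrier M. f (r \<odot>\<^bsub>M\<^esub> x) = r \<odot>\<^bsub>N\<^esub> f x)}"

definition gen_submodule :: "'a ring \<Rightarrow> ('a, 'm) module \<Rightarrow> 'm set \<Rightarrow> 'm set"
  where "gen_submodule R M S = \<Inter>{H. submodule H R M \<and> S \<subseteq> H}"

definition generated_by_le :: "'a ring \<Rightarrow> ('a, 'm) module \<Rightarrow> nat \<Rightarrow> bool"
  where "generated_by_le R M r \<longleftrightarrow>
    (\<exists>S \<subseteq> carrier M. finite S \<and> card S \<le> r \<and> gen_submodule R M S = carrier M)"

text \<open>If \<open>f\<close> is additive and maps the submodule \<open>H\<close> into \<open>K\<close>, then \<open>quot_map N K f\<close> is
  the map \<open>x + H \<mapsto> f x + K\<close>.\<close>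

definition quot_map :: "('n, 'z) ring_scheme \<Rightarrow> 'n set \<Rightarrow> ('m \<Rightarrow> 'n) \<Rightarrow> 'm set \<Rightarrow> 'n set"
  where "quot_map N K f X = (\<Union>x\<in>X. K +>\<^bsub>N\<^esub> f x)"

definition quot_module :: "('a, 'm) module \<Rightarrow> 'm set \<Rightarrow> ('a, 'm set) module"
  where "quot_module M H =
    module_of (a_rcosets\<^bsub>M\<^esub> H) (\<lambda>X Y. X <+>\<^bsub>M\<^esub> Y) H (\<lambda>r. quot_map M H (smult M r))"

definition dsum :: "'j set \<Rightarrow> ('j \<Rightarrow> ('a, 'm) module) \<Rightarrow> ('a, 'j \<Rightarrow> 'm) module"
  where "dsum J N = module_of
    {f \<in> (\<Pi>\<^sub>E j\<in>J. carrier (N j)). finite {j \<in> J. f j \<noteq> \<zero>\<^bsub>N j\<^esub>}}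
    (\<lambda>f g. \<lambda>j\<in>J. f j \<oplus>\<^bsub>N j\<^esub> g j) (\<lambda>j\<in>J. \<zero>\<^bsub>N j\<^esub>) (\<lambda>r f. \<lambda>j\<in>J. r \<odot>\<^bsub>N j\<^esub> f j)"

text \<open>Limit of the tower \<open>N 0 \<leftarrow> N 1 \<leftarrow> N 2 \<leftarrow> \<dots>\<close> with transition maps \<open>t k : N (k+1) \<rightarrow> N k\<close>.\<close>

definition inv_lim :: "(nat \<Rightarrow> ('a, 'm) module) \<Rightarrow> (nat \<Rightarrow> 'm \<Rightarrow> 'm) \<Rightarrow> ('a, nat \<Rightarrow> 'm) module"
  where "inv_lim N t = module_of
    {x. (\<forall>k. x k \<in> carrier (N k)) \<and> (\<forall>k. t k (x (Suc k)) = x k)}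
    (\<lambda>x y k. x k \<oplus>\<^bsub>N k\<^esub> y k) (\<lambda>k. \<zero>\<^bsub>N k\<^esub>) (\<lambda>r x k. r \<odot>\<^bsub>N k\<^esub> x k)"

subsection \<open>Free modules\<close>

definition free_module :: "'a ring \<Rightarrow> 's set \<Rightarrow> ('a, 's \<Rightarrow> 'a) module"
  where "free_module R S = module_of
    {f. (\<forall>s. f s \<in> carrier R) \<and> finite {s. f s \<noteq> \<zero>\<^bsub>R\<^esub>} \<and> {s. f s \<noteq> \<zero>\<^bsub>R\<^esub>} \<subseteq> S}
    (\<lambda>f g s. f s \<oplus>\<^bsub>R\<^esub> g s) (\<lambda>s. \<zero>\<^bsub>R\<^esub>) (\<lambda>r f s. r \<otimes>\<^bsub>R\<^esub> f s)"

definition free_gen :: "'a ring \<Rightarrow> 's \<Rightarrow> 's \<Rightarrow> 'a"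
  where "free_gen R s = (\<lambda>t. if t = s then \<one>\<^bsub>R\<^esub> else \<zero>\<^bsub>R\<^esub>)"

text \<open>The linear map between free modules that sends the generator \<open>s\<close> to the generator \<open>\<phi> s\<close>.\<close>

definition free_map :: "'a ring \<Rightarrow> ('s \<Rightarrow> 't) \<Rightarrow> ('s \<Rightarrow> 'a) \<Rightarrow> 't \<Rightarrow> 'a"
  where "free_map R \<phi> f = (\<lambda>t. \<Oplus>\<^bsub>R\<^esub>s\<in>{s. f s \<noteq> \<zero>\<^bsub>R\<^esub> \<and> \<phi> s = t}. f s)"

definition is_free :: "'a ring \<Rightarrow> ('a, 'm) module \<Rightarrow> bool"
  where "is_free R M \<longleftrightarrow> (\<exists>B \<subseteq> carrier M.
    bij_betw (\<lambda>f. \<Oplus>\<^bsub>M\<^esub>b\<in>{b. f b \<noteq> \<zero>\<^bsub>R\<^esub>}. f b \<odot>\<^bsub>M\<^esub> b) (carrier (free_module R B)) (carrier M))"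

subsection \<open>Tensor products\<close>

definition tensor_free :: "'a ring \<Rightarrow> ('a, 'm) module \<Rightarrow> ('a, 'n) module \<Rightarrow> ('a, 'm \<times> 'n \<Rightarrow> 'a) module"
  where "tensor_free R M N = free_module R (carrier M \<times> carrier N)"

definition tensor_rel :: "'a ring \<Rightarrow> ('a, 'm) module \<Rightarrow> ('a, 'n) module \<Rightarrow> ('m \<times> 'n \<Rightarrow> 'a) set"
  where "tensor_rel R M N =
    (let F = tensor_free R M N; e = (\<lambda>x y. free_gen R (x, y)) in
     gen_submodule R F
       ({e (x \<oplus>\<^bsub>M\<^esub> x') y \<ominus>\<^bsub>F\<^esub> (e x y \<oplus>\<^bsub>F\<^esub> e x' y) | x x' y.
           x \<in> carrier M \<and> x' \<in> carrier M \<and> y \<in> carrier N}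
      \<union> {e x (y \<oplus>\<^bsub>N\<^esub> y') \<ominus>\<^bsub>F\<^esub> (e x y \<oplus>\<^bsub>F\<^esub> e x y') | x y y'.
           x \<in> carrier M \<and> y \<in> carrier N \<and> y' \<in> carrier N}
      \<union> {e (r \<odot>\<^bsub>M\<^esub> x) y \<ominus>\<^bsub>F\<^esub> r \<odot>\<^bsub>F\<^esub> e x y | r x y.
           r \<in> carrier R \<and> x \<in> carrier M \<and> y \<in> carrier N}
      \<union> {e x (r \<odot>\<^bsub>N\<^esub> y) \<ominus>\<^bsub>F\<^esub> r \<odot>\<^bsub>F\<^esub> e x y | r x y.
           r \<in> carrier R \<and> x \<in> carrier M \<and> y \<in> carrier N}))"

definition tensor :: "'a ring \<Rightarrow> ('a, 'm) module \<Rightarrow> ('a, 'n) module \<Rightarrow> ('a, ('m \<times> 'n \<Rightarrow> 'a) set) module"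
  where "tensor R M N = quot_module (tensor_free R M N) (tensor_rel R M N)"

definition tensor_elt ::
    "'a ring \<Rightarrow> ('a, 'm) module \<Rightarrow> ('a, 'n) module \<Rightarrow> 'm \<Rightarrow> 'n \<Rightarrow> ('m \<times> 'n \<Rightarrow> 'a) set"
  where "tensor_elt R M N x y = tensor_rel R M N +>\<^bsub>tensor_free R M N\<^esub> free_gen R (x, y)"

text \<open>The homomorphism induced by \<open>f\<close> and \<open>g\<close>, where \<open>M\<close> and \<open>N\<close> are the target modules.\<close>

definition tensor_map :: "'a ring \<Rightarrow> ('a, 'm) module \<Rightarrow> ('a, 'n) module \<Rightarrow>
    ('k \<Rightarrow> 'm) \<Rightarrow> ('l \<Rightarrow> 'n) \<Rightarrow> ('k \<times> 'l \<Rightarrow> 'a) set \<Rightarrow> ('m \<times> 'n \<Rightarrow> 'a) set"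
  where "tensor_map R M N f g =
    quot_map (tensor_free R M N) (tensor_rel R M N) (free_map R (map_prod f g))"

text \<open>The tensor product of the finite family \<open>M 0, \<dots>, M (p-1)\<close>: an iterated binary tensor
  product would have a type depending on \<open>p\<close>.\<close>

definition mtensor_free ::
    "'a ring \<Rightarrow> nat \<Rightarrow> (nat \<Rightarrow> ('a, 'm) module) \<Rightarrow> ('a, (nat \<Rightarrow> 'm) \<Rightarrow> 'a) module"
  where "mtensor_free R p M = free_module R (\<Pi>\<^sub>E i\<in>{..<p}. carrier (M i))"

definition mtensor_rel :: "'a ring \<Rightarrow> nat \<Rightarrow> (nat \<Rightarrow> ('a, 'm) module) \<Rightarrow> ((nat \<Rightarrow> 'm) \<Rightarrow> 'a) set"
  where "mtensor_rel R p M =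
    (let F = mtensor_free R p M; e = free_gen R; X = (\<Pi>\<^sub>E i\<in>{..<p}. carrier (M i)) in
     gen_submodule R F
       ({e (x(i := u \<oplus>\<^bsub>M i\<^esub> v)) \<ominus>\<^bsub>F\<^esub> (e (x(i := u)) \<oplus>\<^bsub>F\<^esub> e (x(i := v))) | x i u v.
           x \<in> X \<and> i < p \<and> u \<in> carrier (M i) \<and> v \<in> carrier (M i)}
      \<union> {e (x(i := r \<odot>\<^bsub>M i\<^esub> u)) \<ominus>\<^bsub>F\<^esub> r \<odot>\<^bsub>F\<^esub> e (x(i := u)) | x i r u.
           x \<in> X \<and> i < p \<and> r \<in> carrier R \<and> u \<in> carrier (M i)}))"

definition mtensor ::
    "'a ring \<Rightarrow> nat \<Rightarrow> (nat \<Rightarrow> ('a, 'm) module) \<Rightarrow> ('a, ((nat \<Rightarrow> 'm) \<Rightarrow> 'a) set) module"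
  where "mtensor R p M = quot_module (mtensor_free R p M) (mtensor_rel R p M)"

definition mtensor_map :: "'a ring \<Rightarrow> nat \<Rightarrow> (nat \<Rightarrow> ('a, 'm) module) \<Rightarrow>
    (nat \<Rightarrow> 'k \<Rightarrow> 'm) \<Rightarrow> ((nat \<Rightarrow> 'k) \<Rightarrow> 'a) set \<Rightarrow> ((nat \<Rightarrow> 'm) \<Rightarrow> 'a) set"
  where "mtensor_map R p M f =
    quot_map (mtensor_free R p M) (mtensor_rel R p M) (free_map R (\<lambda>x. \<lambda>i\<in>{..<p}. f i (x i)))"

section \<open>Complexes\<close>

text \<open>Cohomological grading: \<open>dif C i : obj C i \<rightarrow> obj C (i+1)\<close>.\<close>

record ('a, 'm) cx =
  obj :: "int \<Rightarrow> ('a, 'm) module"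
  dif :: "int \<Rightarrow> 'm \<Rightarrow> 'm"

definition cochain_complex :: "'a ring \<Rightarrow> ('a, 'm) cx \<Rightarrow> bool"
  where "cochain_complex R C \<longleftrightarrow>
    (\<forall>i. Module.module R (obj C i) \<and> dif C i \<in> mod_hom R (obj C i) (obj C (i + 1)) \<and>
      (\<forall>x\<in>carrier (obj C i). dif C (i + 1) (dif C i x) = \<zero>\<^bsub>obj C (i + 2)\<^esub>))"

definition cocycles :: "('a, 'm) cx \<Rightarrow> int \<Rightarrow> 'm set"
  where "cocycles C i = {x \<in> carrier (obj C i). dif C i x = \<zero>\<^bsub>obj C (i + 1)\<^esub>}"

definition coboundaries :: "('a, 'm) cx \<Rightarrow> int \<Rightarrow> 'm set"
  where "coboundaries C i = dif C (i - 1) ` carrier (obj C (i - 1))"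

definition cohom :: "('a, 'm) cx \<Rightarrow> int \<Rightarrow> ('a, 'm set) module"
  where "cohom C i = quot_module ((obj C i)\<lparr>carrier := cocycles C i\<rparr>) (coboundaries C i)"

definition cohom_nonzero :: "('a, 'm) cx \<Rightarrow> int \<Rightarrow> bool"
  where "cohom_nonzero C i \<longleftrightarrow> carrier (cohom C i) \<noteq> {\<zero>\<^bsub>cohom C i\<^esub>}"

definition cohom_sup :: "('a, 'm) cx \<Rightarrow> ereal"
  where "cohom_sup C = (SUP i\<in>{i. cohom_nonzero C i}. ereal (of_int i))"

definition acyclic_cx :: "'a ring \<Rightarrow> ('a, 'm) cx \<Rightarrow> bool"
  where "acyclic_cx R C \<longleftrightarrow> cochain_complex R C \<and> (\<forall>i. \<not> cohom_nonzero C i)"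

definition chain_map :: "'a ring \<Rightarrow> ('a, 'm) cx \<Rightarrow> ('a, 'n) cx \<Rightarrow> (int \<Rightarrow> 'm \<Rightarrow> 'n) \<Rightarrow> bool"
  where "chain_map R C D f \<longleftrightarrow> (\<forall>i. f i \<in> mod_hom R (obj C i) (obj D i) \<and>
    (\<forall>x\<in>carrier (obj C i). f (i + 1) (dif C i x) = dif D i (f i x)))"

text \<open>The map induced on cohomology by a chain map with target \<open>D\<close>.\<close>

definition cohom_map :: "('a, 'n) cx \<Rightarrow> (int \<Rightarrow> 'm \<Rightarrow> 'n) \<Rightarrow> int \<Rightarrow> 'm set \<Rightarrow> 'n set"
  where "cohom_map D f i = quot_map (obj D i) (coboundaries D i) (f i)"

definition quasi_iso :: "'a ring \<Rightarrow> ('a, 'm) cx \<Rightarrow> ('a, 'n) cx \<Rightarrow> (int \<Rightarrow> 'm \<Rightarrow> 'n) \<Rightarrow> bool"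
  where "quasi_iso R C D f \<longleftrightarrow>
    cochain_complex R C \<and> cochain_complex R D \<and> chain_map R C D f \<and>
    (\<forall>i. bij_betw (cohom_map D f i) (carrier (cohom C i)) (carrier (cohom D i)))"

definition koszul_sign :: "('a, 'm) module \<Rightarrow> int \<Rightarrow> 'm \<Rightarrow> 'm"
  where "koszul_sign M n x = (if even n then x else \<ominus>\<^bsub>M\<^esub> x)"

text \<open>The component of degree \<open>n\<close> is the direct sum over \<open>p\<close> of \<open>C\<^sup>p \<otimes> D\<^sup>n\<^sup>-\<^sup>p\<close>, with
  \<open>d (x \<otimes> y) = d x \<otimes> y + (-1)\<^sup>p x \<otimes> d y\<close>.\<close>

definition tensor_cx ::
    "'a ring \<Rightarrow> ('a, 'm) cx \<Rightarrow> ('a, 'n) cx \<Rightarrow> ('a, int \<Rightarrow> ('m \<times> 'n \<Rightarrow> 'a) set) cx"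
  where "tensor_cx R C D =
    \<lparr>obj = (\<lambda>n. dsum UNIV (\<lambda>p. tensor R (obj C p) (obj D (n - p)))),
     dif = (\<lambda>n f p. let T = tensor R (obj C p) (obj D (n + 1 - p)) in
        tensor_map R (obj C p) (obj D (n + 1 - p)) (dif C (p - 1)) id (f (p - 1))
        \<oplus>\<^bsub>T\<^esub> koszul_sign T p
          (tensor_map R (obj C p) (obj D (n + 1 - p)) id (dif D (n - p)) (f p)))\<rparr>"

text \<open>The tensor product of the complexes \<open>C 0, \<dots>, C (p-1)\<close>. Its component of degree \<open>n\<close> is the
  direct sum over all multidegrees \<open>g\<close> of total degree \<open>n\<close>, and
  \<open>d (x 0 \<otimes> \<dots> \<otimes> x (p-1))\<close> is the sum over \<open>i\<close> of the elements
  \<open>x 0 \<otimes> \<dots> \<otimes> d (x i) \<otimes> \<dots> \<otimes> x (p-1)\<close> with sign \<open>(-1)^(g 0 + \<dots> + g (i-1))\<close>.\<close>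

definition multideg :: "nat \<Rightarrow> int \<Rightarrow> (nat \<Rightarrow> int) set"
  where "multideg p n = {g \<in> {..<p} \<rightarrow>\<^sub>E UNIV. (\<Sum>i<p. g i) = n}"

definition mtensor_cx ::
    "'a ring \<Rightarrow> nat \<Rightarrow> (nat \<Rightarrow> ('a, 'm) cx) \<Rightarrow> ('a, (nat \<Rightarrow> int) \<Rightarrow> ((nat \<Rightarrow> 'm) \<Rightarrow> 'a) set) cx"
  where "mtensor_cx R p C =
    \<lparr>obj = (\<lambda>n. dsum (multideg p n) (\<lambda>g. mtensor R p (\<lambda>i. obj (C i) (g i)))),
     dif = (\<lambda>n f. \<lambda>g\<in>multideg p (n + 1). let T = mtensor R p (\<lambda>l. obj (C l) (g l)) in
        \<Oplus>\<^bsub>T\<^esub>i\<in>{..<p}. koszul_sign T (\<Sum>l<i. g l)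
          (mtensor_map R p (\<lambda>l. obj (C l) (g l))
            (\<lambda>l. if l = i then dif (C i) (g i - 1) else id) (f (g(i := g i - 1)))))\<rparr>"

definition K_flat :: "'a ring \<Rightarrow> ('a, 'm) cx \<Rightarrow> bool"
  where \<comment> \<open>Every acyclic complex is a directed union of acyclic subcomplexes of cardinality at most
    \<open>max |A| \<aleph>\<^sub>0\<close>, so testing on complexes carried by the type \<open>'a list\<close> is no restriction.\<close>
  "K_flat A P \<longleftrightarrow> cochain_complex A P \<and>
    (\<forall>N :: ('a, 'a list) cx. acyclic_cx A N \<longrightarrow> acyclic_cx A (tensor_cx A P N))"

text \<open>The filtration \<open>0 = F\<^sub>-\<^sub>1 \<subseteq> F\<^sub>0 \<subseteq> \<dots>\<close> is indexed with a shift: \<open>F j\<close> below is \<open>F\<^sub>j\<^sub>-\<^sub>1\<close>.\<close>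

definition semi_free :: "'a ring \<Rightarrow> ('a, 'm) cx \<Rightarrow> bool"
  where "semi_free A P \<longleftrightarrow> cochain_complex A P \<and>
    (\<exists>F :: nat \<Rightarrow> int \<Rightarrow> 'm set.
      (\<forall>i. F 0 i = {\<zero>\<^bsub>obj P i\<^esub>}) \<and>
      (\<forall>i. (\<Union>j. F j i) = carrier (obj P i)) \<and>
      (\<forall>j i. submodule (F j i) A (obj P i)) \<and>
      (\<forall>j i. F j i \<subseteq> F (Suc j) i) \<and>
      (\<forall>j i. dif P i ` F j i \<subseteq> F j (i + 1)) \<and>
      (\<forall>j i. dif P i ` F (Suc j) i \<subseteq> F j (i + 1)) \<and>
      (\<forall>j i. is_free A (quot_module ((obj P i)\<lparr>carrier := F (Suc j) i\<rparr>) (F j i))))"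

section \<open>Weak proregularity\<close>

definition koszul1 :: "'a ring \<Rightarrow> 'a \<Rightarrow> ('a, 'a) cx"
  where "koszul1 A a =
    \<lparr>obj = (\<lambda>i. module_of (if i = -1 \<or> i = 0 then carrier A else {\<zero>\<^bsub>A\<^esub>}) (add A) \<zero>\<^bsub>A\<^esub> (mult A)),
     dif = (\<lambda>i x. if i = -1 then a \<otimes>\<^bsub>A\<^esub> x else \<zero>\<^bsub>A\<^esub>)\<rparr>"

definition koszul_pow ::
    "'a ring \<Rightarrow> 'a list \<Rightarrow> nat \<Rightarrow> ('a, (nat \<Rightarrow> int) \<Rightarrow> ((nat \<Rightarrow> 'a) \<Rightarrow> 'a) set) cx"
  where "koszul_pow A as j = mtensor_cx A (length as) (\<lambda>l. koszul1 A ((as ! l) [^]\<^bsub>A\<^esub> j))"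

definition koszul1_trans :: "'a ring \<Rightarrow> 'a \<Rightarrow> nat \<Rightarrow> nat \<Rightarrow> int \<Rightarrow> 'a \<Rightarrow> 'a"
  where "koszul1_trans A a j1 j0 i x = (if i = -1 then a [^]\<^bsub>A\<^esub> (j1 - j0) \<otimes>\<^bsub>A\<^esub> x else x)"

definition koszul_trans :: "'a ring \<Rightarrow> 'a list \<Rightarrow> nat \<Rightarrow> nat \<Rightarrow> int \<Rightarrow>
    ((nat \<Rightarrow> int) \<Rightarrow> ((nat \<Rightarrow> 'a) \<Rightarrow> 'a) set) \<Rightarrow> (nat \<Rightarrow> int) \<Rightarrow> ((nat \<Rightarrow> 'a) \<Rightarrow> 'a) set"
  where "koszul_trans A as j1 j0 n f = (\<lambda>g\<in>multideg (length as) n.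
    mtensor_map A (length as) (\<lambda>l. obj (koszul1 A ((as ! l) [^]\<^bsub>A\<^esub> j0)) (g l))
      (\<lambda>l. koszul1_trans A (as ! l) j1 j0 (g l)) (f g))"

definition weakly_proregular_seq :: "'a ring \<Rightarrow> 'a list \<Rightarrow> bool"
  where "weakly_proregular_seq A as \<longleftrightarrow> as \<noteq> [] \<and> set as \<subseteq> carrier A \<and>
    (\<forall>i \<le> -1. \<forall>j0 \<ge> 1. \<exists>j1 \<ge> j0. \<forall>X\<in>carrier (cohom (koszul_pow A as j1) i).
      cohom_map (koszul_pow A as j0) (koszul_trans A as j1 j0) i X
        = \<zero>\<^bsub>cohom (koszul_pow A as j0) i\<^esub>)"

definition weakly_proregular :: "'a ring \<Rightarrow> 'a set \<Rightarrow> bool"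
  where "weakly_proregular A I \<longleftrightarrow> (\<exists>as. weakly_proregular_seq A as \<and> I = Idl\<^bsub>A\<^esub> (set as))"

section \<open>Adic completion\<close>

definition quot_alg :: "'a ring \<Rightarrow> 'a set \<Rightarrow> ('a, 'a set) module"
  where "quot_alg A J = module_of (carrier (A Quot J)) (add (A Quot J)) \<zero>\<^bsub>A Quot J\<^esub>
    (\<lambda>r X. (J +>\<^bsub>A\<^esub> r) \<otimes>\<^bsub>A Quot J\<^esub> X)"

text \<open>\<open>(A/J) \<otimes>\<^sub>A M\<close> as a module over the ring \<open>A/J\<close>.\<close>

definition base_change :: "'a ring \<Rightarrow> 'a set \<Rightarrow> ('a, 'm) module \<Rightarrow> ('a set, ('a set \<times> 'm \<Rightarrow> 'a) set) module"
  where "base_change A J M = (let T = tensor A (quot_alg A J) M in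
    module_of (carrier T) (add T) \<zero>\<^bsub>T\<^esub>
      (\<lambda>b. tensor_map A (quot_alg A J) M (\<lambda>X. b \<otimes>\<^bsub>A Quot J\<^esub> X) id))"

definition base_change_cx ::
    "'a ring \<Rightarrow> 'a set \<Rightarrow> ('a, 'm) cx \<Rightarrow> ('a set, ('a set \<times> 'm \<Rightarrow> 'a) set) cx"
  where "base_change_cx A J C =
    \<lparr>obj = (\<lambda>i. base_change A J (obj C i)),
     dif = (\<lambda>i. tensor_map A (quot_alg A J) (obj C (i + 1)) id (dif C i))\<rparr>"

definition ipow :: "'a ring \<Rightarrow> 'a set \<Rightarrow> nat \<Rightarrow> 'a set"
  where "ipow A I k = I [^]\<^bsub>ideals_set A\<^esub> k"

definition Lam :: "'a ring \<Rightarrow> 'a set \<Rightarrow> ('a, 'm) module \<Rightarrow> ('a, nat \<Rightarrow> ('a set \<times> 'm \<Rightarrow> 'a) set) module"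
  where "Lam A I M = inv_lim
    (\<lambda>k. tensor A (quot_alg A (ipow A I (k + 1))) M)
    (\<lambda>k. tensor_map A (quot_alg A (ipow A I (k + 1))) M (quot_map A (ipow A I (k + 1)) id) id)"

definition tau :: "'a ring \<Rightarrow> 'a set \<Rightarrow> ('a, 'm) module \<Rightarrow> 'm \<Rightarrow> nat \<Rightarrow> ('a set \<times> 'm \<Rightarrow> 'a) set"
  where "tau A I M x = (\<lambda>k.
    tensor_elt A (quot_alg A (ipow A I (k + 1))) M \<one>\<^bsub>A Quot ipow A I (k + 1)\<^esub> x)"

definition Lam_map ::
    "'a ring \<Rightarrow> 'a set \<Rightarrow> ('a, 'n) module \<Rightarrow> ('m \<Rightarrow> 'n) \<Rightarrow>
     (nat \<Rightarrow> ('a set \<times> 'm \<Rightarrow> 'a) set) \<Rightarrow> nat \<Rightarrow> ('a set \<times> 'n \<Rightarrow> 'a) set"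
  where "Lam_map A I N f x = (\<lambda>k. tensor_map A (quot_alg A (ipow A I (k + 1))) N id f (x k))"

definition Lam_cx :: "'a ring \<Rightarrow> 'a set \<Rightarrow> ('a, 'm) cx \<Rightarrow> ('a, nat \<Rightarrow> ('a set \<times> 'm \<Rightarrow> 'a) set) cx"
  where "Lam_cx A I C =
    \<lparr>obj = (\<lambda>i. Lam A I (obj C i)), dif = (\<lambda>i. Lam_map A I (obj C (i + 1)) (dif C i))\<rparr>"

definition tau_cx ::
    "'a ring \<Rightarrow> 'a set \<Rightarrow> ('a, 'm) cx \<Rightarrow> int \<Rightarrow> 'm \<Rightarrow> nat \<Rightarrow> ('a set \<times> 'm \<Rightarrow> 'a) set"
  where "tau_cx A I C i = tau A I (obj C i)"

text \<open>The ring \<open>\<Lambda>(A)\<close>, with the canonical identification of \<open>(A/I\<^sup>k\<^sup>+\<^sup>1) \<otimes>\<^sub>A A\<close> with the quotient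
  ring \<open>A/I\<^sup>k\<^sup>+\<^sup>1\<close>.\<close>

definition hat_ring :: "'a ring \<Rightarrow> 'a set \<Rightarrow> (nat \<Rightarrow> 'a set) ring"
  where "hat_ring A I = (let Q = (\<lambda>k. A Quot ipow A I (k + 1)) in
    \<lparr>carrier = {x. (\<forall>k. x k \<in> carrier (Q k)) \<and>
                   (\<forall>k. quot_map A (ipow A I (k + 1)) id (x (Suc k)) = x k)},
     monoid.mult = (\<lambda>x y k. x k \<otimes>\<^bsub>Q k\<^esub> y k), one = (\<lambda>k. \<one>\<^bsub>Q k\<^esub>),
     ring.zero = (\<lambda>k. \<zero>\<^bsub>Q k\<^esub>), ring.add = (\<lambda>x y k. x k \<oplus>\<^bsub>Q k\<^esub> y k)\<rparr>)"

text \<open>\<open>\<Lambda>(M)\<close> and \<open>\<Lambda>(C)\<close> with scalars from \<open>hat_ring\<close>.\<close>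

definition Lam_hat ::
    "'a ring \<Rightarrow> 'a set \<Rightarrow> ('a, 'm) module \<Rightarrow> (nat \<Rightarrow> 'a set, nat \<Rightarrow> ('a set \<times> 'm \<Rightarrow> 'a) set) module"
  where "Lam_hat A I M = module_of (carrier (Lam A I M)) (add (Lam A I M)) \<zero>\<^bsub>Lam A I M\<^esub>
    (\<lambda>c x k. c k \<odot>\<^bsub>base_change A (ipow A I (k + 1)) M\<^esub> x k)"

definition Lam_hat_cx ::
    "'a ring \<Rightarrow> 'a set \<Rightarrow> ('a, 'm) cx \<Rightarrow> (nat \<Rightarrow> 'a set, nat \<Rightarrow> ('a set \<times> 'm \<Rightarrow> 'a) set) cx"
  where "Lam_hat_cx A I C =
    \<lparr>obj = (\<lambda>i. Lam_hat A I (obj C i)), dif = dif (Lam_cx A I C)\<rparr>"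

section \<open>Derived functors\<close>

definition K_flat_resolution ::
    "'a ring \<Rightarrow> ('a, 'q) cx \<Rightarrow> (int \<Rightarrow> 'q \<Rightarrow> 'm) \<Rightarrow> ('a, 'm) cx \<Rightarrow> bool"
  where "K_flat_resolution A Q \<rho> M \<longleftrightarrow> K_flat A Q \<and> quasi_iso A Q M \<rho>"

text \<open>The models \<open>(A/J) \<otimes>\<^sub>A Q\<close> of the derived tensor product of \<open>A/J\<close> and \<open>M\<close>, for all
  K-flat resolutions \<open>Q \<rightarrow> M\<close> carried by the type \<open>'q\<close>.\<close>

definition derived_base_change ::
    "'a ring \<Rightarrow> 'a set \<Rightarrow> ('a, 'm) cx \<Rightarrow> ('a set, ('a set \<times> 'q \<Rightarrow> 'a) set) cx set"
  where "derived_base_change A J M =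
    {base_change_cx A J Q | (Q :: ('a, 'q) cx) \<rho>. K_flat_resolution A Q \<rho> M}"

text \<open>The type \<open>('a + 'm) list\<close> has cardinality \<open>max |'a| |'m| \<aleph>\<^sub>0\<close>, hence it can carry a
  semi-free resolution of any complex carried by \<open>'m\<close>. Since \<open>\<tau>\<^sup>L\<close> is \<open>\<tau>\<^sub>Q \<circ> \<rho>\<^sup>-\<^sup>1\<close> for any K-flat
  resolution \<open>\<rho> : Q \<rightarrow> M\<close>, it is an isomorphism iff \<open>\<tau>\<^sub>Q\<close> is a quasi-isomorphism, and this does not
  depend on \<open>Q\<close>.\<close>

type_synonym ('a, 'm) resol_type = "('a + 'm) list"

definition derived_complete :: "'a ring \<Rightarrow> 'a set \<Rightarrow> ('a, 'm) cx \<Rightarrow> bool"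
  where "derived_complete A I M \<longleftrightarrow> cochain_complex A M \<and>
    (\<exists>(Q :: ('a, ('a, 'm) resol_type) cx) \<rho>.
      K_flat_resolution A Q \<rho> M \<and> quasi_iso A Q (Lam_cx A I Q) (tau_cx A I Q))"

text \<open>An isomorphism from \<open>M\<close> to \<open>N\<close> in the derived category, given as a roof of quasi-isomorphisms
  \<open>M \<leftarrow> T \<rightarrow> N\<close>, and the bijection that it induces on cohomology.\<close>

definition derived_iso :: "'a ring \<Rightarrow> ('a, 'm) cx \<Rightarrow> ('a, 'n) cx \<Rightarrow>
    ('a, 't) cx \<Rightarrow> (int \<Rightarrow> 't \<Rightarrow> 'm) \<Rightarrow> (int \<Rightarrow> 't \<Rightarrow> 'n) \<Rightarrow> bool"
  where "derived_iso A M N T f g \<longleftrightarrow> quasi_iso A T M f \<and> quasi_iso A T N g"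

definition roof_cohom_map :: "('a, 'm) cx \<Rightarrow> ('a, 'n) cx \<Rightarrow>
    ('a, 't) cx \<Rightarrow> (int \<Rightarrow> 't \<Rightarrow> 'm) \<Rightarrow> (int \<Rightarrow> 't \<Rightarrow> 'n) \<Rightarrow> int \<Rightarrow> 'm set \<Rightarrow> 'n set"
  where "roof_cohom_map M N T f g i X =
    cohom_map N g i (inv_into (carrier (cohom T i)) (cohom_map M f i) X)"

text \<open>The structures of a module over \<open>hat_ring\<close> on the cohomology of \<open>M\<close> that are transported along
  an isomorphism \<open>M \<cong> \<Lambda>(P)\<close> in the derived category with \<open>P\<close> semi-free. All choices of \<open>P\<close>
  and of the isomorphism are admitted (for derived complete \<open>M\<close> they give the same structure).\<close>

definition hat_cohom ::
    "'a ring \<Rightarrow> 'a set \<Rightarrow> ('a, 'm) cx \<Rightarrow> int \<Rightarrow> (nat \<Rightarrow> 'a set, 'm set) module set"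
  where "hat_cohom A I M i =
    {module_of (carrier (cohom M i)) (add (cohom M i)) \<zero>\<^bsub>cohom M i\<^esub>
       (\<lambda>c X. let \<theta> = roof_cohom_map M (Lam_cx A I P) T f g i in
          inv_into (carrier (cohom M i)) \<theta> (c \<odot>\<^bsub>cohom (Lam_hat_cx A I P) i\<^esub> \<theta> X))
     | (P :: ('a, ('a, 'm) resol_type) cx) (T :: ('a, ('a, 'm) resol_type) cx) f g.
       semi_free A P \<and> derived_iso A M (Lam_cx A I P) T f g}"

end

theory Submission
  imports Defs
begin

text \<open>
  The idea is to replace \<open>M\<close> by complexes of free modules that are zero above degree \<open>i\<^sub>0\<close>. In the top
  degree of such a complex every element is a cocycle, and generators can be found by Nakayama's
  lemma.

  Let \<open>Q \<rightarrow> M\<close> be a K-flat resolution. Since the cohomology of \<open>M\<close> vanishes above \<open>i\<^sub>0\<close>, there is a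
  quasi-isomorphism \<open>P \<rightarrow> Q\<close> with \<open>P\<close> free and zero above \<open>i\<^sub>0\<close> (\<open>free_resolution\<close>). Its cone remains exact
  when reduced modulo an ideal \<open>J\<close> (\<open>cone_exact_mod\<close>): the tensor product of the cone with any acyclic
  complex is exact, because \<open>Q\<close> is K-flat and \<open>P\<close> is bounded above and free; for an acyclic complex
  that consists of \<open>A/J\<close> and a free resolution of it, this yields exactness of the cone modulo \<open>J\<close>.
  This is applied to two kinds of ideals.

  For the powers of \<open>\<aa>\<close>, primitives modulo successive powers can be chosen compatibly
  (\<open>exact_mod_limit\<close>), so \<open>\<Lambda>(P) \<rightarrow> \<Lambda>(Q)\<close> is injective on cohomology. If \<open>\<tau>\<^sub>Q\<close> is a quasi-isomorphism, then
  so is \<open>\<tau>\<^sub>P\<close>, and \<open>P\<close> defines a structure over the completed ring on the cohomology of \<open>M\<close>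
  (\<open>hat_cohom_exists\<close>).

  For \<open>\<aa>\<close> itself, generators of the top cohomology of \<open>A\<^sub>0 \<otimes> Q\<close> lift to elements that generate \<open>P\<close> in
  degree \<open>i\<^sub>0\<close> modulo \<open>\<aa>\<close> and boundaries (\<open>generators_lift\<close>). Now let the structure on the cohomology be
  given by some semi-free complex, written \<open>C\<close> here, and a roof \<open>M \<leftarrow> T \<rightarrow> \<Lambda>(C)\<close>. If \<open>P\<close> is chosen as a resolution of
  the homotopy pullback of \<open>Q\<close> and \<open>T\<close> over \<open>M\<close>, then it comes with a quasi-isomorphism \<open>h : P \<rightarrow> \<Lambda>(C)\<close>, and
  every cocycle of \<open>\<Lambda>(C)\<close> in degree \<open>i\<^sub>0\<close> is \<open>h p\<close> up to a boundary. Successive approximation writes \<open>p\<close> modulo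
  higher and higher powers of \<open>\<aa>\<close> as a combination of the generators plus a boundary. Applying \<open>h\<close> makes
  these approximations converge in \<open>\<Lambda>(C)\<close>, with coefficients in the completed ring
  (\<open>completed_combination\<close>). Hence the images of the generators under \<open>h\<close> generate the cohomology over
  the completed ring (\<open>generated_hat\<close>).
\<close>

section \<open>Modules, homomorphisms and quotients\<close>

text \<open>This registers abelian groups with the method \<open>algebra\<close>, which then decides the identities between
  sums and differences that diagram chases produce.\<close>

lemmas (in abelian_group) abelian_group_simprules
  [algebra abelian_group "zero G" "add G" "a_inv G" "a_minus G"] =
  a_closed zero_closed a_inv_closed minus_closed a_assoc l_zero l_neg a_comm minus_eq
  r_zero r_neg r_neg2 r_neg1 minus_add minus_minus add.inv_one a_lcomm

lemma (in abelian_group) diff_zero [simp]: "x \<in> carrier G \<Longrightarrow> x \<ominus> \<zero> = x"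
  by (simp add: a_minus_def add.inv_one)

lemma (in abelian_group) neg_zero [simp]: "\<ominus> \<zero> = \<zero>"
  by (rule minus_equality) simp_all

lemma (in abelian_group) diff_self [simp]: "x \<in> carrier G \<Longrightarrow> x \<ominus> x = \<zero>"
  by (simp add: a_minus_def r_neg)

lemma (in abelian_group) diff_eq_zero_iff:
  "x \<in> carrier G \<Longrightarrow> y \<in> carrier G \<Longrightarrow> x \<ominus> y = \<zero> \<longleftrightarrow> x = y"
  by (metis a_minus_def add.inv_closed add.inv_inv minus_equality r_neg)

lemma module_of_simps [simp]:
  "carrier (module_of S p z s) = S" "ring.add (module_of S p z s) = p"
  "ring.zero (module_of S p z s) = z" "smult (module_of S p z s) = s"
  by (simp_all add: module_of_def)

lemma moduleD:
  assumes "Module.module R M"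
  shows module_cring: "cring R" and module_abelian_group: "abelian_group M"
  using assms by (auto simp: Module.module_def)

lemma mod_homI:
  assumes "\<And>x. x \<in> carrier M \<Longrightarrow> f x \<in> carrier N"
    and "\<And>x y. x \<in> carrier M \<Longrightarrow> y \<in> carrier M \<Longrightarrow> f (x \<oplus>\<^bsub>M\<^esub> y) = f x \<oplus>\<^bsub>N\<^esub> f y"
    and "\<And>r x. r \<in> carrier R \<Longrightarrow> x \<in> carrier M \<Longrightarrow> f (r \<odot>\<^bsub>M\<^esub> x) = r \<odot>\<^bsub>N\<^esub> f x"
  shows "f \<in> mod_hom R M N"
  using assms by (auto simp: mod_hom_def)

lemma mod_hom_closed: "f \<in> mod_hom R M N \<Longrightarrow> x \<in> carrier M \<Longrightarrow> f x \<in> carrier N"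
  by (auto simp: mod_hom_def)

lemma mod_hom_add: "f \<in> mod_hom R M N \<Longrightarrow> x \<in> carrier M \<Longrightarrow> y \<in> carrier M \<Longrightarrow>
    f (x \<oplus>\<^bsub>M\<^esub> y) = f x \<oplus>\<^bsub>N\<^esub> f y"
  by (auto simp: mod_hom_def)

lemma mod_hom_smult: "f \<in> mod_hom R M N \<Longrightarrow> r \<in> carrier R \<Longrightarrow> x \<in> carrier M \<Longrightarrow>
    f (r \<odot>\<^bsub>M\<^esub> x) = r \<odot>\<^bsub>N\<^esub> f x"
  by (auto simp: mod_hom_def)

lemma additive_zero:
  assumes "abelian_group M" "abelian_group N" "f \<in> carrier M \<rightarrow> carrier N"
    "\<And>x y. x \<in> carrier M \<Longrightarrow> y \<in> carrier M \<Longrightarrow> f (x \<oplus>\<^bsub>M\<^esub> y) = f x \<oplus>\<^bsub>N\<^esub> f y"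
  shows "f \<zero>\<^bsub>M\<^esub> = \<zero>\<^bsub>N\<^esub>"
proof -
  interpret M: abelian_group M by fact
  interpret N: abelian_group N by fact
  have c: "f \<zero>\<^bsub>M\<^esub> \<in> carrier N" using assms by auto
  have "f \<zero>\<^bsub>M\<^esub> \<oplus>\<^bsub>N\<^esub> f \<zero>\<^bsub>M\<^esub> = f \<zero>\<^bsub>M\<^esub>" using assms(4)[of "\<zero>\<^bsub>M\<^esub>" "\<zero>\<^bsub>M\<^esub>"] by simp
  with c show ?thesis by (metis N.add.l_cancel_one')
qed

lemma mod_hom_zero:
  assumes "f \<in> mod_hom R M N" "Module.module R M" "Module.module R N"
  shows "f \<zero>\<^bsub>M\<^esub> = \<zero>\<^bsub>N\<^esub>"
  by (rule additive_zero) (use assms in \<open>auto simp: mod_hom_def dest: moduleD\<close>)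

lemma mod_hom_neg:
  assumes "f \<in> mod_hom R M N" "Module.module R M" "Module.module R N" "x \<in> carrier M"
  shows "f (\<ominus>\<^bsub>M\<^esub> x) = \<ominus>\<^bsub>N\<^esub> f x"
proof -
  interpret M: Module.module R M by fact
  interpret N: Module.module R N by fact
  have "f (\<ominus>\<^bsub>M\<^esub> x) \<oplus>\<^bsub>N\<^esub> f x = \<zero>\<^bsub>N\<^esub>"
    using assms by (simp add: mod_hom_add[symmetric] mod_hom_zero[OF assms(1-3)] M.l_neg)
  from N.minus_equality[OF this] show ?thesis
    using assms by (simp add: mod_hom_closed)
qed

lemma mod_hom_diff:
  assumes "f \<in> mod_hom R M N" "Module.module R M" "Module.module R N" "x \<in> carrier M" "y \<in> carrier M"
  shows "f (x \<ominus>\<^bsub>M\<^esub> y) = f x \<ominus>\<^bsub>N\<^esub> f y"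
proof -
  interpret M: Module.module R M by fact
  show ?thesis
    using assms by (simp add: a_minus_def mod_hom_add mod_hom_neg)
qed

lemma mod_hom_comp:
  "f \<in> mod_hom R M N \<Longrightarrow> g \<in> mod_hom R N K \<Longrightarrow> (\<lambda>x. g (f x)) \<in> mod_hom R M K"
  by (rule mod_homI) (simp_all add: mod_hom_add mod_hom_smult mod_hom_closed)

lemma mod_hom_id: "(\<lambda>x. x) \<in> mod_hom R M M" "id \<in> mod_hom R M M"
  by (auto simp: mod_hom_def)

lemma mod_hom_sum:
  assumes "Module.module R N" "f \<in> mod_hom R M N" "g \<in> mod_hom R M N"
  shows "(\<lambda>x. f x \<oplus>\<^bsub>N\<^esub> g x) \<in> mod_hom R M N"
proof -
  interpret N: Module.module R N by fact
  show ?thesis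
    by (rule mod_homI)
      (use assms in \<open>auto simp: mod_hom_add mod_hom_smult mod_hom_closed N.smult_r_distr N.a_ac\<close>)
qed

lemma mod_hom_uminus:
  assumes "Module.module R N" "f \<in> mod_hom R M N"
  shows "(\<lambda>x. \<ominus>\<^bsub>N\<^esub> f x) \<in> mod_hom R M N"
proof -
  interpret N: Module.module R N by fact
  show ?thesis
    by (rule mod_homI)
      (use assms in \<open>auto simp: mod_hom_add mod_hom_smult mod_hom_closed N.smult_r_minus N.minus_add\<close>)
qed

lemma mod_hom_const_zero:
  assumes "Module.module R N" shows "(\<lambda>x. \<zero>\<^bsub>N\<^esub>) \<in> mod_hom R M N"
proof -
  interpret N: Module.module R N by fact
  show ?thesis by (rule mod_homI) auto
qed

lemma mod_hom_koszul_sign: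
  assumes "Module.module R N" "f \<in> mod_hom R M N"
  shows "(\<lambda>x. koszul_sign N n (f x)) \<in> mod_hom R M N"
  using assms mod_hom_uminus[OF assms] by (cases "even n") (simp_all add: koszul_sign_def)

lemma mod_hom_finsum:
  assumes f: "f \<in> mod_hom R M N" and M: "Module.module R M" and N: "Module.module R N"
    and "finite E" "\<And>s. s \<in> E \<Longrightarrow> x s \<in> carrier M"
  shows "f (\<Oplus>\<^bsub>M\<^esub>s\<in>E. x s) = (\<Oplus>\<^bsub>N\<^esub>s\<in>E. f (x s))"
proof -
  interpret M: Module.module R M by fact
  interpret N: Module.module R N by fact
  from assms(4,5) show ?thesis
    by (induct rule: finite_induct)
      (auto simp: mod_hom_zero[OF f M N] mod_hom_add[OF f] mod_hom_closed[OF f] M.finsum_closed Pi_def)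
qed

text \<open>The module axioms other than the existence of zero and negatives are equations, so they pass to
  the image of a map that respects the operations. Quotients and copies of modules arise in this way.\<close>

lemma module_image:
  fixes M :: "('a, 'm) module" and N :: "('a, 'n) module"
  assumes M: "Module.module R M" and img: "\<phi> ` carrier M = carrier N"
    and add: "\<And>x y. x \<in> carrier M \<Longrightarrow> y \<in> carrier M \<Longrightarrow> \<phi> (x \<oplus>\<^bsub>M\<^esub> y) = \<phi> x \<oplus>\<^bsub>N\<^esub> \<phi> y"
    and smult: "\<And>r x. r \<in> carrier R \<Longrightarrow> x \<in> carrier M \<Longrightarrow> \<phi> (r \<odot>\<^bsub>M\<^esub> x) = r \<odot>\<^bsub>N\<^esub> \<phi> x"
    and zero: "\<phi> \<zero>\<^bsub>M\<^esub> = \<zero>\<^bsub>N\<^esub>"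
  shows "Module.module R N" and "\<phi> \<in> mod_hom R M N"
proof -
  interpret M: Module.module R M by fact
  have cl: "\<phi> x \<in> carrier N" if "x \<in> carrier M" for x using that img by auto
  have ex: "\<exists>x \<in> carrier M. y = \<phi> x" if "y \<in> carrier N" for y using that img by auto
  show "Module.module R N"
  proof (rule moduleI)
    show "cring R" by (rule M.R.is_cring)
    show "abelian_group N"
    proof (rule abelian_groupI)
      fix x y assume "x \<in> carrier N" "y \<in> carrier N"
      then obtain a b where ab: "a \<in> carrier M" "b \<in> carrier M" "x = \<phi> a" "y = \<phi> b" using ex by blast
      then show "x \<oplus>\<^bsub>N\<^esub> y \<in> carrier N" using add[of a b] cl[of "a \<oplus>\<^bsub>M\<^esub> b"] by simp
      show "x \<oplus>\<^bsub>N\<^esub> y = y \<oplus>\<^bsub>N\<^esub> x" using ab add[of a b] add[of b a] by (simp add: M.a_comm)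
      fix z assume "z \<in> carrier N"
      then obtain c where c: "c \<in> carrier M" "z = \<phi> c" using ex by blast
      show "x \<oplus>\<^bsub>N\<^esub> y \<oplus>\<^bsub>N\<^esub> z = x \<oplus>\<^bsub>N\<^esub> (y \<oplus>\<^bsub>N\<^esub> z)"
        using ab c by (simp add: add[symmetric] M.a_assoc)
    next
      show "\<zero>\<^bsub>N\<^esub> \<in> carrier N" using zero cl[of "\<zero>\<^bsub>M\<^esub>"] by simp
    next
      fix x assume "x \<in> carrier N"
      then obtain a where a: "a \<in> carrier M" "x = \<phi> a" using ex by blast
      show "\<zero>\<^bsub>N\<^esub> \<oplus>\<^bsub>N\<^esub> x = x" using a by (simp add: zero[symmetric] add[symmetric])
      show "\<exists>y\<in>carrier N. y \<oplus>\<^bsub>N\<^esub> x = \<zero>\<^bsub>N\<^esub>"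
        by (rule bexI[of _ "\<phi> (\<ominus>\<^bsub>M\<^esub> a)"])
          (use a cl in \<open>auto simp: zero[symmetric] add[symmetric] M.l_neg\<close>)
    qed
  next
    fix a x assume a: "a \<in> carrier R" "x \<in> carrier N"
    then obtain u where u: "u \<in> carrier M" "x = \<phi> u" using ex by blast
    show "a \<odot>\<^bsub>N\<^esub> x \<in> carrier N" using a u cl by (simp add: smult[symmetric])
    fix b assume b: "b \<in> carrier R"
    show "(a \<oplus>\<^bsub>R\<^esub> b) \<odot>\<^bsub>N\<^esub> x = a \<odot>\<^bsub>N\<^esub> x \<oplus>\<^bsub>N\<^esub> b \<odot>\<^bsub>N\<^esub> x"
      using a b u by (simp add: smult[symmetric] add[symmetric] M.smult_l_distr)
    show "(a \<otimes>\<^bsub>R\<^esub> b) \<odot>\<^bsub>N\<^esub> x = a \<odot>\<^bsub>N\<^esub> (b \<odot>\<^bsub>N\<^esub> x)"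
      using a b u by (simp add: smult[symmetric] M.smult_assoc1)
  next
    fix a x y assume a: "a \<in> carrier R" "x \<in> carrier N" "y \<in> carrier N"
    then obtain u v where u: "u \<in> carrier M" "x = \<phi> u" "v \<in> carrier M" "y = \<phi> v" using ex by blast
    then show "a \<odot>\<^bsub>N\<^esub> (x \<oplus>\<^bsub>N\<^esub> y) = a \<odot>\<^bsub>N\<^esub> x \<oplus>\<^bsub>N\<^esub> a \<odot>\<^bsub>N\<^esub> y"
      using a by (simp add: smult[symmetric] add[symmetric] M.smult_r_distr)
  next
    fix x assume "x \<in> carrier N"
    then obtain u where u: "u \<in> carrier M" "x = \<phi> u" using ex by blast
    then show "\<one>\<^bsub>R\<^esub> \<odot>\<^bsub>N\<^esub> x = x" by (simp add: smult[symmetric])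
  qed
  show "\<phi> \<in> mod_hom R M N" using cl add smult by (auto intro: mod_homI)
qed

text \<open>An equation holds if it holds after every member of a jointly injective family of maps. With
  the coordinates as the family, this gives the axioms for function modules, direct sums and limits.\<close>

lemma module_of_joint_inj:
  fixes M :: "'k \<Rightarrow> ('a, 'm) module" and N :: "('a, 'n) module"
  assumes R: "cring R" and M: "\<And>k. k \<in> K \<Longrightarrow> Module.module R (M k)"
    and cl: "\<And>k x. k \<in> K \<Longrightarrow> x \<in> carrier N \<Longrightarrow> p k x \<in> carrier (M k)"
    and addc: "\<And>x y. x \<in> carrier N \<Longrightarrow> y \<in> carrier N \<Longrightarrow> x \<oplus>\<^bsub>N\<^esub> y \<in> carrier N"
    and smultc: "\<And>r x. r \<in> carrier R \<Longrightarrow> x \<in> carrier N \<Longrightarrow> r \<odot>\<^bsub>N\<^esub> x \<in> carrier N"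
    and zeroc: "\<zero>\<^bsub>N\<^esub> \<in> carrier N"
    and neg: "\<And>x. x \<in> carrier N \<Longrightarrow> \<exists>y\<in>carrier N. \<forall>k\<in>K. p k y = \<ominus>\<^bsub>M k\<^esub> p k x"
    and add: "\<And>k x y. k \<in> K \<Longrightarrow> x \<in> carrier N \<Longrightarrow> y \<in> carrier N \<Longrightarrow> p k (x \<oplus>\<^bsub>N\<^esub> y) = p k x \<oplus>\<^bsub>M k\<^esub> p k y"
    and smult: "\<And>k r x. k \<in> K \<Longrightarrow> r \<in> carrier R \<Longrightarrow> x \<in> carrier N \<Longrightarrow> p k (r \<odot>\<^bsub>N\<^esub> x) = r \<odot>\<^bsub>M k\<^esub> p k x"
    and zero: "\<And>k. k \<in> K \<Longrightarrow> p k \<zero>\<^bsub>N\<^esub> = \<zero>\<^bsub>M k\<^esub>"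
    and inj: "\<And>x y. x \<in> carrier N \<Longrightarrow> y \<in> carrier N \<Longrightarrow> (\<And>k. k \<in> K \<Longrightarrow> p k x = p k y) \<Longrightarrow> x = y"
  shows "Module.module R N"
proof -
  interpret R: cring R by fact
  have ag: "abelian_monoid (M k)" "abelian_group (M k)" if "k \<in> K" for k
    using moduleD(2)[OF M[OF that]] by (auto simp: abelian_group_def)
  show "Module.module R N"
  proof (rule moduleI)
    show "cring R" by fact
    show "abelian_group N"
    proof (rule abelian_groupI)
      fix x y assume xy: "x \<in> carrier N" "y \<in> carrier N"
      show "x \<oplus>\<^bsub>N\<^esub> y \<in> carrier N" by (simp add: addc xy)
      show "x \<oplus>\<^bsub>N\<^esub> y = y \<oplus>\<^bsub>N\<^esub> x"
        by (rule inj) (auto simp: xy addc add cl abelian_monoid.a_comm[OF ag(1)])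
      fix z assume z: "z \<in> carrier N"
      show "x \<oplus>\<^bsub>N\<^esub> y \<oplus>\<^bsub>N\<^esub> z = x \<oplus>\<^bsub>N\<^esub> (y \<oplus>\<^bsub>N\<^esub> z)"
        by (rule inj) (auto simp: xy z addc add cl abelian_monoid.a_assoc[OF ag(1)])
    next
      show "\<zero>\<^bsub>N\<^esub> \<in> carrier N" by (rule zeroc)
    next
      fix x assume x: "x \<in> carrier N"
      show "\<zero>\<^bsub>N\<^esub> \<oplus>\<^bsub>N\<^esub> x = x"
        by (rule inj) (auto simp: x addc zeroc add zero cl abelian_monoid.l_zero[OF ag(1)])
      obtain y where y: "y \<in> carrier N" "\<forall>k\<in>K. p k y = \<ominus>\<^bsub>M k\<^esub> p k x" using neg[OF x] by auto
      have "y \<oplus>\<^bsub>N\<^esub> x = \<zero>\<^bsub>N\<^esub>"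
        by (rule inj) (auto simp: x y addc zeroc add zero cl abelian_group.l_neg[OF ag(2)])
      then show "\<exists>y\<in>carrier N. y \<oplus>\<^bsub>N\<^esub> x = \<zero>\<^bsub>N\<^esub>" using y by auto
    qed
  next
    fix a x assume a: "a \<in> carrier R" "x \<in> carrier N"
    show "a \<odot>\<^bsub>N\<^esub> x \<in> carrier N" by (simp add: smultc a)
    fix b assume b: "b \<in> carrier R"
    show "(a \<oplus>\<^bsub>R\<^esub> b) \<odot>\<^bsub>N\<^esub> x = a \<odot>\<^bsub>N\<^esub> x \<oplus>\<^bsub>N\<^esub> b \<odot>\<^bsub>N\<^esub> x"
      by (rule inj) (auto simp: a b addc add cl smult smultc module.smult_l_distr[OF M])
    show "(a \<otimes>\<^bsub>R\<^esub> b) \<odot>\<^bsub>N\<^esub> x = a \<odot>\<^bsub>N\<^esub> (b \<odot>\<^bsub>N\<^esub> x)"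
      by (rule inj) (auto simp: a b addc add cl smult smultc module.smult_assoc1[OF M])
  next
    fix a x y assume a: "a \<in> carrier R" "x \<in> carrier N" "y \<in> carrier N"
    show "a \<odot>\<^bsub>N\<^esub> (x \<oplus>\<^bsub>N\<^esub> y) = a \<odot>\<^bsub>N\<^esub> x \<oplus>\<^bsub>N\<^esub> a \<odot>\<^bsub>N\<^esub> y"
      by (rule inj) (auto simp: a addc add cl smult smultc module.smult_r_distr[OF M])
  next
    fix x assume x: "x \<in> carrier N"
    show "\<one>\<^bsub>R\<^esub> \<odot>\<^bsub>N\<^esub> x = x"
      by (rule inj) (auto simp: x cl smult smultc module.smult_one[OF M])
  qed
qed

subsection \<open>Submodules and quotients\<close>

lemma submodule_abelian_subgroup:
  assumes "Module.module R M" "submodule H R M"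
  shows "abelian_subgroup H M"
  using assms by (auto intro!: abelian_subgroupI3 additive_subgroup.intro dest: moduleD submodule.axioms)

lemma submoduleI':
  assumes "Module.module R M" "H \<subseteq> carrier M" "\<zero>\<^bsub>M\<^esub> \<in> H"
    "\<And>a b. a \<in> H \<Longrightarrow> b \<in> H \<Longrightarrow> a \<oplus>\<^bsub>M\<^esub> b \<in> H"
    "\<And>a x. a \<in> carrier R \<Longrightarrow> x \<in> H \<Longrightarrow> a \<odot>\<^bsub>M\<^esub> x \<in> H"
  shows "submodule H R M"
proof -
  interpret M: Module.module R M by fact
  show ?thesis
  proof (rule M.submoduleI)
    fix a assume a: "a \<in> H"
    have "(\<ominus>\<^bsub>R\<^esub> \<one>\<^bsub>R\<^esub>) \<odot>\<^bsub>M\<^esub> a = \<ominus>\<^bsub>M\<^esub> a" using a assms(2) by (simp add: M.smult_l_minus subsetD)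
    then show "\<ominus>\<^bsub>M\<^esub> a \<in> H" using assms(5)[of "\<ominus>\<^bsub>R\<^esub> \<one>\<^bsub>R\<^esub>" a] a by simp
  qed (use assms in auto)
qed

lemma gen_submodule_submodule:
  assumes "Module.module R M" "S \<subseteq> carrier M"
  shows "submodule (gen_submodule R M S) R M"
proof -
  interpret M: Module.module R M by fact
  have sub: "submodule (carrier M) R M" by (rule M.carrier_is_submodule)
  show ?thesis
    unfolding gen_submodule_def
  proof (rule M.submoduleI)
    show "\<Inter>{H. submodule H R M \<and> S \<subseteq> H} \<subseteq> carrier M" using sub assms(2) by auto
    show "\<zero>\<^bsub>M\<^esub> \<in> \<Inter>{H. submodule H R M \<and> S \<subseteq> H}"
      using subgroup.one_closed[OF submodule.axioms(1)] by fastforce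
  qed (auto dest: M.submoduleE(3,4,5))
qed

lemma gen_submodule_least:
  "submodule H R M \<Longrightarrow> S \<subseteq> H \<Longrightarrow> gen_submodule R M S \<subseteq> H"
  by (auto simp: gen_submodule_def)

lemma gen_submodule_incl: "S \<subseteq> gen_submodule R M S"
  by (auto simp: gen_submodule_def)

lemma submodule_kernel:
  assumes "Module.module R M" "Module.module R N" "f \<in> mod_hom R M N"
  shows "submodule {x \<in> carrier M. f x = \<zero>\<^bsub>N\<^esub>} R M"
proof -
  interpret M: Module.module R M by fact
  interpret N: Module.module R N by fact
  show ?thesis
    by (rule submoduleI'[OF assms(1)])
      (auto simp: mod_hom_zero[OF assms(3,1,2)] mod_hom_add[OF assms(3)] mod_hom_smult[OF assms(3)])
qed

lemma submodule_image:
  assumes "Module.module R M" "Module.module R N" "f \<in> mod_hom R M N" "submodule H R M"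
  shows "submodule (f ` H) R N"
proof -
  interpret M: Module.module R M by fact
  interpret N: Module.module R N by fact
  note H = M.submoduleE[OF assms(4)]
  have sub: "x \<in> H \<Longrightarrow> x \<in> carrier M" for x using H(1) by auto
  have z: "\<zero>\<^bsub>M\<^esub> \<in> H" using subgroup.one_closed[OF submodule.axioms(1)[OF assms(4)]] by simp
  show ?thesis
  proof (rule submoduleI'[OF assms(2)])
    show "f ` H \<subseteq> carrier N" using sub by (auto intro: mod_hom_closed[OF assms(3)])
    show "\<zero>\<^bsub>N\<^esub> \<in> f ` H" using z mod_hom_zero[OF assms(3,1,2)] by (metis imageI)
    fix a b assume "a \<in> f ` H" "b \<in> f ` H"
    then show "a \<oplus>\<^bsub>N\<^esub> b \<in> f ` H"
      using H(5) mod_hom_add[OF assms(3)] sub by (smt (verit) imageE imageI)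
  next
    fix a x assume "a \<in> carrier R" "x \<in> f ` H"
    then show "a \<odot>\<^bsub>N\<^esub> x \<in> f ` H"
      using H(4) mod_hom_smult[OF assms(3)] sub by (smt (verit) imageE imageI)
  qed
qed

lemma coset_restrict [simp]: "H +>\<^bsub>M\<lparr>carrier := S\<rparr>\<^esub> x = H +>\<^bsub>M\<^esub> x"
  by (simp add: a_r_coset_def r_coset_def)

lemma set_add_restrict [simp]: "H <+>\<^bsub>M\<lparr>carrier := S\<rparr>\<^esub> K = H <+>\<^bsub>M\<^esub> K"
  by (simp add: set_add_def set_mult_def)

lemma quot_map_restrict [simp]: "quot_map (M\<lparr>carrier := S\<rparr>) H f = quot_map M H f"
  by (simp add: quot_map_def fun_eq_iff)

lemma a_rcosets_eq: "a_rcosets\<^bsub>M\<^esub> H = (\<lambda>x. H +>\<^bsub>M\<^esub> x) ` carrier M"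
  by (auto simp: A_RCOSETS_def RCOSETS_def a_r_coset_def)

lemma coset_eq_iff:
  assumes "abelian_subgroup H M" "x \<in> carrier M" "y \<in> carrier M"
  shows "H +>\<^bsub>M\<^esub> x = H +>\<^bsub>M\<^esub> y \<longleftrightarrow> x \<ominus>\<^bsub>M\<^esub> y \<in> H"
proof -
  interpret abelian_subgroup H M by fact
  show ?thesis
    using assms by (metis a_rcos_module a_rcos_self a_repr_independence' minus_eq)
qed

text \<open>The union in \<open>quot_map\<close> runs over cosets that all coincide.\<close>

lemma quot_map_coset:
  assumes H: "abelian_subgroup H M" and K: "abelian_subgroup K N"
    and f: "f \<in> carrier M \<rightarrow> carrier N"
      "\<And>x y. x \<in> carrier M \<Longrightarrow> y \<in> carrier M \<Longrightarrow> f (x \<oplus>\<^bsub>M\<^esub> y) = f x \<oplus>\<^bsub>N\<^esub> f y"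
    and fH: "\<And>x. x \<in> H \<Longrightarrow> f x \<in> K" and x: "x \<in> carrier M"
  shows "quot_map N K f (H +>\<^bsub>M\<^esub> x) = K +>\<^bsub>N\<^esub> f x"
proof -
  interpret H: abelian_subgroup H M by fact
  interpret K: abelian_subgroup K N by fact
  have "K +>\<^bsub>N\<^esub> f y = K +>\<^bsub>N\<^esub> f x" if y: "y \<in> H +>\<^bsub>M\<^esub> x" for y
  proof -
    obtain h where h: "h \<in> H" "y = h \<oplus>\<^bsub>M\<^esub> x" using y by (auto simp: a_r_coset_defs)
    have "f y = f h \<oplus>\<^bsub>N\<^esub> f x" using h x f(2) by simp
    then have "f y \<ominus>\<^bsub>N\<^esub> f x = f h"
      using h x f(1) fH[of h] by (simp add: K.minus_eq K.a_assoc K.r_neg Pi_iff)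
    then show ?thesis
      using coset_eq_iff[OF K, of "f y" "f x"] h x f(1) fH[of h] H.a_Hcarr by (auto simp: Pi_iff)
  qed
  then have *: "\<forall>y \<in> H +>\<^bsub>M\<^esub> x. K +>\<^bsub>N\<^esub> f y = K +>\<^bsub>N\<^esub> f x" by blast
  have "x \<in> H +>\<^bsub>M\<^esub> x" using x by (rule H.a_rcos_self)
  with * show ?thesis unfolding quot_map_def by blast
qed

lemma quot_module_simps:
  assumes "Module.module R M" "submodule H R M"
  shows quot_carrier: "carrier (quot_module M H) = (\<lambda>x. H +>\<^bsub>M\<^esub> x) ` carrier M"
    and quot_zero: "\<zero>\<^bsub>quot_module M H\<^esub> = H +>\<^bsub>M\<^esub> \<zero>\<^bsub>M\<^esub>"
    and quot_add: "x \<in> carrier M \<Longrightarrow> y \<in> carrier M \<Longrightarrow>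
        (H +>\<^bsub>M\<^esub> x) \<oplus>\<^bsub>quot_module M H\<^esub> (H +>\<^bsub>M\<^esub> y) = H +>\<^bsub>M\<^esub> (x \<oplus>\<^bsub>M\<^esub> y)"
    and quot_smult: "r \<in> carrier R \<Longrightarrow> x \<in> carrier M \<Longrightarrow>
        r \<odot>\<^bsub>quot_module M H\<^esub> (H +>\<^bsub>M\<^esub> x) = H +>\<^bsub>M\<^esub> (r \<odot>\<^bsub>M\<^esub> x)"
    and quot_eq_iff: "x \<in> carrier M \<Longrightarrow> y \<in> carrier M \<Longrightarrow>
        H +>\<^bsub>M\<^esub> x = H +>\<^bsub>M\<^esub> y \<longleftrightarrow> x \<ominus>\<^bsub>M\<^esub> y \<in> H"
proof -
  interpret M: Module.module R M by fact
  have H: "abelian_subgroup H M" using assms by (rule submodule_abelian_subgroup)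
  interpret H: abelian_subgroup H M by fact
  show "carrier (quot_module M H) = (\<lambda>x. H +>\<^bsub>M\<^esub> x) ` carrier M"
    by (simp add: quot_module_def a_rcosets_eq)
  show "\<zero>\<^bsub>quot_module M H\<^esub> = H +>\<^bsub>M\<^esub> \<zero>\<^bsub>M\<^esub>"
    by (simp add: quot_module_def H.a_rcos_const)
  show "x \<in> carrier M \<Longrightarrow> y \<in> carrier M \<Longrightarrow>
        (H +>\<^bsub>M\<^esub> x) \<oplus>\<^bsub>quot_module M H\<^esub> (H +>\<^bsub>M\<^esub> y) = H +>\<^bsub>M\<^esub> (x \<oplus>\<^bsub>M\<^esub> y)"
    by (simp add: quot_module_def H.a_rcos_sum)
  show "r \<in> carrier R \<Longrightarrow> x \<in> carrier M \<Longrightarrow>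
        r \<odot>\<^bsub>quot_module M H\<^esub> (H +>\<^bsub>M\<^esub> x) = H +>\<^bsub>M\<^esub> (r \<odot>\<^bsub>M\<^esub> x)"
    by (simp add: quot_module_def)
      (rule quot_map_coset[OF H H], auto simp: M.smult_r_distr submodule.smult_closed[OF assms(2)])
  show "x \<in> carrier M \<Longrightarrow> y \<in> carrier M \<Longrightarrow>
        H +>\<^bsub>M\<^esub> x = H +>\<^bsub>M\<^esub> y \<longleftrightarrow> x \<ominus>\<^bsub>M\<^esub> y \<in> H"
    by (rule coset_eq_iff[OF H])
qed

lemma quot_module_module:
  assumes "Module.module R M" "submodule H R M"
  shows "Module.module R (quot_module M H)"
    and quot_proj_hom: "(\<lambda>x. H +>\<^bsub>M\<^esub> x) \<in> mod_hom R M (quot_module M H)"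
  by (rule module_image[OF assms(1), of "\<lambda>x. H +>\<^bsub>M\<^esub> x"];
      simp add: quot_module_simps[OF assms])+

lemma quot_eq_zero_iff:
  assumes "Module.module R M" "submodule H R M" "x \<in> carrier M"
  shows "H +>\<^bsub>M\<^esub> x = \<zero>\<^bsub>quot_module M H\<^esub> \<longleftrightarrow> x \<in> H"
proof -
  interpret M: Module.module R M by fact
  show ?thesis
    using quot_eq_iff[OF assms(1,2,3), of "\<zero>\<^bsub>M\<^esub>"] assms(3) by (simp add: quot_zero[OF assms(1,2)] M.M.diff_zero)
qed

lemma quot_map_hom:
  assumes M: "Module.module R M" "submodule H R M" and N: "Module.module R N" "submodule K R N"
    and f: "f \<in> mod_hom R M N" and fH: "\<And>x. x \<in> H \<Longrightarrow> f x \<in> K"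
  shows "quot_map N K f \<in> mod_hom R (quot_module M H) (quot_module N K)"
    and "x \<in> carrier M \<Longrightarrow> quot_map N K f (H +>\<^bsub>M\<^esub> x) = K +>\<^bsub>N\<^esub> f x"
proof -
  interpret M: Module.module R M by fact
  interpret N: Module.module R N by fact
  show *: "x \<in> carrier M \<Longrightarrow> quot_map N K f (H +>\<^bsub>M\<^esub> x) = K +>\<^bsub>N\<^esub> f x" for x
    by (rule quot_map_coset[OF submodule_abelian_subgroup[OF M] submodule_abelian_subgroup[OF N]])
      (auto simp: fH mod_hom_add[OF f] mod_hom_closed[OF f])
  show "quot_map N K f \<in> mod_hom R (quot_module M H) (quot_module N K)"
    by (rule mod_homI)
      (auto simp: quot_carrier[OF M] quot_carrier[OF N] quot_add[OF M] quot_add[OF N]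
        quot_smult[OF M] quot_smult[OF N] * mod_hom_closed[OF f] mod_hom_add[OF f] mod_hom_smult[OF f])
qed

subsection \<open>Ideal multiples\<close>

inductive_set ideal_mult :: "'a set \<Rightarrow> ('a, 'm) module \<Rightarrow> 'm set" for J M where
  zero: "\<zero>\<^bsub>M\<^esub> \<in> ideal_mult J M"
| step: "j \<in> J \<Longrightarrow> m \<in> carrier M \<Longrightarrow> x \<in> ideal_mult J M \<Longrightarrow> (j \<odot>\<^bsub>M\<^esub> m) \<oplus>\<^bsub>M\<^esub> x \<in> ideal_mult J M"

lemma ideal_mult_submodule:
  assumes M: "Module.module R M" and J: "ideal J R"
  shows "submodule (ideal_mult J M) R M"
proof -
  interpret M: Module.module R M by fact
  interpret J: ideal J R by fact
  have sub: "x \<in> carrier M" if "x \<in> ideal_mult J M" for x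
    using that by induct (auto simp: J.Icarr)
  show ?thesis
  proof (rule submoduleI'[OF M])
    show "ideal_mult J M \<subseteq> carrier M" using sub by auto
    show "\<zero>\<^bsub>M\<^esub> \<in> ideal_mult J M" by (rule ideal_mult.zero)
    show "a \<oplus>\<^bsub>M\<^esub> b \<in> ideal_mult J M" if "a \<in> ideal_mult J M" "b \<in> ideal_mult J M" for a b
      using that(1)
    proof induct
      case zero then show ?case using that(2) sub by simp
    next
      case (step j m x)
      then show ?case using ideal_mult.step[OF step(1,2,4)] sub that(2)
        by (simp add: M.a_assoc J.Icarr)
    qed
    show "a \<odot>\<^bsub>M\<^esub> x \<in> ideal_mult J M" if "a \<in> carrier R" "x \<in> ideal_mult J M" for a x
      using that(2)
    proof induct
      case zero then show ?case using that(1) by (simp add: ideal_mult.zero)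
    next
      case (step j m x)
      have "((a \<otimes>\<^bsub>R\<^esub> j) \<odot>\<^bsub>M\<^esub> m) \<oplus>\<^bsub>M\<^esub> (a \<odot>\<^bsub>M\<^esub> x) \<in> ideal_mult J M"
        by (rule ideal_mult.step) (use step that J.I_l_closed in auto)
      then show ?case using step sub that(1)
        by (simp add: M.smult_r_distr M.smult_assoc1 J.Icarr)
    qed
  qed
qed

lemma ideal_mult_incl:
  assumes M: "Module.module R M" and "ideal J R" "j \<in> J" "m \<in> carrier M"
  shows "j \<odot>\<^bsub>M\<^esub> m \<in> ideal_mult J M"
proof -
  interpret M: Module.module R M by fact
  interpret J: ideal J R by fact
  show ?thesis using ideal_mult.step[OF assms(3,4) ideal_mult.zero] assms by (simp add: J.Icarr)
qed

lemma ideal_mult_least: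
  assumes M: "Module.module R M" and H: "submodule H R M"
    and "\<And>j m. j \<in> J \<Longrightarrow> m \<in> carrier M \<Longrightarrow> j \<odot>\<^bsub>M\<^esub> m \<in> H" and x: "x \<in> ideal_mult J M"
  shows "x \<in> H"
proof -
  interpret H: abelian_subgroup H M by (rule submodule_abelian_subgroup[OF M H])
  show ?thesis using x by induct (auto simp: assms)
qed

lemma ideal_mult_hom:
  assumes M: "Module.module R M" and N: "Module.module R N" and f: "f \<in> mod_hom R M N"
    and J: "ideal J R" and x: "x \<in> ideal_mult J M"
  shows "f x \<in> ideal_mult J N"
proof -
  interpret M: Module.module R M by fact
  interpret J: ideal J R by fact
  interpret H: abelian_subgroup "ideal_mult J M" M
    by (rule submodule_abelian_subgroup[OF M ideal_mult_submodule[OF M J]])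
  show ?thesis using x
    by induct (auto simp: mod_hom_zero[OF f M N] mod_hom_add[OF f] mod_hom_smult[OF f] J.Icarr
       intro!: ideal_mult.intros mod_hom_closed[OF f])
qed

lemma ideal_mult_carrier:
  assumes "Module.module R M" "ideal J R" "x \<in> ideal_mult J M" shows "x \<in> carrier M"
  using abelian_subgroup.axioms(1)[OF submodule_abelian_subgroup[OF assms(1) ideal_mult_submodule[OF assms(1,2)]]]
    assms(3) by (rule additive_subgroup.a_Hcarr)

section \<open>Free modules and tensor products\<close>

definition reg :: "'a ring \<Rightarrow> ('a, 'a) module"
  where "reg R = module_of (carrier R) (ring.add R) \<zero>\<^bsub>R\<^esub> (monoid.mult R)"

lemma reg_simps [simp]:
  "carrier (reg R) = carrier R" "ring.add (reg R) = ring.add R" "\<zero>\<^bsub>reg R\<^esub> = \<zero>\<^bsub>R\<^esub>"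
  "smult (reg R) = monoid.mult R"
  by (simp_all add: reg_def)

lemma reg_module:
  assumes "cring R" shows "Module.module R (reg R)"
proof -
  interpret R: cring R by fact
  show ?thesis
  proof (rule moduleI)
    show "abelian_group (reg R)"
      by (rule abelian_groupI) (auto simp: R.a_ac intro!: bexI[of _ "\<ominus>\<^bsub>R\<^esub> _"] R.l_neg)
  qed (auto simp: R.l_distr R.r_distr R.m_assoc assms)
qed

lemma free_module_simps:
  "f \<in> carrier (free_module R S) \<longleftrightarrow>
    (\<forall>s. f s \<in> carrier R) \<and> finite {s. f s \<noteq> \<zero>\<^bsub>R\<^esub>} \<and> {s. f s \<noteq> \<zero>\<^bsub>R\<^esub>} \<subseteq> S"
  "f \<oplus>\<^bsub>free_module R S\<^esub> g = (\<lambda>s. f s \<oplus>\<^bsub>R\<^esub> g s)"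
  "\<zero>\<^bsub>free_module R S\<^esub> = (\<lambda>s. \<zero>\<^bsub>R\<^esub>)"
  "r \<odot>\<^bsub>free_module R S\<^esub> f = (\<lambda>s. r \<otimes>\<^bsub>R\<^esub> f s)"
  by (auto simp: free_module_def)

lemma free_module_module:
  assumes "cring R"
  shows "Module.module R (free_module R S)"
    and free_module_eval_hom: "(\<lambda>f. f s) \<in> mod_hom R (free_module R S) (reg R)"
proof -
  interpret R: cring R by fact
  let ?F = "free_module R S"
  have fin: "{s. f s \<oplus>\<^bsub>R\<^esub> g s \<noteq> \<zero>\<^bsub>R\<^esub>} \<subseteq> {s. f s \<noteq> \<zero>\<^bsub>R\<^esub>} \<union> {s. g s \<noteq> \<zero>\<^bsub>R\<^esub>}" for f g :: "'b \<Rightarrow> 'a"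
    by auto
  have fin2: "{s. r \<otimes>\<^bsub>R\<^esub> g s \<noteq> \<zero>\<^bsub>R\<^esub>} \<subseteq> {s. g s \<noteq> \<zero>\<^bsub>R\<^esub>}" if "r \<in> carrier R" for r and g :: "'b \<Rightarrow> 'a"
    using that by auto
  have fin3: "{s. \<ominus>\<^bsub>R\<^esub> g s \<noteq> \<zero>\<^bsub>R\<^esub>} \<subseteq> {s. g s \<noteq> \<zero>\<^bsub>R\<^esub>}" for g :: "'b \<Rightarrow> 'a"
    by (auto simp: R.add.inv_one)
  have neg: "(\<lambda>s. \<ominus>\<^bsub>R\<^esub> f s) \<in> carrier ?F" if "f \<in> carrier ?F" for f
    using that fin3[of f] by (auto simp: free_module_simps intro: finite_subset)
  have addc: "f \<oplus>\<^bsub>?F\<^esub> g \<in> carrier ?F" if "f \<in> carrier ?F" "g \<in> carrier ?F" for f g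
    using that fin[of f g] by (auto simp: free_module_simps intro: finite_subset)
  have smc: "r \<odot>\<^bsub>?F\<^esub> g \<in> carrier ?F" if "r \<in> carrier R" "g \<in> carrier ?F" for r g
    using that fin2[of r g] by (auto simp: free_module_simps intro: finite_subset)
  have inv: "\<exists>y\<in>carrier ?F. \<forall>k\<in>UNIV. y k = \<ominus>\<^bsub>reg R\<^esub> (f k)" if "f \<in> carrier ?F" for f
    by (rule bexI[OF _ neg[OF that]]) (simp add: a_inv_def m_inv_def)
  show "Module.module R ?F"
    by (rule module_of_joint_inj(1)[of R UNIV "\<lambda>_. reg R" ?F "\<lambda>s f. f s"])
      (use assms reg_module addc smc inv in \<open>auto simp: free_module_simps\<close>)
  show "(\<lambda>f. f s) \<in> mod_hom R ?F (reg R)"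
    by (rule mod_homI) (auto simp: free_module_simps)
qed

lemma free_gen_closed: "cring R \<Longrightarrow> s \<in> S \<Longrightarrow> free_gen R s \<in> carrier (free_module R S)"
proof -
  assume R: "cring R" and s: "s \<in> S"
  interpret R: cring R by fact
  have "{t. free_gen R s t \<noteq> \<zero>\<^bsub>R\<^esub>} \<subseteq> {s}" by (auto simp: free_gen_def)
  then show ?thesis using s by (auto simp: free_module_simps free_gen_def intro: finite_subset)
qed

definition lin_ext :: "'a ring \<Rightarrow> ('a, 'n) module \<Rightarrow> ('s \<Rightarrow> 'n) \<Rightarrow> ('s \<Rightarrow> 'a) \<Rightarrow> 'n"
  where "lin_ext R N \<beta> f = (\<Oplus>\<^bsub>N\<^esub>s\<in>{s. f s \<noteq> \<zero>\<^bsub>R\<^esub>}. f s \<odot>\<^bsub>N\<^esub> \<beta> s)"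

text \<open>The support of \<open>f\<close> varies with \<open>f\<close>; to compare two values the sums are taken over a common
  finite set.\<close>

lemma lin_ext_superset:
  assumes N: "Module.module R N" and f: "f \<in> carrier (free_module R S)"
    and \<beta>: "\<And>s. s \<in> S \<Longrightarrow> \<beta> s \<in> carrier N"
    and E: "finite E" "{s. f s \<noteq> \<zero>\<^bsub>R\<^esub>} \<subseteq> E" "E \<subseteq> S"
  shows "lin_ext R N \<beta> f = (\<Oplus>\<^bsub>N\<^esub>s\<in>E. f s \<odot>\<^bsub>N\<^esub> \<beta> s)"
proof -
  interpret N: Module.module R N by fact
  show ?thesis unfolding lin_ext_def
    by (rule N.M.add.finprod_mono_neutral_cong_left)
      (use assms in \<open>auto simp: free_module_simps subset_iff\<close>)
qed

lemma lin_ext_hom: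
  assumes N: "Module.module R N" and \<beta>: "\<And>s. s \<in> S \<Longrightarrow> \<beta> s \<in> carrier N"
  shows "lin_ext R N \<beta> \<in> mod_hom R (free_module R S) N"
    and "s \<in> S \<Longrightarrow> lin_ext R N \<beta> (free_gen R s) = \<beta> s"
proof -
  interpret N: Module.module R N by fact
  interpret F: Module.module R "free_module R S" by (rule free_module_module(1)[OF N.R.is_cring])
  note sup = lin_ext_superset[OF N _ \<beta>]
  have cl: "f s \<odot>\<^bsub>N\<^esub> \<beta> s \<in> carrier N" if "f \<in> carrier (free_module R S)" "s \<in> S" for f s
    using that \<beta> by (auto simp: free_module_simps)
  show "lin_ext R N \<beta> \<in> mod_hom R (free_module R S) N"
  proof (rule mod_homI)
    fix f assume f: "f \<in> carrier (free_module R S)"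
    show "lin_ext R N \<beta> f \<in> carrier N" unfolding lin_ext_def
      by (rule N.M.finsum_closed) (use cl f in \<open>auto simp: free_module_simps\<close>)
    fix g assume g: "g \<in> carrier (free_module R S)"
    let ?E = "{s. f s \<noteq> \<zero>\<^bsub>R\<^esub>} \<union> {s. g s \<noteq> \<zero>\<^bsub>R\<^esub>}"
    have E: "finite ?E" "?E \<subseteq> S" using f g by (auto simp: free_module_simps)
    have "f \<oplus>\<^bsub>free_module R S\<^esub> g \<in> carrier (free_module R S)" using f g by simp
    then have "lin_ext R N \<beta> (f \<oplus>\<^bsub>free_module R S\<^esub> g) = (\<Oplus>\<^bsub>N\<^esub>s\<in>?E. (f s \<oplus>\<^bsub>R\<^esub> g s) \<odot>\<^bsub>N\<^esub> \<beta> s)"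
      by (subst sup[OF _ _ E(1) _ E(2)]) (auto simp: free_module_simps)
    also have "\<dots> = (\<Oplus>\<^bsub>N\<^esub>s\<in>?E. f s \<odot>\<^bsub>N\<^esub> \<beta> s \<oplus>\<^bsub>N\<^esub> g s \<odot>\<^bsub>N\<^esub> \<beta> s)"
      by (rule N.M.finsum_cong') (use f g E \<beta> in \<open>auto simp: free_module_simps N.smult_l_distr subset_iff\<close>)
    also have "\<dots> = (\<Oplus>\<^bsub>N\<^esub>s\<in>?E. f s \<odot>\<^bsub>N\<^esub> \<beta> s) \<oplus>\<^bsub>N\<^esub> (\<Oplus>\<^bsub>N\<^esub>s\<in>?E. g s \<odot>\<^bsub>N\<^esub> \<beta> s)"
      by (rule N.M.finsum_addf) (use f g E cl in \<open>auto simp: free_module_simps subset_iff\<close>)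
    also have "\<dots> = lin_ext R N \<beta> f \<oplus>\<^bsub>N\<^esub> lin_ext R N \<beta> g"
      by (subst (1 2) sup[OF _ _ E(1) _ E(2)]) (use f g in auto)
    finally show "lin_ext R N \<beta> (f \<oplus>\<^bsub>free_module R S\<^esub> g) = lin_ext R N \<beta> f \<oplus>\<^bsub>N\<^esub> lin_ext R N \<beta> g" .
  next
    fix r f assume r: "r \<in> carrier R" and f: "f \<in> carrier (free_module R S)"
    let ?E = "{s. f s \<noteq> \<zero>\<^bsub>R\<^esub>}"
    have E: "finite ?E" "?E \<subseteq> S" using f by (auto simp: free_module_simps)
    have "r \<odot>\<^bsub>free_module R S\<^esub> f \<in> carrier (free_module R S)" using r f by simp
    then have "lin_ext R N \<beta> (r \<odot>\<^bsub>free_module R S\<^esub> f) = (\<Oplus>\<^bsub>N\<^esub>s\<in>?E. (r \<otimes>\<^bsub>R\<^esub> f s) \<odot>\<^bsub>N\<^esub> \<beta> s)"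
      by (subst sup[OF _ _ E(1) _ E(2)]) (use r in \<open>auto simp: free_module_simps\<close>)
    also have "\<dots> = (\<Oplus>\<^bsub>N\<^esub>s\<in>?E. r \<odot>\<^bsub>N\<^esub> (f s \<odot>\<^bsub>N\<^esub> \<beta> s))"
      by (rule N.M.finsum_cong') (use f r E \<beta> in \<open>auto simp: free_module_simps N.smult_assoc1 subset_iff\<close>)
    also have "\<dots> = r \<odot>\<^bsub>N\<^esub> lin_ext R N \<beta> f" unfolding lin_ext_def
      by (rule N.finsum_smult_ldistr[symmetric]) (use r E cl f in auto)
    finally show "lin_ext R N \<beta> (r \<odot>\<^bsub>free_module R S\<^esub> f) = r \<odot>\<^bsub>N\<^esub> lin_ext R N \<beta> f" .
  qed
  show "lin_ext R N \<beta> (free_gen R s) = \<beta> s" if s: "s \<in> S"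
    by (subst sup[OF free_gen_closed[OF N.R.is_cring s], where E = "{s}"])
      (use s \<beta> in \<open>auto simp: free_gen_def\<close>)
qed

lemma free_module_induct [consumes 2, case_names zero step]:
  assumes R: "cring R" and f: "f \<in> carrier (free_module R S)"
    and z: "P \<zero>\<^bsub>free_module R S\<^esub>"
    and st: "\<And>r s g. r \<in> carrier R \<Longrightarrow> s \<in> S \<Longrightarrow> g \<in> carrier (free_module R S) \<Longrightarrow> P g \<Longrightarrow>
      P (r \<odot>\<^bsub>free_module R S\<^esub> free_gen R s \<oplus>\<^bsub>free_module R S\<^esub> g)"
  shows "P f"
proof -
  interpret R: cring R by fact
  have "finite {s. f s \<noteq> \<zero>\<^bsub>R\<^esub>}" using f by (simp add: free_module_simps)
  then show ?thesis using f
  proof (induct "{s. f s \<noteq> \<zero>\<^bsub>R\<^esub>}" arbitrary: f rule: finite_psubset_induct)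
    case psubset
    show ?case
    proof (cases "{s. f s \<noteq> \<zero>\<^bsub>R\<^esub>} = {}")
      case True
      then have "f = \<zero>\<^bsub>free_module R S\<^esub>" by (auto simp: free_module_simps)
      then show ?thesis using z by simp
    next
      case False
      then obtain s where s: "f s \<noteq> \<zero>\<^bsub>R\<^esub>" by auto
      then have sS: "s \<in> S" using psubset(3) by (auto simp: free_module_simps)
      let ?g = "f(s := \<zero>\<^bsub>R\<^esub>)"
      have fs: "f t \<in> carrier R" for t using psubset(3) by (auto simp: free_module_simps)
      have lt: "{t. ?g t \<noteq> \<zero>\<^bsub>R\<^esub>} \<subset> {t. f t \<noteq> \<zero>\<^bsub>R\<^esub>}" using s by auto
      then have g: "?g \<in> carrier (free_module R S)"
        using psubset(1,3) by (auto simp: free_module_simps intro: finite_subset)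
      have "P ?g" using psubset(2)[OF lt g] .
      moreover have "f = f s \<odot>\<^bsub>free_module R S\<^esub> free_gen R s \<oplus>\<^bsub>free_module R S\<^esub> ?g"
        using fs by (auto simp: free_module_simps free_gen_def fun_eq_iff)
      ultimately show ?thesis using st[OF fs[of s] sS g] by simp
    qed
  qed
qed

lemma free_hom_eq:
  assumes N: "Module.module R N" and f: "f \<in> mod_hom R (free_module R S) N"
    and g: "g \<in> mod_hom R (free_module R S) N"
    and eq: "\<And>s. s \<in> S \<Longrightarrow> f (free_gen R s) = g (free_gen R s)" and x: "x \<in> carrier (free_module R S)"
  shows "f x = g x"
proof -
  interpret N: Module.module R N by fact
  note F = free_module_module(1)[OF N.R.is_cring, of S]
  interpret F: Module.module R "free_module R S" by (rule F)
  show ?thesis using N.R.is_cring x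
  proof (induct rule: free_module_induct)
    case zero show ?case by (simp add: mod_hom_zero[OF f F N] mod_hom_zero[OF g F N])
  next
    case (step r s h)
    then show ?case
      by (simp add: mod_hom_add[OF f] mod_hom_add[OF g] mod_hom_smult[OF f] mod_hom_smult[OF g]
          free_gen_closed[OF N.R.is_cring] eq)
  qed
qed

lemma free_map_hom:
  assumes R: "cring R" and \<phi>: "\<And>s. s \<in> S \<Longrightarrow> \<phi> s \<in> T"
  shows "free_map R \<phi> \<in> mod_hom R (free_module R S) (free_module R T)"
    and "s \<in> S \<Longrightarrow> free_map R \<phi> (free_gen R s) = free_gen R (\<phi> s)"
proof -
  interpret R: cring R by fact
  let ?\<beta> = "\<lambda>t s. if \<phi> s = t then \<one>\<^bsub>R\<^esub> else \<zero>\<^bsub>R\<^esub>"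
  have eq: "free_map R \<phi> f t = lin_ext R (reg R) (?\<beta> t) f" if f: "f \<in> carrier (free_module R S)" for f t
  proof -
    have [simp]: "finsum (reg R) = finsum R" by (simp add: finsum_def finprod_def reg_def module_of_def fun_eq_iff)
    have fs: "f s \<in> carrier R" for s using f by (auto simp: free_module_simps)
    show ?thesis unfolding free_map_def lin_ext_def
      by (simp, rule R.add.finprod_mono_neutral_cong_left)
        (use f in \<open>auto simp: free_module_simps\<close>)
  qed
  have h: "lin_ext R (reg R) (?\<beta> t) \<in> mod_hom R (free_module R S) (reg R)" for t
    by (rule lin_ext_hom[OF reg_module[OF R]]) auto
  have sup: "{t. free_map R \<phi> f t \<noteq> \<zero>\<^bsub>R\<^esub>} \<subseteq> \<phi> ` {s. f s \<noteq> \<zero>\<^bsub>R\<^esub>}" for f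
  proof (rule subsetI, rule ccontr)
    fix t assume t: "t \<in> {t. free_map R \<phi> f t \<noteq> \<zero>\<^bsub>R\<^esub>}" "t \<notin> \<phi> ` {s. f s \<noteq> \<zero>\<^bsub>R\<^esub>}"
    then have "{s. f s \<noteq> \<zero>\<^bsub>R\<^esub> \<and> \<phi> s = t} = {}" by auto
    then have "free_map R \<phi> f t = \<zero>\<^bsub>R\<^esub>" unfolding free_map_def by (simp only: R.finsum_empty)
    with t show False by simp
  qed
  show "free_map R \<phi> \<in> mod_hom R (free_module R S) (free_module R T)"
  proof (rule mod_homI)
    fix f assume f: "f \<in> carrier (free_module R S)"
    show "free_map R \<phi> f \<in> carrier (free_module R T)"
    proof -
      have "\<phi> ` {s. f s \<noteq> \<zero>\<^bsub>R\<^esub>} \<subseteq> T" using f \<phi> by (auto simp: free_module_simps)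
      then have "{t. free_map R \<phi> f t \<noteq> \<zero>\<^bsub>R\<^esub>} \<subseteq> T" using sup[of f] by (rule subset_trans[rotated])
      moreover have "finite {t. free_map R \<phi> f t \<noteq> \<zero>\<^bsub>R\<^esub>}"
        by (rule finite_subset[OF sup[of f]]) (use f in \<open>auto simp: free_module_simps\<close>)
      moreover have "\<forall>t. free_map R \<phi> f t \<in> carrier R"
        using mod_hom_closed[OF h f] by (simp add: eq[OF f])
      ultimately show ?thesis unfolding free_module_simps by blast
    qed
  next
    interpret F: Module.module R "free_module R S" by (rule free_module_module(1)[OF R])
    show "free_map R \<phi> (f \<oplus>\<^bsub>free_module R S\<^esub> g) = free_map R \<phi> f \<oplus>\<^bsub>free_module R T\<^esub> free_map R \<phi> g"
      if "f \<in> carrier (free_module R S)" "g \<in> carrier (free_module R S)" for f g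
      using that by (simp add: fun_eq_iff eq mod_hom_add[OF h]) (simp add: free_module_simps eq fun_eq_iff)
    show "free_map R \<phi> (r \<odot>\<^bsub>free_module R S\<^esub> f) = r \<odot>\<^bsub>free_module R T\<^esub> free_map R \<phi> f"
      if "f \<in> carrier (free_module R S)" "r \<in> carrier R" for f r
      using that by (simp add: fun_eq_iff eq mod_hom_smult[OF h]) (simp add: free_module_simps eq fun_eq_iff)
  qed
  show "free_map R \<phi> (free_gen R s) = free_gen R (\<phi> s)" if s: "s \<in> S"
  proof
    fix t
    show "free_map R \<phi> (free_gen R s) t = free_gen R (\<phi> s) t"
      using lin_ext_hom(2)[OF reg_module[OF R], of S "?\<beta> t" s] s
      by (simp add: eq[OF free_gen_closed[OF R s]]) (auto simp: free_gen_def)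
  qed
qed

lemma quot_lift:
  assumes M: "Module.module R M" and H: "submodule H R M" and K: "Module.module R K"
    and \<psi>: "\<psi> \<in> mod_hom R M K" and k: "\<And>x. x \<in> H \<Longrightarrow> \<psi> x = \<zero>\<^bsub>K\<^esub>"
  obtains \<phi> where "\<phi> \<in> mod_hom R (quot_module M H) K"
    and "\<And>x. x \<in> carrier M \<Longrightarrow> \<phi> (H +>\<^bsub>M\<^esub> x) = \<psi> x"
proof -
  interpret M: Module.module R M by fact
  interpret K: Module.module R K by fact
  define \<phi> where "\<phi> X = \<psi> (SOME x. x \<in> carrier M \<and> H +>\<^bsub>M\<^esub> x = X)" for X
  have eq: "\<phi> (H +>\<^bsub>M\<^esub> x) = \<psi> x" if x: "x \<in> carrier M" for x
  proof -
    define y where "y = (SOME y. y \<in> carrier M \<and> H +>\<^bsub>M\<^esub> y = H +>\<^bsub>M\<^esub> x)"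
    have y: "y \<in> carrier M \<and> H +>\<^bsub>M\<^esub> y = H +>\<^bsub>M\<^esub> x"
      unfolding y_def by (rule someI[of _ x]) (simp add: x)
    then have "y \<ominus>\<^bsub>M\<^esub> x \<in> H" using quot_eq_iff[OF M H] x by blast
    then have "\<psi> y \<ominus>\<^bsub>K\<^esub> \<psi> x = \<zero>\<^bsub>K\<^esub>" using k[of "y \<ominus>\<^bsub>M\<^esub> x"] y x mod_hom_diff[OF \<psi> M K] by simp
    then have "\<psi> y = \<psi> x"
      using K.M.diff_eq_zero_iff[of "\<psi> y" "\<psi> x"] y x mod_hom_closed[OF \<psi>] by blast
    then show ?thesis by (simp add: \<phi>_def y_def)
  qed
  have "\<phi> \<in> mod_hom R (quot_module M H) K"
    by (rule mod_homI)
      (auto simp: quot_carrier[OF M H] quot_add[OF M H] quot_smult[OF M H] eq mod_hom_closed[OF \<psi>]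
        mod_hom_add[OF \<psi>] mod_hom_smult[OF \<psi>])
  with eq that show thesis by blast
qed

subsection \<open>Tensor products\<close>

definition bilinear :: "'a ring \<Rightarrow> ('a, 'm) module \<Rightarrow> ('a, 'n) module \<Rightarrow> ('a, 'k) module \<Rightarrow>
    ('m \<Rightarrow> 'n \<Rightarrow> 'k) \<Rightarrow> bool"
  where "bilinear R M N K \<beta> \<longleftrightarrow>
    (\<forall>x\<in>carrier M. \<beta> x \<in> mod_hom R N K) \<and> (\<forall>y\<in>carrier N. (\<lambda>x. \<beta> x y) \<in> mod_hom R M K)"

context
  fixes R :: "'a ring" and M :: "('a, 'm) module" and N :: "('a, 'n) module"
  assumes M: "Module.module R M" and N: "Module.module R N"
begin

interpretation M: Module.module R M by (rule M)
interpretation N: Module.module R N by (rule N)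

lemma tensor_free_module: "Module.module R (tensor_free R M N)"
  unfolding tensor_free_def by (rule free_module_module(1)[OF M.R.is_cring])

interpretation F: Module.module R "tensor_free R M N" by (rule tensor_free_module)

lemma tensor_gen_closed:
  "x \<in> carrier M \<Longrightarrow> y \<in> carrier N \<Longrightarrow> free_gen R (x, y) \<in> carrier (tensor_free R M N)"
  unfolding tensor_free_def by (rule free_gen_closed[OF M.R.is_cring]) auto

lemma tensor_rel_submodule: "submodule (tensor_rel R M N) R (tensor_free R M N)"
  unfolding tensor_rel_def Let_def
  by (rule gen_submodule_submodule[OF tensor_free_module])
    (auto intro!: tensor_gen_closed F.a_closed F.minus_closed F.M.minus_closed F.M.a_closed)

text \<open>Each defining relation of the tensor product expresses one of the identities of a bilinear map.\<close>

lemma tensor_rel_kernel: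
  assumes K: "Module.module R K" and \<psi>: "\<psi> \<in> mod_hom R (tensor_free R M N) K"
    and \<beta>: "bilinear R M N K \<beta>"
    and eq: "\<And>x y. x \<in> carrier M \<Longrightarrow> y \<in> carrier N \<Longrightarrow> \<psi> (free_gen R (x, y)) = \<beta> x y"
    and f: "f \<in> tensor_rel R M N"
  shows "\<psi> f = \<zero>\<^bsub>K\<^esub>"
proof -
  interpret K: Module.module R K by fact
  note dif = mod_hom_diff[OF \<psi> tensor_free_module K]
  have b: "\<beta> x \<in> mod_hom R N K" if "x \<in> carrier M" for x using \<beta> that by (simp add: bilinear_def)
  have b': "(\<lambda>x. \<beta> x y) \<in> mod_hom R M K" if "y \<in> carrier N" for y using \<beta> that by (simp add: bilinear_def)
  have bc: "\<beta> x y \<in> carrier K" if "x \<in> carrier M" "y \<in> carrier N" for x y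
    using mod_hom_closed[OF b] that by blast
  have zz: "u \<ominus>\<^bsub>K\<^esub> u = \<zero>\<^bsub>K\<^esub>" if "u \<in> carrier K" for u using that by (simp add: a_minus_def K.M.r_neg)
  have "tensor_rel R M N \<subseteq> {x \<in> carrier (tensor_free R M N). \<psi> x = \<zero>\<^bsub>K\<^esub>}"
    unfolding tensor_rel_def Let_def
    by (rule gen_submodule_least[OF submodule_kernel[OF tensor_free_module K \<psi>]])
      (auto simp: dif tensor_gen_closed mod_hom_add[OF \<psi>] mod_hom_smult[OF \<psi>] eq bc
        mod_hom_add[OF b] mod_hom_add[OF b'] mod_hom_smult[OF b] mod_hom_smult[OF b'] zz)
  then show ?thesis using f by auto
qed

lemma tensor_module: "Module.module R (tensor R M N)"
  unfolding tensor_def by (rule quot_module_module[OF tensor_free_module tensor_rel_submodule])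

lemma tensor_elt_closed:
  "x \<in> carrier M \<Longrightarrow> y \<in> carrier N \<Longrightarrow> tensor_elt R M N x y \<in> carrier (tensor R M N)"
  unfolding tensor_def tensor_elt_def
  by (simp add: quot_carrier[OF tensor_free_module tensor_rel_submodule] tensor_gen_closed)

lemma tensor_elt_bilinear: "bilinear R M N (tensor R M N) (tensor_elt R M N)"
proof -
  let ?F = "tensor_free R M N" and ?H = "tensor_rel R M N"
  note q = tensor_free_module tensor_rel_submodule
  have eqI: "?H +>\<^bsub>?F\<^esub> u = ?H +>\<^bsub>?F\<^esub> v"
    if "u \<ominus>\<^bsub>?F\<^esub> v \<in> ?H" "u \<in> carrier ?F" "v \<in> carrier ?F" for u v
    using that quot_eq_iff[OF q] by blast
  note inc = subsetD[OF gen_submodule_incl]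
  have 1: "tensor_elt R M N (x \<oplus>\<^bsub>M\<^esub> x') y =
      tensor_elt R M N x y \<oplus>\<^bsub>tensor R M N\<^esub> tensor_elt R M N x' y"
    if "x \<in> carrier M" "x' \<in> carrier M" "y \<in> carrier N" for x x' y
    unfolding tensor_def tensor_elt_def quot_add[OF q tensor_gen_closed[OF that(1,3)] tensor_gen_closed[OF that(2,3)]]
  proof (rule eqI)
    show "free_gen R (x \<oplus>\<^bsub>M\<^esub> x', y) \<ominus>\<^bsub>?F\<^esub> (free_gen R (x, y) \<oplus>\<^bsub>?F\<^esub> free_gen R (x', y)) \<in> ?H"
      unfolding tensor_rel_def Let_def by (rule inc) (use that in blast)
  qed (use that in \<open>auto intro!: tensor_gen_closed F.M.a_closed\<close>)
  have 2: "tensor_elt R M N x (y \<oplus>\<^bsub>N\<^esub> y') =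
      tensor_elt R M N x y \<oplus>\<^bsub>tensor R M N\<^esub> tensor_elt R M N x y'"
    if "x \<in> carrier M" "y \<in> carrier N" "y' \<in> carrier N" for x y y'
    unfolding tensor_def tensor_elt_def quot_add[OF q tensor_gen_closed[OF that(1,2)] tensor_gen_closed[OF that(1,3)]]
  proof (rule eqI)
    show "free_gen R (x, y \<oplus>\<^bsub>N\<^esub> y') \<ominus>\<^bsub>?F\<^esub> (free_gen R (x, y) \<oplus>\<^bsub>?F\<^esub> free_gen R (x, y')) \<in> ?H"
      unfolding tensor_rel_def Let_def by (rule inc) (use that in blast)
  qed (use that in \<open>auto intro!: tensor_gen_closed F.M.a_closed\<close>)
  have 3: "tensor_elt R M N (r \<odot>\<^bsub>M\<^esub> x) y = r \<odot>\<^bsub>tensor R M N\<^esub> tensor_elt R M N x y"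
    if "r \<in> carrier R" "x \<in> carrier M" "y \<in> carrier N" for r x y
    unfolding tensor_def tensor_elt_def quot_smult[OF q that(1) tensor_gen_closed[OF that(2,3)]]
  proof (rule eqI)
    show "free_gen R (r \<odot>\<^bsub>M\<^esub> x, y) \<ominus>\<^bsub>?F\<^esub> (r \<odot>\<^bsub>?F\<^esub> free_gen R (x, y)) \<in> ?H"
      unfolding tensor_rel_def Let_def by (rule inc) (use that in blast)
  qed (use that in \<open>auto intro!: tensor_gen_closed F.smult_closed\<close>)
  have 4: "tensor_elt R M N x (r \<odot>\<^bsub>N\<^esub> y) = r \<odot>\<^bsub>tensor R M N\<^esub> tensor_elt R M N x y"
    if "r \<in> carrier R" "x \<in> carrier M" "y \<in> carrier N" for r x y
    unfolding tensor_def tensor_elt_def quot_smult[OF q that(1) tensor_gen_closed[OF that(2,3)]]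
  proof (rule eqI)
    show "free_gen R (x, r \<odot>\<^bsub>N\<^esub> y) \<ominus>\<^bsub>?F\<^esub> (r \<odot>\<^bsub>?F\<^esub> free_gen R (x, y)) \<in> ?H"
      unfolding tensor_rel_def Let_def by (rule inc) (use that in blast)
  qed (use that in \<open>auto intro!: tensor_gen_closed F.smult_closed\<close>)
  show ?thesis unfolding bilinear_def
    by (intro conjI ballI mod_homI 1 2 3 4 tensor_elt_closed)
qed

lemma tensor_elt_hom_right: "x \<in> carrier M \<Longrightarrow> tensor_elt R M N x \<in> mod_hom R N (tensor R M N)"
  and tensor_elt_hom_left: "y \<in> carrier N \<Longrightarrow> (\<lambda>x. tensor_elt R M N x y) \<in> mod_hom R M (tensor R M N)"
  using tensor_elt_bilinear by (auto simp: bilinear_def)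

lemma tensor_induct [consumes 1, case_names zero step]:
  assumes t: "t \<in> carrier (tensor R M N)"
    and z: "P \<zero>\<^bsub>tensor R M N\<^esub>"
    and st: "\<And>x y t. x \<in> carrier M \<Longrightarrow> y \<in> carrier N \<Longrightarrow> t \<in> carrier (tensor R M N) \<Longrightarrow> P t \<Longrightarrow>
      P (tensor_elt R M N x y \<oplus>\<^bsub>tensor R M N\<^esub> t)"
  shows "P t"
proof -
  let ?F = "tensor_free R M N" and ?H = "tensor_rel R M N"
  note q = tensor_free_module tensor_rel_submodule
  have "P (?H +>\<^bsub>?F\<^esub> f)" if "f \<in> carrier (free_module R (carrier M \<times> carrier N))" for f
    using M.R.is_cring that
  proof (induct rule: free_module_induct)
    case zero
    then show ?case using z quot_zero[OF q] by (simp add: tensor_def tensor_free_def)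
  next
    case (step r s g)
    obtain x y where s: "s = (x, y)" "x \<in> carrier M" "y \<in> carrier N" using step(2) by auto
    have g: "g \<in> carrier ?F" using step(3) by (simp add: tensor_free_def)
    have "P (tensor_elt R M N (r \<odot>\<^bsub>M\<^esub> x) y \<oplus>\<^bsub>tensor R M N\<^esub> (?H +>\<^bsub>?F\<^esub> g))"
      by (rule st) (use s step g in \<open>auto simp: tensor_def quot_carrier[OF q]\<close>)
    moreover have "tensor_elt R M N (r \<odot>\<^bsub>M\<^esub> x) y = ?H +>\<^bsub>?F\<^esub> (r \<odot>\<^bsub>?F\<^esub> free_gen R (x, y))"
      using mod_hom_smult[OF tensor_elt_hom_left[OF s(3)] step(1) s(2)] s step(1)
      by (simp add: tensor_def tensor_elt_def quot_smult[OF q] tensor_gen_closed)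
    ultimately show ?case
      using s step g by (simp add: tensor_def quot_add[OF q] tensor_gen_closed) (simp add: tensor_free_def)
  qed
  then show ?thesis using t
    by (auto simp: tensor_def quot_carrier[OF q] simp flip: tensor_free_def)
qed

lemma tensor_hom_eq:
  assumes K: "Module.module R K" and f: "f \<in> mod_hom R (tensor R M N) K" and g: "g \<in> mod_hom R (tensor R M N) K"
    and eq: "\<And>x y. x \<in> carrier M \<Longrightarrow> y \<in> carrier N \<Longrightarrow> f (tensor_elt R M N x y) = g (tensor_elt R M N x y)"
    and t: "t \<in> carrier (tensor R M N)"
  shows "f t = g t"
  using t
proof (induct rule: tensor_induct)
  case zero show ?case by (simp add: mod_hom_zero[OF f tensor_module K] mod_hom_zero[OF g tensor_module K])
next
  case (step x y t)
  then show ?case by (simp add: mod_hom_add[OF f] mod_hom_add[OF g] tensor_elt_closed eq)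
qed

lemma tensor_lift:
  assumes K: "Module.module R K" and \<beta>: "bilinear R M N K \<beta>"
  obtains \<phi> where "\<phi> \<in> mod_hom R (tensor R M N) K"
    and "\<And>x y. x \<in> carrier M \<Longrightarrow> y \<in> carrier N \<Longrightarrow> \<phi> (tensor_elt R M N x y) = \<beta> x y"
proof -
  let ?\<psi> = "lin_ext R K (case_prod \<beta>)"
  have bc: "\<beta> x y \<in> carrier K" if "x \<in> carrier M" "y \<in> carrier N" for x y
    using \<beta> that mod_hom_closed unfolding bilinear_def by metis
  have \<psi>: "?\<psi> \<in> mod_hom R (tensor_free R M N) K" unfolding tensor_free_def
    by (rule lin_ext_hom(1)[OF K]) (use bc in auto)
  have eq: "?\<psi> (free_gen R (x, y)) = \<beta> x y" if "x \<in> carrier M" "y \<in> carrier N" for x y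
    using lin_ext_hom(2)[OF K, of "carrier M \<times> carrier N" "case_prod \<beta>" "(x, y)"] bc that by auto
  obtain \<phi> where \<phi>: "\<phi> \<in> mod_hom R (quot_module (tensor_free R M N) (tensor_rel R M N)) K"
    "\<And>x. x \<in> carrier (tensor_free R M N) \<Longrightarrow> \<phi> (tensor_rel R M N +>\<^bsub>tensor_free R M N\<^esub> x) = ?\<psi> x"
    using quot_lift[OF tensor_free_module tensor_rel_submodule K \<psi> tensor_rel_kernel[OF K \<psi> \<beta> eq]] by blast
  show thesis
    by (rule that[of \<phi>]) (use \<phi> eq in \<open>auto simp: tensor_def tensor_elt_def tensor_gen_closed\<close>)
qed

end

lemma tensor_map_hom:
  assumes M: "Module.module R M" and N: "Module.module R N"
    and M': "Module.module R M'" and N': "Module.module R N'"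
    and f: "f \<in> mod_hom R M M'" and g: "g \<in> mod_hom R N N'"
  shows "tensor_map R M' N' f g \<in> mod_hom R (tensor R M N) (tensor R M' N')"
    and "x \<in> carrier M \<Longrightarrow> y \<in> carrier N \<Longrightarrow>
      tensor_map R M' N' f g (tensor_elt R M N x y) = tensor_elt R M' N' (f x) (g y)"
proof -
  let ?F = "tensor_free R M N" and ?H = "tensor_rel R M N"
  let ?F' = "tensor_free R M' N'" and ?H' = "tensor_rel R M' N'"
  interpret M: Module.module R M by fact
  note q = tensor_free_module[OF M N] tensor_rel_submodule[OF M N]
  note q' = tensor_free_module[OF M' N'] tensor_rel_submodule[OF M' N']
  have fm: "free_map R (map_prod f g) \<in> mod_hom R ?F ?F'" unfolding tensor_free_def
    by (rule free_map_hom[OF M.R.is_cring]) (auto simp: mod_hom_closed[OF f] mod_hom_closed[OF g])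
  have gen: "free_map R (map_prod f g) (free_gen R (x, y)) = free_gen R (f x, g y)"
    if "x \<in> carrier M" "y \<in> carrier N" for x y
    using free_map_hom(2)[OF M.R.is_cring, of "carrier M \<times> carrier N" "map_prod f g" "carrier M' \<times> carrier N'" "(x, y)"]
      that by (auto simp: mod_hom_closed[OF f] mod_hom_closed[OF g])
  let ?\<psi> = "\<lambda>x. ?H' +>\<^bsub>?F'\<^esub> free_map R (map_prod f g) x"
  have \<psi>: "?\<psi> \<in> mod_hom R ?F (tensor R M' N')" unfolding tensor_def
    by (rule mod_hom_comp[OF fm quot_proj_hom[OF q']])
  have bil: "bilinear R M N (tensor R M' N') (\<lambda>x y. tensor_elt R M' N' (f x) (g y))"
    unfolding bilinear_def
    using mod_hom_comp[OF g tensor_elt_hom_right[OF M' N' mod_hom_closed[OF f]]]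
      mod_hom_comp[OF f tensor_elt_hom_left[OF M' N' mod_hom_closed[OF g]]] by auto
  have inH: "free_map R (map_prod f g) h \<in> ?H'" if h: "h \<in> ?H" for h
  proof -
    have "?\<psi> h = \<zero>\<^bsub>tensor R M' N'\<^esub>"
      by (rule tensor_rel_kernel[OF M N tensor_module[OF M' N'] \<psi> bil _ h]) (simp add: gen tensor_elt_def)
    moreover have "h \<in> carrier ?F" using h subsetD[OF Module.module.submoduleE(1)[OF q]] by auto
    ultimately show ?thesis
      using quot_eq_zero_iff[OF q' mod_hom_closed[OF fm]] by (auto simp: tensor_def)
  qed
  show "tensor_map R M' N' f g \<in> mod_hom R (tensor R M N) (tensor R M' N')"
    unfolding tensor_map_def tensor_def by (rule quot_map_hom(1)[OF q q' fm inH])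
  show "x \<in> carrier M \<Longrightarrow> y \<in> carrier N \<Longrightarrow>
      tensor_map R M' N' f g (tensor_elt R M N x y) = tensor_elt R M' N' (f x) (g y)"
    unfolding tensor_map_def tensor_elt_def
    by (simp add: quot_map_hom(2)[OF q q' fm inH] tensor_gen_closed[OF M N] gen)
qed

lemma tensor_map_comp:
  assumes M: "Module.module R M" and N: "Module.module R N"
    and M': "Module.module R M'" and N': "Module.module R N'"
    and K: "Module.module R K" and L: "Module.module R L"
    and f: "f \<in> mod_hom R M M'" and g: "g \<in> mod_hom R N N'"
    and f': "f' \<in> mod_hom R M' K" and g': "g' \<in> mod_hom R N' L"
    and h: "\<And>x. x \<in> carrier M \<Longrightarrow> h x = f' (f x)" and k: "\<And>y. y \<in> carrier N \<Longrightarrow> k y = g' (g y)"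
    and t: "t \<in> carrier (tensor R M N)"
  shows "tensor_map R K L f' g' (tensor_map R M' N' f g t) = tensor_map R K L h k t"
proof -
  interpret M: Module.module R M by fact
  interpret N: Module.module R N by fact
  have h': "h \<in> mod_hom R M K" using mod_hom_comp[OF f f'] h by (auto simp: mod_hom_def Pi_iff)
  have k': "k \<in> mod_hom R N L" using mod_hom_comp[OF g g'] k by (auto simp: mod_hom_def Pi_iff)
  show ?thesis
    by (rule tensor_hom_eq[OF M N tensor_module[OF K L] _ _ _ t,
        OF mod_hom_comp[OF tensor_map_hom(1)[OF M N M' N' f g] tensor_map_hom(1)[OF M' N' K L f' g']]
          tensor_map_hom(1)[OF M N K L h' k']])
      (simp add: tensor_map_hom(2)[OF M N M' N' f g] tensor_map_hom(2)[OF M' N' K L f' g']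
        tensor_map_hom(2)[OF M N K L h' k'] h k mod_hom_closed[OF f] mod_hom_closed[OF g])
qed

lemma tensor_map_ident:
  assumes M: "Module.module R M" and N: "Module.module R N"
    and h: "\<And>x. x \<in> carrier M \<Longrightarrow> h x = x" and k: "\<And>y. y \<in> carrier N \<Longrightarrow> k y = y"
    and t: "t \<in> carrier (tensor R M N)"
  shows "tensor_map R M N h k t = t"
proof -
  interpret M: Module.module R M by fact
  interpret N: Module.module R N by fact
  have h': "h \<in> mod_hom R M M" using h by (auto simp: mod_hom_def Pi_iff)
  have k': "k \<in> mod_hom R N N" using k by (auto simp: mod_hom_def Pi_iff)
  show ?thesis
    by (rule tensor_hom_eq[OF M N tensor_module[OF M N] tensor_map_hom(1)[OF M N M N h' k'] mod_hom_id(1) _ t])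
      (simp add: tensor_map_hom(2)[OF M N M N h' k'] h k)
qed

lemma tensor_map_zero:
  assumes M: "Module.module R M" and N: "Module.module R N"
    and M': "Module.module R M'" and N': "Module.module R N'"
    and f: "f \<in> mod_hom R M M'" and g: "g \<in> mod_hom R N N'"
    and z: "(\<forall>x \<in> carrier M. f x = \<zero>\<^bsub>M'\<^esub>) \<or> (\<forall>y \<in> carrier N. g y = \<zero>\<^bsub>N'\<^esub>)"
    and t: "t \<in> carrier (tensor R M N)"
  shows "tensor_map R M' N' f g t = \<zero>\<^bsub>tensor R M' N'\<^esub>"
proof (rule tensor_hom_eq[OF M N tensor_module[OF M' N'] tensor_map_hom(1)[OF M N M' N' f g]
      mod_hom_const_zero[OF tensor_module[OF M' N']] _ t])
  fix x y assume x: "x \<in> carrier M" "y \<in> carrier N"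
  show "tensor_map R M' N' f g (tensor_elt R M N x y) = \<zero>\<^bsub>tensor R M' N'\<^esub>"
    using z x mod_hom_zero[OF tensor_elt_hom_left[OF M' N' mod_hom_closed[OF g]] M' tensor_module[OF M' N']]
      mod_hom_zero[OF tensor_elt_hom_right[OF M' N' mod_hom_closed[OF f]] N' tensor_module[OF M' N']]
    by (auto simp: tensor_map_hom(2)[OF M N M' N' f g])
qed

subsection \<open>Tensoring with a free module\<close>

text \<open>The expansion of \<open>x\<close> is required over every finite set that contains \<open>E0\<close>, so that several elements
  can be expanded over one common index set.\<close>

definition dual_basis :: "'a ring \<Rightarrow> ('a, 'm) module \<Rightarrow> 's set \<Rightarrow> ('s \<Rightarrow> 'm) \<Rightarrow> ('s \<Rightarrow> 'm \<Rightarrow> 'a) \<Rightarrow> bool"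
  where "dual_basis R M B e c \<longleftrightarrow>
    (\<forall>b\<in>B. e b \<in> carrier M \<and> c b \<in> mod_hom R M (reg R)) \<and>
    (\<forall>x\<in>carrier M. \<exists>E0. finite E0 \<and> E0 \<subseteq> B \<and>
      (\<forall>E. finite E \<longrightarrow> E0 \<subseteq> E \<longrightarrow> E \<subseteq> B \<longrightarrow> x = (\<Oplus>\<^bsub>M\<^esub>b\<in>E. c b x \<odot>\<^bsub>M\<^esub> e b)))"

lemma mod_hom_inv:
  assumes f: "f \<in> mod_hom R M N" and bij: "bij_betw f (carrier M) (carrier N)" and M: "Module.module R M"
  shows "inv_into (carrier M) f \<in> mod_hom R N M"
proof -
  interpret M: Module.module R M by fact
  have inj: "inj_on f (carrier M)" and im: "f ` carrier M = carrier N" using bij by (auto simp: bij_betw_def)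
  let ?g = "inv_into (carrier M) f"
  have gc: "?g y \<in> carrier M" "f (?g y) = y" if "y \<in> carrier N" for y
    using that im by (auto intro: inv_into_into f_inv_into_f)
  have gf: "?g (f x) = x" if "x \<in> carrier M" for x using that inj by simp
  show ?thesis
  proof (rule mod_homI)
    fix x y assume "x \<in> carrier N" "y \<in> carrier N"
    then show "?g (x \<oplus>\<^bsub>N\<^esub> y) = ?g x \<oplus>\<^bsub>M\<^esub> ?g y"
      using gc gf[of "?g x \<oplus>\<^bsub>M\<^esub> ?g y"] by (simp add: mod_hom_add[OF f])
  next
    fix r x assume "r \<in> carrier R" "x \<in> carrier N"
    then show "?g (r \<odot>\<^bsub>N\<^esub> x) = r \<odot>\<^bsub>M\<^esub> ?g x"
      using gc gf[of "r \<odot>\<^bsub>M\<^esub> ?g x"] by (simp add: mod_hom_smult[OF f])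
  qed (rule gc)
qed

lemma is_free_iso:
  assumes M: "Module.module R M" and "is_free R M"
  obtains B where "B \<subseteq> carrier M" "lin_ext R M (\<lambda>b. b) \<in> mod_hom R (free_module R B) M"
    "bij_betw (lin_ext R M (\<lambda>b. b)) (carrier (free_module R B)) (carrier M)"
proof -
  obtain B where B: "B \<subseteq> carrier M"
    and bij: "bij_betw (\<lambda>f. \<Oplus>\<^bsub>M\<^esub>b\<in>{b. f b \<noteq> \<zero>\<^bsub>R\<^esub>}. f b \<odot>\<^bsub>M\<^esub> b) (carrier (free_module R B)) (carrier M)"
    using assms(2) unfolding is_free_def by blast
  show thesis
  proof (rule that[OF B])
    show "lin_ext R M (\<lambda>b. b) \<in> mod_hom R (free_module R B) M"
      by (rule lin_ext_hom(1)[OF M]) (use B in auto)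
    show "bij_betw (lin_ext R M (\<lambda>b. b)) (carrier (free_module R B)) (carrier M)"
      using bij unfolding lin_ext_def[abs_def] .
  qed
qed

lemma is_free_dual_basis:
  fixes M :: "('a, 'm) module"
  assumes M: "Module.module R M" and free: "is_free R M"
  obtains B :: "'m set" and e c where "dual_basis R M B e c"
proof -
  interpret M: Module.module R M by fact
  obtain B where B: "B \<subseteq> carrier M" and h: "lin_ext R M (\<lambda>b. b) \<in> mod_hom R (free_module R B) M"
    and bij: "bij_betw (lin_ext R M (\<lambda>b. b)) (carrier (free_module R B)) (carrier M)"
    using is_free_iso[OF M free] by blast
  let ?ev = "lin_ext R M (\<lambda>b. b)" and ?F = "free_module R B"
  note F = free_module_module(1)[OF M.R.is_cring, of B]
  have inv: "inv_into (carrier ?F) ?ev \<in> mod_hom R M ?F" by (rule mod_hom_inv[OF h bij F])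
  have ex: "\<exists>E0. finite E0 \<and> E0 \<subseteq> B \<and>
      (\<forall>E. finite E \<longrightarrow> E0 \<subseteq> E \<longrightarrow> E \<subseteq> B \<longrightarrow> x = (\<Oplus>\<^bsub>M\<^esub>b\<in>E. inv_into (carrier ?F) ?ev x b \<odot>\<^bsub>M\<^esub> b))"
    if x: "x \<in> carrier M" for x
  proof -
    define f where "f = inv_into (carrier ?F) ?ev x"
    have f: "f \<in> carrier ?F" unfolding f_def by (rule mod_hom_closed[OF inv x])
    have ev: "?ev f = x" unfolding f_def by (rule bij_betw_inv_into_right[OF bij x])
    show ?thesis
    proof (intro exI conjI allI impI)
      show "finite {b. f b \<noteq> \<zero>\<^bsub>R\<^esub>}" "{b. f b \<noteq> \<zero>\<^bsub>R\<^esub>} \<subseteq> B" using f by (auto simp: free_module_simps)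
      fix E assume E: "finite E" "{b. f b \<noteq> \<zero>\<^bsub>R\<^esub>} \<subseteq> E" "E \<subseteq> B"
      have "x = (\<Oplus>\<^bsub>M\<^esub>b\<in>E. f b \<odot>\<^bsub>M\<^esub> b)"
        using lin_ext_superset[OF M f _ E, of "\<lambda>b. b"] ev B by auto
      then show "x = (\<Oplus>\<^bsub>M\<^esub>b\<in>E. inv_into (carrier ?F) ?ev x b \<odot>\<^bsub>M\<^esub> b)" by (simp add: f_def)
    qed
  qed
  have "dual_basis R M B (\<lambda>b. b) (\<lambda>b x. inv_into (carrier ?F) ?ev x b)"
    unfolding dual_basis_def
    using B ex mod_hom_comp[OF inv free_module_eval_hom[OF M.R.is_cring]] by auto
  then show thesis by (rule that)
qed

text \<open>A free module is flat: the coordinate maps of the free factor split a tensor into elements of the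
  other factor, and they commute with maps of that factor, so a cycle is a boundary coordinate by
  coordinate.\<close>

lemma tensor_free_exact:
  assumes X: "Module.module R X1" "Module.module R X2" "Module.module R X3" and F: "Module.module R F"
    and f: "f \<in> mod_hom R X1 X2" and g: "g \<in> mod_hom R X2 X3"
    and ex: "\<And>x. x \<in> carrier X2 \<Longrightarrow> g x = \<zero>\<^bsub>X3\<^esub> \<Longrightarrow> \<exists>w\<in>carrier X1. x = f w"
    and db: "dual_basis R F B e c"
    and t: "t \<in> carrier (tensor R X2 F)" and gt: "tensor_map R X3 F g id t = \<zero>\<^bsub>tensor R X3 F\<^esub>"
  shows "\<exists>s\<in>carrier (tensor R X1 F). t = tensor_map R X2 F f id s"
proof -
  interpret X1: Module.module R X1 by (rule X)
  interpret X2: Module.module R X2 by (rule X)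
  interpret X3: Module.module R X3 by (rule X)
  interpret F: Module.module R F by (rule F)
  interpret T: Module.module R "tensor R X2 F" by (rule tensor_module[OF X(2) F])
  interpret T1: Module.module R "tensor R X1 F" by (rule tensor_module[OF X(1) F])
  have eB: "e b \<in> carrier F" and cB: "c b \<in> mod_hom R F (reg R)" if "b \<in> B" for b
    using db that by (auto simp: dual_basis_def)
  have bil: "bilinear R X F X (\<lambda>x y. c b y \<odot>\<^bsub>X\<^esub> x)" if b: "b \<in> B" and XX: "Module.module R X" for b and X :: "('a, 'x) module"
  proof -
    interpret X: Module.module R X by (rule XX)
    have cc: "c b y \<in> carrier R" if "y \<in> carrier F" for y using mod_hom_closed[OF cB[OF b] that] by simp
    have cadd: "c b (y \<oplus>\<^bsub>F\<^esub> y') = c b y \<oplus>\<^bsub>R\<^esub> c b y'" if "y \<in> carrier F" "y' \<in> carrier F" for y y'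
      using mod_hom_add[OF cB[OF b] that] by simp
    have csm: "c b (r \<odot>\<^bsub>F\<^esub> y) = r \<otimes>\<^bsub>R\<^esub> c b y" if "r \<in> carrier R" "y \<in> carrier F" for r y
      using mod_hom_smult[OF cB[OF b] that] by simp
    have comm: "c b y \<odot>\<^bsub>X\<^esub> (r \<odot>\<^bsub>X\<^esub> x) = r \<odot>\<^bsub>X\<^esub> (c b y \<odot>\<^bsub>X\<^esub> x)"
      if "r \<in> carrier R" "y \<in> carrier F" "x \<in> carrier X" for r x y
    proof -
      have "c b y \<odot>\<^bsub>X\<^esub> (r \<odot>\<^bsub>X\<^esub> x) = (c b y \<otimes>\<^bsub>R\<^esub> r) \<odot>\<^bsub>X\<^esub> x"
        by (rule X.smult_assoc1[OF cc[OF that(2)] that(1,3), symmetric])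
      also have "\<dots> = (r \<otimes>\<^bsub>R\<^esub> c b y) \<odot>\<^bsub>X\<^esub> x"
        by (rule arg_cong[OF X1.R.m_comm[OF cc[OF that(2)] that(1)]])
      also have "\<dots> = r \<odot>\<^bsub>X\<^esub> (c b y \<odot>\<^bsub>X\<^esub> x)" by (rule X.smult_assoc1[OF that(1) cc[OF that(2)] that(3)])
      finally show ?thesis .
    qed
    show ?thesis unfolding bilinear_def
      by (intro conjI ballI mod_homI)
        (simp_all add: cc cadd csm X.smult_l_distr X.smult_r_distr X.smult_assoc1, rule comm)
  qed
  have "\<exists>\<kappa>. \<kappa> \<in> mod_hom R (tensor R X2 F) X2 \<and>
      (\<forall>x\<in>carrier X2. \<forall>y\<in>carrier F. \<kappa> (tensor_elt R X2 F x y) = c b y \<odot>\<^bsub>X2\<^esub> x)" if "b \<in> B" for b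
    by (rule tensor_lift[OF X(2) F X(2) bil[OF that X(2)]]) blast
  then obtain \<kappa> where \<kappa>: "\<And>b. b \<in> B \<Longrightarrow> \<kappa> b \<in> mod_hom R (tensor R X2 F) X2"
    and \<kappa>e: "\<And>b x y. b \<in> B \<Longrightarrow> x \<in> carrier X2 \<Longrightarrow> y \<in> carrier F \<Longrightarrow> \<kappa> b (tensor_elt R X2 F x y) = c b y \<odot>\<^bsub>X2\<^esub> x"
    by metis
  have ker: "g (\<kappa> b t) = \<zero>\<^bsub>X3\<^esub>" if b: "b \<in> B" for b
  proof -
    obtain \<kappa>' where \<kappa>': "\<kappa>' \<in> mod_hom R (tensor R X3 F) X3"
      and \<kappa>'e: "\<And>x y. x \<in> carrier X3 \<Longrightarrow> y \<in> carrier F \<Longrightarrow> \<kappa>' (tensor_elt R X3 F x y) = c b y \<odot>\<^bsub>X3\<^esub> x"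
      using tensor_lift[OF X(3) F X(3) bil[OF b X(3)]] by blast
    note gm = tensor_map_hom[OF X(2) F X(3) F g mod_hom_id(2)]
    have "g (\<kappa> b t) = \<kappa>' (tensor_map R X3 F g id t)"
      by (rule tensor_hom_eq[OF X(2) F X(3) mod_hom_comp[OF \<kappa>[OF b] g] mod_hom_comp[OF gm(1) \<kappa>'] _ t])
        (use mod_hom_closed[OF cB[OF b]] in
          \<open>simp add: gm(2) \<kappa>e[OF b] \<kappa>'e mod_hom_closed[OF g] mod_hom_smult[OF g]\<close>)
    then show ?thesis by (simp add: gt mod_hom_zero[OF \<kappa>' tensor_module[OF X(3) F] X(3)])
  qed
  have "\<exists>E0. finite E0 \<and> E0 \<subseteq> B \<and> (\<forall>E. finite E \<longrightarrow> E0 \<subseteq> E \<longrightarrow> E \<subseteq> B \<longrightarrow>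
      t = (\<Oplus>\<^bsub>tensor R X2 F\<^esub>b\<in>E. tensor_elt R X2 F (\<kappa> b t) (e b)))"
    using t
  proof (induct rule: tensor_induct[OF X(2) F, consumes 1, case_names zero step])
    case zero
    have z: "tensor_elt R X2 F (\<kappa> b \<zero>\<^bsub>tensor R X2 F\<^esub>) (e b) = \<zero>\<^bsub>tensor R X2 F\<^esub>" if "b \<in> B" for b
      using mod_hom_zero[OF tensor_elt_hom_left[OF X(2) F eB[OF that]] X(2) tensor_module[OF X(2) F]]
        mod_hom_zero[OF \<kappa>[OF that] tensor_module[OF X(2) F] X(2)] by simp
    show ?case
      by (intro exI[of _ "{}"] conjI allI impI finite.emptyI empty_subsetI,
          rule sym, rule T.M.add.finprod_one_eqI) (use z in auto)
  next
    case (step x y s)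
    let ?T = "tensor R X2 F" and ?e = "tensor_elt R X2 F"
    obtain E1 where E1: "finite E1" "E1 \<subseteq> B"
      "\<And>E. finite E \<Longrightarrow> E1 \<subseteq> E \<Longrightarrow> E \<subseteq> B \<Longrightarrow> s = (\<Oplus>\<^bsub>?T\<^esub>b\<in>E. ?e (\<kappa> b s) (e b))"
      using step(4) by blast
    obtain E2 where E2: "finite E2" "E2 \<subseteq> B"
      "\<And>E. finite E \<Longrightarrow> E2 \<subseteq> E \<Longrightarrow> E \<subseteq> B \<Longrightarrow> y = (\<Oplus>\<^bsub>F\<^esub>b\<in>E. c b y \<odot>\<^bsub>F\<^esub> e b)"
      using db step(2) unfolding dual_basis_def by blast
    have cl: "?e (\<kappa> b u) (e b) \<in> carrier ?T" if "b \<in> B" "u \<in> carrier ?T" for b u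
      using that by (auto intro!: tensor_elt_closed[OF X(2) F] eB mod_hom_closed[OF \<kappa>])
    have cy: "c b y \<in> carrier R" if "b \<in> B" for b using mod_hom_closed[OF cB[OF that] step(2)] by simp
    have "?e x y \<oplus>\<^bsub>?T\<^esub> s = (\<Oplus>\<^bsub>?T\<^esub>b\<in>E. ?e (\<kappa> b (?e x y \<oplus>\<^bsub>?T\<^esub> s)) (e b))"
      if E: "finite E" "E1 \<union> E2 \<subseteq> E" "E \<subseteq> B" for E
    proof -
      have E': "b \<in> B" if "b \<in> E" for b using that E by auto
      have xy: "?e x y \<in> carrier ?T" by (rule tensor_elt_closed[OF X(2) F step(1,2)])
      have "?e x y = ?e x (\<Oplus>\<^bsub>F\<^esub>b\<in>E. c b y \<odot>\<^bsub>F\<^esub> e b)" using E2(3)[of E] E by simp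
      also have "\<dots> = (\<Oplus>\<^bsub>?T\<^esub>b\<in>E. ?e x (c b y \<odot>\<^bsub>F\<^esub> e b))"
        by (rule mod_hom_finsum[OF tensor_elt_hom_right[OF X(2) F step(1)] F tensor_module[OF X(2) F] E(1)])
          (use E' cy eB in auto)
      also have "\<dots> = (\<Oplus>\<^bsub>?T\<^esub>b\<in>E. ?e (\<kappa> b (?e x y)) (e b))"
        by (rule T.M.finsum_cong')
          (use E' cl xy step in \<open>auto simp: \<kappa>e mod_hom_smult[OF tensor_elt_hom_right[OF X(2) F]]
             mod_hom_smult[OF tensor_elt_hom_left[OF X(2) F]] cy eB\<close>)
      finally have 1: "?e x y = (\<Oplus>\<^bsub>?T\<^esub>b\<in>E. ?e (\<kappa> b (?e x y)) (e b))" .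
      have 2: "s = (\<Oplus>\<^bsub>?T\<^esub>b\<in>E. ?e (\<kappa> b s) (e b))" using E1(3)[of E] E by simp
      have "(\<Oplus>\<^bsub>?T\<^esub>b\<in>E. ?e (\<kappa> b (?e x y \<oplus>\<^bsub>?T\<^esub> s)) (e b)) =
          (\<Oplus>\<^bsub>?T\<^esub>b\<in>E. ?e (\<kappa> b (?e x y)) (e b) \<oplus>\<^bsub>?T\<^esub> ?e (\<kappa> b s) (e b))"
        by (rule T.M.finsum_cong')
          (use E' cl xy step(3) in \<open>auto simp: mod_hom_add[OF \<kappa>] mod_hom_closed[OF \<kappa>]
             mod_hom_add[OF tensor_elt_hom_left[OF X(2) F]] eB\<close>)
      also have "\<dots> = (\<Oplus>\<^bsub>?T\<^esub>b\<in>E. ?e (\<kappa> b (?e x y)) (e b)) \<oplus>\<^bsub>?T\<^esub> (\<Oplus>\<^bsub>?T\<^esub>b\<in>E. ?e (\<kappa> b s) (e b))"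
        by (rule T.M.finsum_addf) (use E' cl xy step(3) in auto)
      also have "\<dots> = ?e x y \<oplus>\<^bsub>?T\<^esub> s" using 1 2 by simp
      finally show ?thesis by simp
    qed
    then show ?case using E1 E2 by (intro exI[of _ "E1 \<union> E2"]) auto
  qed
  then obtain E where E: "finite E" "E \<subseteq> B" and all: "\<forall>E'. finite E' \<longrightarrow> E \<subseteq> E' \<longrightarrow> E' \<subseteq> B \<longrightarrow>
      t = (\<Oplus>\<^bsub>tensor R X2 F\<^esub>b\<in>E'. tensor_elt R X2 F (\<kappa> b t) (e b))" by (elim exE conjE)
  have tE: "t = (\<Oplus>\<^bsub>tensor R X2 F\<^esub>b\<in>E. tensor_elt R X2 F (\<kappa> b t) (e b))"
    by (rule all[rule_format, OF E(1) subset_refl E(2)])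
  have "\<exists>w. w \<in> carrier X1 \<and> \<kappa> b t = f w" if "b \<in> B" for b
    using ex[OF mod_hom_closed[OF \<kappa>[OF that] t] ker[OF that]] by blast
  then obtain w where w: "\<And>b. b \<in> B \<Longrightarrow> w b \<in> carrier X1" "\<And>b. b \<in> B \<Longrightarrow> \<kappa> b t = f (w b)" by metis
  let ?s = "\<Oplus>\<^bsub>tensor R X1 F\<^esub>b\<in>E. tensor_elt R X1 F (w b) (e b)"
  note fm = tensor_map_hom[OF X(1) F X(2) F f mod_hom_id(2)]
  have wc: "tensor_elt R X1 F (w b) (e b) \<in> carrier (tensor R X1 F)" if "b \<in> E" for b
    using that E w eB by (auto intro!: tensor_elt_closed[OF X(1) F])
  have sc: "?s \<in> carrier (tensor R X1 F)" by (rule T1.M.finsum_closed) (use wc in auto)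
  have "tensor_map R X2 F f id ?s =
      (\<Oplus>\<^bsub>tensor R X2 F\<^esub>b\<in>E. tensor_map R X2 F f id (tensor_elt R X1 F (w b) (e b)))"
    by (rule mod_hom_finsum[OF fm(1) tensor_module[OF X(1) F] tensor_module[OF X(2) F] E(1)]) (use wc in auto)
  also have "\<dots> = (\<Oplus>\<^bsub>tensor R X2 F\<^esub>b\<in>E. tensor_elt R X2 F (\<kappa> b t) (e b))"
  proof (rule T.M.finsum_cong')
    fix b assume "b \<in> E"
    then have b: "b \<in> B" using E by auto
    show "tensor_map R X2 F f id (tensor_elt R X1 F (w b) (e b)) = tensor_elt R X2 F (\<kappa> b t) (e b)"
      by (simp add: fm(2) w b eB)
  next
    show "(\<lambda>b. tensor_elt R X2 F (\<kappa> b t) (e b)) \<in> E \<rightarrow> carrier (tensor R X2 F)"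
      using E eB by (auto intro!: tensor_elt_closed[OF X(2) F] mod_hom_closed[OF \<kappa> t])
  qed simp
  also have "\<dots> = t" by (rule tE[symmetric])
  finally have "t = tensor_map R X2 F f id ?s" by (rule sym)
  then show ?thesis using sc by (rule bexI)
qed

definition tensor_swap :: "'a ring \<Rightarrow> ('a, 'm) module \<Rightarrow> ('a, 'n) module \<Rightarrow> ('m \<times> 'n \<Rightarrow> 'a) set \<Rightarrow> ('n \<times> 'm \<Rightarrow> 'a) set"
  where "tensor_swap R M N = (SOME \<phi>. \<phi> \<in> mod_hom R (tensor R M N) (tensor R N M) \<and>
    (\<forall>x\<in>carrier M. \<forall>y\<in>carrier N. \<phi> (tensor_elt R M N x y) = tensor_elt R N M y x))"

lemma tensor_swap:
  assumes M: "Module.module R M" and N: "Module.module R N"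
  shows tensor_swap_hom: "tensor_swap R M N \<in> mod_hom R (tensor R M N) (tensor R N M)"
    and tensor_swap_elt: "\<And>x y. x \<in> carrier M \<Longrightarrow> y \<in> carrier N \<Longrightarrow>
      tensor_swap R M N (tensor_elt R M N x y) = tensor_elt R N M y x"
proof -
  have "bilinear R M N (tensor R N M) (\<lambda>x y. tensor_elt R N M y x)"
    using tensor_elt_bilinear[OF N M] by (auto simp: bilinear_def)
  then have "\<exists>\<phi>. \<phi> \<in> mod_hom R (tensor R M N) (tensor R N M) \<and>
      (\<forall>x\<in>carrier M. \<forall>y\<in>carrier N. \<phi> (tensor_elt R M N x y) = tensor_elt R N M y x)"
    by (rule tensor_lift[OF M N tensor_module[OF N M]]) blast
  from someI_ex[OF this, folded tensor_swap_def]
  show "tensor_swap R M N \<in> mod_hom R (tensor R M N) (tensor R N M)"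
    "\<And>x y. x \<in> carrier M \<Longrightarrow> y \<in> carrier N \<Longrightarrow>
      tensor_swap R M N (tensor_elt R M N x y) = tensor_elt R N M y x" by auto
qed

lemma tensor_swap_swap:
  assumes M: "Module.module R M" and N: "Module.module R N" and t: "t \<in> carrier (tensor R M N)"
  shows "tensor_swap R N M (tensor_swap R M N t) = t"
  by (rule tensor_hom_eq[OF M N tensor_module[OF M N]
        mod_hom_comp[OF tensor_swap_hom[OF M N] tensor_swap_hom[OF N M]] mod_hom_id(1) _ t])
    (simp add: tensor_swap_elt[OF M N] tensor_swap_elt[OF N M])

lemma tensor_swap_map:
  assumes M: "Module.module R M" and N: "Module.module R N"
    and M': "Module.module R M'" and N': "Module.module R N'"
    and f: "f \<in> mod_hom R M M'" and g: "g \<in> mod_hom R N N'" and t: "t \<in> carrier (tensor R M N)"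
  shows "tensor_swap R M' N' (tensor_map R M' N' f g t) = tensor_map R N' M' g f (tensor_swap R M N t)"
  by (rule tensor_hom_eq[OF M N tensor_module[OF N' M']
        mod_hom_comp[OF tensor_map_hom(1)[OF M N M' N' f g] tensor_swap_hom[OF M' N']]
        mod_hom_comp[OF tensor_swap_hom[OF M N] tensor_map_hom(1)[OF N M N' M' g f]] _ t])
    (simp add: tensor_swap_elt[OF M N] tensor_swap_elt[OF M' N'] tensor_map_hom(2)[OF M N M' N' f g]
      tensor_map_hom(2)[OF N M N' M' g f] mod_hom_closed[OF f] mod_hom_closed[OF g])

lemma free_tensor_exact:
  assumes X: "Module.module R X1" "Module.module R X2" "Module.module R X3" and F: "Module.module R F"
    and f: "f \<in> mod_hom R X1 X2" and g: "g \<in> mod_hom R X2 X3"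
    and ex: "\<And>x. x \<in> carrier X2 \<Longrightarrow> g x = \<zero>\<^bsub>X3\<^esub> \<Longrightarrow> \<exists>w\<in>carrier X1. x = f w"
    and db: "dual_basis R F B e c"
    and t: "t \<in> carrier (tensor R F X2)" and gt: "tensor_map R F X3 id g t = \<zero>\<^bsub>tensor R F X3\<^esub>"
  shows "\<exists>s\<in>carrier (tensor R F X1). t = tensor_map R F X2 id f s"
proof -
  let ?t = "tensor_swap R F X2 t"
  note I = mod_hom_id(2)
  have "\<exists>s\<in>carrier (tensor R X1 F). ?t = tensor_map R X2 F f id s"
  proof (rule tensor_free_exact[OF X F f g ex db])
    show "?t \<in> carrier (tensor R X2 F)" by (rule mod_hom_closed[OF tensor_swap_hom[OF F X(2)] t])
    show "tensor_map R X3 F g id ?t = \<zero>\<^bsub>tensor R X3 F\<^esub>"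
      using tensor_swap_map[OF F X(2) F X(3) I g t] gt
      by (simp add: mod_hom_zero[OF tensor_swap_hom[OF F X(3)] tensor_module[OF F X(3)] tensor_module[OF X(3) F]])
  qed
  then obtain s where s: "s \<in> carrier (tensor R X1 F)" "?t = tensor_map R X2 F f id s" by blast
  have "t = tensor_swap R X2 F ?t" by (rule tensor_swap_swap[OF F X(2) t, symmetric])
  also have "\<dots> = tensor_map R F X2 id f (tensor_swap R X1 F s)"
    using tensor_swap_map[OF X(1) F X(2) F f I s(1)] s(2) by simp
  finally show ?thesis using mod_hom_closed[OF tensor_swap_hom[OF X(1) F] s(1)] by blast
qed

subsection \<open>Tensoring with a cyclic module\<close>

text \<open>\<open>E\<close> is a copy of \<open>R/J\<close>, with \<open>e\<close> in the place of \<open>1\<close>. The carrier is left open because a copy of \<open>R/J\<close>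
  in another type is needed for testing K-flatness.\<close>

definition cyclic_quot :: "'a ring \<Rightarrow> 'a set \<Rightarrow> ('a, 'e) module \<Rightarrow> 'e \<Rightarrow> bool"
  where "cyclic_quot R J E e \<longleftrightarrow> Module.module R E \<and> ideal J R \<and> e \<in> carrier E \<and>
    (\<forall>x\<in>carrier E. \<exists>r\<in>carrier R. x = r \<odot>\<^bsub>E\<^esub> e) \<and>
    (\<forall>r\<in>carrier R. r \<odot>\<^bsub>E\<^esub> e = \<zero>\<^bsub>E\<^esub> \<longleftrightarrow> r \<in> J)"

lemma cyclic_tensor_surj:
  assumes E: "cyclic_quot R J E e" and M: "Module.module R M" and t: "t \<in> carrier (tensor R E M)"
  shows "\<exists>m\<in>carrier M. t = tensor_elt R E M e m"
proof -
  have EM: "Module.module R E" and e: "e \<in> carrier E" using E by (auto simp: cyclic_quot_def)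
  interpret M: Module.module R M by (rule M)
  note h = tensor_elt_hom_right[OF EM M e]
  show ?thesis using t
  proof (induct rule: tensor_induct[OF EM M, consumes 1, case_names zero step])
    case zero
    then show ?case using mod_hom_zero[OF h M tensor_module[OF EM M]] by (metis M.M.zero_closed)
  next
    case (step x y s)
    obtain r where r: "r \<in> carrier R" "x = r \<odot>\<^bsub>E\<^esub> e" using E step(1) by (auto simp: cyclic_quot_def)
    obtain m where m: "m \<in> carrier M" "s = tensor_elt R E M e m" using step(4) by blast
    have "tensor_elt R E M x y = tensor_elt R E M e (r \<odot>\<^bsub>M\<^esub> y)"
      using mod_hom_smult[OF h r(1) step(2)] mod_hom_smult[OF tensor_elt_hom_left[OF EM M step(2)] r(1) e] r(2) by simp
    then have "tensor_elt R E M x y \<oplus>\<^bsub>tensor R E M\<^esub> s = tensor_elt R E M e ((r \<odot>\<^bsub>M\<^esub> y) \<oplus>\<^bsub>M\<^esub> m)"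
      using r step(2) m by (simp add: mod_hom_add[OF h])
    then show ?case using r step(2) m by (metis M.M.a_closed M.smult_closed)
  qed
qed

text \<open>This is \<open>(R/J) \<otimes> M = M/JM\<close>: the inverse map sends \<open>(r e) \<otimes> y\<close> to the class of \<open>r y\<close>.\<close>

lemma cyclic_tensor_zero_iff:
  assumes E: "cyclic_quot R J E e" and M: "Module.module R M" and m: "m \<in> carrier M"
  shows "tensor_elt R E M e m = \<zero>\<^bsub>tensor R E M\<^esub> \<longleftrightarrow> m \<in> ideal_mult J M"
proof -
  have EM: "Module.module R E" and e: "e \<in> carrier E" and J: "ideal J R"
    and gen: "\<And>x. x \<in> carrier E \<Longrightarrow> \<exists>r\<in>carrier R. x = r \<odot>\<^bsub>E\<^esub> e"
    and ann: "\<And>r. r \<in> carrier R \<Longrightarrow> r \<odot>\<^bsub>E\<^esub> e = \<zero>\<^bsub>E\<^esub> \<longleftrightarrow> r \<in> J"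
    using E by (auto simp: cyclic_quot_def)
  interpret M: Module.module R M by (rule M)
  interpret E: Module.module R E by (rule EM)
  interpret J: ideal J R by (rule J)
  note h = tensor_elt_hom_right[OF EM M e]
  note T = tensor_module[OF EM M]
  let ?Q = "quot_module M (ideal_mult J M)"
  note q = M ideal_mult_submodule[OF M J]
  let ?p = "\<lambda>x. ideal_mult J M +>\<^bsub>M\<^esub> x"
  note ph = quot_proj_hom[OF q]
  \<comment> \<open>A coefficient of \<open>x\<close> is determined up to \<open>J\<close>, so the class of \<open>\<rho> x y\<close> in \<open>M/JM\<close> is bilinear in \<open>x\<close> and \<open>y\<close>.\<close>
  define \<rho> where "\<rho> x = (SOME r. r \<in> carrier R \<and> x = r \<odot>\<^bsub>E\<^esub> e)" for x
  have \<rho>: "\<rho> x \<in> carrier R" "x = \<rho> x \<odot>\<^bsub>E\<^esub> e" if "x \<in> carrier E" for x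
    using someI_ex[of "\<lambda>r. r \<in> carrier R \<and> x = r \<odot>\<^bsub>E\<^esub> e"] gen[OF that] unfolding \<rho>_def by blast+
  have key: "?p (r \<odot>\<^bsub>M\<^esub> y) = ?p (s \<odot>\<^bsub>M\<^esub> y)"
    if "r \<in> carrier R" "s \<in> carrier R" "r \<odot>\<^bsub>E\<^esub> e = s \<odot>\<^bsub>E\<^esub> e" "y \<in> carrier M" for r s y
  proof -
    have "(r \<ominus>\<^bsub>R\<^esub> s) \<odot>\<^bsub>E\<^esub> e = \<zero>\<^bsub>E\<^esub>"
      using that e by (simp add: a_minus_def E.smult_l_distr E.smult_l_minus E.M.r_neg)
    then have "r \<ominus>\<^bsub>R\<^esub> s \<in> J" using ann that by simp
    then have "(r \<ominus>\<^bsub>R\<^esub> s) \<odot>\<^bsub>M\<^esub> y \<in> ideal_mult J M" using ideal_mult_incl[OF M J _ that(4)] by simp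
    then have "(r \<odot>\<^bsub>M\<^esub> y) \<ominus>\<^bsub>M\<^esub> (s \<odot>\<^bsub>M\<^esub> y) \<in> ideal_mult J M"
      using that by (simp add: a_minus_def M.smult_l_distr M.smult_l_minus)
    then show ?thesis using quot_eq_iff[OF q] that by blast
  qed
  have bil: "bilinear R E M ?Q (\<lambda>x y. ?p (\<rho> x \<odot>\<^bsub>M\<^esub> y))"
    unfolding bilinear_def
  proof (intro conjI ballI)
    fix x assume x: "x \<in> carrier E"
    have sm: "(\<lambda>y. \<rho> x \<odot>\<^bsub>M\<^esub> y) \<in> mod_hom R M M"
      using \<rho>[OF x] by (intro mod_homI) (auto simp: M.smult_r_distr M.smult_assoc1[symmetric] M.R.m_comm)
    show "(\<lambda>y. ?p (\<rho> x \<odot>\<^bsub>M\<^esub> y)) \<in> mod_hom R M ?Q" using mod_hom_comp[OF sm ph] .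
  next
    fix y assume y: "y \<in> carrier M"
    show "(\<lambda>x. ?p (\<rho> x \<odot>\<^bsub>M\<^esub> y)) \<in> mod_hom R E ?Q"
    proof (rule mod_homI)
      show "?p (\<rho> x \<odot>\<^bsub>M\<^esub> y) \<in> carrier ?Q" if "x \<in> carrier E" for x
        using \<rho>[OF that] y by (auto intro: mod_hom_closed[OF ph])
      fix x x' assume x: "x \<in> carrier E" "x' \<in> carrier E"
      have "?p (\<rho> (x \<oplus>\<^bsub>E\<^esub> x') \<odot>\<^bsub>M\<^esub> y) = ?p ((\<rho> x \<oplus>\<^bsub>R\<^esub> \<rho> x') \<odot>\<^bsub>M\<^esub> y)"
        using \<rho>[OF x(1)] \<rho>[OF x(2)] \<rho>[of "x \<oplus>\<^bsub>E\<^esub> x'"] x y e by (intro key) (auto simp: E.smult_l_distr)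
      also have "\<dots> = ?p (\<rho> x \<odot>\<^bsub>M\<^esub> y) \<oplus>\<^bsub>?Q\<^esub> ?p (\<rho> x' \<odot>\<^bsub>M\<^esub> y)"
        using \<rho>(1) x y by (simp add: M.smult_l_distr mod_hom_add[OF ph])
      finally show "?p (\<rho> (x \<oplus>\<^bsub>E\<^esub> x') \<odot>\<^bsub>M\<^esub> y) = ?p (\<rho> x \<odot>\<^bsub>M\<^esub> y) \<oplus>\<^bsub>?Q\<^esub> ?p (\<rho> x' \<odot>\<^bsub>M\<^esub> y)" .
    next
      fix r x assume r: "r \<in> carrier R" and x: "x \<in> carrier E"
      have "?p (\<rho> (r \<odot>\<^bsub>E\<^esub> x) \<odot>\<^bsub>M\<^esub> y) = ?p ((r \<otimes>\<^bsub>R\<^esub> \<rho> x) \<odot>\<^bsub>M\<^esub> y)"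
        using \<rho>[OF x] \<rho>[of "r \<odot>\<^bsub>E\<^esub> x"] r x y e by (intro key) (auto simp: E.smult_assoc1)
      also have "\<dots> = r \<odot>\<^bsub>?Q\<^esub> ?p (\<rho> x \<odot>\<^bsub>M\<^esub> y)"
        using \<rho>(1) r x y by (simp add: M.smult_assoc1 mod_hom_smult[OF ph])
      finally show "?p (\<rho> (r \<odot>\<^bsub>E\<^esub> x) \<odot>\<^bsub>M\<^esub> y) = r \<odot>\<^bsub>?Q\<^esub> ?p (\<rho> x \<odot>\<^bsub>M\<^esub> y)" .
    qed
  qed
  obtain \<phi> where \<phi>: "\<phi> \<in> mod_hom R (tensor R E M) ?Q"
    "\<And>x y. x \<in> carrier E \<Longrightarrow> y \<in> carrier M \<Longrightarrow> \<phi> (tensor_elt R E M x y) = ?p (\<rho> x \<odot>\<^bsub>M\<^esub> y)"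
    using tensor_lift[OF EM M quot_module_module(1)[OF q] bil] by blast
  show ?thesis
  proof
    assume "tensor_elt R E M e m = \<zero>\<^bsub>tensor R E M\<^esub>"
    then have "?p (\<rho> e \<odot>\<^bsub>M\<^esub> m) = \<zero>\<^bsub>?Q\<^esub>"
      using \<phi>(2)[OF e m] mod_hom_zero[OF \<phi>(1) T quot_module_module(1)[OF q]] by simp
    moreover have "?p (\<rho> e \<odot>\<^bsub>M\<^esub> m) = ?p (\<one>\<^bsub>R\<^esub> \<odot>\<^bsub>M\<^esub> m)"
      using \<rho>[OF e] m e by (intro key) auto
    ultimately show "m \<in> ideal_mult J M" using quot_eq_zero_iff[OF q m] m by simp
  next
    assume "m \<in> ideal_mult J M"
    then have "m \<in> {x \<in> carrier M. tensor_elt R E M e x = \<zero>\<^bsub>tensor R E M\<^esub>}"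
    proof (rule ideal_mult_least[OF M submodule_kernel[OF M T h], rotated])
      fix j x assume j: "j \<in> J" and x: "x \<in> carrier M"
      have jR: "j \<in> carrier R" using j by (rule J.Icarr)
      have "tensor_elt R E M e (j \<odot>\<^bsub>M\<^esub> x) = tensor_elt R E M (j \<odot>\<^bsub>E\<^esub> e) x"
        using mod_hom_smult[OF h jR x] mod_hom_smult[OF tensor_elt_hom_left[OF EM M x] jR e] by simp
      also have "\<dots> = \<zero>\<^bsub>tensor R E M\<^esub>"
        using ann[OF jR] j mod_hom_zero[OF tensor_elt_hom_left[OF EM M x] EM T] by simp
      finally show "j \<odot>\<^bsub>M\<^esub> x \<in> {x \<in> carrier M. tensor_elt R E M e x = \<zero>\<^bsub>tensor R E M\<^esub>}"
        using jR x by simp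
    qed
    then show "tensor_elt R E M e m = \<zero>\<^bsub>tensor R E M\<^esub>" by simp
  qed
qed

lemma cyclic_tensor_eq_iff:
  assumes E: "cyclic_quot R J E e" and M: "Module.module R M" and m: "m \<in> carrier M" "n \<in> carrier M"
  shows "tensor_elt R E M e m = tensor_elt R E M e n \<longleftrightarrow> m \<ominus>\<^bsub>M\<^esub> n \<in> ideal_mult J M"
proof -
  have EM: "Module.module R E" and e: "e \<in> carrier E" using E by (auto simp: cyclic_quot_def)
  interpret M: Module.module R M by (rule M)
  interpret T: Module.module R "tensor R E M" by (rule tensor_module[OF EM M])
  show ?thesis
    using cyclic_tensor_zero_iff[OF E M, of "m \<ominus>\<^bsub>M\<^esub> n"] m
    by (simp add: mod_hom_diff[OF tensor_elt_hom_right[OF EM M e] M T.module_axioms]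
        T.M.diff_eq_zero_iff tensor_elt_closed[OF EM M e])
qed

lemma tensor_cyclic_surj:
  assumes E: "cyclic_quot R J E e" and M: "Module.module R M" and t: "t \<in> carrier (tensor R M E)"
  shows "\<exists>m\<in>carrier M. t = tensor_elt R M E m e"
proof -
  have EM: "Module.module R E" and e: "e \<in> carrier E" using E by (auto simp: cyclic_quot_def)
  obtain m where m: "m \<in> carrier M" "tensor_swap R M E t = tensor_elt R E M e m"
    using cyclic_tensor_surj[OF E M mod_hom_closed[OF tensor_swap_hom[OF M EM] t]] by blast
  then have "t = tensor_elt R M E m e"
    using tensor_swap_swap[OF M EM t] tensor_swap_elt[OF EM M e m(1)] by simp
  then show ?thesis using m(1) by blast
qed

lemma tensor_cyclic_eq_iff:
  assumes E: "cyclic_quot R J E e" and M: "Module.module R M" and m: "m \<in> carrier M" "n \<in> carrier M"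
  shows "tensor_elt R M E m e = tensor_elt R M E n e \<longleftrightarrow> m \<ominus>\<^bsub>M\<^esub> n \<in> ideal_mult J M"
proof -
  have EM: "Module.module R E" and e: "e \<in> carrier E" using E by (auto simp: cyclic_quot_def)
  show ?thesis
    using cyclic_tensor_eq_iff[OF E M m] tensor_swap_elt[OF EM M e] tensor_swap_elt[OF M EM _ e] m by metis
qed

lemma quot_alg_cyclic:
  assumes R: "cring R" and J: "ideal J R"
  shows "cyclic_quot R J (quot_alg R J) \<one>\<^bsub>R Quot J\<^esub>"
    and quot_alg_carrier: "carrier (quot_alg R J) = (\<lambda>r. J +>\<^bsub>R\<^esub> r) ` carrier R"
proof -
  interpret R: cring R by fact
  interpret J: ideal J R by fact
  have Js: "abelian_subgroup J R" by (rule abelian_subgroupI3[OF J.is_additive_subgroup R.is_abelian_group])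
  interpret Js: abelian_subgroup J R by (rule Js)
  show car: "carrier (quot_alg R J) = (\<lambda>r. J +>\<^bsub>R\<^esub> r) ` carrier R"
    by (simp add: quot_alg_def FactRing_def a_rcosets_eq)
  have zero: "\<zero>\<^bsub>quot_alg R J\<^esub> = J +>\<^bsub>R\<^esub> \<zero>\<^bsub>R\<^esub>"
    by (simp add: quot_alg_def FactRing_def J.a_rcos_const)
  have add: "(J +>\<^bsub>R\<^esub> x) \<oplus>\<^bsub>quot_alg R J\<^esub> (J +>\<^bsub>R\<^esub> y) = J +>\<^bsub>R\<^esub> (x \<oplus>\<^bsub>R\<^esub> y)"
    if "x \<in> carrier R" "y \<in> carrier R" for x y
    using that by (simp add: quot_alg_def FactRing_def J.a_rcos_sum)
  have sm: "x \<odot>\<^bsub>quot_alg R J\<^esub> (J +>\<^bsub>R\<^esub> y) = J +>\<^bsub>R\<^esub> (x \<otimes>\<^bsub>R\<^esub> y)"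
    if "x \<in> carrier R" "y \<in> carrier R" for x y
    using that by (simp add: quot_alg_def FactRing_def J.rcoset_mult_add)
  have one: "\<one>\<^bsub>R Quot J\<^esub> = J +>\<^bsub>R\<^esub> \<one>\<^bsub>R\<^esub>" by (simp add: FactRing_def)
  have smo: "r \<odot>\<^bsub>quot_alg R J\<^esub> \<one>\<^bsub>R Quot J\<^esub> = J +>\<^bsub>R\<^esub> r" if "r \<in> carrier R" for r
    using sm[OF that R.one_closed] that by (simp add: one)
  have mod: "Module.module R (quot_alg R J)"
    by (rule module_image(1)[OF reg_module[OF R], of "\<lambda>r. J +>\<^bsub>R\<^esub> r"]) (simp_all add: car zero add sm)
  show "cyclic_quot R J (quot_alg R J) \<one>\<^bsub>R Quot J\<^esub>"
    unfolding cyclic_quot_def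
  proof (intro conjI ballI)
    fix x assume "x \<in> carrier (quot_alg R J)"
    then show "\<exists>r\<in>carrier R. x = r \<odot>\<^bsub>quot_alg R J\<^esub> \<one>\<^bsub>R Quot J\<^esub>" using car smo by auto
  next
    fix r assume r: "r \<in> carrier R"
    show "(r \<odot>\<^bsub>quot_alg R J\<^esub> \<one>\<^bsub>R Quot J\<^esub> = \<zero>\<^bsub>quot_alg R J\<^esub>) = (r \<in> J)"
      using coset_eq_iff[OF Js r R.zero_closed] r by (simp add: smo zero)
  qed (use mod J car one in auto)
qed

subsection \<open>Killing the components of a cycle in a double complex\<close>

text \<open>Three consecutive diagonals of a double complex, with the differentials \<open>a\<close> (raising the
  index) and \<open>b\<close> (keeping it). A cycle that vanishes far down is cleared from the lowest index
  upwards, as far as the differentials \<open>b\<close> are exact: subtracting the boundary of an element at one index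
  makes the next component a cycle for \<open>b\<close>.\<close>

lemma kill_components:
  fixes Z X Y :: "int \<Rightarrow> ('a, 't) module"
  assumes Z: "\<And>k. Module.module R (Z k)" and X: "\<And>k. Module.module R (X k)" and Y: "\<And>k. Module.module R (Y k)"
    and az: "\<And>k. az k \<in> mod_hom R (Z k) (X (k + 1))" and ax: "\<And>k. ax k \<in> mod_hom R (X k) (Y (k + 1))"
    and bz: "\<And>k. bz k \<in> mod_hom R (Z k) (X k)" and bx: "\<And>k. bx k \<in> mod_hom R (X k) (Y k)"
    and aa: "\<And>k z. z \<in> carrier (Z k) \<Longrightarrow> ax (k + 1) (az k z) = \<zero>\<^bsub>Y (k + 1 + 1)\<^esub>"
    and ab: "\<And>k z. z \<in> carrier (Z k) \<Longrightarrow> ax k (bz k z) \<oplus>\<^bsub>Y (k + 1)\<^esub> bx (k + 1) (az k z) = \<zero>\<^bsub>Y (k + 1)\<^esub>"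
    and ex: "\<And>k x. k \<le> b \<Longrightarrow> x \<in> carrier (X k) \<Longrightarrow> bx k x = \<zero>\<^bsub>Y k\<^esub> \<Longrightarrow> \<exists>z\<in>carrier (Z k). x = bz k z"
    and f: "\<And>k. f k \<in> carrier (X k)" and f0: "\<And>k. k < a \<Longrightarrow> f k = \<zero>\<^bsub>X k\<^esub>"
    and eq: "\<And>k. k + 1 \<le> b \<Longrightarrow> ax k (f k) \<oplus>\<^bsub>Y (k + 1)\<^esub> bx (k + 1) (f (k + 1)) = \<zero>\<^bsub>Y (k + 1)\<^esub>"
  shows "\<exists>g. (\<forall>k. g k \<in> carrier (Z k)) \<and> (\<forall>k<a. g k = \<zero>\<^bsub>Z k\<^esub>) \<and>
    (\<forall>k. k + 1 \<le> b \<longrightarrow> f (k + 1) = az k (g k) \<oplus>\<^bsub>X (k + 1)\<^esub> bz (k + 1) (g (k + 1)))"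
proof -
  let ?k = "\<lambda>i. a - 1 + int i"
  \<comment> \<open>The invariant \<open>P\<close>: the component of \<open>f\<close> at the current index has the same image under \<open>a\<close> as \<open>b x\<close>.\<close>
  define P where "P i x \<longleftrightarrow> x \<in> carrier (Z (?k i)) \<and> (i = 0 \<longrightarrow> x = \<zero>\<^bsub>Z (?k i)\<^esub>) \<and>
    (?k i \<le> b \<longrightarrow> ax (?k i) (f (?k i)) = ax (?k i) (bz (?k i) x))" for i x
  define Q where "Q i x y \<longleftrightarrow> (?k i + 1 \<le> b \<longrightarrow>
    f (?k i + 1) = az (?k i) x \<oplus>\<^bsub>X (?k i + 1)\<^esub> bz (?k i + 1) y)" for i x y
  have z0: "\<zero>\<^bsub>Z k\<^esub> \<in> carrier (Z k)" for k
    using abelian_group.axioms(1)[OF moduleD(2)[OF Z[of k]]] by (rule abelian_monoid.zero_closed)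
  have start: "\<exists>x. P 0 x"
    using z0 f0[of "a - 1"] by (auto simp: P_def mod_hom_zero[OF bz Z X] mod_hom_zero[OF ax X Y])
  have step: "\<exists>y. P (Suc i) y \<and> Q i x y" if Px: "P i x" for i x
  proof -
    define c where "c = ?k i"
    have c1: "?k (Suc i) = c + 1" by (simp add: c_def)
    have x: "x \<in> carrier (Z c)" using Px by (simp add: P_def c_def)
    show ?thesis
    proof (cases "c + 1 \<le> b")
      case False
      then show ?thesis using z0[of "c + 1"] unfolding P_def Q_def c1 c_def[symmetric] by auto
    next
      case True
      interpret X': Module.module R "X (c + 1)" by (rule X)
      interpret Y': Module.module R "Y (c + 1)" by (rule Y)
      interpret Y'': Module.module R "Y (c + 1 + 1)" by (rule Y)
      note Y1 = Y'.M.abelian_group_axioms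
      let ?u = "f (c + 1) \<ominus>\<^bsub>X (c + 1)\<^esub> az c x"
      have azx: "az c x \<in> carrier (X (c + 1))" by (rule mod_hom_closed[OF az x])
      have inv: "ax c (f c) = ax c (bz c x)" using Px True by (simp add: P_def c_def)
      have cl: "ax c (bz c x) \<in> carrier (Y (c + 1))" "bx (c + 1) (f (c + 1)) \<in> carrier (Y (c + 1))"
        "bx (c + 1) (az c x) \<in> carrier (Y (c + 1))"
        by (rule mod_hom_closed[OF ax] mod_hom_closed[OF bx] mod_hom_closed[OF bz] f x azx)+
      have "bx (c + 1) (f (c + 1)) = bx (c + 1) (az c x)"
        using eq[OF True] ab[OF x] cl unfolding inv by (metis Y'.M.minus_equality Y'.M.a_comm)
      then have "bx (c + 1) ?u = \<zero>\<^bsub>Y (c + 1)\<^esub>"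
        using cl by (simp add: mod_hom_diff[OF bx X Y f azx])
      then obtain y where y: "y \<in> carrier (Z (c + 1))" "?u = bz (c + 1) y"
        using ex[OF True X'.M.minus_closed[OF f azx]] by blast
      have bzy: "bz (c + 1) y \<in> carrier (X (c + 1))" by (rule mod_hom_closed[OF bz y(1)])
      have fe: "f (c + 1) = az c x \<oplus>\<^bsub>X (c + 1)\<^esub> bz (c + 1) y"
        unfolding y(2)[symmetric] using f[of "c + 1"] azx by algebra
      have "ax (c + 1) (f (c + 1)) = ax (c + 1) (bz (c + 1) y)"
        unfolding fe mod_hom_add[OF ax azx bzy] aa[OF x]
        by (rule Y''.M.l_zero[OF mod_hom_closed[OF ax bzy]])
      then show ?thesis using y(1) fe unfolding P_def Q_def c1 c_def[symmetric] by auto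
    qed
  qed
  obtain h where h: "\<And>i. P i (h i)" "\<And>i. Q i (h i) (h (Suc i))"
    using dependent_nat_choice[of P Q] start step by metis
  define g where "g k = (if k < a then \<zero>\<^bsub>Z k\<^esub> else h (nat (k - a + 1)))" for k
  have gk: "g k = h i" if "k = ?k i" for k i
  proof (cases i)
    case 0 then show ?thesis using h(1)[of 0] that by (auto simp: g_def P_def)
  next
    case (Suc j)
    then have "\<not> k < a" "nat (k - a + 1) = i" using that by auto
    then show ?thesis by (simp add: g_def)
  qed
  have "f (k + 1) = az k (g k) \<oplus>\<^bsub>X (k + 1)\<^esub> bz (k + 1) (g (k + 1))" if k: "k + 1 \<le> b" for k
  proof (cases "k + 1 < a")
    case True
    interpret X': Module.module R "X (k + 1)" by (rule X)
    show ?thesis using True by (simp add: g_def f0 mod_hom_zero[OF bz Z X] mod_hom_zero[OF az Z X])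
  next
    case False
    define i where "i = nat (k - a + 1)"
    have ki: "k = ?k i" "k + 1 = ?k (Suc i)" using False by (auto simp: i_def)
    show ?thesis using h(2)[of i] k gk[OF ki(1)] gk[OF ki(2)] unfolding Q_def ki(1)[symmetric] by simp
  qed
  moreover have "g k \<in> carrier (Z k)" for k
  proof (cases "k < a")
    case False
    then have "k = ?k (nat (k - a + 1))" by simp
    then show ?thesis using h(1)[of "nat (k - a + 1)"] gk unfolding P_def by metis
  qed (simp add: g_def z0)
  moreover have "\<forall>k<a. g k = \<zero>\<^bsub>Z k\<^esub>" by (simp add: g_def)
  ultimately show ?thesis by blast
qed

section \<open>Complexes\<close>

lemma cx_module: "cochain_complex A C \<Longrightarrow> Module.module A (obj C i)"
  and cx_dif: "cochain_complex A C \<Longrightarrow> dif C i \<in> mod_hom A (obj C i) (obj C (i + 1))"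
  and cx_dd: "cochain_complex A C \<Longrightarrow> x \<in> carrier (obj C i) \<Longrightarrow>
    dif C (i + 1) (dif C i x) = \<zero>\<^bsub>obj C (i + 1 + 1)\<^esub>"
  by (auto simp: cochain_complex_def add.assoc)

lemma cx_dif': "cochain_complex A C \<Longrightarrow> dif C (i - 1) \<in> mod_hom A (obj C (i - 1)) (obj C i)"
  and cx_dd': "cochain_complex A C \<Longrightarrow> x \<in> carrier (obj C (i - 1)) \<Longrightarrow>
    dif C i (dif C (i - 1) x) = \<zero>\<^bsub>obj C (i + 1)\<^esub>"
  using cx_dif[of A C "i - 1"] cx_dd[of A C x "i - 1"] by auto

lemma chain_mapD:
  "chain_map A C D f \<Longrightarrow> f i \<in> mod_hom A (obj C i) (obj D i)"
  "chain_map A C D f \<Longrightarrow> x \<in> carrier (obj C i) \<Longrightarrow> f (i + 1) (dif C i x) = dif D i (f i x)"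
  by (auto simp: chain_map_def)

lemma chain_mapD':
  "chain_map A C D f \<Longrightarrow> x \<in> carrier (obj C (i - 1)) \<Longrightarrow> f i (dif C (i - 1) x) = dif D (i - 1) (f (i - 1) x)"
  using chain_mapD(2)[of A C D f x "i - 1"] by simp

definition exact_at :: "('a, 'm) cx \<Rightarrow> int \<Rightarrow> bool"
  where "exact_at C i \<longleftrightarrow> cocycles C i \<subseteq> coboundaries C i"

lemma cocycles_submodule: "cochain_complex A C \<Longrightarrow> submodule (cocycles C i) A (obj C i)"
  unfolding cocycles_def by (rule submodule_kernel[OF cx_module cx_module cx_dif])

lemma coboundaries_submodule: "cochain_complex A C \<Longrightarrow> submodule (coboundaries C i) A (obj C i)"
  unfolding coboundaries_def
  by (rule submodule_image[OF cx_module cx_module cx_dif' Module.module.carrier_is_submodule[OF cx_module]])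

lemma coboundaries_cocycles: "cochain_complex A C \<Longrightarrow> coboundaries C i \<subseteq> cocycles C i"
  unfolding coboundaries_def cocycles_def
  by (auto simp: cx_dd' intro: mod_hom_closed[OF cx_dif'])

lemma submodule_restrict:
  assumes "Module.module R M" "submodule H R M" "submodule K R M" "H \<subseteq> K"
  shows "submodule H R (M\<lparr>carrier := K\<rparr>)" and "Module.module R (M\<lparr>carrier := K\<rparr>)"
proof -
  interpret M: Module.module R M by fact
  show mod: "Module.module R (M\<lparr>carrier := K\<rparr>)"
    by (rule submodule.submodule_is_module[OF assms(3,1)])
  note H = M.submoduleE[OF assms(2)]
  show "submodule H R (M\<lparr>carrier := K\<rparr>)"
    by (rule submoduleI'[OF mod]) (use H assms(4) subgroup.one_closed[OF submodule.axioms(1)[OF assms(2)]] in auto)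
qed

abbreviation cclass :: "('a, 'm) cx \<Rightarrow> int \<Rightarrow> 'm \<Rightarrow> 'm set"
  where "cclass C i x \<equiv> coboundaries C i +>\<^bsub>obj C i\<^esub> x"

context
  fixes A :: "'a ring" and C :: "('a, 'm) cx" and i :: int
  assumes C: "cochain_complex A C"
begin

private lemmas q = submodule_restrict(2)[OF cx_module[OF C] coboundaries_submodule[OF C] cocycles_submodule[OF C]
      coboundaries_cocycles[OF C], of i]
  submodule_restrict(1)[OF cx_module[OF C] coboundaries_submodule[OF C] cocycles_submodule[OF C]
      coboundaries_cocycles[OF C], of i]

lemma cocycles_closed: "x \<in> cocycles C i \<Longrightarrow> x \<in> carrier (obj C i)"
  by (simp add: cocycles_def)

lemma cohom_carrier: "carrier (cohom C i) = cclass C i ` cocycles C i"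
  using quot_carrier[OF q] by (simp add: cohom_def)

lemma cohom_zero: "\<zero>\<^bsub>cohom C i\<^esub> = cclass C i \<zero>\<^bsub>obj C i\<^esub>"
  using quot_zero[OF q] by (simp add: cohom_def)

lemma cohom_add: "x \<in> cocycles C i \<Longrightarrow> y \<in> cocycles C i \<Longrightarrow>
    cclass C i x \<oplus>\<^bsub>cohom C i\<^esub> cclass C i y = cclass C i (x \<oplus>\<^bsub>obj C i\<^esub> y)"
  using quot_add[OF q] by (simp add: cohom_def)

lemma cohom_module: "Module.module A (cohom C i)"
  using quot_module_module(1)[OF q] by (simp add: cohom_def)

lemma cclass_eq_iff: "x \<in> carrier (obj C i) \<Longrightarrow> y \<in> carrier (obj C i) \<Longrightarrow>
    cclass C i x = cclass C i y \<longleftrightarrow> x \<ominus>\<^bsub>obj C i\<^esub> y \<in> coboundaries C i"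
  by (rule quot_eq_iff[OF cx_module[OF C] coboundaries_submodule[OF C]])

lemma cclass_zero_iff: "x \<in> carrier (obj C i) \<Longrightarrow>
    cclass C i x = \<zero>\<^bsub>cohom C i\<^esub> \<longleftrightarrow> x \<in> coboundaries C i"
proof -
  interpret M: Module.module A "obj C i" by (rule cx_module[OF C])
  show "x \<in> carrier (obj C i) \<Longrightarrow> cclass C i x = \<zero>\<^bsub>cohom C i\<^esub> \<longleftrightarrow> x \<in> coboundaries C i"
    using cclass_eq_iff[of x "\<zero>\<^bsub>obj C i\<^esub>"] by (simp add: cohom_zero)
qed

lemma cocycles_zero: "\<zero>\<^bsub>obj C i\<^esub> \<in> cocycles C i"
  using subgroup.one_closed[OF submodule.axioms(1)[OF cocycles_submodule[OF C]]] by simp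

lemma cohom_nonzero_iff: "cohom_nonzero C i \<longleftrightarrow> \<not> exact_at C i"
proof -
  have "\<zero>\<^bsub>cohom C i\<^esub> \<in> carrier (cohom C i)"
    unfolding cohom_zero cohom_carrier by (rule imageI) (rule cocycles_zero)
  then have "cohom_nonzero C i \<longleftrightarrow> (\<exists>x\<in>cocycles C i. cclass C i x \<noteq> \<zero>\<^bsub>cohom C i\<^esub>)"
    unfolding cohom_nonzero_def cohom_carrier by auto
  also have "\<dots> \<longleftrightarrow> \<not> exact_at C i"
    unfolding exact_at_def using cclass_zero_iff cocycles_closed by auto
  finally show ?thesis .
qed

end

lemma acyclic_iff: "acyclic_cx A C \<longleftrightarrow> cochain_complex A C \<and> (\<forall>i. exact_at C i)"
  by (auto simp: acyclic_cx_def cohom_nonzero_iff)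

lemma exact_atI:
  assumes "\<And>x. x \<in> carrier (obj C i) \<Longrightarrow> dif C i x = \<zero>\<^bsub>obj C (i + 1)\<^esub> \<Longrightarrow>
    \<exists>y\<in>carrier (obj C (i - 1)). x = dif C (i - 1) y"
  shows "exact_at C i"
  using assms by (auto simp: exact_at_def cocycles_def coboundaries_def image_iff)

lemma exact_atD:
  assumes "exact_at C i" "x \<in> carrier (obj C i)" "dif C i x = \<zero>\<^bsub>obj C (i + 1)\<^esub>"
  shows "\<exists>y\<in>carrier (obj C (i - 1)). x = dif C (i - 1) y"
  using assms by (auto simp: exact_at_def cocycles_def coboundaries_def image_iff subset_iff)

lemma chain_map_cocycles:
  assumes D: "cochain_complex A D" and C: "cochain_complex A C" and f: "chain_map A C D f" and x: "x \<in> cocycles C i"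
  shows "f i x \<in> cocycles D i"
  using x mod_hom_zero[OF chain_mapD(1)[OF f] cx_module[OF C] cx_module[OF D], of "i + 1"]
    mod_hom_closed[OF chain_mapD(1)[OF f], of x i] chain_mapD(2)[OF f, of x i]
  by (auto simp: cocycles_def)

lemma chain_map_coboundaries:
  assumes f: "chain_map A C D f" and x: "x \<in> coboundaries C i"
  shows "f i x \<in> coboundaries D i"
  using x chain_mapD'[OF f] mod_hom_closed[OF chain_mapD(1)[OF f]] unfolding coboundaries_def by auto

lemma cohom_map_class:
  assumes C: "cochain_complex A C" and D: "cochain_complex A D" and f: "chain_map A C D f"
    and x: "x \<in> carrier (obj C i)"
  shows "cohom_map D f i (cclass C i x) = cclass D i (f i x)"
  unfolding cohom_map_def
  by (rule quot_map_coset[OF submodule_abelian_subgroup[OF cx_module[OF C] coboundaries_submodule[OF C]]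
        submodule_abelian_subgroup[OF cx_module[OF D] coboundaries_submodule[OF D]]])
    (auto simp: x mod_hom_add[OF chain_mapD(1)[OF f]] intro: chain_map_coboundaries[OF f] mod_hom_closed[OF chain_mapD(1)[OF f]])

definition cohom_inj :: "('a, 'm) cx \<Rightarrow> ('a, 'n) cx \<Rightarrow> (int \<Rightarrow> 'm \<Rightarrow> 'n) \<Rightarrow> int \<Rightarrow> bool"
  where "cohom_inj C D f i \<longleftrightarrow> (\<forall>x\<in>cocycles C i. f i x \<in> coboundaries D i \<longrightarrow> x \<in> coboundaries C i)"

definition cohom_surj :: "('a, 'm) cx \<Rightarrow> ('a, 'n) cx \<Rightarrow> (int \<Rightarrow> 'm \<Rightarrow> 'n) \<Rightarrow> int \<Rightarrow> bool"
  where "cohom_surj C D f i \<longleftrightarrow> (\<forall>y\<in>cocycles D i. \<exists>x\<in>cocycles C i. y \<ominus>\<^bsub>obj D i\<^esub> f i x \<in> coboundaries D i)"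

lemma quasi_iso_iff:
  "quasi_iso A C D f \<longleftrightarrow> cochain_complex A C \<and> cochain_complex A D \<and> chain_map A C D f \<and>
    (\<forall>i. cohom_inj C D f i \<and> cohom_surj C D f i)"
proof -
  have "bij_betw (cohom_map D f i) (carrier (cohom C i)) (carrier (cohom D i)) \<longleftrightarrow>
      cohom_inj C D f i \<and> cohom_surj C D f i"
    if C: "cochain_complex A C" and D: "cochain_complex A D" and f: "chain_map A C D f" for i
  proof -
    interpret Ci: Module.module A "obj C i" by (rule cx_module[OF C])
    interpret Di: Module.module A "obj D i" by (rule cx_module[OF D])
    note zc = cocycles_closed[OF C]
    note fz = chain_map_cocycles[OF D C f]
    note zd = cocycles_closed[OF D]
    have cm: "cohom_map D f i (cclass C i x) = cclass D i (f i x)" if "x \<in> cocycles C i" for x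
      by (rule cohom_map_class[OF C D f zc[OF that]])
    have inj: "inj_on (cohom_map D f i) (carrier (cohom C i)) \<longleftrightarrow> cohom_inj C D f i"
    proof
      assume L: "inj_on (cohom_map D f i) (carrier (cohom C i))"
      show "cohom_inj C D f i" unfolding cohom_inj_def
      proof (intro ballI impI)
        fix x assume x: "x \<in> cocycles C i" "f i x \<in> coboundaries D i"
        have "cohom_map D f i (cclass C i x) = cohom_map D f i (cclass C i \<zero>\<^bsub>obj C i\<^esub>)"
          using x cclass_zero_iff[OF D zd[OF fz[OF x(1)]]]
          by (simp add: cm cocycles_zero[OF C] mod_hom_zero[OF chain_mapD(1)[OF f] cx_module[OF C] cx_module[OF D]]
              cohom_zero[OF D])
        then have "cclass C i x = cclass C i \<zero>\<^bsub>obj C i\<^esub>"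
        proof (rule inj_onD[OF L])
          show "cclass C i x \<in> carrier (cohom C i)" "cclass C i \<zero>\<^bsub>obj C i\<^esub> \<in> carrier (cohom C i)"
            unfolding cohom_carrier[OF C] using x(1) cocycles_zero[OF C] by blast+
        qed
        then show "x \<in> coboundaries C i"
          using cclass_zero_iff[OF C zc[OF x(1)]] by (simp add: cohom_zero[OF C])
      qed
    next
      assume R: "cohom_inj C D f i"
      show "inj_on (cohom_map D f i) (carrier (cohom C i))"
        unfolding cohom_carrier[OF C]
      proof (rule inj_onI, elim imageE)
        fix X Y x y assume X: "X = cclass C i x" "x \<in> cocycles C i" and Y: "Y = cclass C i y" "y \<in> cocycles C i"
          and eq: "cohom_map D f i X = cohom_map D f i Y"
        have "f i x \<ominus>\<^bsub>obj D i\<^esub> f i y \<in> coboundaries D i"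
          using eq X Y cclass_eq_iff[OF D zd[OF fz[OF X(2)]] zd[OF fz[OF Y(2)]]] by (simp add: cm)
        then have "f i (x \<ominus>\<^bsub>obj C i\<^esub> y) \<in> coboundaries D i"
          using X Y by (simp add: mod_hom_diff[OF chain_mapD(1)[OF f] cx_module[OF C] cx_module[OF D]] zc)
        moreover have "x \<ominus>\<^bsub>obj C i\<^esub> y \<in> cocycles C i"
          using X Y Ci.submoduleE(3,5)[OF cocycles_submodule[OF C]] by (auto simp: a_minus_def)
        ultimately show "X = Y"
          using R X Y cclass_eq_iff[OF C zc[OF X(2)] zc[OF Y(2)]] by (auto simp: cohom_inj_def)
      qed
    qed
    have img: "cohom_map D f i ` carrier (cohom C i) = (\<lambda>x. cclass D i (f i x)) ` cocycles C i"
      unfolding cohom_carrier[OF C] image_image by (rule image_cong[OF refl cm])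
    have "cohom_map D f i ` carrier (cohom C i) \<subseteq> carrier (cohom D i)"
      unfolding img cohom_carrier[OF D] using fz by blast
    moreover have "carrier (cohom D i) \<subseteq> cohom_map D f i ` carrier (cohom C i) \<longleftrightarrow> cohom_surj C D f i"
    proof -
      have eq: "cclass D i y = cclass D i (f i x) \<longleftrightarrow> y \<ominus>\<^bsub>obj D i\<^esub> f i x \<in> coboundaries D i"
        if "y \<in> cocycles D i" "x \<in> cocycles C i" for x y
        by (rule cclass_eq_iff[OF D zd[OF that(1)] zd[OF fz[OF that(2)]]])
      show ?thesis unfolding img cohom_carrier[OF D] cohom_surj_def
        unfolding image_subset_iff unfolding image_iff using eq by (meson)
    qed
    ultimately show ?thesis unfolding bij_betw_def inj by blast
  qed
  then show ?thesis unfolding quasi_iso_def by blast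
qed

lemma quasi_isoD:
  assumes "quasi_iso A C D f"
  shows "cochain_complex A C" "cochain_complex A D" "chain_map A C D f" "cohom_inj C D f i" "cohom_surj C D f i"
  using assms unfolding quasi_iso_iff by auto

lemma quasi_iso_comp:
  assumes f: "quasi_iso A C D f" and g: "quasi_iso A D E g"
  shows "quasi_iso A C E (\<lambda>i x. g i (f i x))"
proof -
  note C = quasi_isoD(1)[OF f] and D = quasi_isoD(2)[OF f] and E = quasi_isoD(2)[OF g]
  note fc = quasi_isoD(3)[OF f] and gc = quasi_isoD(3)[OF g]
  have ch: "chain_map A C E (\<lambda>i x. g i (f i x))"
    unfolding chain_map_def
    using mod_hom_comp[OF chain_mapD(1)[OF fc] chain_mapD(1)[OF gc]] chain_mapD(2)[OF fc] chain_mapD(2)[OF gc]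
      mod_hom_closed[OF chain_mapD(1)[OF fc]] by auto
  have eq: "cohom_map E (\<lambda>i x. g i (f i x)) i X = cohom_map E g i (cohom_map D f i X)"
    if X: "X \<in> carrier (cohom C i)" for i X
    using X mod_hom_closed[OF chain_mapD(1)[OF fc]]
    by (auto simp: cohom_carrier[OF C] cohom_map_class[OF C E ch] cohom_map_class[OF C D fc] cohom_map_class[OF D E gc]
      cocycles_closed[OF C])
  have "bij_betw (cohom_map E (\<lambda>i x. g i (f i x)) i) (carrier (cohom C i)) (carrier (cohom E i))" for i
  proof -
    have "bij_betw (cohom_map E g i \<circ> cohom_map D f i) (carrier (cohom C i)) (carrier (cohom E i))"
      by (rule bij_betw_trans) (use f g in \<open>auto simp: quasi_iso_def\<close>)
    then show ?thesis using eq by (subst bij_betw_cong[where g = "cohom_map E g i \<circ> cohom_map D f i"]) auto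
  qed
  then show ?thesis using C E ch by (simp add: quasi_iso_def)
qed

text \<open>The long exact sequence argument for a degreewise split extension, with exact outer terms.\<close>

lemma split_extension_exact:
  assumes X: "cochain_complex A X" and Y: "cochain_complex A Y" and Z: "cochain_complex A Z"
    and \<iota>: "chain_map A X Y \<iota>" and \<rho>: "chain_map A Y Z \<rho>"
    and \<sigma>: "\<And>i. \<sigma> i \<in> mod_hom A (obj Z i) (obj Y i)" and \<kappa>: "\<And>i. \<kappa> i \<in> mod_hom A (obj Y i) (obj X i)"
    and \<rho>\<sigma>: "\<And>i z. z \<in> carrier (obj Z i) \<Longrightarrow> \<rho> i (\<sigma> i z) = z"
    and \<kappa>\<iota>: "\<And>i x. x \<in> carrier (obj X i) \<Longrightarrow> \<kappa> i (\<iota> i x) = x"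
    and split: "\<And>i y. y \<in> carrier (obj Y i) \<Longrightarrow> \<rho> i y = \<zero>\<^bsub>obj Z i\<^esub> \<Longrightarrow> y = \<iota> i (\<kappa> i y)"
    and exactX: "\<And>i. exact_at X i" and exactZ: "\<And>i. exact_at Z i"
  shows "exact_at Y i"
proof (rule exact_atI)
  fix f assume f: "f \<in> carrier (obj Y i)" and df: "dif Y i f = \<zero>\<^bsub>obj Y (i + 1)\<^esub>"
  interpret Y1: Module.module A "obj Y (i + 1)" by (rule cx_module[OF Y])
  interpret Y0: Module.module A "obj Y i" by (rule cx_module[OF Y])
  interpret Y': Module.module A "obj Y (i - 1)" by (rule cx_module[OF Y])
  interpret Z0: Module.module A "obj Z i" by (rule cx_module[OF Z])
  note \<iota>h = chain_mapD(1)[OF \<iota>] and \<rho>h = chain_mapD(1)[OF \<rho>]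
  have "dif Z i (\<rho> i f) = \<zero>\<^bsub>obj Z (i + 1)\<^esub>"
    using chain_mapD(2)[OF \<rho> f] df mod_hom_zero[OF \<rho>h cx_module[OF Y] cx_module[OF Z]] by simp
  then obtain s where s: "s \<in> carrier (obj Z (i - 1))" "\<rho> i f = dif Z (i - 1) s"
    using exact_atD[OF exactZ mod_hom_closed[OF \<rho>h f]] by blast
  let ?s = "\<sigma> (i - 1) s"
  have sc: "?s \<in> carrier (obj Y (i - 1))" by (rule mod_hom_closed[OF \<sigma> s(1)])
  have dsc: "dif Y (i - 1) ?s \<in> carrier (obj Y i)" by (rule mod_hom_closed[OF cx_dif'[OF Y] sc])
  let ?t = "f \<ominus>\<^bsub>obj Y i\<^esub> dif Y (i - 1) ?s"
  have t: "?t \<in> carrier (obj Y i)" using f dsc by simp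
  have "\<rho> i (dif Y (i - 1) ?s) = \<rho> i f" using chain_mapD'[OF \<rho> sc] s \<rho>\<sigma>[OF s(1)] by simp
  then have "\<rho> i ?t = \<zero>\<^bsub>obj Z i\<^esub>"
    using mod_hom_closed[OF \<rho>h f] by (simp add: mod_hom_diff[OF \<rho>h cx_module[OF Y] cx_module[OF Z] f dsc])
  then have tq: "?t = \<iota> i (\<kappa> i ?t)" by (rule split[OF t])
  let ?q = "\<kappa> i ?t"
  have q: "?q \<in> carrier (obj X i)" by (rule mod_hom_closed[OF \<kappa> t])
  have "dif Y i ?t = \<zero>\<^bsub>obj Y (i + 1)\<^esub>"
    by (simp add: mod_hom_diff[OF cx_dif[OF Y] cx_module[OF Y] cx_module[OF Y] f dsc] df cx_dd'[OF Y sc])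
  then have "\<iota> (i + 1) (dif X i ?q) = \<zero>\<^bsub>obj Y (i + 1)\<^esub>"
    using chain_mapD(2)[OF \<iota> q] tq by simp
  then have "dif X i ?q = \<zero>\<^bsub>obj X (i + 1)\<^esub>"
    using \<kappa>\<iota>[OF mod_hom_closed[OF cx_dif[OF X] q]] mod_hom_zero[OF \<kappa> cx_module[OF Y] cx_module[OF X]] by metis
  then obtain q' where q': "q' \<in> carrier (obj X (i - 1))" "?q = dif X (i - 1) q'"
    using exact_atD[OF exactX q] by blast
  have iq: "\<iota> (i - 1) q' \<in> carrier (obj Y (i - 1))" by (rule mod_hom_closed[OF \<iota>h q'(1)])
  have "?t = dif Y (i - 1) (\<iota> (i - 1) q')"
    using tq q'(2) chain_mapD'[OF \<iota> q'(1)] by simp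
  moreover have "f = dif Y (i - 1) ?s \<oplus>\<^bsub>obj Y i\<^esub> ?t" using f dsc by algebra
  ultimately have "f = dif Y (i - 1) (?s \<oplus>\<^bsub>obj Y (i - 1)\<^esub> \<iota> (i - 1) q')"
    by (simp add: mod_hom_add[OF cx_dif'[OF Y] sc iq])
  then show "\<exists>y\<in>carrier (obj Y (i - 1)). f = dif Y (i - 1) y" using sc iq by blast
qed

section \<open>Tensor products of complexes\<close>

lemma dsum_simps:
  "f \<in> carrier (dsum UNIV N) \<longleftrightarrow> (\<forall>j. f j \<in> carrier (N j)) \<and> finite {j. f j \<noteq> \<zero>\<^bsub>N j\<^esub>}"
  "f \<oplus>\<^bsub>dsum UNIV N\<^esub> g = (\<lambda>j. f j \<oplus>\<^bsub>N j\<^esub> g j)"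
  "\<zero>\<^bsub>dsum UNIV N\<^esub> = (\<lambda>j. \<zero>\<^bsub>N j\<^esub>)"
  "r \<odot>\<^bsub>dsum UNIV N\<^esub> f = (\<lambda>j. r \<odot>\<^bsub>N j\<^esub> f j)"
  by (auto simp: dsum_def)

lemma dsum_module:
  fixes R :: "'a ring"
  assumes R: "cring R" and N: "\<And>j. Module.module R (N j)"
  shows "Module.module R (dsum UNIV N)"
proof -
  have ag: "abelian_group (N j)" "abelian_monoid (N j)" for j
    using moduleD(2)[OF N[of j]] by (auto simp: abelian_group_def)
  have z: "\<zero>\<^bsub>N j\<^esub> \<in> carrier (N j)" for j by (rule abelian_monoid.zero_closed[OF ag(2)])
  have fin: "finite {j. f j \<oplus>\<^bsub>N j\<^esub> g j \<noteq> \<zero>\<^bsub>N j\<^esub>}"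
    if "finite {j. f j \<noteq> \<zero>\<^bsub>N j\<^esub>}" "finite {j. g j \<noteq> \<zero>\<^bsub>N j\<^esub>}" for f g
    by (rule finite_subset[of _ "{j. f j \<noteq> \<zero>\<^bsub>N j\<^esub>} \<union> {j. g j \<noteq> \<zero>\<^bsub>N j\<^esub>}"])
      (use that abelian_monoid.l_zero[OF ag(2) z] in auto)
  have fin2: "finite {j. r \<odot>\<^bsub>N j\<^esub> g j \<noteq> \<zero>\<^bsub>N j\<^esub>}"
    if "finite {j. g j \<noteq> \<zero>\<^bsub>N j\<^esub>}" "r \<in> carrier R" for g r
    by (rule finite_subset[OF _ that(1)]) (use that module.smult_r_null[OF N] in auto)
  have fin3: "finite {j. \<ominus>\<^bsub>N j\<^esub> g j \<noteq> \<zero>\<^bsub>N j\<^esub>}"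
    if "finite {j. g j \<noteq> \<zero>\<^bsub>N j\<^esub>}" for g
  proof (rule finite_subset[OF _ that], rule subsetI, rule CollectI)
    fix j assume j: "j \<in> {j. \<ominus>\<^bsub>N j\<^esub> g j \<noteq> \<zero>\<^bsub>N j\<^esub>}"
    interpret abelian_group "N j" by (rule ag(1))
    show "g j \<noteq> \<zero>\<^bsub>N j\<^esub>" using j add.inv_one by auto
  qed
  have negc: "(\<lambda>j. \<ominus>\<^bsub>N j\<^esub> f j) \<in> carrier (dsum UNIV N)" if "f \<in> carrier (dsum UNIV N)" for f
    using that fin3[of f] by (auto simp: dsum_simps intro: abelian_group.a_inv_closed[OF ag(1)])
  show ?thesis
  proof (rule module_of_joint_inj(1)[OF R, of UNIV N "dsum UNIV N" "\<lambda>j f. f j"])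
    show "\<exists>y\<in>carrier (dsum UNIV N). \<forall>k\<in>UNIV. y k = \<ominus>\<^bsub>N k\<^esub> x k" if "x \<in> carrier (dsum UNIV N)" for x
      using negc[OF that] by (rule bexI[rotated]) simp
  qed (use fin fin2 in \<open>auto simp: dsum_simps z N intro: abelian_monoid.a_closed[OF ag(2)] module.smult_closed[OF N]\<close>)
qed

text \<open>The two differentials of the double complex \<open>X\<^sup>m \<otimes> N\<^sup>p\<close>, without the sign.\<close>

definition dh :: "'a ring \<Rightarrow> ('a, 'm) cx \<Rightarrow> ('a, 'n) cx \<Rightarrow> int \<Rightarrow> int \<Rightarrow> ('m \<times> 'n \<Rightarrow> 'a) set \<Rightarrow> ('m \<times> 'n \<Rightarrow> 'a) set"
  where "dh A X N m p = tensor_map A (obj X (m + 1)) (obj N p) (dif X m) id"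

definition dv :: "'a ring \<Rightarrow> ('a, 'm) cx \<Rightarrow> ('a, 'n) cx \<Rightarrow> int \<Rightarrow> int \<Rightarrow> ('m \<times> 'n \<Rightarrow> 'a) set \<Rightarrow> ('m \<times> 'n \<Rightarrow> 'a) set"
  where "dv A X N m p = tensor_map A (obj X m) (obj N (p + 1)) id (dif N p)"

lemma koszul_sign_simps:
  assumes "Module.module R M" "x \<in> carrier M"
  shows koszul_sign_closed: "koszul_sign M n x \<in> carrier M"
    and koszul_sign_twice: "koszul_sign M n (koszul_sign M n x) = x"
    and koszul_sign_cancel: "koszul_sign M n x \<oplus>\<^bsub>M\<^esub> koszul_sign M (n + 1) x = \<zero>\<^bsub>M\<^esub>"
    and koszul_sign_cancel': "koszul_sign M (n + 1) x \<oplus>\<^bsub>M\<^esub> koszul_sign M n x = \<zero>\<^bsub>M\<^esub>"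
proof -
  interpret M: Module.module R M by fact
  show "koszul_sign M n x \<in> carrier M" "koszul_sign M n (koszul_sign M n x) = x"
    "koszul_sign M n x \<oplus>\<^bsub>M\<^esub> koszul_sign M (n + 1) x = \<zero>\<^bsub>M\<^esub>"
    "koszul_sign M (n + 1) x \<oplus>\<^bsub>M\<^esub> koszul_sign M n x = \<zero>\<^bsub>M\<^esub>"
    using assms(2) by (auto simp: koszul_sign_def M.M.r_neg M.M.l_neg)
qed

lemma koszul_sign_hom:
  assumes "f \<in> mod_hom R M N" "Module.module R M" "Module.module R N" "x \<in> carrier M"
  shows "f (koszul_sign M n x) = koszul_sign N n (f x)"
  using mod_hom_neg[OF assms] by (simp add: koszul_sign_def)

lemma koszul_sign_zero:
  assumes "Module.module R M" shows "koszul_sign M n \<zero>\<^bsub>M\<^esub> = \<zero>\<^bsub>M\<^esub>"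
proof -
  interpret M: Module.module R M by fact
  show ?thesis by (simp add: koszul_sign_def M.M.add.inv_one)
qed

context
  fixes A :: "'a ring" and X :: "('a, 'm) cx" and N :: "('a, 'n) cx"
  assumes X: "cochain_complex A X" and N: "cochain_complex A N"
begin

private abbreviation (input) T :: "int \<Rightarrow> int \<Rightarrow> ('a, ('m \<times> 'n \<Rightarrow> 'a) set) module"
  where "T m p \<equiv> tensor A (obj X m) (obj N p)"

lemma T_module: "Module.module A (T m p)"
  by (rule tensor_module[OF cx_module[OF X] cx_module[OF N]])

private lemmas Xm = cx_module[OF X] and Nm = cx_module[OF N]

lemma dh_hom: "dh A X N m p \<in> mod_hom A (T m p) (T (m + 1) p)"
  unfolding dh_def by (rule tensor_map_hom(1)[OF Xm Nm Xm Nm cx_dif[OF X] mod_hom_id(2)])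

lemma dv_hom: "dv A X N m p \<in> mod_hom A (T m p) (T m (p + 1))"
  unfolding dv_def by (rule tensor_map_hom(1)[OF Xm Nm Xm Nm mod_hom_id(2) cx_dif[OF N]])

lemma dh_elt: "x \<in> carrier (obj X m) \<Longrightarrow> y \<in> carrier (obj N p) \<Longrightarrow>
    dh A X N m p (tensor_elt A (obj X m) (obj N p) x y) = tensor_elt A (obj X (m + 1)) (obj N p) (dif X m x) y"
  unfolding dh_def by (simp add: tensor_map_hom(2)[OF Xm Nm Xm Nm cx_dif[OF X] mod_hom_id(2)])

lemma dv_elt: "x \<in> carrier (obj X m) \<Longrightarrow> y \<in> carrier (obj N p) \<Longrightarrow>
    dv A X N m p (tensor_elt A (obj X m) (obj N p) x y) = tensor_elt A (obj X m) (obj N (p + 1)) x (dif N p y)"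
  unfolding dv_def by (simp add: tensor_map_hom(2)[OF Xm Nm Xm Nm mod_hom_id(2) cx_dif[OF N]])

lemma dh_dh:
  assumes t: "t \<in> carrier (T m p)"
  shows "dh A X N (m + 1) p (dh A X N m p t) = \<zero>\<^bsub>T (m + 1 + 1) p\<^esub>"
  by (rule tensor_hom_eq[OF Xm Nm T_module mod_hom_comp[OF dh_hom dh_hom] mod_hom_const_zero[OF T_module] _ t])
    (simp add: dh_elt mod_hom_closed[OF cx_dif[OF X]] cx_dd[OF X]
      mod_hom_zero[OF tensor_elt_hom_left[OF Xm Nm] Xm T_module])

lemma dv_dv:
  assumes t: "t \<in> carrier (T m p)"
  shows "dv A X N m (p + 1) (dv A X N m p t) = \<zero>\<^bsub>T m (p + 1 + 1)\<^esub>"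
  by (rule tensor_hom_eq[OF Xm Nm T_module mod_hom_comp[OF dv_hom dv_hom] mod_hom_const_zero[OF T_module] _ t])
    (simp add: dv_elt mod_hom_closed[OF cx_dif[OF N]] cx_dd[OF N]
      mod_hom_zero[OF tensor_elt_hom_right[OF Xm Nm] Nm T_module])

lemma dh_dv:
  assumes t: "t \<in> carrier (T m p)"
  shows "dv A X N (m + 1) p (dh A X N m p t) = dh A X N m (p + 1) (dv A X N m p t)"
  by (rule tensor_hom_eq[OF Xm Nm T_module mod_hom_comp[OF dh_hom dv_hom] mod_hom_comp[OF dv_hom dh_hom] _ t])
    (simp add: dv_elt dh_elt mod_hom_closed[OF cx_dif[OF N]] mod_hom_closed[OF cx_dif[OF X]])

lemma tensor_cx_carrier: "f \<in> carrier (obj (tensor_cx A X N) n) \<longleftrightarrow>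
    (\<forall>m. f m \<in> carrier (T m (n - m))) \<and> finite {m. f m \<noteq> \<zero>\<^bsub>T m (n - m)\<^esub>}"
  by (simp add: tensor_cx_def dsum_simps)

lemma tensor_cx_zero: "\<zero>\<^bsub>obj (tensor_cx A X N) n\<^esub> = (\<lambda>m. \<zero>\<^bsub>T m (n - m)\<^esub>)"
  by (simp add: tensor_cx_def dsum_simps)

lemma tensor_cx_dif: "dif (tensor_cx A X N) n f m =
    dh A X N (m - 1) (n + 1 - m) (f (m - 1)) \<oplus>\<^bsub>T m (n + 1 - m)\<^esub>
      koszul_sign (T m (n + 1 - m)) m (dv A X N m (n - m) (f m))"
proof -
  have e: "n - m + 1 = n + 1 - m" by simp
  show ?thesis unfolding dh_def dv_def e by (simp add: tensor_cx_def Let_def)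
qed

lemma dh_hom': "dh A X N (m - 1) (n + 1 - m) \<in> mod_hom A (T (m - 1) (n - (m - 1))) (T m (n + 1 - m))"
proof -
  have e: "n - (m - 1) = n + 1 - m" "m - 1 + 1 = m" by simp_all
  show ?thesis using dh_hom[of "m - 1" "n + 1 - m"] unfolding e .
qed

lemma dv_hom': "(\<lambda>t. koszul_sign (T m (n + 1 - m)) m (dv A X N m (n - m) t))
    \<in> mod_hom A (T m (n - m)) (T m (n + 1 - m))"
proof -
  have e: "n - m + 1 = n + 1 - m" by simp
  show ?thesis using mod_hom_koszul_sign[OF T_module dv_hom[of m "n - m"]] unfolding e .
qed

text \<open>One component of \<open>d (d f) = 0\<close>: the pure squares vanish, and the mixed terms cancel because the
  differentials commute and the sign alternates with the first index.\<close>

lemma double_complex_square: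
  assumes u: "u \<in> carrier (T k (p + 1 + 1))" and v: "v \<in> carrier (T (k + 1) (p + 1))"
    and w: "w \<in> carrier (T (k + 1 + 1) p)"
  shows "dh A X N (k + 1) (p + 1 + 1) (dh A X N k (p + 1 + 1) u \<oplus>\<^bsub>T (k + 1) (p + 1 + 1)\<^esub>
        koszul_sign (T (k + 1) (p + 1 + 1)) (k + 1) (dv A X N (k + 1) (p + 1) v))
      \<oplus>\<^bsub>T (k + 1 + 1) (p + 1 + 1)\<^esub> koszul_sign (T (k + 1 + 1) (p + 1 + 1)) (k + 1 + 1)
        (dv A X N (k + 1 + 1) (p + 1) (dh A X N (k + 1) (p + 1) v \<oplus>\<^bsub>T (k + 1 + 1) (p + 1)\<^esub>
          koszul_sign (T (k + 1 + 1) (p + 1)) (k + 1 + 1) (dv A X N (k + 1 + 1) p w)))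
      = \<zero>\<^bsub>T (k + 1 + 1) (p + 1 + 1)\<^esub>"
proof -
  let ?U = "T (k + 1 + 1) (p + 1 + 1)"
  interpret U: Module.module A ?U by (rule T_module)
  note c = mod_hom_closed[OF dh_hom] mod_hom_closed[OF dv_hom]
  have dvv: "dv A X N (k + 1) (p + 1) v \<in> carrier (T (k + 1) (p + 1 + 1))" by (rule c(2)[OF v])
  have dhv: "dh A X N (k + 1) (p + 1) v \<in> carrier (T (k + 1 + 1) (p + 1))" by (rule c(1)[OF v])
  have dvw: "dv A X N (k + 1 + 1) p w \<in> carrier (T (k + 1 + 1) (p + 1))" by (rule c(2)[OF w])
  let ?z = "dh A X N (k + 1) (p + 1 + 1) (dv A X N (k + 1) (p + 1) v)"
  have z: "?z \<in> carrier ?U" by (rule c(1)[OF dvv])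
  have 1: "dh A X N (k + 1) (p + 1 + 1) (dh A X N k (p + 1 + 1) u \<oplus>\<^bsub>T (k + 1) (p + 1 + 1)\<^esub>
        koszul_sign (T (k + 1) (p + 1 + 1)) (k + 1) (dv A X N (k + 1) (p + 1) v)) = koszul_sign ?U (k + 1) ?z"
    using koszul_sign_closed[OF T_module z] z
    by (simp only: mod_hom_add[OF dh_hom c(1)[OF u] koszul_sign_closed[OF T_module dvv]] dh_dh[OF u]
        koszul_sign_hom[OF dh_hom T_module T_module dvv] U.M.l_zero)
  have 2: "dv A X N (k + 1 + 1) (p + 1) (dh A X N (k + 1) (p + 1) v \<oplus>\<^bsub>T (k + 1 + 1) (p + 1)\<^esub>
          koszul_sign (T (k + 1 + 1) (p + 1)) (k + 1 + 1) (dv A X N (k + 1 + 1) p w)) = ?z"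
    using z by (simp only: mod_hom_add[OF dv_hom dhv koszul_sign_closed[OF T_module dvw]] dh_dv[OF v]
        koszul_sign_hom[OF dv_hom T_module T_module dvw] dv_dv[OF w] koszul_sign_zero[OF T_module] U.M.r_zero)
  show ?thesis unfolding 1 2 by (rule koszul_sign_cancel[OF T_module z])
qed

lemma tensor_cx_complex: "cochain_complex A (tensor_cx A X N)"
  unfolding cochain_complex_def
proof (intro allI conjI ballI)
  fix n
  let ?C = "tensor_cx A X N"
  have R: "cring A" by (rule module_cring[OF Xm])
  have obj: "obj ?C n = dsum UNIV (\<lambda>m. T m (n - m))" for n by (simp add: tensor_cx_def)
  show mod: "Module.module A (obj ?C n)" unfolding obj by (rule dsum_module[OF R T_module])
  show "dif ?C n \<in> mod_hom A (obj ?C n) (obj ?C (n + 1))"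
  proof (rule mod_homI)
    fix f assume f: "f \<in> carrier (obj ?C n)"
    let ?S = "{m. f m \<noteq> \<zero>\<^bsub>T m (n - m)\<^esub>}"
    have fc: "f m \<in> carrier (T m (n - m))" for m using f by (simp add: tensor_cx_carrier)
    have S: "finite ?S" using f by (simp add: tensor_cx_carrier)
    have "{m. dif ?C n f m \<noteq> \<zero>\<^bsub>T m (n + 1 - m)\<^esub>} \<subseteq> ?S \<union> (\<lambda>m. m + 1) ` ?S"
    proof
      fix m assume m: "m \<in> {m. dif ?C n f m \<noteq> \<zero>\<^bsub>T m (n + 1 - m)\<^esub>}"
      interpret U: Module.module A "T m (n + 1 - m)" by (rule T_module)
      show "m \<in> ?S \<union> (\<lambda>m. m + 1) ` ?S"
      proof (rule ccontr)
        assume "m \<notin> ?S \<union> (\<lambda>m. m + 1) ` ?S"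
        then have "f m = \<zero>\<^bsub>T m (n - m)\<^esub>" "m - 1 \<notin> ?S" by (auto simp: image_iff)
        then have "f m = \<zero>\<^bsub>T m (n - m)\<^esub>" "f (m - 1) = \<zero>\<^bsub>T (m - 1) (n - (m - 1))\<^esub>" by auto
        then have "dif ?C n f m = \<zero>\<^bsub>T m (n + 1 - m)\<^esub>"
          by (simp only: tensor_cx_dif mod_hom_zero[OF dh_hom' T_module T_module]
            mod_hom_zero[OF dv_hom' T_module T_module] U.M.l_zero[OF U.M.zero_closed])
        then show False using m by simp
      qed
    qed
    then have "finite {m. dif ?C n f m \<noteq> \<zero>\<^bsub>T m (n + 1 - m)\<^esub>}" using S by (auto intro: finite_subset)
    moreover have "dif ?C n f m \<in> carrier (T m (n + 1 - m))" for m
    proof -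
      interpret U: Module.module A "T m (n + 1 - m)" by (rule T_module)
      show ?thesis unfolding tensor_cx_dif
        by (intro U.M.a_closed mod_hom_closed[OF dh_hom'] mod_hom_closed[OF dv_hom'] fc)
    qed
    ultimately show "dif ?C n f \<in> carrier (obj ?C (n + 1))" by (simp add: tensor_cx_carrier)
  next
    fix f g assume f: "f \<in> carrier (obj ?C n)" and g: "g \<in> carrier (obj ?C n)"
    have fc: "f m \<in> carrier (T m (n - m))" "g m \<in> carrier (T m (n - m))" for m
      using f g by (simp_all add: tensor_cx_carrier)
    show "dif ?C n (f \<oplus>\<^bsub>obj ?C n\<^esub> g) = dif ?C n f \<oplus>\<^bsub>obj ?C (n + 1)\<^esub> dif ?C n g"
    proof
      fix m
      interpret U: Module.module A "T m (n + 1 - m)" by (rule T_module)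
      note c = mod_hom_closed[OF dh_hom' fc(1)] mod_hom_closed[OF dh_hom' fc(2)]
        mod_hom_closed[OF dv_hom' fc(1)] mod_hom_closed[OF dv_hom' fc(2)]
      show "dif ?C n (f \<oplus>\<^bsub>obj ?C n\<^esub> g) m = (dif ?C n f \<oplus>\<^bsub>obj ?C (n + 1)\<^esub> dif ?C n g) m"
        unfolding obj dsum_simps tensor_cx_dif mod_hom_add[OF dh_hom' fc] mod_hom_add[OF dv_hom' fc]
        using c by algebra
    qed
  next
    fix r f assume r: "r \<in> carrier A" and f: "f \<in> carrier (obj ?C n)"
    have fc: "f m \<in> carrier (T m (n - m))" for m using f by (simp_all add: tensor_cx_carrier)
    show "dif ?C n (r \<odot>\<^bsub>obj ?C n\<^esub> f) = r \<odot>\<^bsub>obj ?C (n + 1)\<^esub> dif ?C n f"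
    proof
      fix m
      interpret U: Module.module A "T m (n + 1 - m)" by (rule T_module)
      show "dif ?C n (r \<odot>\<^bsub>obj ?C n\<^esub> f) m = (r \<odot>\<^bsub>obj ?C (n + 1)\<^esub> dif ?C n f) m"
        unfolding obj dsum_simps tensor_cx_dif mod_hom_smult[OF dh_hom' r fc] mod_hom_smult[OF dv_hom' r fc]
        by (rule U.smult_r_distr[symmetric, OF r mod_hom_closed[OF dh_hom' fc] mod_hom_closed[OF dv_hom' fc]])
    qed
  qed
  fix f assume f: "f \<in> carrier (obj ?C n)"
  have fc: "f m \<in> carrier (T m (n - m))" for m using f by (simp_all add: tensor_cx_carrier)
  show "dif ?C (n + 1) (dif ?C n f) = \<zero>\<^bsub>obj ?C (n + 2)\<^esub>"
  proof
    fix m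
    define k p where "k = m - 1 - 1" and "p = n - m"
    have e: "m = k + 1 + 1" "n = p + k + 1 + 1" by (simp_all add: k_def p_def)
    have i: "p + k + 1 + 1 - k = p + 1 + 1" "p + k + 1 + 1 - (k + 1) = p + 1" "p + k + 1 + 1 - (k + 1 + 1) = p"
      "p + k + 1 + 1 + 1 - (k + 1) = p + 1 + 1" "p + k + 1 + 1 + 1 - (k + 1 + 1) = p + 1"
      "p + k + 1 + 1 + 1 + 1 - (k + 1 + 1) = p + 1 + 1" "k + 1 + 1 - 1 = k + 1" "k + 1 - 1 = k"
      "p + k + 1 + 1 + 2 - (k + 1 + 1) = p + 1 + 1"
      by simp_all
    show "dif ?C (n + 1) (dif ?C n f) m = \<zero>\<^bsub>obj ?C (n + 2)\<^esub> m"
      using double_complex_square[of "f k" k p "f (k + 1)" "f (k + 1 + 1)"] fc[of k] fc[of "k + 1"] fc[of "k + 1 + 1"]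
      unfolding tensor_cx_dif tensor_cx_zero e i by blast
  qed
qed

text \<open>A cycle of the total complex has finitely many components. They are cleared from the lowest index
  upwards by exactness of the rows \<open>X\<^sup>m \<otimes> N\<close>, and this ends because \<open>X\<close> is bounded above.\<close>

lemma tensor_cx_exact_rows:
  assumes ex: "\<And>m p t. t \<in> carrier (T m p) \<Longrightarrow> dv A X N m p t = \<zero>\<^bsub>T m (p + 1)\<^esub> \<Longrightarrow>
      \<exists>s\<in>carrier (T m (p - 1)). t = dv A X N m (p - 1) s"
    and bd: "\<And>m. b < m \<Longrightarrow> carrier (obj X m) = {\<zero>\<^bsub>obj X m\<^esub>}"
  shows "exact_at (tensor_cx A X N) n"
proof (rule exact_atI)
  let ?C = "tensor_cx A X N"
  fix f assume f: "f \<in> carrier (obj ?C n)" and df: "dif ?C n f = \<zero>\<^bsub>obj ?C (n + 1)\<^esub>"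
  have fc: "f m \<in> carrier (T m (n - m))" for m using f by (simp_all add: tensor_cx_carrier)
  have triv: "t = \<zero>\<^bsub>T m p\<^esub>" if "b < m" "t \<in> carrier (T m p)" for t m p
  proof -
    have "tensor_map A (obj X m) (obj N p) id id t = \<zero>\<^bsub>T m p\<^esub>"
      by (rule tensor_map_zero[OF Xm Nm Xm Nm mod_hom_id(2) mod_hom_id(2) _ that(2)]) (use bd[OF that(1)] in auto)
    then show ?thesis using tensor_map_ident[OF Xm Nm _ _ that(2), of id id] by simp
  qed
  have "bdd_below {m. f m \<noteq> \<zero>\<^bsub>T m (n - m)\<^esub>}" using f by (simp add: tensor_cx_carrier)
  then obtain a where a: "\<And>m. f m \<noteq> \<zero>\<^bsub>T m (n - m)\<^esub> \<Longrightarrow> a \<le> m" by (auto simp: bdd_below_def)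
  have i: "n - (k + 1) = n - 1 - k" "n + 1 - (k + 1) = n - k" "n + 1 - (k + 1 + 1) = n - 1 - k"
    "n - 1 - k + 1 = n - k" "n - k + 1 = n + 1 - k" "k + 1 - 1 = k" "n - 1 + 1 = n"
    "n - 1 - (k + 1) + 1 = n - 1 - k" "n - k - 1 = n - 1 - k" for k by simp_all
  have "\<exists>g. (\<forall>k. g k \<in> carrier (T k (n - 1 - k))) \<and> (\<forall>k<a. g k = \<zero>\<^bsub>T k (n - 1 - k)\<^esub>) \<and>
    (\<forall>k. k + 1 \<le> b \<longrightarrow> f (k + 1) = dh A X N k (n - 1 - k) (g k) \<oplus>\<^bsub>T (k + 1) (n - (k + 1))\<^esub>
      koszul_sign (T (k + 1) (n - (k + 1))) (k + 1) (dv A X N (k + 1) (n - 1 - (k + 1)) (g (k + 1))))"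
  proof (rule kill_components[where Y = "\<lambda>k. T k (n + 1 - k)" and X = "\<lambda>k. T k (n - k)" and R = A
      and ax = "\<lambda>k. dh A X N k (n - k)" and bx = "\<lambda>k t. koszul_sign (T k (n + 1 - k)) k (dv A X N k (n - k) t)"
      and az = "\<lambda>k. dh A X N k (n - 1 - k)"
      and bz = "\<lambda>k t. koszul_sign (T k (n - k)) k (dv A X N k (n - 1 - k) t)"])
    show "dh A X N k (n - 1 - k) \<in> mod_hom A (T k (n - 1 - k)) (T (k + 1) (n - (k + 1)))" for k
      unfolding i by (rule dh_hom)
    show "dh A X N k (n - k) \<in> mod_hom A (T k (n - k)) (T (k + 1) (n + 1 - (k + 1)))" for k
      unfolding i by (rule dh_hom)
    show "(\<lambda>t. koszul_sign (T k (n - k)) k (dv A X N k (n - 1 - k) t)) \<in> mod_hom A (T k (n - 1 - k)) (T k (n - k))" for k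
      using dv_hom'[of k "n - 1"] by (simp only: i)
    show "(\<lambda>t. koszul_sign (T k (n + 1 - k)) k (dv A X N k (n - k) t)) \<in> mod_hom A (T k (n - k)) (T k (n + 1 - k))" for k
      by (rule dv_hom')
    show "dh A X N (k + 1) (n - (k + 1)) (dh A X N k (n - 1 - k) z) = \<zero>\<^bsub>T (k + 1 + 1) (n + 1 - (k + 1 + 1))\<^esub>"
      if "z \<in> carrier (T k (n - 1 - k))" for k z
      unfolding i by (rule dh_dh[OF that])
    show "dh A X N k (n - k) (koszul_sign (T k (n - k)) k (dv A X N k (n - 1 - k) z))
        \<oplus>\<^bsub>T (k + 1) (n + 1 - (k + 1))\<^esub> koszul_sign (T (k + 1) (n + 1 - (k + 1))) (k + 1)
          (dv A X N (k + 1) (n - (k + 1)) (dh A X N k (n - 1 - k) z)) = \<zero>\<^bsub>T (k + 1) (n + 1 - (k + 1))\<^esub>"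
      if z: "z \<in> carrier (T k (n - 1 - k))" for k z
    proof -
      have dz: "dv A X N k (n - 1 - k) z \<in> carrier (T k (n - k))"
        using mod_hom_closed[OF dv_hom z] by (simp only: i)
      show ?thesis using dh_dv[OF z] unfolding i
        by (simp only: koszul_sign_hom[OF dh_hom T_module T_module dz] koszul_sign_cancel[OF T_module mod_hom_closed[OF dh_hom dz]])
    qed
    show "\<exists>z\<in>carrier (T k (n - 1 - k)). x = koszul_sign (T k (n - k)) k (dv A X N k (n - 1 - k) z)"
      if x: "x \<in> carrier (T k (n - k))" and 0: "koszul_sign (T k (n + 1 - k)) k (dv A X N k (n - k) x) = \<zero>\<^bsub>T k (n + 1 - k)\<^esub>"
      for k x
    proof -
      have dx: "dv A X N k (n - k) x \<in> carrier (T k (n + 1 - k))"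
        using mod_hom_closed[OF dv_hom x] by (simp only: i)
      have "dv A X N k (n - k) x = \<zero>\<^bsub>T k (n - k + 1)\<^esub>"
        using koszul_sign_twice[OF T_module dx, of k] 0 koszul_sign_zero[OF T_module] unfolding i by metis
      then obtain s where s: "s \<in> carrier (T k (n - 1 - k))" "x = dv A X N k (n - 1 - k) s"
        using ex[OF x] unfolding i by blast
      have ds: "dv A X N k (n - 1 - k) s \<in> carrier (T k (n - k))" using x s(2) by simp
      have "x = koszul_sign (T k (n - k)) k (dv A X N k (n - 1 - k) (koszul_sign (T k (n - 1 - k)) k s))"
        using koszul_sign_hom[OF dv_hom T_module T_module s(1), of k] koszul_sign_twice[OF T_module ds, of k] s(2)
        unfolding i by simp
      then show ?thesis using koszul_sign_closed[OF T_module s(1)] by blast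
    qed
    show "dh A X N k (n - k) (f k) \<oplus>\<^bsub>T (k + 1) (n + 1 - (k + 1))\<^esub> koszul_sign (T (k + 1) (n + 1 - (k + 1))) (k + 1)
        (dv A X N (k + 1) (n - (k + 1)) (f (k + 1))) = \<zero>\<^bsub>T (k + 1) (n + 1 - (k + 1))\<^esub>" for k
      using fun_cong[OF df, of "k + 1"] unfolding tensor_cx_dif tensor_cx_zero i .
    show "f k = \<zero>\<^bsub>T k (n - k)\<^esub>" if "k < a" for k using a[of k] that by force
  qed (use fc T_module in auto)
  then obtain g where g: "\<And>k. g k \<in> carrier (T k (n - 1 - k))" "\<And>k. k < a \<Longrightarrow> g k = \<zero>\<^bsub>T k (n - 1 - k)\<^esub>"
    "\<And>k. k + 1 \<le> b \<Longrightarrow> f (k + 1) = dh A X N k (n - 1 - k) (g k) \<oplus>\<^bsub>T (k + 1) (n - (k + 1))\<^esub>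
      koszul_sign (T (k + 1) (n - (k + 1))) (k + 1) (dv A X N (k + 1) (n - 1 - (k + 1)) (g (k + 1)))" by blast
  have "{m. g m \<noteq> \<zero>\<^bsub>T m (n - 1 - m)\<^esub>} \<subseteq> {a..b}" using g(2) triv[OF _ g(1)] by force
  then have gC: "g \<in> carrier (obj ?C (n - 1))" using g(1) by (auto simp: tensor_cx_carrier intro: finite_subset)
  have "f m = dif ?C (n - 1) g m" for m
  proof (cases "m \<le> b")
    case True
    have "m - 1 + 1 = m" "n - 1 - (m - 1) = n - m" "n - 1 + 1 - m = n - m" by simp_all
    then show ?thesis using g(3)[of "m - 1"] True unfolding tensor_cx_dif by metis
  next
    case False
    have "dif ?C (n - 1) g \<in> carrier (obj ?C (n - 1 + 1))" by (rule mod_hom_closed[OF cx_dif[OF tensor_cx_complex] gC])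
    then have "dif ?C (n - 1) g m \<in> carrier (T m (n - m))" by (simp add: tensor_cx_carrier)
    then show ?thesis using triv[of m] fc[of m] False by (metis not_le)
  qed
  then show "\<exists>y\<in>carrier (obj ?C (n - 1)). f = dif ?C (n - 1) y" using gC by blast
qed

end

text \<open>Let \<open>N\<close> have \<open>A/J\<close> in degree 1 and free modules below. If \<open>d x\<close> vanishes modulo \<open>J\<close>, then
  \<open>x \<otimes> e\<close> is a cycle of the total complex, hence a boundary of some \<open>w\<close>. The columns \<open>X \<otimes> N\<^sup>p\<close> with \<open>p \<le> 0\<close>
  are exact, since \<open>X\<close> is exact and \<open>N\<^sup>p\<close> is free. Therefore \<open>w\<close> can be changed by a boundary until its
  component in \<open>X\<^sup>n \<otimes> N\<^sup>0\<close> contributes only horizontal terms, and its component in \<open>X\<^sup>n\<^sup>-\<^sup>1 \<otimes> A/J\<close> becomes a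
  primitive of \<open>x\<close> modulo \<open>J\<close>.\<close>

lemma exact_mod_cyclic:
  assumes X: "cochain_complex A X" and N: "cochain_complex A N"
    and exT: "\<And>n. exact_at (tensor_cx A X N) n" and exX: "\<And>n. exact_at X n"
    and free: "\<And>p. p \<le> 0 \<Longrightarrow> is_free A (obj N p)"
    and cyc: "cyclic_quot A J (obj N 1) e" and de: "dif N 1 e = \<zero>\<^bsub>obj N 2\<^esub>"
    and x: "x \<in> carrier (obj X n)" and dx: "dif X n x \<in> ideal_mult J (obj X (n + 1))"
  shows "\<exists>y\<in>carrier (obj X (n - 1)). x \<ominus>\<^bsub>obj X n\<^esub> dif X (n - 1) y \<in> ideal_mult J (obj X n)"
proof -
  let ?C = "tensor_cx A X N" and ?T = "\<lambda>m p. tensor A (obj X m) (obj N p)"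
  note Xm = cx_module[OF X] and Nm = cx_module[OF N]
  note Tm = T_module[OF X N] and dhh = dh_hom[OF X N] and dvh = dv_hom[OF X N]
  have e: "e \<in> carrier (obj N 1)" using cyc by (auto simp: cyclic_quot_def)
  have z: "\<zero>\<^bsub>?T m p\<^esub> \<in> carrier (?T m p)" for m p
  proof -
    interpret Module.module A "?T m p" by (rule Tm)
    show ?thesis by (rule M.zero_closed)
  qed
  define f where "f m = (if m = n then tensor_elt A (obj X n) (obj N 1) x e else \<zero>\<^bsub>?T m (n + 1 - m)\<^esub>)" for m
  have fn: "f n \<in> carrier (?T n 1)" using tensor_elt_closed[OF Xm Nm x e] by (simp add: f_def)
  have fc: "f m \<in> carrier (?T m (n + 1 - m))" for m
    using fn z by (cases "m = n") (simp_all add: f_def)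
  have "{m. f m \<noteq> \<zero>\<^bsub>?T m (n + 1 - m)\<^esub>} \<subseteq> {n}" by (auto simp: f_def)
  then have fC: "f \<in> carrier (obj ?C (n + 1))" using fc by (auto simp: tensor_cx_carrier[OF X N] intro: finite_subset)
  have dhf: "dh A X N (m - 1) (n + 1 + 1 - m) (f (m - 1)) = \<zero>\<^bsub>?T m (n + 1 + 1 - m)\<^esub>" for m
  proof (cases "m - 1 = n")
    case True
    then have m: "m = n + 1" by simp
    interpret X1: Module.module A "obj X (n + 1)" by (rule Xm)
    have "tensor_elt A (obj X (n + 1)) (obj N 1) (dif X n x) e = tensor_elt A (obj X (n + 1)) (obj N 1) \<zero>\<^bsub>obj X (n + 1)\<^esub> e"
      using tensor_cyclic_eq_iff[OF cyc Xm mod_hom_closed[OF cx_dif[OF X] x] X1.M.zero_closed] dx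
        mod_hom_closed[OF cx_dif[OF X] x] by simp
    also have "\<dots> = \<zero>\<^bsub>?T (n + 1) 1\<^esub>" by (rule mod_hom_zero[OF tensor_elt_hom_left[OF Xm Nm e] Xm Tm])
    finally show ?thesis using dh_elt[OF X N x e] unfolding m by (simp add: f_def)
  next
    case False
    have i: "n + 1 - (m - 1) = n + 1 + 1 - m" "m - 1 + 1 = m" by simp_all
    show ?thesis
      using False mod_hom_zero[OF dhh[of "m - 1" "n + 1 + 1 - m"] Tm Tm] unfolding f_def i by simp
  qed
  have dvf: "dv A X N m (n + 1 - m) (f m) = \<zero>\<^bsub>?T m (n + 1 - m + 1)\<^esub>" for m
  proof (cases "m = n")
    case True
    then show ?thesis
      using dv_elt[OF X N x e] mod_hom_zero[OF tensor_elt_hom_right[OF Xm Nm x] Nm Tm] de by (simp add: f_def)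
  next
    case False
    then show ?thesis using mod_hom_zero[OF dvh Tm Tm] by (simp add: f_def)
  qed
  have "dif ?C (n + 1) f = \<zero>\<^bsub>obj ?C (n + 1 + 1)\<^esub>"
  proof
    fix m
    have i: "n + 1 - m + 1 = n + 1 + 1 - m" by simp
    interpret U: Module.module A "?T m (n + 1 + 1 - m)" by (rule Tm)
    show "dif ?C (n + 1) f m = \<zero>\<^bsub>obj ?C (n + 1 + 1)\<^esub> m"
      unfolding tensor_cx_dif[OF X N] tensor_cx_zero[OF X N] dhf dvf i koszul_sign_zero[OF Tm]
      by (rule U.M.l_zero[OF U.M.zero_closed])
  qed
  then obtain w where w: "w \<in> carrier (obj ?C n)" and fw: "f = dif ?C n w"
    using exact_atD[OF exT fC] by auto
  have wc: "w m \<in> carrier (?T m (n - m))" for m using w by (simp add: tensor_cx_carrier[OF X N])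
  have "bdd_above {m. w m \<noteq> \<zero>\<^bsub>?T m (n - m)\<^esub>}" using w by (simp add: tensor_cx_carrier[OF X N])
  then obtain c where c: "\<And>m. w m \<noteq> \<zero>\<^bsub>?T m (n - m)\<^esub> \<Longrightarrow> m \<le> c" by (auto simp: bdd_above_def)
  have Dw: "dh A X N (m - 1) (n + 1 - m) (w (m - 1)) \<oplus>\<^bsub>?T m (n + 1 - m)\<^esub>
      koszul_sign (?T m (n + 1 - m)) m (dv A X N m (n - m) (w m)) = f m" for m
    unfolding fw tensor_cx_dif[OF X N] ..
  have i: "n - (k + 1) = n - 1 - k" "n - (n - k) = k" "n + 1 - (k + 1) = n - k" "n - 1 - k + 1 = n - k"
    "n - k + 1 = n + 1 - k" "n - k - 1 = n - 1 - k" "n + 1 - (n - k) = k + 1" "n + 1 - (k + 1 + 1) = n - 1 - k" for k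
    by simp_all
  have "\<exists>g. (\<forall>k. g k \<in> carrier (?T (n - 1 - k) k)) \<and> (\<forall>k<n - c. g k = \<zero>\<^bsub>?T (n - 1 - k) k\<^esub>) \<and>
    (\<forall>k. k + 1 \<le> 0 \<longrightarrow> w (n - (k + 1)) =
      koszul_sign (?T (n - 1 - k) (k + 1)) (n - 1 - k) (dv A X N (n - 1 - k) k (g k)) \<oplus>\<^bsub>?T (n - (k + 1)) (k + 1)\<^esub>
      dh A X N (n - 1 - (k + 1)) (k + 1) (g (k + 1)))"
  proof (rule kill_components[where Y = "\<lambda>k. ?T (n + 1 - k) k" and X = "\<lambda>k. ?T (n - k) k" and R = A
      and ax = "\<lambda>k t. koszul_sign (?T (n - k) (k + 1)) (n - k) (dv A X N (n - k) k t)"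
      and bx = "\<lambda>k. dh A X N (n - k) k"
      and az = "\<lambda>k t. koszul_sign (?T (n - 1 - k) (k + 1)) (n - 1 - k) (dv A X N (n - 1 - k) k t)"
      and bz = "\<lambda>k. dh A X N (n - 1 - k) k" and f = "\<lambda>k. w (n - k)"])
    show "(\<lambda>t. koszul_sign (?T (n - 1 - k) (k + 1)) (n - 1 - k) (dv A X N (n - 1 - k) k t))
        \<in> mod_hom A (?T (n - 1 - k) k) (?T (n - (k + 1)) (k + 1))" for k
      unfolding i by (rule mod_hom_koszul_sign[OF Tm dvh])
    show "(\<lambda>t. koszul_sign (?T (n - k) (k + 1)) (n - k) (dv A X N (n - k) k t))
        \<in> mod_hom A (?T (n - k) k) (?T (n + 1 - (k + 1)) (k + 1))" for k
      unfolding i by (rule mod_hom_koszul_sign[OF Tm dvh])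
    show "dh A X N (n - 1 - k) k \<in> mod_hom A (?T (n - 1 - k) k) (?T (n - k) k)" for k
      using dhh[of "n - 1 - k" k] unfolding i .
    show "dh A X N (n - k) k \<in> mod_hom A (?T (n - k) k) (?T (n + 1 - k) k)" for k
      using dhh[of "n - k" k] unfolding i .
    show "koszul_sign (?T (n - (k + 1)) (k + 1 + 1)) (n - (k + 1)) (dv A X N (n - (k + 1)) (k + 1)
        (koszul_sign (?T (n - 1 - k) (k + 1)) (n - 1 - k) (dv A X N (n - 1 - k) k t))) = \<zero>\<^bsub>?T (n + 1 - (k + 1 + 1)) (k + 1 + 1)\<^esub>"
      if t: "t \<in> carrier (?T (n - 1 - k) k)" for k t
      unfolding i koszul_sign_hom[OF dvh Tm Tm mod_hom_closed[OF dvh t]] dv_dv[OF X N t] koszul_sign_zero[OF Tm] ..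
    show "koszul_sign (?T (n - k) (k + 1)) (n - k) (dv A X N (n - k) k (dh A X N (n - 1 - k) k t))
        \<oplus>\<^bsub>?T (n + 1 - (k + 1)) (k + 1)\<^esub> dh A X N (n - (k + 1)) (k + 1)
          (koszul_sign (?T (n - 1 - k) (k + 1)) (n - 1 - k) (dv A X N (n - 1 - k) k t)) = \<zero>\<^bsub>?T (n + 1 - (k + 1)) (k + 1)\<^esub>"
      if t: "t \<in> carrier (?T (n - 1 - k) k)" for k t
    proof -
      note dt = mod_hom_closed[OF dvh t]
      have 1: "dv A X N (n - k) k (dh A X N (n - 1 - k) k t) = dh A X N (n - 1 - k) (k + 1) (dv A X N (n - 1 - k) k t)"
        using dh_dv[OF X N t] unfolding i .
      have 2: "dh A X N (n - 1 - k) (k + 1) (dv A X N (n - 1 - k) k t) \<in> carrier (?T (n - k) (k + 1))"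
        using mod_hom_closed[OF dhh dt] unfolding i .
      have 3: "dh A X N (n - 1 - k) (k + 1) (koszul_sign (?T (n - 1 - k) (k + 1)) (n - 1 - k) (dv A X N (n - 1 - k) k t))
          = koszul_sign (?T (n - k) (k + 1)) (n - 1 - k) (dh A X N (n - 1 - k) (k + 1) (dv A X N (n - 1 - k) k t))"
        using koszul_sign_hom[OF dhh Tm Tm dt] unfolding i .
      show ?thesis unfolding i 1 3 using koszul_sign_cancel'[OF Tm 2, of "n - 1 - k"] unfolding i .
    qed
    show "\<exists>s\<in>carrier (?T (n - 1 - k) k). t = dh A X N (n - 1 - k) k s"
      if k: "k \<le> 0" and t: "t \<in> carrier (?T (n - k) k)" and 0: "dh A X N (n - k) k t = \<zero>\<^bsub>?T (n + 1 - k) k\<^esub>" for k t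
    proof -
      obtain B :: "'c set" and ee cc where db: "dual_basis A (obj N k) B ee cc"
        using is_free_dual_basis[OF Nm free[OF k]] .
      have j: "n - 1 - k = n - k - 1" "n - k - 1 + 1 = n - k" by simp_all
      have "\<exists>s\<in>carrier (tensor A (obj X (n - k - 1)) (obj N k)).
          t = tensor_map A (obj X (n - k)) (obj N k) (dif X (n - k - 1)) id s"
      proof (rule tensor_free_exact[OF Xm Xm Xm Nm cx_dif'[OF X] cx_dif[OF X] _ db t])
        show "tensor_map A (obj X (n - k + 1)) (obj N k) (dif X (n - k)) id t = \<zero>\<^bsub>tensor A (obj X (n - k + 1)) (obj N k)\<^esub>"
          using 0 unfolding dh_def i .
        show "\<exists>v\<in>carrier (obj X (n - k - 1)). u = dif X (n - k - 1) v"
          if "u \<in> carrier (obj X (n - k))" "dif X (n - k) u = \<zero>\<^bsub>obj X (n - k + 1)\<^esub>" for u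
          by (rule exact_atD[OF exX that])
      qed
      then show ?thesis unfolding dh_def j .
    qed
    show "koszul_sign (?T (n - k) (k + 1)) (n - k) (dv A X N (n - k) k (w (n - k)))
        \<oplus>\<^bsub>?T (n + 1 - (k + 1)) (k + 1)\<^esub> dh A X N (n - (k + 1)) (k + 1) (w (n - (k + 1))) = \<zero>\<^bsub>?T (n + 1 - (k + 1)) (k + 1)\<^esub>"
      if k: "k + 1 \<le> 0" for k
    proof -
      interpret U: Module.module A "?T (n - k) (k + 1)" by (rule Tm)
      have wk: "w (n - k) \<in> carrier (?T (n - k) k)" "w (n - 1 - k) \<in> carrier (?T (n - 1 - k) (k + 1))"
      proof -
        have j: "n - (n - 1 - k) = k + 1" by simp
        show "w (n - k) \<in> carrier (?T (n - k) k)" "w (n - 1 - k) \<in> carrier (?T (n - 1 - k) (k + 1))"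
          using wc[of "n - k"] wc[of "n - 1 - k"] unfolding i j by blast+
      qed
      have 1: "koszul_sign (?T (n - k) (k + 1)) (n - k) (dv A X N (n - k) k (w (n - k))) \<in> carrier (?T (n - k) (k + 1))"
        by (rule koszul_sign_closed[OF Tm mod_hom_closed[OF dvh wk(1)]])
      have 2: "dh A X N (n - 1 - k) (k + 1) (w (n - 1 - k)) \<in> carrier (?T (n - k) (k + 1))"
        using mod_hom_closed[OF dhh wk(2)] unfolding i .
      have "f (n - k) = \<zero>\<^bsub>?T (n - k) (k + 1)\<^esub>" using k by (simp add: f_def add.commute)
      then show ?thesis using Dw[of "n - k"] unfolding i using U.M.a_comm[OF 1 2] by simp
    qed
    show "w (n - k) = \<zero>\<^bsub>?T (n - k) k\<^esub>" if "k < n - c" for k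
      using c[of "n - k"] that unfolding i by force
    show "w (n - k) \<in> carrier (?T (n - k) k)" for k using wc[of "n - k"] unfolding i .
  qed (rule Tm)+
  then obtain g where g: "\<And>k. g k \<in> carrier (?T (n - 1 - k) k)"
    and wg: "\<And>k. k + 1 \<le> 0 \<Longrightarrow> w (n - (k + 1)) =
      koszul_sign (?T (n - 1 - k) (k + 1)) (n - 1 - k) (dv A X N (n - 1 - k) k (g k)) \<oplus>\<^bsub>?T (n - (k + 1)) (k + 1)\<^esub>
      dh A X N (n - 1 - (k + 1)) (k + 1) (g (k + 1))" by blast
  have gm: "g (-1) \<in> carrier (?T n (-1))" and g0: "g 0 \<in> carrier (?T (n - 1) 0)" using g[of "-1"] g[of 0] by simp_all
  have wn: "w n = koszul_sign (?T n 0) n (dv A X N n (-1) (g (-1))) \<oplus>\<^bsub>?T n 0\<^esub> dh A X N (n - 1) 0 (g 0)"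
    using wg[of "-1"] by simp
  have d1: "dv A X N n (-1) (g (-1)) \<in> carrier (?T n 0)" using mod_hom_closed[OF dvh gm] by simp
  have d2: "dh A X N (n - 1) 0 (g 0) \<in> carrier (?T n 0)" using mod_hom_closed[OF dhh g0] by simp
  have vg: "dv A X N (n - 1) 0 (g 0) \<in> carrier (?T (n - 1) 1)" using mod_hom_closed[OF dvh g0] by simp
  have dvh0: "dv A X N n 0 \<in> mod_hom A (?T n 0) (?T n 1)" using dvh[of n 0] by simp
  have dhh1: "dh A X N (n - 1) 1 \<in> mod_hom A (?T (n - 1) 1) (?T n 1)" using dhh[of "n - 1" 1] by simp
  interpret U: Module.module A "?T n 1" by (rule Tm)
  interpret U1: Module.module A "?T (n - 1) 1" by (rule Tm)
  have dd1: "dv A X N n 0 (dv A X N n (-1) (g (-1))) = \<zero>\<^bsub>?T n 1\<^esub>" using dv_dv[OF X N gm] by simp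
  have dd2: "dv A X N n 0 (dh A X N (n - 1) 0 (g 0)) = dh A X N (n - 1) 1 (dv A X N (n - 1) 0 (g 0))"
    using dh_dv[OF X N g0] by simp
  have cl: "dh A X N (n - 1) 1 (dv A X N (n - 1) 0 (g 0)) \<in> carrier (?T n 1)" by (rule mod_hom_closed[OF dhh1 vg])
  have dvw: "dv A X N n 0 (w n) = dh A X N (n - 1) 1 (dv A X N (n - 1) 0 (g 0))"
    unfolding wn mod_hom_add[OF dvh0 koszul_sign_closed[OF Tm d1] d2] koszul_sign_hom[OF dvh0 Tm Tm d1]
      dd1 dd2 koszul_sign_zero[OF Tm] by (rule U.M.l_zero[OF cl])
  let ?s = "koszul_sign (?T (n - 1) 1) n (dv A X N (n - 1) 0 (g 0))"
  have sc: "?s \<in> carrier (?T (n - 1) 1)" by (rule koszul_sign_closed[OF Tm vg])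
  have w1: "w (n - 1) \<in> carrier (?T (n - 1) 1)" using wc[of "n - 1"] by simp
  have "f n = dh A X N (n - 1) 1 (w (n - 1)) \<oplus>\<^bsub>?T n 1\<^esub> koszul_sign (?T n 1) n (dv A X N n 0 (w n))"
    using Dw[of n] by simp
  also have "\<dots> = dh A X N (n - 1) 1 (w (n - 1) \<oplus>\<^bsub>?T (n - 1) 1\<^esub> ?s)"
    unfolding dvw koszul_sign_hom[OF dhh1 Tm Tm vg, symmetric] mod_hom_add[OF dhh1 w1 sc] ..
  finally have fn2: "f n = dh A X N (n - 1) 1 (w (n - 1) \<oplus>\<^bsub>?T (n - 1) 1\<^esub> ?s)" .
  obtain y where y: "y \<in> carrier (obj X (n - 1))"
    "w (n - 1) \<oplus>\<^bsub>?T (n - 1) 1\<^esub> ?s = tensor_elt A (obj X (n - 1)) (obj N 1) y e"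
    using tensor_cyclic_surj[OF cyc Xm U1.M.a_closed[OF w1 sc]] by blast
  have "tensor_elt A (obj X n) (obj N 1) x e = tensor_elt A (obj X n) (obj N 1) (dif X (n - 1) y) e"
    using fn2 dh_elt[OF X N y(1) e] unfolding y(2) by (simp add: f_def)
  then have "x \<ominus>\<^bsub>obj X n\<^esub> dif X (n - 1) y \<in> ideal_mult J (obj X n)"
    using tensor_cyclic_eq_iff[OF cyc Xm x mod_hom_closed[OF cx_dif'[OF X] y(1)]] by simp
  then show ?thesis using y(1) by blast
qed

subsection \<open>Functoriality\<close>

definition tensor_cx_map :: "'a ring \<Rightarrow> ('a, 'm) cx \<Rightarrow> ('a, 'n) cx \<Rightarrow> (int \<Rightarrow> 'k \<Rightarrow> 'm) \<Rightarrow> int \<Rightarrow>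
    (int \<Rightarrow> ('k \<times> 'n \<Rightarrow> 'a) set) \<Rightarrow> int \<Rightarrow> ('m \<times> 'n \<Rightarrow> 'a) set"
  where "tensor_cx_map A D N \<phi> n f = (\<lambda>m. tensor_map A (obj D m) (obj N (n - m)) (\<phi> m) id (f m))"

context
  fixes A :: "'a ring" and C :: "('a, 'k) cx" and D :: "('a, 'm) cx" and N :: "('a, 'n) cx" and \<phi>
  assumes C: "cochain_complex A C" and D: "cochain_complex A D" and N: "cochain_complex A N"
    and \<phi>: "\<And>m. \<phi> m \<in> mod_hom A (obj C m) (obj D m)"
begin

private lemmas modC = cx_module[OF C] and modD = cx_module[OF D] and modN = cx_module[OF N]

lemma tensor_cx_map_comp_hom: "tensor_map A (obj D m) (obj N p) (\<phi> m) id \<in>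
    mod_hom A (tensor A (obj C m) (obj N p)) (tensor A (obj D m) (obj N p))"
  by (rule tensor_map_hom(1)[OF modC modN modD modN \<phi> mod_hom_id(2)])

lemma tensor_cx_map_hom:
  "tensor_cx_map A D N \<phi> n \<in> mod_hom A (obj (tensor_cx A C N) n) (obj (tensor_cx A D N) n)"
proof (rule mod_homI)
  let ?T = "\<lambda>m. tensor A (obj C m) (obj N (n - m))" and ?U = "\<lambda>m. tensor A (obj D m) (obj N (n - m))"
  note h = tensor_cx_map_comp_hom
  fix f assume f: "f \<in> carrier (obj (tensor_cx A C N) n)"
  have fc: "f m \<in> carrier (?T m)" for m using f by (simp add: tensor_cx_carrier[OF C N])
  have "{m. tensor_cx_map A D N \<phi> n f m \<noteq> \<zero>\<^bsub>?U m\<^esub>} \<subseteq> {m. f m \<noteq> \<zero>\<^bsub>?T m\<^esub>}"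
    using mod_hom_zero[OF h T_module[OF C N] T_module[OF D N]] by (auto simp: tensor_cx_map_def)
  then show "tensor_cx_map A D N \<phi> n f \<in> carrier (obj (tensor_cx A D N) n)"
    using f mod_hom_closed[OF h fc] unfolding tensor_cx_carrier[OF C N] tensor_cx_carrier[OF D N]
    by (auto simp: tensor_cx_map_def intro: finite_subset)
  show "tensor_cx_map A D N \<phi> n (r \<odot>\<^bsub>obj (tensor_cx A C N) n\<^esub> f) =
      r \<odot>\<^bsub>obj (tensor_cx A D N) n\<^esub> tensor_cx_map A D N \<phi> n f" if r: "r \<in> carrier A" for r
    by (simp add: tensor_cx_map_def tensor_cx_def dsum_simps mod_hom_smult[OF h r fc])
  fix g assume g: "g \<in> carrier (obj (tensor_cx A C N) n)"
  have gc: "g m \<in> carrier (?T m)" for m using g by (simp add: tensor_cx_carrier[OF C N])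
  show "tensor_cx_map A D N \<phi> n (f \<oplus>\<^bsub>obj (tensor_cx A C N) n\<^esub> g) =
      tensor_cx_map A D N \<phi> n f \<oplus>\<^bsub>obj (tensor_cx A D N) n\<^esub> tensor_cx_map A D N \<phi> n g"
    by (simp add: tensor_cx_map_def tensor_cx_def dsum_simps mod_hom_add[OF h fc gc])
qed

lemma tensor_cx_map_chain:
  assumes ch: "chain_map A C D \<phi>"
  shows "chain_map A (tensor_cx A C N) (tensor_cx A D N) (tensor_cx_map A D N \<phi>)"
  unfolding chain_map_def
proof (intro allI conjI ballI tensor_cx_map_hom)
  fix n f assume f: "f \<in> carrier (obj (tensor_cx A C N) n)"
  have fc: "f m \<in> carrier (tensor A (obj C m) (obj N (n - m)))" for m using f by (simp add: tensor_cx_carrier[OF C N])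
  note h = tensor_cx_map_comp_hom
  note I = mod_hom_id(2)
  show "tensor_cx_map A D N \<phi> (n + 1) (dif (tensor_cx A C N) n f) =
      dif (tensor_cx A D N) n (tensor_cx_map A D N \<phi> n f)"
  proof
    fix m
    have i: "n - (m - 1) = n + 1 - m" "n - m + 1 = n + 1 - m" by simp_all
    have fm: "f (m - 1) \<in> carrier (tensor A (obj C (m - 1)) (obj N (n + 1 - m)))" using fc[of "m - 1"] unfolding i .
    have 1: "tensor_map A (obj D m) (obj N (n + 1 - m)) (\<phi> m) id (dh A C N (m - 1) (n + 1 - m) (f (m - 1))) =
        dh A D N (m - 1) (n + 1 - m) (tensor_map A (obj D (m - 1)) (obj N (n + 1 - m)) (\<phi> (m - 1)) id (f (m - 1)))"
    proof -
      have "tensor_map A (obj D m) (obj N (n + 1 - m)) (\<phi> m) id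
          (tensor_map A (obj C m) (obj N (n + 1 - m)) (dif C (m - 1)) id (f (m - 1))) =
        tensor_map A (obj D m) (obj N (n + 1 - m)) (\<lambda>x. \<phi> m (dif C (m - 1) x)) id (f (m - 1))"
        by (rule tensor_map_comp[OF modC modN modC modN modD modN cx_dif'[OF C] I \<phi> I _ _ fm]) auto
      moreover have "tensor_map A (obj D m) (obj N (n + 1 - m)) (dif D (m - 1)) id
          (tensor_map A (obj D (m - 1)) (obj N (n + 1 - m)) (\<phi> (m - 1)) id (f (m - 1))) =
        tensor_map A (obj D m) (obj N (n + 1 - m)) (\<lambda>x. \<phi> m (dif C (m - 1) x)) id (f (m - 1))"
        by (rule tensor_map_comp[OF modC modN modD modN modD modN \<phi> I cx_dif'[OF D] I _ _ fm]) (auto simp: chain_mapD'[OF ch])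
      ultimately show ?thesis by (simp add: dh_def)
    qed
    have 2: "tensor_map A (obj D m) (obj N (n + 1 - m)) (\<phi> m) id (dv A C N m (n - m) (f m)) =
        dv A D N m (n - m) (tensor_map A (obj D m) (obj N (n - m)) (\<phi> m) id (f m))"
    proof -
      have "tensor_map A (obj D m) (obj N (n - m + 1)) (\<phi> m) id
          (tensor_map A (obj C m) (obj N (n - m + 1)) id (dif N (n - m)) (f m)) =
        tensor_map A (obj D m) (obj N (n - m + 1)) (\<phi> m) (dif N (n - m)) (f m)"
        by (rule tensor_map_comp[OF modC modN modC modN modD modN I cx_dif[OF N] \<phi> I _ _ fc]) auto
      moreover have "tensor_map A (obj D m) (obj N (n - m + 1)) id (dif N (n - m))
          (tensor_map A (obj D m) (obj N (n - m)) (\<phi> m) id (f m)) =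
        tensor_map A (obj D m) (obj N (n - m + 1)) (\<phi> m) (dif N (n - m)) (f m)"
        by (rule tensor_map_comp[OF modC modN modD modN modD modN \<phi> I I cx_dif[OF N] _ _ fc]) auto
      ultimately show ?thesis unfolding dv_def i by simp
    qed
    have 3: "dv A C N m (n - m) (f m) \<in> carrier (tensor A (obj C m) (obj N (n + 1 - m)))"
      using mod_hom_closed[OF dv_hom[OF C N] fc[of m]] unfolding i .
    have 4: "dh A C N (m - 1) (n + 1 - m) (f (m - 1)) \<in> carrier (tensor A (obj C m) (obj N (n + 1 - m)))"
      using mod_hom_closed[OF dh_hom[OF C N] fm] by simp
    show "tensor_cx_map A D N \<phi> (n + 1) (dif (tensor_cx A C N) n f) m =
        dif (tensor_cx A D N) n (tensor_cx_map A D N \<phi> n f) m"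
      unfolding tensor_cx_map_def tensor_cx_dif[OF C N] tensor_cx_dif[OF D N] i
        mod_hom_add[OF h 4 koszul_sign_closed[OF T_module[OF C N] 3]] 1
        koszul_sign_hom[OF h T_module[OF C N] T_module[OF D N] 3] 2 ..
  qed
qed

end

text \<open>Tensoring preserves degreewise split extensions, so exactness of the total complex is
  inherited by extensions.\<close>

lemma tensor_split_extension_exact:
  assumes X: "cochain_complex A X" and Y: "cochain_complex A Y" and Z: "cochain_complex A Z"
    and N: "cochain_complex A N"
    and \<iota>: "chain_map A X Y \<iota>" and \<rho>: "chain_map A Y Z \<rho>"
    and \<sigma>: "\<And>i. \<sigma> i \<in> mod_hom A (obj Z i) (obj Y i)" and \<kappa>: "\<And>i. \<kappa> i \<in> mod_hom A (obj Y i) (obj X i)"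
    and \<rho>\<sigma>: "\<And>i z. z \<in> carrier (obj Z i) \<Longrightarrow> \<rho> i (\<sigma> i z) = z"
    and \<kappa>\<iota>: "\<And>i x. x \<in> carrier (obj X i) \<Longrightarrow> \<kappa> i (\<iota> i x) = x"
    and split: "\<And>i y. y \<in> carrier (obj Y i) \<Longrightarrow> y = \<iota> i (\<kappa> i y) \<oplus>\<^bsub>obj Y i\<^esub> \<sigma> i (\<rho> i y)"
    and exactX: "\<And>i. exact_at (tensor_cx A X N) i" and exactZ: "\<And>i. exact_at (tensor_cx A Z N) i"
  shows "exact_at (tensor_cx A Y N) i"
proof (rule split_extension_exact[OF tensor_cx_complex[OF X N] tensor_cx_complex[OF Y N] tensor_cx_complex[OF Z N]
      tensor_cx_map_chain[OF X Y N chain_mapD(1)[OF \<iota>] \<iota>] tensor_cx_map_chain[OF Y Z N chain_mapD(1)[OF \<rho>] \<rho>]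
      tensor_cx_map_hom[OF Z Y N \<sigma>] tensor_cx_map_hom[OF Y X N \<kappa>] _ _ _ exactX exactZ])
  note \<iota>h = chain_mapD(1)[OF \<iota>] and \<rho>h = chain_mapD(1)[OF \<rho>]
  note Xm = cx_module[OF X] and Ym = cx_module[OF Y] and Zm = cx_module[OF Z] and Nm = cx_module[OF N]
  note I = mod_hom_id(2)
  fix i
  show "tensor_cx_map A Z N \<rho> i (tensor_cx_map A Y N \<sigma> i z) = z" if z: "z \<in> carrier (obj (tensor_cx A Z N) i)" for z
  proof
    fix m
    have zm: "z m \<in> carrier (tensor A (obj Z m) (obj N (i - m)))" using z by (simp add: tensor_cx_carrier[OF Z N])
    have "tensor_map A (obj Z m) (obj N (i - m)) (\<rho> m) id (tensor_map A (obj Y m) (obj N (i - m)) (\<sigma> m) id (z m)) =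
        tensor_map A (obj Z m) (obj N (i - m)) id id (z m)"
      by (rule tensor_map_comp[OF Zm Nm Ym Nm Zm Nm \<sigma> I \<rho>h I _ _ zm]) (auto simp: \<rho>\<sigma>)
    also have "\<dots> = z m" by (rule tensor_map_ident[OF Zm Nm _ _ zm]) auto
    finally show "tensor_cx_map A Z N \<rho> i (tensor_cx_map A Y N \<sigma> i z) m = z m" by (simp add: tensor_cx_map_def)
  qed
  show "tensor_cx_map A X N \<kappa> i (tensor_cx_map A Y N \<iota> i x) = x" if x: "x \<in> carrier (obj (tensor_cx A X N) i)" for x
  proof
    fix m
    have xm: "x m \<in> carrier (tensor A (obj X m) (obj N (i - m)))" using x by (simp add: tensor_cx_carrier[OF X N])
    have "tensor_map A (obj X m) (obj N (i - m)) (\<kappa> m) id (tensor_map A (obj Y m) (obj N (i - m)) (\<iota> m) id (x m)) =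
        tensor_map A (obj X m) (obj N (i - m)) id id (x m)"
      by (rule tensor_map_comp[OF Xm Nm Ym Nm Xm Nm \<iota>h I \<kappa> I _ _ xm]) (auto simp: \<kappa>\<iota>)
    also have "\<dots> = x m" by (rule tensor_map_ident[OF Xm Nm _ _ xm]) auto
    finally show "tensor_cx_map A X N \<kappa> i (tensor_cx_map A Y N \<iota> i x) m = x m" by (simp add: tensor_cx_map_def)
  qed
  show "y = tensor_cx_map A Y N \<iota> i (tensor_cx_map A X N \<kappa> i y)"
    if y: "y \<in> carrier (obj (tensor_cx A Y N) i)" and 0: "tensor_cx_map A Z N \<rho> i y = \<zero>\<^bsub>obj (tensor_cx A Z N) i\<^esub>" for y
  proof
    fix m
    let ?p = "i - m"
    have ym: "y m \<in> carrier (tensor A (obj Y m) (obj N ?p))" using y by (simp add: tensor_cx_carrier[OF Y N])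
    have y0: "tensor_map A (obj Z m) (obj N ?p) (\<rho> m) id (y m) = \<zero>\<^bsub>tensor A (obj Z m) (obj N ?p)\<^esub>"
      using fun_cong[OF 0, of m] by (simp add: tensor_cx_map_def tensor_cx_zero[OF Z N])
    interpret U: Module.module A "tensor A (obj Y m) (obj N ?p)" by (rule T_module[OF Y N])
    let ?a = "\<lambda>t. tensor_map A (obj Y m) (obj N ?p) (\<iota> m) id (tensor_map A (obj X m) (obj N ?p) (\<kappa> m) id t)"
    let ?b = "\<lambda>t. tensor_map A (obj Y m) (obj N ?p) (\<sigma> m) id (tensor_map A (obj Z m) (obj N ?p) (\<rho> m) id t)"
    note h\<iota> = tensor_map_hom[OF Xm Nm Ym Nm \<iota>h I] and h\<kappa> = tensor_map_hom[OF Ym Nm Xm Nm \<kappa> I]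
    note h\<sigma> = tensor_map_hom[OF Zm Nm Ym Nm \<sigma> I] and h\<rho> = tensor_map_hom[OF Ym Nm Zm Nm \<rho>h I]
    note ah = mod_hom_comp[OF h\<kappa>(1) h\<iota>(1)] and bh = mod_hom_comp[OF h\<rho>(1) h\<sigma>(1)]
    have ay: "?a (y m) \<in> carrier (tensor A (obj Y m) (obj N ?p))" by (rule mod_hom_closed[OF ah ym])
    have "y m = ?a (y m) \<oplus>\<^bsub>tensor A (obj Y m) (obj N ?p)\<^esub> ?b (y m)"
    proof (rule tensor_hom_eq[OF Ym Nm U.module_axioms mod_hom_id(1) mod_hom_sum[OF U.module_axioms ah bh] _ ym])
      fix u v assume u: "u \<in> carrier (obj Y m)" and v: "v \<in> carrier (obj N ?p)"
      have c: "\<iota> m (\<kappa> m u) \<in> carrier (obj Y m)" "\<sigma> m (\<rho> m u) \<in> carrier (obj Y m)"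
        using u by (auto intro: mod_hom_closed[OF \<iota>h] mod_hom_closed[OF \<rho>h] mod_hom_closed[OF \<kappa>] mod_hom_closed[OF \<sigma>])
      have "tensor_elt A (obj Y m) (obj N ?p) u v =
          tensor_elt A (obj Y m) (obj N ?p) (\<iota> m (\<kappa> m u) \<oplus>\<^bsub>obj Y m\<^esub> \<sigma> m (\<rho> m u)) v"
        using split[OF u] by simp
      also have "\<dots> = tensor_elt A (obj Y m) (obj N ?p) (\<iota> m (\<kappa> m u)) v \<oplus>\<^bsub>tensor A (obj Y m) (obj N ?p)\<^esub>
          tensor_elt A (obj Y m) (obj N ?p) (\<sigma> m (\<rho> m u)) v"
        by (rule mod_hom_add[OF tensor_elt_hom_left[OF Ym Nm v] c])
      also have "\<dots> = ?a (tensor_elt A (obj Y m) (obj N ?p) u v) \<oplus>\<^bsub>tensor A (obj Y m) (obj N ?p)\<^esub>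
          ?b (tensor_elt A (obj Y m) (obj N ?p) u v)"
        using u v by (simp add: h\<iota>(2) h\<kappa>(2) h\<sigma>(2) h\<rho>(2) mod_hom_closed[OF \<kappa>] mod_hom_closed[OF \<rho>h])
      finally show "tensor_elt A (obj Y m) (obj N ?p) u v =
          ?a (tensor_elt A (obj Y m) (obj N ?p) u v) \<oplus>\<^bsub>tensor A (obj Y m) (obj N ?p)\<^esub>
          ?b (tensor_elt A (obj Y m) (obj N ?p) u v)" .
    qed
    also have "\<dots> = ?a (y m)"
      unfolding y0 mod_hom_zero[OF h\<sigma>(1) T_module[OF Z N] T_module[OF Y N]] by (rule U.M.r_zero[OF ay])
    finally show "y m = tensor_cx_map A Y N \<iota> i (tensor_cx_map A X N \<kappa> i y) m" by (simp add: tensor_cx_map_def)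
  qed
qed

section \<open>Free resolutions\<close>

text \<open>\<open>is_free\<close> asks for a basis inside the module, so the generators are moved along \<open>\<phi>\<close>. They stay
  distinct because \<open>1 \<noteq> 0\<close>.\<close>

lemma is_freeI:
  fixes M :: "('a, 'm) module" and \<phi> :: "('s \<Rightarrow> 'a) \<Rightarrow> 'm"
  assumes M: "Module.module R M" and \<phi>: "\<phi> \<in> mod_hom R (free_module R S) M"
    and bij: "bij_betw \<phi> (carrier (free_module R S)) (carrier M)" and ne: "\<one>\<^bsub>R\<^esub> \<noteq> \<zero>\<^bsub>R\<^esub>"
  shows "is_free R M"
proof -
  interpret M: Module.module R M by fact
  have R: "cring R" by (rule M.R.is_cring)
  let ?F = "free_module R S"
  define b where "b s = \<phi> (free_gen R s)" for s
  let ?B = "b ` S"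
  have gen: "free_gen R s \<in> carrier ?F" if "s \<in> S" for s by (rule free_gen_closed[OF R that])
  have bM: "b s \<in> carrier M" if "s \<in> S" for s unfolding b_def by (rule mod_hom_closed[OF \<phi> gen[OF that]])
  have geninj: "s = t" if "free_gen R s = free_gen R t" for s t :: 's
    using fun_cong[OF that, of s] ne by (auto simp: free_gen_def split: if_splits)
  have binj: "inj_on b S"
    unfolding b_def by (intro inj_onI geninj inj_onD[OF bij_betw_imp_inj_on[OF bij]] gen)
  let ?G = "free_module R ?B"
  let ?ev = "lin_ext R M (\<lambda>b. b)"
  define \<psi> where "\<psi> f = (\<lambda>s. if s \<in> S then f (b s) else \<zero>\<^bsub>R\<^esub>)" for f :: "'m \<Rightarrow> 'a"
  have evh: "?ev \<in> mod_hom R ?G M" and evg: "\<And>c. c \<in> ?B \<Longrightarrow> ?ev (free_gen R c) = c"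
    using lin_ext_hom[OF M, of ?B "\<lambda>b. b"] bM by auto
  have \<psi>h: "\<psi> \<in> mod_hom R ?G ?F"
  proof (rule mod_homI)
    fix f assume f: "f \<in> carrier ?G"
    have "b ` {s. \<psi> f s \<noteq> \<zero>\<^bsub>R\<^esub>} \<subseteq> {c. f c \<noteq> \<zero>\<^bsub>R\<^esub>}" by (auto simp: \<psi>_def)
    moreover have "inj_on b {s. \<psi> f s \<noteq> \<zero>\<^bsub>R\<^esub>}"
      by (rule inj_on_subset[OF binj]) (auto simp: \<psi>_def)
    ultimately have "finite {s. \<psi> f s \<noteq> \<zero>\<^bsub>R\<^esub>}"
      using f finite_imageD[of b "{s. \<psi> f s \<noteq> \<zero>\<^bsub>R\<^esub>}"] finite_subset unfolding free_module_simps by blast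
    then show "\<psi> f \<in> carrier ?F" using f by (auto simp: free_module_simps \<psi>_def)
  qed (auto simp: free_module_simps \<psi>_def fun_eq_iff)
  have ev: "?ev f = \<phi> (\<psi> f)" if f: "f \<in> carrier ?G" for f
  proof (rule free_hom_eq[OF M evh mod_hom_comp[OF \<psi>h \<phi>] _ f])
    fix c assume "c \<in> ?B"
    then obtain s where s: "s \<in> S" "c = b s" by blast
    have "\<psi> (free_gen R c) = free_gen R s"
      using s by (auto simp: \<psi>_def free_gen_def fun_eq_iff inj_on_eq_iff[OF binj])
    then show "?ev (free_gen R c) = \<phi> (\<psi> (free_gen R c))" using evg[of c] s by (simp add: b_def)
  qed
  have "inj_on ?ev (carrier ?G)"
  proof (rule inj_onI)
    fix f g assume f: "f \<in> carrier ?G" and g: "g \<in> carrier ?G" and eq: "?ev f = ?ev g"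
    have "\<psi> f = \<psi> g"
      using eq ev[OF f] ev[OF g] inj_onD[OF bij_betw_imp_inj_on[OF bij] _ mod_hom_closed[OF \<psi>h f] mod_hom_closed[OF \<psi>h g]]
      by simp
    then have B: "f c = g c" if "c \<in> ?B" for c using that by (auto simp: \<psi>_def fun_eq_iff split: if_splits)
    have "f c = g c" if "c \<notin> ?B" for c
    proof -
      have "f c = \<zero>\<^bsub>R\<^esub>" "g c = \<zero>\<^bsub>R\<^esub>" using that f g unfolding free_module_simps by blast+
      then show ?thesis by simp
    qed
    with B show "f = g" by blast
  qed
  moreover have "?ev ` carrier ?G = carrier M"
  proof
    show "?ev ` carrier ?G \<subseteq> carrier M" by (auto intro: mod_hom_closed[OF evh])
    show "carrier M \<subseteq> ?ev ` carrier ?G"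
    proof
      fix m assume "m \<in> carrier M"
      then obtain g where g: "g \<in> carrier ?F" "m = \<phi> g" using bij by (auto simp: bij_betw_def)
      define f where "f c = (if c \<in> ?B then g (inv_into S b c) else \<zero>\<^bsub>R\<^esub>)" for c
      have fb: "f (b s) = g s" if "s \<in> S" for s using that binj by (simp add: f_def)
      have "{c. f c \<noteq> \<zero>\<^bsub>R\<^esub>} \<subseteq> b ` {s. g s \<noteq> \<zero>\<^bsub>R\<^esub>}"
      proof
        fix c assume "c \<in> {c. f c \<noteq> \<zero>\<^bsub>R\<^esub>}"
        then obtain s where "s \<in> S" "c = b s" "f c \<noteq> \<zero>\<^bsub>R\<^esub>" by (auto simp: f_def split: if_splits)
        then show "c \<in> b ` {s. g s \<noteq> \<zero>\<^bsub>R\<^esub>}" using fb by auto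
      qed
      then have "finite {c. f c \<noteq> \<zero>\<^bsub>R\<^esub>}" using g(1) by (auto simp: free_module_simps intro: finite_subset)
      moreover have "{c. f c \<noteq> \<zero>\<^bsub>R\<^esub>} \<subseteq> ?B" by (auto simp: f_def)
      moreover have "f c \<in> carrier R" for c using g(1) by (auto simp: f_def free_module_simps)
      ultimately have f: "f \<in> carrier ?G" unfolding free_module_simps by blast
      have "\<psi> f s = g s" for s
      proof (cases "s \<in> S")
        case False
        then have "g s = \<zero>\<^bsub>R\<^esub>" using g(1) unfolding free_module_simps by blast
        then show ?thesis using False by (simp add: \<psi>_def)
      qed (simp add: \<psi>_def fb)
      then have "\<psi> f = g" by (rule ext)
      then have "m = ?ev f" using ev[OF f] g(2) by simp
      then show "m \<in> ?ev ` carrier ?G" using f by (rule image_eqI)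
    qed
  qed
  ultimately have "bij_betw ?ev (carrier ?G) (carrier M)" by (simp add: bij_betw_def)
  then show ?thesis unfolding is_free_def lin_ext_def[abs_def] using bM by blast
qed

definition transport :: "('m \<Rightarrow> 'u) \<Rightarrow> ('a, 'm) module \<Rightarrow> ('a, 'u) module"
  where "transport \<epsilon> M = (let g = inv_into (carrier M) \<epsilon> in
    module_of (\<epsilon> ` carrier M) (\<lambda>x y. \<epsilon> (g x \<oplus>\<^bsub>M\<^esub> g y)) (\<epsilon> \<zero>\<^bsub>M\<^esub>) (\<lambda>r x. \<epsilon> (r \<odot>\<^bsub>M\<^esub> g x)))"

lemma transport:
  assumes M: "Module.module R M" and inj: "inj_on \<epsilon> (carrier M)"
  shows transport_module: "Module.module R (transport \<epsilon> M)"
    and transport_hom: "\<epsilon> \<in> mod_hom R M (transport \<epsilon> M)"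
    and transport_bij: "bij_betw \<epsilon> (carrier M) (carrier (transport \<epsilon> M))"
    and transport_inv_hom: "inv_into (carrier M) \<epsilon> \<in> mod_hom R (transport \<epsilon> M) M"
proof -
  have g: "inv_into (carrier M) \<epsilon> (\<epsilon> x) = x" if "x \<in> carrier M" for x using inj that by simp
  show "Module.module R (transport \<epsilon> M)"
    by (rule module_image(1)[OF M, of \<epsilon>]) (simp_all add: transport_def Let_def g)
  show h: "\<epsilon> \<in> mod_hom R M (transport \<epsilon> M)"
    by (rule module_image(2)[OF M, of \<epsilon>]) (simp_all add: transport_def Let_def g)
  show b: "bij_betw \<epsilon> (carrier M) (carrier (transport \<epsilon> M))"
    using inj by (simp add: bij_betw_def transport_def Let_def)
  show "inv_into (carrier M) \<epsilon> \<in> mod_hom R (transport \<epsilon> M) M" by (rule mod_hom_inv[OF h b M])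
qed

lemma transport_carrier: "carrier (transport \<epsilon> M) = \<epsilon> ` carrier M"
  by (simp add: transport_def Let_def)

lemma transport_zero: "\<zero>\<^bsub>transport \<epsilon> M\<^esub> = \<epsilon> \<zero>\<^bsub>M\<^esub>"
  by (simp add: transport_def Let_def)

subsection \<open>Free modules carried by a given type\<close>

definition fin_supp :: "'a ring \<Rightarrow> ('s \<Rightarrow> 'a) set"
  where "fin_supp R = {f. finite {s. f s \<noteq> \<zero>\<^bsub>R\<^esub>}}"

text \<open>The free module on \<open>S\<close> has functions as elements. A resolution needs all its terms in one type,
  which is achieved by coding finitely supported functions in \<open>'u\<close> through an injection \<open>\<epsilon>\<close>.\<close>

definition cfree :: "'a ring \<Rightarrow> (('s \<Rightarrow> 'a) \<Rightarrow> 'u) \<Rightarrow> 's set \<Rightarrow> ('a, 'u) module"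
  where "cfree R \<epsilon> S = transport \<epsilon> (free_module R S)"

definition cfree_ext :: "'a ring \<Rightarrow> (('s \<Rightarrow> 'a) \<Rightarrow> 'u) \<Rightarrow> 's set \<Rightarrow> ('a, 'n) module \<Rightarrow> ('s \<Rightarrow> 'n) \<Rightarrow> 'u \<Rightarrow> 'n"
  where "cfree_ext R \<epsilon> S N \<beta> v = lin_ext R N \<beta> (inv_into (carrier (free_module R S)) \<epsilon> v)"

lemma cfree:
  fixes R :: "'a ring" and \<epsilon> :: "('s \<Rightarrow> 'a) \<Rightarrow> 'u"
  assumes R: "cring R" and inj: "inj_on \<epsilon> (fin_supp R)"
  shows cfree_module: "Module.module R (cfree R \<epsilon> S)"
    and cfree_gen: "s \<in> S \<Longrightarrow> \<epsilon> (free_gen R s) \<in> carrier (cfree R \<epsilon> S)"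
    and cfree_empty: "carrier (cfree R \<epsilon> {}) = {\<zero>\<^bsub>cfree R \<epsilon> {}\<^esub>}"
    and cfree_is_free: "\<one>\<^bsub>R\<^esub> \<noteq> \<zero>\<^bsub>R\<^esub> \<Longrightarrow> is_free R (cfree R \<epsilon> S)"
    and cfree_ext_hom: "Module.module R N \<Longrightarrow> (\<And>s. s \<in> S \<Longrightarrow> \<beta> s \<in> carrier N) \<Longrightarrow>
      cfree_ext R \<epsilon> S N \<beta> \<in> mod_hom R (cfree R \<epsilon> S) N"
    and cfree_ext_gen: "Module.module R N \<Longrightarrow> (\<And>s. s \<in> S \<Longrightarrow> \<beta> s \<in> carrier N) \<Longrightarrow> s \<in> S \<Longrightarrow>
      cfree_ext R \<epsilon> S N \<beta> (\<epsilon> (free_gen R s)) = \<beta> s"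
    and cfree_hom_eq: "Module.module R N \<Longrightarrow> f \<in> mod_hom R (cfree R \<epsilon> S) N \<Longrightarrow> g \<in> mod_hom R (cfree R \<epsilon> S) N \<Longrightarrow>
      (\<And>s. s \<in> S \<Longrightarrow> f (\<epsilon> (free_gen R s)) = g (\<epsilon> (free_gen R s))) \<Longrightarrow> x \<in> carrier (cfree R \<epsilon> S) \<Longrightarrow> f x = g x"
proof -
  let ?F = "free_module R S"
  note F = free_module_module(1)[OF R, of S]
  have inj': "inj_on \<epsilon> (carrier (free_module R S))" for S
    by (rule inj_on_subset[OF inj]) (auto simp: free_module_simps fin_supp_def)
  show mod: "Module.module R (cfree R \<epsilon> S)" unfolding cfree_def by (rule transport_module[OF F inj'])
  show gen: "\<epsilon> (free_gen R s) \<in> carrier (cfree R \<epsilon> S)" if "s \<in> S" for s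
    using free_gen_closed[OF R that] by (simp add: cfree_def transport_carrier)
  have "carrier (free_module R {}) = {\<zero>\<^bsub>free_module R ({} :: 's set)\<^esub>}"
    using cring.cring_simprules(2)[OF R] by (auto simp: free_module_simps)
  then show "carrier (cfree R \<epsilon> {}) = {\<zero>\<^bsub>cfree R \<epsilon> {}\<^esub>}"
    by (simp add: cfree_def transport_carrier transport_zero)
  show "is_free R (cfree R \<epsilon> S)" if "\<one>\<^bsub>R\<^esub> \<noteq> \<zero>\<^bsub>R\<^esub>"
    using is_freeI[OF mod _ _ that] transport_hom[OF F inj'] transport_bij[OF F inj'] unfolding cfree_def by blast
  note ih = transport_inv_hom[OF F inj', folded cfree_def]
  show ext: "cfree_ext R \<epsilon> S N \<beta> \<in> mod_hom R (cfree R \<epsilon> S) N"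
    if "Module.module R N" "\<And>s. s \<in> S \<Longrightarrow> \<beta> s \<in> carrier N"
    using mod_hom_comp[OF ih lin_ext_hom(1)[OF that]] by (simp add: cfree_ext_def[abs_def])
  show "cfree_ext R \<epsilon> S N \<beta> (\<epsilon> (free_gen R s)) = \<beta> s"
    if "Module.module R N" "\<And>s. s \<in> S \<Longrightarrow> \<beta> s \<in> carrier N" "s \<in> S"
    using lin_ext_hom(2)[OF that] inv_into_f_f[OF inj' free_gen_closed[OF R that(3)]] by (simp add: cfree_ext_def)
  show "f x = g x"
    if N: "Module.module R N" and f: "f \<in> mod_hom R (cfree R \<epsilon> S) N" and g: "g \<in> mod_hom R (cfree R \<epsilon> S) N"
      and eq: "\<And>s. s \<in> S \<Longrightarrow> f (\<epsilon> (free_gen R s)) = g (\<epsilon> (free_gen R s))" and x: "x \<in> carrier (cfree R \<epsilon> S)"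
  proof -
    obtain y where y: "y \<in> carrier ?F" "x = \<epsilon> y" using x by (auto simp: cfree_def transport_carrier)
    note h = transport_hom[OF F inj', folded cfree_def]
    have "f (\<epsilon> y) = g (\<epsilon> y)"
      by (rule free_hom_eq[OF N mod_hom_comp[OF h f] mod_hom_comp[OF h g] eq y(1)])
    then show ?thesis by (simp add: y)
  qed
qed

subsection \<open>The resolution\<close>

text \<open>The generators in degree \<open>b + 1 - k\<close>: one for each way \<open>(p, x)\<close> in which the image in \<open>X\<close> of a
  cycle \<open>p\<close> of the part built so far is the boundary of an element \<open>x\<close>. They make \<open>p\<close> a boundary,
  and those with \<open>p = 0\<close> hit all cycles of \<open>X\<close>.\<close>

fun res_gens :: "'a ring \<Rightarrow> (('u \<times> 'x \<Rightarrow> 'a) \<Rightarrow> 'u) \<Rightarrow> ('a, 'x) cx \<Rightarrow> int \<Rightarrow> nat \<Rightarrow> ('u \<times> 'x) set" where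
  "res_gens A \<epsilon> X b 0 = {}"
| "res_gens A \<epsilon> X b (Suc k) = (let S = res_gens A \<epsilon> X b k; S' = (case k of 0 \<Rightarrow> {} | Suc l \<Rightarrow> res_gens A \<epsilon> X b l) in
    {(p, x). p \<in> carrier (cfree A \<epsilon> S) \<and> cfree_ext A \<epsilon> S (cfree A \<epsilon> S') fst p = \<zero>\<^bsub>cfree A \<epsilon> S'\<^esub> \<and>
      x \<in> carrier (obj X (b - int k)) \<and>
      cfree_ext A \<epsilon> S (obj X (b - int k + 1)) snd p = dif X (b - int k) x})"

text \<open>The resolution is built downwards from degree \<open>b\<close>. The type \<open>'u\<close> has to contain a code for every
  finite combination of generators, and these are themselves pairs with a first component in \<open>'u\<close>.\<close>

lemma free_resolution:
  fixes X :: "('a, 'x) cx" and \<epsilon> :: "('u \<times> 'x \<Rightarrow> 'a) \<Rightarrow> 'u"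
  assumes X: "cochain_complex A X" and ex: "\<And>i. b < i \<Longrightarrow> exact_at X i"
    and inj: "inj_on \<epsilon> (fin_supp A)" and ne: "\<one>\<^bsub>A\<^esub> \<noteq> \<zero>\<^bsub>A\<^esub>"
  obtains P :: "('a, 'u) cx" and \<pi> where "quasi_iso A P X \<pi>"
    and "\<And>i. b < i \<Longrightarrow> carrier (obj P i) = {\<zero>\<^bsub>obj P i\<^esub>}" and "\<And>i. is_free A (obj P i)"
proof -
  have R: "cring A" by (rule module_cring[OF cx_module[OF X]])
  note Xm = cx_module[OF X]
  note cf = cfree[OF R inj]
  define G where "G i = (if i \<le> b then res_gens A \<epsilon> X b (nat (b + 1 - i)) else {})" for i
  let ?P = "\<lambda>i. cfree A \<epsilon> (G i)"
  define d where "d i = cfree_ext A \<epsilon> (G i) (?P (i + 1)) fst" for i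
  define \<pi> where "\<pi> i = cfree_ext A \<epsilon> (G i) (obj X i) snd" for i
  have G: "G i = {(p, x). p \<in> carrier (?P (i + 1)) \<and> d (i + 1) p = \<zero>\<^bsub>?P (i + 1 + 1)\<^esub> \<and> x \<in> carrier (obj X i) \<and>
      \<pi> (i + 1) p = dif X i x}" if i: "i \<le> b" for i
  proof -
    define k where "k = nat (b - i)"
    have k: "nat (b + 1 - i) = Suc k" "i = b - int k" using i by (auto simp: k_def)
    have S: "res_gens A \<epsilon> X b k = G (i + 1)"
    proof (cases "i + 1 \<le> b")
      case True
      have "nat (b + 1 - (i + 1)) = k" by (simp add: k_def)
      then show ?thesis using True by (simp add: G_def)
    next
      case False
      then have "k = 0" by (simp add: k_def)
      then show ?thesis using False by (simp add: G_def)
    qed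
    have S': "(case k of 0 \<Rightarrow> {} | Suc l \<Rightarrow> res_gens A \<epsilon> X b l) = G (i + 1 + 1)"
    proof (cases k)
      case (Suc l)
      have e: "nat (b + 1 - (i + 1 + 1)) = l" "i + 1 \<le> b" using k Suc by auto
      show ?thesis
      proof (cases l)
        case 0 then show ?thesis using e k Suc by (simp add: G_def)
      next
        case (Suc m)
        then have "i + 1 + 1 \<le> b" using e by linarith
        then show ?thesis unfolding \<open>k = Suc l\<close> using e(1) by (simp add: G_def)
      qed
    qed (use k in \<open>simp add: G_def\<close>)
    have "G i = res_gens A \<epsilon> X b (Suc k)" using i k(1) by (simp add: G_def)
    also have "\<dots> = {(p, x). p \<in> carrier (?P (i + 1)) \<and> d (i + 1) p = \<zero>\<^bsub>?P (i + 1 + 1)\<^esub> \<and> x \<in> carrier (obj X i) \<and>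
      \<pi> (i + 1) p = dif X i x}"
      unfolding res_gens.simps S S' Let_def k(2)[symmetric] d_def \<pi>_def ..
    finally show ?thesis .
  qed
  have Gp: "p \<in> carrier (?P (i + 1))" "d (i + 1) p = \<zero>\<^bsub>?P (i + 1 + 1)\<^esub>" "x \<in> carrier (obj X i)"
    "\<pi> (i + 1) p = dif X i x" if px: "(p, x) \<in> G i" for i p x
  proof -
    have "i \<le> b" using px by (auto simp: G_def split: if_splits)
    from px[unfolded G[OF this]] show "p \<in> carrier (?P (i + 1))" "d (i + 1) p = \<zero>\<^bsub>?P (i + 1 + 1)\<^esub>"
      "x \<in> carrier (obj X i)" "\<pi> (i + 1) p = dif X i x" by auto
  qed
  have Gf: "fst s \<in> carrier (?P (i + 1))" "snd s \<in> carrier (obj X i)" if "s \<in> G i" for i s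
    using Gp(1,3)[of "fst s" "snd s" i] that by auto
  note Pm = cf(1)
  have dh: "d i \<in> mod_hom A (?P i) (?P (i + 1))" for i unfolding d_def by (rule cf(5)[OF Pm Gf(1)])
  have dg: "d i (\<epsilon> (free_gen A s)) = fst s" if "s \<in> G i" for i s
    unfolding d_def by (rule cf(6)[OF Pm Gf(1) that])
  have \<pi>h: "\<pi> i \<in> mod_hom A (?P i) (obj X i)" for i unfolding \<pi>_def by (rule cf(5)[OF Xm Gf(2)])
  have \<pi>g: "\<pi> i (\<epsilon> (free_gen A s)) = snd s" if "s \<in> G i" for i s
    unfolding \<pi>_def by (rule cf(6)[OF Xm Gf(2) that])
  define P where "P = \<lparr>obj = ?P, dif = d\<rparr>"
  have [simp]: "obj P = ?P" "dif P = d" by (simp_all add: P_def)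
  have triv: "carrier (?P i) = {\<zero>\<^bsub>?P i\<^esub>}" if "b < i" for i using cf(3) that by (simp add: G_def)
  have dd: "d (i + 1) (d i x) = \<zero>\<^bsub>?P (i + 1 + 1)\<^esub>" if "x \<in> carrier (?P i)" for i x
    by (rule cf(7)[OF Pm mod_hom_comp[OF dh dh] mod_hom_const_zero[OF Pm] _ that]) (use Gp(2) dg in force)
  have P: "cochain_complex A P"
    unfolding cochain_complex_def using Pm dh dd by (simp add: add.assoc)
  have ch: "chain_map A P X \<pi>"
    unfolding chain_map_def
  proof (intro allI conjI ballI)
    show "\<pi> i \<in> mod_hom A (obj P i) (obj X i)" for i using \<pi>h by simp
    show "\<pi> (i + 1) (dif P i x) = dif X i (\<pi> i x)" if "x \<in> carrier (obj P i)" for i x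
      using cf(7)[OF Xm mod_hom_comp[OF dh \<pi>h] mod_hom_comp[OF \<pi>h cx_dif[OF X]] _ that[simplified]]
        Gp(4) dg \<pi>g by force
  qed
  have inj: "cohom_inj P X \<pi> i" for i
    unfolding cohom_inj_def
  proof (intro ballI impI)
    fix p assume p: "p \<in> cocycles P i" and "\<pi> i p \<in> coboundaries X i"
    then obtain x where x: "x \<in> carrier (obj X (i - 1))" "\<pi> i p = dif X (i - 1) x" by (auto simp: coboundaries_def)
    have pc: "p \<in> carrier (?P i)" "d i p = \<zero>\<^bsub>?P (i + 1)\<^esub>" using p by (auto simp: cocycles_def)
    show "p \<in> coboundaries P i"
    proof (cases "i - 1 \<le> b")
      case True
      have e: "i - 1 + 1 = i" by simp
      have px: "(p, x) \<in> G (i - 1)" unfolding G[OF True] e using pc x by simp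
      show ?thesis unfolding coboundaries_def
        by (rule image_eqI[of _ _ "\<epsilon> (free_gen A (p, x))"]) (use dg[OF px] cf(2)[OF px] in simp_all)
    next
      case False
      then have "p = \<zero>\<^bsub>obj P i\<^esub>" using triv[of i] pc by auto
      then show ?thesis
        using subgroup.one_closed[OF submodule.axioms(1)[OF coboundaries_submodule[OF P]]] by simp
    qed
  qed
  have surj: "cohom_surj P X \<pi> i" for i
    unfolding cohom_surj_def
  proof
    fix x assume x: "x \<in> cocycles X i"
    interpret Xi: Module.module A "obj X i" by (rule Xm)
    have xc: "x \<in> carrier (obj X i)" "dif X i x = \<zero>\<^bsub>obj X (i + 1)\<^esub>" using x by (auto simp: cocycles_def)
    have z: "\<zero>\<^bsub>?P i\<^esub> \<in> carrier (?P i)" for i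
      using subgroup.one_closed[OF submodule.axioms(1)[OF Module.module.carrier_is_submodule[OF Pm]]] by simp
    have zX: "\<zero>\<^bsub>obj X i\<^esub> \<in> coboundaries X i"
      using subgroup.one_closed[OF submodule.axioms(1)[OF coboundaries_submodule[OF X]]] by simp
    show "\<exists>p\<in>cocycles P i. x \<ominus>\<^bsub>obj X i\<^esub> \<pi> i p \<in> coboundaries X i"
    proof (cases "i \<le> b")
      case True
      have g: "(\<zero>\<^bsub>?P (i + 1)\<^esub>, x) \<in> G i"
        unfolding G[OF True] using xc z mod_hom_zero[OF dh Pm Pm] mod_hom_zero[OF \<pi>h Pm Xm] by simp
      let ?p = "\<epsilon> (free_gen A (\<zero>\<^bsub>?P (i + 1)\<^esub>, x))"
      have "?p \<in> cocycles P i" using cf(2)[OF g] dg[OF g] by (simp add: cocycles_def)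
      moreover have "x \<ominus>\<^bsub>obj X i\<^esub> \<pi> i ?p = \<zero>\<^bsub>obj X i\<^esub>" using \<pi>g[OF g] xc by simp
      ultimately show ?thesis using zX by metis
    next
      case False
      then have "x \<in> coboundaries X i" using ex[of i] x by (auto simp: exact_at_def)
      moreover have "\<zero>\<^bsub>obj P i\<^esub> \<in> cocycles P i" by (rule cocycles_zero[OF P])
      moreover have "x \<ominus>\<^bsub>obj X i\<^esub> \<pi> i \<zero>\<^bsub>obj P i\<^esub> = x" using mod_hom_zero[OF \<pi>h Pm Xm] xc by simp
      ultimately show ?thesis by metis
    qed
  qed
  show thesis
  proof (rule that[of P \<pi>])
    show "quasi_iso A P X \<pi>" unfolding quasi_iso_iff using P X ch inj surj by simp
    show "carrier (obj P i) = {\<zero>\<^bsub>obj P i\<^esub>}" if "b < i" for i using triv[OF that] by simp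
    show "is_free A (obj P i)" for i using cf(4)[OF ne] by simp
  qed
qed

subsection \<open>Encoding finitely supported functions by lists\<close>

text \<open>Each word is preceded by its length in unary, with the digit \<open>x\<close> and the separator \<open>y\<close>, which makes
  the code uniquely decodable.\<close>

fun enc_list :: "'b \<Rightarrow> 'b \<Rightarrow> 'b list list \<Rightarrow> 'b list" where
  "enc_list x y [] = []"
| "enc_list x y (w # ws) = replicate (length w) x @ y # w @ enc_list x y ws"

lemma enc_list_inj:
  assumes xy: "x \<noteq> y" shows "enc_list x y ws = enc_list x y vs \<Longrightarrow> ws = vs"
proof (induct ws arbitrary: vs)
  case Nil
  then show ?case by (cases vs) auto
next
  case (Cons w ws)
  then obtain v vs' where vs: "vs = v # vs'" by (cases vs) auto
  have eq: "replicate (length w) x @ y # w @ enc_list x y ws = replicate (length v) x @ y # v @ enc_list x y vs'"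
    using Cons(2) vs by simp
  have tw: "takeWhile (\<lambda>z. z = x) (replicate n x @ y # r) = replicate n x" for n r
    using xy by (induct n) auto
  have len: "length w = length v"
    using arg_cong[OF eq, of "\<lambda>l. length (takeWhile (\<lambda>z. z = x) l)"] unfolding tw by simp
  then have "w = v" "enc_list x y ws = enc_list x y vs'" using eq by auto
  then show ?case using Cons(1) vs by simp
qed

text \<open>A function of finite support is determined by a list of its support together with the values there.\<close>

lemma fin_supp_encoding:
  fixes R :: "'a ring" and x y :: 'b and i :: "'a \<Rightarrow> 'b list" and j :: "'x \<Rightarrow> 'b list"
  assumes "x \<noteq> y" "inj i" "inj j"
  shows "\<exists>\<epsilon> :: ('b list \<times> 'x \<Rightarrow> 'a) \<Rightarrow> 'b list. inj_on \<epsilon> (fin_supp R)"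
proof -
  define sup where "sup f = {s. f s \<noteq> \<zero>\<^bsub>R\<^esub>}" for f :: "'b list \<times> 'x \<Rightarrow> 'a"
  define L where "L f = (SOME xs. set xs = sup f)" for f
  have L: "set (L f) = sup f" if "f \<in> fin_supp R" for f
  proof -
    have "\<exists>xs. set xs = sup f" using that by (simp add: finite_list fin_supp_def sup_def)
    then show ?thesis unfolding L_def by (rule someI_ex)
  qed
  define t where "t f s = enc_list x y [fst s, j (snd s), i (f s)]" for f s
  define \<epsilon> where "\<epsilon> f = enc_list x y (map (t f) (L f))" for f
  have tinj: "s = s' \<and> f s = g s'" if "t f s = t g s'" for f g s s'
  proof -
    have "[fst s, j (snd s), i (f s)] = [fst s', j (snd s'), i (g s')]"
      using enc_list_inj[OF assms(1)] that unfolding t_def by blast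
    then show ?thesis using assms(2,3) by (simp add: prod_eq_iff inj_eq)
  qed
  have "inj_on \<epsilon> (fin_supp R)"
  proof (rule inj_onI)
    fix f g assume f: "f \<in> fin_supp R" and g: "g \<in> fin_supp R" and eq: "\<epsilon> f = \<epsilon> g"
    have m: "map (t f) (L f) = map (t g) (L g)" using enc_list_inj[OF assms(1)] eq unfolding \<epsilon>_def by blast
    then have len: "length (L f) = length (L g)" by (metis length_map)
    have nth: "L f ! n = L g ! n \<and> f (L f ! n) = g (L g ! n)" if "n < length (L f)" for n
      using tinj[of f "L f ! n" g "L g ! n"] m that len by (metis nth_map)
    have LL: "L f = L g" using len nth by (simp add: list_eq_iff_nth_eq)
    show "f = g"
    proof
      fix s
      show "f s = g s"
      proof (cases "s \<in> set (L f)")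
        case True
        then obtain n where "n < length (L f)" "s = L f ! n" by (metis in_set_conv_nth)
        then show ?thesis using nth[of n] LL by simp
      next
        case False
        then have "s \<notin> sup f" "s \<notin> sup g" using L[OF f] L[OF g] LL by auto
        then show ?thesis by (simp add: sup_def)
      qed
    qed
  qed
  then show ?thesis by blast
qed

section \<open>Mapping cones and homotopy pullbacks\<close>

definition prod_module :: "('a, 'm) module \<Rightarrow> ('a, 'n) module \<Rightarrow> ('a, 'm \<times> 'n) module"
  where "prod_module M N = module_of (carrier M \<times> carrier N)
    (\<lambda>x y. (fst x \<oplus>\<^bsub>M\<^esub> fst y, snd x \<oplus>\<^bsub>N\<^esub> snd y)) (\<zero>\<^bsub>M\<^esub>, \<zero>\<^bsub>N\<^esub>)
    (\<lambda>r x. (r \<odot>\<^bsub>M\<^esub> fst x, r \<odot>\<^bsub>N\<^esub> snd x))"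

lemma prod_module_simps [simp]:
  "carrier (prod_module M N) = carrier M \<times> carrier N"
  "x \<oplus>\<^bsub>prod_module M N\<^esub> y = (fst x \<oplus>\<^bsub>M\<^esub> fst y, snd x \<oplus>\<^bsub>N\<^esub> snd y)"
  "\<zero>\<^bsub>prod_module M N\<^esub> = (\<zero>\<^bsub>M\<^esub>, \<zero>\<^bsub>N\<^esub>)"
  "r \<odot>\<^bsub>prod_module M N\<^esub> x = (r \<odot>\<^bsub>M\<^esub> fst x, r \<odot>\<^bsub>N\<^esub> snd x)"
  by (simp_all add: prod_module_def)

lemma prod_module_module:
  fixes R :: "'a ring"
  assumes M: "Module.module R M" and N: "Module.module R N"
  shows "Module.module R (prod_module M N)"
proof -
  interpret M: Module.module R M by fact
  interpret N: Module.module R N by fact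
  have inv: "\<exists>y\<in>carrier (prod_module M N). y \<oplus>\<^bsub>prod_module M N\<^esub> x = \<zero>\<^bsub>prod_module M N\<^esub>"
    if "x \<in> carrier (prod_module M N)" for x
    by (rule bexI[of _ "(\<ominus>\<^bsub>M\<^esub> fst x, \<ominus>\<^bsub>N\<^esub> snd x)"]) (use that in \<open>auto simp: M.M.l_neg N.M.l_neg\<close>)
  have "abelian_group (prod_module M N)"
    by (rule abelian_groupI) (use inv in \<open>auto simp: M.M.a_ac N.M.a_ac\<close>)
  then show ?thesis
    by (intro moduleI[OF M.R.is_cring])
      (auto simp: M.smult_l_distr N.smult_l_distr M.smult_r_distr N.smult_r_distr M.smult_assoc1 N.smult_assoc1)
qed

lemma prod_module_diff:
  fixes R :: "'a ring"
  assumes M: "Module.module R M" and N: "Module.module R N"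
    and "x \<in> carrier (prod_module M N)" "y \<in> carrier (prod_module M N)"
  shows "x \<ominus>\<^bsub>prod_module M N\<^esub> y = (fst x \<ominus>\<^bsub>M\<^esub> fst y, snd x \<ominus>\<^bsub>N\<^esub> snd y)"
proof -
  note P = prod_module_module[OF M N]
  have "fst \<in> mod_hom R (prod_module M N) M" "snd \<in> mod_hom R (prod_module M N) N"
    by (auto intro: mod_homI)
  then show ?thesis
    using mod_hom_diff[OF _ P M assms(3,4)] mod_hom_diff[OF _ P N assms(3,4)] by (auto simp: prod_eq_iff)
qed

lemma prod_hom:
  "fst \<in> mod_hom R (prod_module M N) M" "snd \<in> mod_hom R (prod_module M N) N"
  "f \<in> mod_hom R K M \<Longrightarrow> g \<in> mod_hom R K N \<Longrightarrow> (\<lambda>x. (f x, g x)) \<in> mod_hom R K (prod_module M N)"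
  by (auto intro!: mod_homI simp: mod_hom_add mod_hom_smult mod_hom_closed)

lemma ideal_mult_prod:
  fixes R :: "'a ring"
  assumes M: "Module.module R M" and N: "Module.module R N" and J: "ideal J R"
  shows "x \<in> ideal_mult J (prod_module M N) \<longleftrightarrow> fst x \<in> ideal_mult J M \<and> snd x \<in> ideal_mult J N"
proof
  note P = prod_module_module[OF M N]
  assume "x \<in> ideal_mult J (prod_module M N)"
  then show "fst x \<in> ideal_mult J M \<and> snd x \<in> ideal_mult J N"
    using ideal_mult_hom[OF P M prod_hom(1) J] ideal_mult_hom[OF P N prod_hom(2) J] by blast
next
  interpret M: Module.module R M by fact
  interpret N: Module.module R N by fact
  note P = prod_module_module[OF M N]
  assume x: "fst x \<in> ideal_mult J M \<and> snd x \<in> ideal_mult J N"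
  have i: "(\<lambda>m. (m, \<zero>\<^bsub>N\<^esub>)) \<in> mod_hom R M (prod_module M N)" "(\<lambda>n. (\<zero>\<^bsub>M\<^esub>, n)) \<in> mod_hom R N (prod_module M N)"
    by (auto intro!: mod_homI)
  have "(fst x, \<zero>\<^bsub>N\<^esub>) \<oplus>\<^bsub>prod_module M N\<^esub> (\<zero>\<^bsub>M\<^esub>, snd x) \<in> ideal_mult J (prod_module M N)"
    using x ideal_mult_hom[OF M P i(1) J] ideal_mult_hom[OF N P i(2) J]
    by (intro Module.module.submoduleE(5)[OF P ideal_mult_submodule[OF P J]]) auto
  then show "x \<in> ideal_mult J (prod_module M N)"
    using x ideal_mult_carrier[OF M J] ideal_mult_carrier[OF N J] by simp
qed

definition shift :: "('a, 'm) cx \<Rightarrow> ('a, 'm) cx"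
  where "shift P = \<lparr>obj = (\<lambda>n. obj P (n + 1)), dif = (\<lambda>n x. \<ominus>\<^bsub>obj P (n + 1 + 1)\<^esub> dif P (n + 1) x)\<rparr>"

definition cone :: "('a, 'm) cx \<Rightarrow> ('a, 'n) cx \<Rightarrow> (int \<Rightarrow> 'm \<Rightarrow> 'n) \<Rightarrow> ('a, 'm \<times> 'n) cx"
  where "cone P Q u = \<lparr>obj = (\<lambda>n. prod_module (obj P (n + 1)) (obj Q n)),
    dif = (\<lambda>n x. (\<ominus>\<^bsub>obj P (n + 1 + 1)\<^esub> dif P (n + 1) (fst x), u (n + 1) (fst x) \<oplus>\<^bsub>obj Q (n + 1)\<^esub> dif Q n (snd x)))\<rparr>"

lemma shift_simps [simp]: "obj (shift P) n = obj P (n + 1)"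
  "dif (shift P) n x = \<ominus>\<^bsub>obj P (n + 1 + 1)\<^esub> dif P (n + 1) x"
  by (simp_all add: shift_def)

lemma cone_simps [simp]: "obj (cone P Q u) n = prod_module (obj P (n + 1)) (obj Q n)"
  "dif (cone P Q u) n x =
    (\<ominus>\<^bsub>obj P (n + 1 + 1)\<^esub> dif P (n + 1) (fst x), u (n + 1) (fst x) \<oplus>\<^bsub>obj Q (n + 1)\<^esub> dif Q n (snd x))"
  by (simp_all add: cone_def)

lemma cochain_complexI:
  assumes "\<And>i. Module.module R (obj C i)" "\<And>i. dif C i \<in> mod_hom R (obj C i) (obj C (i + 1))"
    "\<And>i x. x \<in> carrier (obj C i) \<Longrightarrow> dif C (i + 1) (dif C i x) = \<zero>\<^bsub>obj C (i + 1 + 1)\<^esub>"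
  shows "cochain_complex R C"
  using assms unfolding cochain_complex_def by (simp add: add.assoc)

lemma shift_complex:
  assumes P: "cochain_complex A P" shows "cochain_complex A (shift P)"
proof (rule cochain_complexI)
  note Pm = cx_module[OF P]
  show d: "dif (shift P) i \<in> mod_hom A (obj (shift P) i) (obj (shift P) (i + 1))" for i
    using mod_hom_uminus[OF Pm cx_dif[OF P, of "i + 1"]] by (simp add: shift_def)
  fix i x assume x: "x \<in> carrier (obj (shift P) i)"
  interpret M: Module.module A "obj P (i + 1 + 1 + 1)" by (rule Pm)
  have x': "x \<in> carrier (obj P (i + 1))" using x by simp
  show "dif (shift P) (i + 1) (dif (shift P) i x) = \<zero>\<^bsub>obj (shift P) (i + 1 + 1)\<^esub>"
    using mod_hom_neg[OF cx_dif[OF P] Pm Pm mod_hom_closed[OF cx_dif[OF P] x']] cx_dd[OF P x']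
    by (simp only: shift_simps M.M.neg_zero)
qed (use cx_module[OF P] in simp)

context
  fixes A :: "'a ring" and P :: "('a, 'm) cx" and Q :: "('a, 'n) cx" and u
  assumes P: "cochain_complex A P" and Q: "cochain_complex A Q" and u: "chain_map A P Q u"
begin

private lemmas Pm = cx_module[OF P] and Qm = cx_module[OF Q] and uh = chain_mapD(1)[OF u]

lemma cone_complex: "cochain_complex A (cone P Q u)"
proof (rule cochain_complexI)
  show "Module.module A (obj (cone P Q u) i)" for i by (simp add: prod_module_module Pm Qm)
  show d: "dif (cone P Q u) i \<in> mod_hom A (obj (cone P Q u) i) (obj (cone P Q u) (i + 1))" for i
    unfolding cone_def cx.simps
    by (intro prod_hom mod_hom_uminus[OF Pm] mod_hom_sum[OF Qm] mod_hom_comp[OF prod_hom(1) cx_dif[OF P]]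
        mod_hom_comp[OF prod_hom(1) uh] mod_hom_comp[OF prod_hom(2) cx_dif[OF Q]])
  fix i x assume "x \<in> carrier (obj (cone P Q u) i)"
  then have x: "fst x \<in> carrier (obj P (i + 1))" "snd x \<in> carrier (obj Q i)" by auto
  interpret M: Module.module A "obj P (i + 1 + 1 + 1)" by (rule Pm)
  interpret N: Module.module A "obj Q (i + 1 + 1)" by (rule Qm)
  have c: "dif P (i + 1) (fst x) \<in> carrier (obj P (i + 1 + 1))" "u (i + 1) (fst x) \<in> carrier (obj Q (i + 1))"
    "dif Q i (snd x) \<in> carrier (obj Q (i + 1))" "u (i + 1 + 1) (dif P (i + 1) (fst x)) \<in> carrier (obj Q (i + 1 + 1))"
    by (rule mod_hom_closed[OF cx_dif[OF P]] mod_hom_closed[OF cx_dif[OF Q]] mod_hom_closed[OF uh] x)+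
  have 1: "\<ominus>\<^bsub>obj P (i + 1 + 1 + 1)\<^esub> dif P (i + 1 + 1) (\<ominus>\<^bsub>obj P (i + 1 + 1)\<^esub> dif P (i + 1) (fst x)) = \<zero>\<^bsub>obj P (i + 1 + 1 + 1)\<^esub>"
    unfolding mod_hom_neg[OF cx_dif[OF P] Pm Pm c(1)] cx_dd[OF P x(1)] by (simp only: M.M.neg_zero)
  have 2: "u (i + 1 + 1) (\<ominus>\<^bsub>obj P (i + 1 + 1)\<^esub> dif P (i + 1) (fst x)) \<oplus>\<^bsub>obj Q (i + 1 + 1)\<^esub>
      dif Q (i + 1) (u (i + 1) (fst x) \<oplus>\<^bsub>obj Q (i + 1)\<^esub> dif Q i (snd x)) = \<zero>\<^bsub>obj Q (i + 1 + 1)\<^esub>"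
    unfolding mod_hom_neg[OF uh Pm Qm c(1)] mod_hom_add[OF cx_dif[OF Q] c(2,3)] cx_dd[OF Q x(2)]
      chain_mapD(2)[OF u x(1), symmetric] N.M.r_zero[OF c(4)]
    by (rule N.M.l_neg[OF c(4)])
  show "dif (cone P Q u) (i + 1) (dif (cone P Q u) i x) = \<zero>\<^bsub>obj (cone P Q u) (i + 1 + 1)\<^esub>"
    unfolding cone_simps fst_conv snd_conv 1 2 prod_module_simps ..
qed

lemma cone_exact:
  assumes inj: "\<And>i. cohom_inj P Q u i" and surj: "\<And>i. cohom_surj P Q u i"
  shows "exact_at (cone P Q u) i"
proof (rule exact_atI)
  fix x assume x: "x \<in> carrier (obj (cone P Q u) i)" and dx: "dif (cone P Q u) i x = \<zero>\<^bsub>obj (cone P Q u) (i + 1)\<^esub>"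
  obtain p q where pq: "x = (p, q)" "p \<in> carrier (obj P (i + 1))" "q \<in> carrier (obj Q i)" using x by auto
  interpret P0: Module.module A "obj P i" by (rule Pm)
  interpret P1: Module.module A "obj P (i + 1)" by (rule Pm)
  interpret P2: Module.module A "obj P (i + 1 + 1)" by (rule Pm)
  interpret Q0: Module.module A "obj Q i" by (rule Qm)
  interpret Q1: Module.module A "obj Q (i + 1)" by (rule Qm)
  have dp0: "\<ominus>\<^bsub>obj P (i + 1 + 1)\<^esub> dif P (i + 1) p = \<zero>\<^bsub>obj P (i + 1 + 1)\<^esub>"
    and uq: "u (i + 1) p \<oplus>\<^bsub>obj Q (i + 1)\<^esub> dif Q i q = \<zero>\<^bsub>obj Q (i + 1)\<^esub>" using dx pq by simp_all
  have c: "dif P (i + 1) p \<in> carrier (obj P (i + 1 + 1))" "u (i + 1) p \<in> carrier (obj Q (i + 1))"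
    "dif Q i q \<in> carrier (obj Q (i + 1))"
    by (rule mod_hom_closed[OF cx_dif[OF P]] mod_hom_closed[OF cx_dif[OF Q]] mod_hom_closed[OF uh] pq)+
  have dp: "dif P (i + 1) p = \<zero>\<^bsub>obj P (i + 1 + 1)\<^esub>"
    using P2.M.minus_minus[OF c(1)] unfolding dp0 P2.M.neg_zero by (rule sym)
  have "u (i + 1) p = \<ominus>\<^bsub>obj Q (i + 1)\<^esub> dif Q i q" by (rule Q1.M.minus_equality[OF uq c(3,2), symmetric])
  also have "\<dots> = dif Q i (\<ominus>\<^bsub>obj Q i\<^esub> q)" by (rule mod_hom_neg[OF cx_dif[OF Q] Qm Qm pq(3), symmetric])
  finally have "u (i + 1) p \<in> coboundaries Q (i + 1)" unfolding coboundaries_def using pq(3) by simp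
  then have "p \<in> coboundaries P (i + 1)"
    using inj[of "i + 1"] dp pq by (simp add: cohom_inj_def cocycles_def)
  then obtain p' where p': "p' \<in> carrier (obj P i)" "p = dif P i p'" by (auto simp: coboundaries_def)
  have up': "u i p' \<in> carrier (obj Q i)" by (rule mod_hom_closed[OF uh p'(1)])
  have "dif Q i (q \<oplus>\<^bsub>obj Q i\<^esub> u i p') = \<zero>\<^bsub>obj Q (i + 1)\<^esub>"
    using uq c Q1.M.a_comm by (simp add: mod_hom_add[OF cx_dif[OF Q] pq(3) up'] chain_mapD(2)[OF u p'(1), symmetric] p'(2))
  then have "q \<oplus>\<^bsub>obj Q i\<^esub> u i p' \<in> cocycles Q i" using pq(3) up' by (simp add: cocycles_def)
  then obtain p3 where p3: "p3 \<in> cocycles P i" and "(q \<oplus>\<^bsub>obj Q i\<^esub> u i p') \<ominus>\<^bsub>obj Q i\<^esub> u i p3 \<in> coboundaries Q i"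
    using surj[of i] unfolding cohom_surj_def by blast
  then obtain q' where q': "q' \<in> carrier (obj Q (i - 1))"
    "(q \<oplus>\<^bsub>obj Q i\<^esub> u i p') \<ominus>\<^bsub>obj Q i\<^esub> u i p3 = dif Q (i - 1) q'" by (auto simp: coboundaries_def)
  have p3c: "p3 \<in> carrier (obj P i)" "dif P i p3 = \<zero>\<^bsub>obj P (i + 1)\<^esub>" using p3 by (auto simp: cocycles_def)
  have up3: "u i p3 \<in> carrier (obj Q i)" by (rule mod_hom_closed[OF uh p3c(1)])
  let ?y = "(p3 \<ominus>\<^bsub>obj P i\<^esub> p', q')"
  have y: "?y \<in> carrier (obj (cone P Q u) (i - 1))" using p3c p' q' by simp
  have "\<ominus>\<^bsub>obj P (i + 1)\<^esub> dif P i (p3 \<ominus>\<^bsub>obj P i\<^esub> p') = p"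
    using pq(2) unfolding mod_hom_diff[OF cx_dif[OF P] Pm Pm p3c(1) p'(1)] p3c(2) p'(2)[symmetric] by algebra
  moreover have "u i (p3 \<ominus>\<^bsub>obj P i\<^esub> p') \<oplus>\<^bsub>obj Q i\<^esub> dif Q (i - 1) q' = q"
    using pq(3) up' up3 unfolding mod_hom_diff[OF uh Pm Qm p3c(1) p'(1)] q'(2)[symmetric] by algebra
  ultimately have "x = dif (cone P Q u) (i - 1) ?y" by (simp add: pq(1))
  then show "\<exists>y\<in>carrier (obj (cone P Q u) (i - 1)). x = dif (cone P Q u) (i - 1) y" using y by blast
qed

text \<open>The cone is a degreewise split extension of the shift of \<open>P\<close> by \<open>Q\<close>.\<close>

lemma cone_tensor_exact:
  assumes N: "cochain_complex A N" and exP: "\<And>i. exact_at (tensor_cx A (shift P) N) i"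
    and exQ: "\<And>i. exact_at (tensor_cx A Q N) i"
  shows "exact_at (tensor_cx A (cone P Q u) N) i"
proof (rule tensor_split_extension_exact[OF Q cone_complex shift_complex[OF P] N, where
      \<iota> = "\<lambda>i q. (\<zero>\<^bsub>obj P (i + 1)\<^esub>, q)" and \<rho> = "\<lambda>i. fst" and \<sigma> = "\<lambda>i p. (p, \<zero>\<^bsub>obj Q i\<^esub>)" and \<kappa> = "\<lambda>i. snd"])
  have ag: "abelian_group (obj P i)" "abelian_group (obj Q i)" for i using moduleD(2) Pm Qm by blast+
  have z: "\<zero>\<^bsub>obj P i\<^esub> \<in> carrier (obj P i)" "\<zero>\<^bsub>obj Q i\<^esub> \<in> carrier (obj Q i)" for i
    using ag by (auto simp: abelian_group_def intro: abelian_monoid.zero_closed)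
  have nz: "\<ominus>\<^bsub>obj P i\<^esub> \<zero>\<^bsub>obj P i\<^esub> = \<zero>\<^bsub>obj P i\<^esub>" for i
  proof -
    interpret abelian_group "obj P i" by (rule ag)
    show ?thesis by (rule neg_zero)
  qed
  have lz: "\<zero>\<^bsub>obj Q i\<^esub> \<oplus>\<^bsub>obj Q i\<^esub> q = q" "q \<oplus>\<^bsub>obj Q i\<^esub> \<zero>\<^bsub>obj Q i\<^esub> = q" if "q \<in> carrier (obj Q i)" for i q
  proof -
    interpret abelian_group "obj Q i" by (rule ag)
    show "\<zero>\<^bsub>obj Q i\<^esub> \<oplus>\<^bsub>obj Q i\<^esub> q = q" "q \<oplus>\<^bsub>obj Q i\<^esub> \<zero>\<^bsub>obj Q i\<^esub> = q" using that by simp_all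
  qed
  have lz': "\<zero>\<^bsub>obj P i\<^esub> \<oplus>\<^bsub>obj P i\<^esub> q = q" if "q \<in> carrier (obj P i)" for i q
  proof -
    interpret abelian_group "obj P i" by (rule ag)
    show ?thesis using that by simp
  qed
  show "chain_map A Q (cone P Q u) (\<lambda>i q. (\<zero>\<^bsub>obj P (i + 1)\<^esub>, q))"
    unfolding chain_map_def
  proof (intro allI conjI ballI)
    show "(\<lambda>q. (\<zero>\<^bsub>obj P (i + 1)\<^esub>, q)) \<in> mod_hom A (obj Q i) (obj (cone P Q u) i)" for i
      unfolding cone_simps by (intro prod_hom mod_hom_const_zero[OF Pm] mod_hom_id)
    show "(\<zero>\<^bsub>obj P (i + 1 + 1)\<^esub>, dif Q i q) = dif (cone P Q u) i (\<zero>\<^bsub>obj P (i + 1)\<^esub>, q)" if "q \<in> carrier (obj Q i)" for i q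
      unfolding cone_simps fst_conv snd_conv mod_hom_zero[OF cx_dif[OF P] Pm Pm] mod_hom_zero[OF uh Pm Qm] nz
        lz(1)[OF mod_hom_closed[OF cx_dif[OF Q] that]] ..
  qed
  show "chain_map A (cone P Q u) (shift P) (\<lambda>i. fst)"
    unfolding chain_map_def by (auto simp: prod_hom(1))
  show "(\<lambda>p. (p, \<zero>\<^bsub>obj Q i\<^esub>)) \<in> mod_hom A (obj (shift P) i) (obj (cone P Q u) i)" for i
    unfolding cone_simps shift_simps by (intro prod_hom mod_hom_const_zero[OF Qm] mod_hom_id)
  show "snd \<in> mod_hom A (obj (cone P Q u) i) (obj Q i)" for i unfolding cone_simps by (rule prod_hom)
  show "y = (\<zero>\<^bsub>obj P (i + 1)\<^esub>, snd y) \<oplus>\<^bsub>obj (cone P Q u) i\<^esub> (fst y, \<zero>\<^bsub>obj Q i\<^esub>)"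
    if "y \<in> carrier (obj (cone P Q u) i)" for i y
    using that lz' lz by auto
qed (use exP exQ in auto)

end

text \<open>The homotopy pullback of \<open>s\<close> and \<open>t\<close>: a cocycle consists of cocycles \<open>x\<close> and \<open>y\<close> and an element \<open>m\<close>
  that bounds the difference \<open>s x - t y\<close>.\<close>

definition pullback :: "('a, 'x) cx \<Rightarrow> ('a, 'y) cx \<Rightarrow> ('a, 'm) cx \<Rightarrow> (int \<Rightarrow> 'x \<Rightarrow> 'm) \<Rightarrow> (int \<Rightarrow> 'y \<Rightarrow> 'm) \<Rightarrow>
    ('a, 'x \<times> 'y \<times> 'm) cx"
  where "pullback X Y M s t = \<lparr>obj = (\<lambda>n. prod_module (obj X n) (prod_module (obj Y n) (obj M (n - 1)))),
    dif = (\<lambda>n w. (dif X n (fst w), dif Y n (fst (snd w)),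
      (s n (fst w) \<ominus>\<^bsub>obj M n\<^esub> t n (fst (snd w))) \<ominus>\<^bsub>obj M n\<^esub> dif M (n - 1) (snd (snd w))))\<rparr>"

lemma pullback_simps [simp]:
  "obj (pullback X Y M s t) n = prod_module (obj X n) (prod_module (obj Y n) (obj M (n - 1)))"
  "dif (pullback X Y M s t) n (x, y, m) = (dif X n x, dif Y n y,
      (s n x \<ominus>\<^bsub>obj M n\<^esub> t n y) \<ominus>\<^bsub>obj M n\<^esub> dif M (n - 1) m)"
  by (simp_all add: pullback_def)

context
  fixes A :: "'a ring" and X :: "('a, 'x) cx" and Y :: "('a, 'y) cx" and M :: "('a, 'm) cx" and s t
  assumes s: "quasi_iso A X M s" and t: "quasi_iso A Y M t"
begin

private lemmas X = quasi_isoD(1)[OF s] and M = quasi_isoD(2)[OF s] and Y = quasi_isoD(1)[OF t]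
  and sc = quasi_isoD(3)[OF s] and tc = quasi_isoD(3)[OF t]
private lemmas modX = cx_module[OF X] and modY = cx_module[OF Y] and modM = cx_module[OF M]
  and sh = chain_mapD(1)[OF sc] and th = chain_mapD(1)[OF tc]

lemma pullback_complex: "cochain_complex A (pullback X Y M s t)"
proof (rule cochain_complexI)
  let ?W = "pullback X Y M s t"
  show "Module.module A (obj ?W i)" for i by (simp add: prod_module_module modX modY modM)
  have 2: "(\<lambda>w. fst (snd w)) \<in> mod_hom A (obj ?W i) (obj Y i)" for i
    unfolding pullback_simps by (rule mod_hom_comp[OF prod_hom(2) prod_hom(1)])
  have 3: "(\<lambda>w. snd (snd w)) \<in> mod_hom A (obj ?W i) (obj M (i - 1))" for i
    unfolding pullback_simps by (rule mod_hom_comp[OF prod_hom(2) prod_hom(2)])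
  have 1: "fst \<in> mod_hom A (obj ?W i) (obj X i)" for i unfolding pullback_simps by (rule prod_hom)
  show "dif ?W i \<in> mod_hom A (obj ?W i) (obj ?W (i + 1))" for i
  proof -
    have "(\<lambda>w. (dif X i (fst w), dif Y i (fst (snd w)),
      (s i (fst w) \<ominus>\<^bsub>obj M i\<^esub> t i (fst (snd w))) \<ominus>\<^bsub>obj M i\<^esub> dif M (i - 1) (snd (snd w))))
      \<in> mod_hom A (obj ?W i) (prod_module (obj X (i + 1)) (prod_module (obj Y (i + 1)) (obj M i)))"
      unfolding a_minus_def
      by (intro prod_hom mod_hom_sum[OF modM] mod_hom_uminus[OF modM] mod_hom_comp[OF 1 sh] mod_hom_comp[OF 2 th]
          mod_hom_comp[OF 3 cx_dif'[OF M]] mod_hom_comp[OF 1 cx_dif[OF X]] mod_hom_comp[OF 2 cx_dif[OF Y]])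
    then show ?thesis by (simp add: pullback_def)
  qed
  fix i w assume "w \<in> carrier (obj ?W i)"
  then obtain x y m where w: "w = (x, y, m)" "x \<in> carrier (obj X i)" "y \<in> carrier (obj Y i)" "m \<in> carrier (obj M (i - 1))"
    by auto
  interpret M0: Module.module A "obj M i" by (rule modM)
  interpret M1: Module.module A "obj M (i + 1)" by (rule modM)
  have c: "s i x \<in> carrier (obj M i)" "t i y \<in> carrier (obj M i)" "dif M (i - 1) m \<in> carrier (obj M i)"
    by (rule mod_hom_closed[OF sh] mod_hom_closed[OF th] mod_hom_closed[OF cx_dif'[OF M]] w)+
  have d: "dif M i (s i x) \<in> carrier (obj M (i + 1))" "dif M i (t i y) \<in> carrier (obj M (i + 1))"
    by (rule mod_hom_closed[OF cx_dif[OF M]] c)+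
  have "dif M i ((s i x \<ominus>\<^bsub>obj M i\<^esub> t i y) \<ominus>\<^bsub>obj M i\<^esub> dif M (i - 1) m) = dif M i (s i x) \<ominus>\<^bsub>obj M (i + 1)\<^esub> dif M i (t i y)"
    unfolding mod_hom_diff[OF cx_dif[OF M] modM modM M0.M.minus_closed[OF c(1,2)] c(3)] mod_hom_diff[OF cx_dif[OF M] modM modM c(1,2)]
      cx_dd'[OF M w(4)] by (rule M1.M.diff_zero[OF M1.M.minus_closed[OF d]])
  then have "(s (i + 1) (dif X i x) \<ominus>\<^bsub>obj M (i + 1)\<^esub> t (i + 1) (dif Y i y)) \<ominus>\<^bsub>obj M (i + 1)\<^esub>
      dif M i ((s i x \<ominus>\<^bsub>obj M i\<^esub> t i y) \<ominus>\<^bsub>obj M i\<^esub> dif M (i - 1) m) = \<zero>\<^bsub>obj M (i + 1)\<^esub>"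
    using d by (simp add: chain_mapD(2)[OF sc w(2)] chain_mapD(2)[OF tc w(3)])
  moreover have "i + 1 - 1 = i" "i + 1 + 1 - 1 = i + 1" by simp_all
  ultimately show "dif ?W (i + 1) (dif ?W i w) = \<zero>\<^bsub>obj ?W (i + 1 + 1)\<^esub>"
    using cx_dd[OF X w(2)] cx_dd[OF Y w(3)] by (simp only: w(1) pullback_simps prod_module_simps)
qed

text \<open>The projection to \<open>X\<close> inherits bijectivity on cohomology from \<open>t\<close>, the opposite side of the square;
  in the same way the projection to \<open>Y\<close> inherits it from \<open>s\<close>.\<close>

lemma pullback_fst: "quasi_iso A (pullback X Y M s t) X (\<lambda>i. fst)"
  unfolding quasi_iso_iff
proof (intro conjI allI pullback_complex X)
  let ?W = "pullback X Y M s t"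
  show "chain_map A ?W X (\<lambda>i. fst)" unfolding chain_map_def by (auto simp: prod_hom)
  fix i
  interpret X0: Module.module A "obj X i" by (rule modX)
  interpret Y0: Module.module A "obj Y i" by (rule modY)
  interpret Y': Module.module A "obj Y (i - 1)" by (rule modY)
  interpret M0: Module.module A "obj M i" by (rule modM)
  interpret M1: Module.module A "obj M (i + 1)" by (rule modM)
  interpret M': Module.module A "obj M (i - 1)" by (rule modM)
  show "cohom_surj ?W X (\<lambda>i. fst) i"
    unfolding cohom_surj_def
  proof
    fix x assume x: "x \<in> cocycles X i"
    have xc: "x \<in> carrier (obj X i)" "dif X i x = \<zero>\<^bsub>obj X (i + 1)\<^esub>" using x by (auto simp: cocycles_def)
    have "s i x \<in> cocycles M i" by (rule chain_map_cocycles[OF M X sc x])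
    then obtain y where y: "y \<in> cocycles Y i" "s i x \<ominus>\<^bsub>obj M i\<^esub> t i y \<in> coboundaries M i"
      using quasi_isoD(5)[OF t, of i] unfolding cohom_surj_def by blast
    then obtain m where m: "m \<in> carrier (obj M (i - 1))" "s i x \<ominus>\<^bsub>obj M i\<^esub> t i y = dif M (i - 1) m"
      by (auto simp: coboundaries_def)
    have yc: "y \<in> carrier (obj Y i)" "dif Y i y = \<zero>\<^bsub>obj Y (i + 1)\<^esub>" using y by (auto simp: cocycles_def)
    have "(x, y, m) \<in> cocycles ?W i"
      using xc yc m mod_hom_closed[OF cx_dif'[OF M] m(1)] by (simp add: cocycles_def)
    moreover have "x \<ominus>\<^bsub>obj X i\<^esub> fst (x, y, m) = \<zero>\<^bsub>obj X i\<^esub>" using xc by simp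
    moreover have "\<zero>\<^bsub>obj X i\<^esub> \<in> coboundaries X i"
      using subgroup.one_closed[OF submodule.axioms(1)[OF coboundaries_submodule[OF X]]] by simp
    ultimately show "\<exists>w\<in>cocycles ?W i. x \<ominus>\<^bsub>obj X i\<^esub> fst w \<in> coboundaries X i" by metis
  qed
  show "cohom_inj ?W X (\<lambda>i. fst) i"
    unfolding cohom_inj_def
  proof (intro ballI impI)
    fix w assume w: "w \<in> cocycles ?W i" and "fst w \<in> coboundaries X i"
    then obtain x' where x': "x' \<in> carrier (obj X (i - 1))" "fst w = dif X (i - 1) x'" by (auto simp: coboundaries_def)
    obtain x y m where we: "w = (x, y, m)" by (cases w)
    have c: "x \<in> carrier (obj X i)" "y \<in> carrier (obj Y i)" "m \<in> carrier (obj M (i - 1))"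
      and dy: "dif Y i y = \<zero>\<^bsub>obj Y (i + 1)\<^esub>"
      and dm: "(s i x \<ominus>\<^bsub>obj M i\<^esub> t i y) \<ominus>\<^bsub>obj M i\<^esub> dif M (i - 1) m = \<zero>\<^bsub>obj M i\<^esub>"
      using w by (auto simp: we cocycles_def)
    have xe: "x = dif X (i - 1) x'" using x' we by simp
    let ?sx' = "s (i - 1) x'"
    have cl: "s i x \<in> carrier (obj M i)" "t i y \<in> carrier (obj M i)" "dif M (i - 1) m \<in> carrier (obj M i)"
      "?sx' \<in> carrier (obj M (i - 1))"
      by (rule mod_hom_closed[OF sh] mod_hom_closed[OF th] mod_hom_closed[OF cx_dif'[OF M]] c x')+
    have sxx: "s i x = dif M (i - 1) ?sx'" unfolding xe by (rule chain_mapD'[OF sc x'(1)])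
    have ty: "t i y = dif M (i - 1) (?sx' \<ominus>\<^bsub>obj M (i - 1)\<^esub> m)"
    proof -
      have "t i y = dif M (i - 1) ?sx' \<ominus>\<^bsub>obj M i\<^esub> dif M (i - 1) m \<ominus>\<^bsub>obj M i\<^esub>
          ((s i x \<ominus>\<^bsub>obj M i\<^esub> t i y) \<ominus>\<^bsub>obj M i\<^esub> dif M (i - 1) m)"
        using cl unfolding sxx[symmetric] by algebra
      then show ?thesis using dm cl mod_hom_closed[OF cx_dif'[OF M] cl(4)]
        by (simp add: mod_hom_diff[OF cx_dif'[OF M] modM modM cl(4) c(3)])
    qed
    then have "t i y \<in> coboundaries M i" unfolding coboundaries_def using cl c by blast
    then have "y \<in> coboundaries Y i"
      using quasi_isoD(4)[OF t, of i] c dy by (simp add: cohom_inj_def cocycles_def)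
    then obtain y' where y': "y' \<in> carrier (obj Y (i - 1))" "y = dif Y (i - 1) y'" by (auto simp: coboundaries_def)
    let ?ty' = "t (i - 1) y'"
    have ty': "?ty' \<in> carrier (obj M (i - 1))" by (rule mod_hom_closed[OF th y'(1)])
    have tyd: "t i y = dif M (i - 1) ?ty'" unfolding y'(2) by (rule chain_mapD'[OF tc y'(1)])
    let ?n = "(?sx' \<ominus>\<^bsub>obj M (i - 1)\<^esub> ?ty') \<ominus>\<^bsub>obj M (i - 1)\<^esub> m"
    have n: "?n \<in> carrier (obj M (i - 1))" using cl c ty' by simp
    have "dif M (i - 1) ?n = dif M (i - 1) ((?sx' \<ominus>\<^bsub>obj M (i - 1)\<^esub> m) \<ominus>\<^bsub>obj M (i - 1)\<^esub> ?ty')"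
      using cl(4) c(3) ty' by (intro arg_cong[where f = "dif M (i - 1)"]) algebra
    also have "\<dots> = \<zero>\<^bsub>obj M i\<^esub>"
      unfolding mod_hom_diff[OF cx_dif'[OF M] modM modM M'.M.minus_closed[OF cl(4) c(3)] ty'] ty[symmetric] tyd[symmetric]
      using cl(2) by simp
    finally have "?n \<in> cocycles M (i - 1)" using n by (simp add: cocycles_def)
    then obtain y2 where y2: "y2 \<in> cocycles Y (i - 1)" "?n \<ominus>\<^bsub>obj M (i - 1)\<^esub> t (i - 1) y2 \<in> coboundaries M (i - 1)"
      using quasi_isoD(5)[OF t, of "i - 1"] unfolding cohom_surj_def by blast
    then obtain m2 where m2: "m2 \<in> carrier (obj M (i - 1 - 1))"
      "?n \<ominus>\<^bsub>obj M (i - 1)\<^esub> t (i - 1) y2 = dif M (i - 1 - 1) m2" by (auto simp: coboundaries_def)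
    have y2c: "y2 \<in> carrier (obj Y (i - 1))" "dif Y (i - 1) y2 = \<zero>\<^bsub>obj Y i\<^esub>" using y2(1) by (auto simp: cocycles_def)
    have ty2: "t (i - 1) y2 \<in> carrier (obj M (i - 1))" by (rule mod_hom_closed[OF th y2c(1)])
    let ?v = "(x', y' \<oplus>\<^bsub>obj Y (i - 1)\<^esub> y2, m2)"
    have v: "?v \<in> carrier (obj ?W (i - 1))" using x' y' y2c m2 by simp
    have e1: "dif Y (i - 1) (y' \<oplus>\<^bsub>obj Y (i - 1)\<^esub> y2) = y"
      using c(2) by (simp add: mod_hom_add[OF cx_dif'[OF Y] y'(1) y2c(1)] y2c(2) y'(2)[symmetric])
    have e2: "(?sx' \<ominus>\<^bsub>obj M (i - 1)\<^esub> t (i - 1) (y' \<oplus>\<^bsub>obj Y (i - 1)\<^esub> y2)) \<ominus>\<^bsub>obj M (i - 1)\<^esub> dif M (i - 1 - 1) m2 = m"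
      unfolding mod_hom_add[OF th y'(1) y2c(1)] m2(2)[symmetric] using cl(4) ty' ty2 c(3) by algebra
    have "dif ?W (i - 1) ?v = w" unfolding pullback_simps e1 e2 xe[symmetric] we ..
    then show "w \<in> coboundaries ?W i" unfolding coboundaries_def using v by blast
  qed
qed

lemma pullback_snd: "quasi_iso A (pullback X Y M s t) Y (\<lambda>i w. fst (snd w))"
  unfolding quasi_iso_iff
proof (intro conjI allI pullback_complex Y)
  let ?W = "pullback X Y M s t"
  show "chain_map A ?W Y (\<lambda>i w. fst (snd w))" unfolding chain_map_def
  proof (intro allI conjI ballI)
    show "(\<lambda>w. fst (snd w)) \<in> mod_hom A (obj ?W i) (obj Y i)" for i
      unfolding pullback_simps by (rule mod_hom_comp[OF prod_hom(2) prod_hom(1)])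
  qed auto
  fix i
  interpret M0: Module.module A "obj M i" by (rule modM)
  interpret M': Module.module A "obj M (i - 1)" by (rule modM)
  interpret Y0: Module.module A "obj Y i" by (rule modY)
  note cobM = coboundaries_submodule[OF M, of i]
  show "cohom_inj ?W Y (\<lambda>i w. fst (snd w)) i"
    unfolding cohom_inj_def
  proof (intro ballI impI)
    fix w assume w: "w \<in> cocycles ?W i" and wy: "fst (snd w) \<in> coboundaries Y i"
    obtain x y m where we: "w = (x, y, m)" by (cases w)
    have c: "x \<in> carrier (obj X i)" "y \<in> carrier (obj Y i)" "m \<in> carrier (obj M (i - 1))"
      and dx: "dif X i x = \<zero>\<^bsub>obj X (i + 1)\<^esub>"
      and dm: "(s i x \<ominus>\<^bsub>obj M i\<^esub> t i y) \<ominus>\<^bsub>obj M i\<^esub> dif M (i - 1) m = \<zero>\<^bsub>obj M i\<^esub>"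
      using w by (auto simp: we cocycles_def)
    have cl: "s i x \<in> carrier (obj M i)" "t i y \<in> carrier (obj M i)" "dif M (i - 1) m \<in> carrier (obj M i)"
      by (rule mod_hom_closed[OF sh] mod_hom_closed[OF th] mod_hom_closed[OF cx_dif'[OF M]] c)+
    have "s i x = ((s i x \<ominus>\<^bsub>obj M i\<^esub> t i y) \<ominus>\<^bsub>obj M i\<^esub> dif M (i - 1) m) \<oplus>\<^bsub>obj M i\<^esub> (t i y \<oplus>\<^bsub>obj M i\<^esub> dif M (i - 1) m)"
      using cl by algebra
    then have sx: "s i x = t i y \<oplus>\<^bsub>obj M i\<^esub> dif M (i - 1) m" using dm cl by simp
    have "t i y \<in> coboundaries M i" using chain_map_coboundaries[OF tc] wy we by simp
    moreover have "dif M (i - 1) m \<in> coboundaries M i" using c(3) by (simp add: coboundaries_def)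
    ultimately have "s i x \<in> coboundaries M i" unfolding sx by (rule M0.submoduleE(5)[OF cobM])
    then have "x \<in> coboundaries X i" using quasi_isoD(4)[OF s, of i] c dx by (simp add: cohom_inj_def cocycles_def)
    then show "w \<in> coboundaries ?W i"
      using quasi_isoD(4)[OF pullback_fst, of i] w we unfolding cohom_inj_def by force
  qed
  show "cohom_surj ?W Y (\<lambda>i w. fst (snd w)) i"
    unfolding cohom_surj_def
  proof
    fix y assume y: "y \<in> cocycles Y i"
    have yc: "y \<in> carrier (obj Y i)" "dif Y i y = \<zero>\<^bsub>obj Y (i + 1)\<^esub>" using y by (auto simp: cocycles_def)
    have "t i y \<in> cocycles M i" by (rule chain_map_cocycles[OF M Y tc y])
    then obtain x where x: "x \<in> cocycles X i" "t i y \<ominus>\<^bsub>obj M i\<^esub> s i x \<in> coboundaries M i"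
      using quasi_isoD(5)[OF s, of i] unfolding cohom_surj_def by blast
    then obtain m where m: "m \<in> carrier (obj M (i - 1))" "t i y \<ominus>\<^bsub>obj M i\<^esub> s i x = dif M (i - 1) m"
      by (auto simp: coboundaries_def)
    have xc: "x \<in> carrier (obj X i)" "dif X i x = \<zero>\<^bsub>obj X (i + 1)\<^esub>" using x by (auto simp: cocycles_def)
    have cl: "s i x \<in> carrier (obj M i)" "t i y \<in> carrier (obj M i)"
      by (rule mod_hom_closed[OF sh] mod_hom_closed[OF th] xc yc)+
    have "(s i x \<ominus>\<^bsub>obj M i\<^esub> t i y) \<ominus>\<^bsub>obj M i\<^esub> dif M (i - 1) (\<ominus>\<^bsub>obj M (i - 1)\<^esub> m) = \<zero>\<^bsub>obj M i\<^esub>"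
      unfolding mod_hom_neg[OF cx_dif'[OF M] modM modM m(1)] m(2)[symmetric] using cl by algebra
    then have "(x, y, \<ominus>\<^bsub>obj M (i - 1)\<^esub> m) \<in> cocycles ?W i" using xc yc m(1) by (simp add: cocycles_def)
    moreover have "y \<ominus>\<^bsub>obj Y i\<^esub> fst (snd (x, y, \<ominus>\<^bsub>obj M (i - 1)\<^esub> m)) = \<zero>\<^bsub>obj Y i\<^esub>" using yc by simp
    moreover have "\<zero>\<^bsub>obj Y i\<^esub> \<in> coboundaries Y i"
      using subgroup.one_closed[OF submodule.axioms(1)[OF coboundaries_submodule[OF Y]]] by simp
    ultimately show "\<exists>w\<in>cocycles ?W i. y \<ominus>\<^bsub>obj Y i\<^esub> fst (snd w) \<in> coboundaries Y i" by metis
  qed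
qed

end

section \<open>K-flat complexes modulo an ideal\<close>

lemma cyclic_quot_transport:
  assumes E: "cyclic_quot R J E e" and inj: "inj_on r (carrier E)"
  shows "cyclic_quot R J (transport r E) (r e)"
proof -
  have EM: "Module.module R E" and e: "e \<in> carrier E" using E by (auto simp: cyclic_quot_def)
  interpret E: Module.module R E by (rule EM)
  note h = transport_hom[OF EM inj]
  have z: "r x = r \<zero>\<^bsub>E\<^esub> \<longleftrightarrow> x = \<zero>\<^bsub>E\<^esub>" if "x \<in> carrier E" for x
    using inj_on_eq_iff[OF inj that] by simp
  show ?thesis unfolding cyclic_quot_def
  proof (intro conjI ballI)
    show "Module.module R (transport r E)" by (rule transport_module[OF EM inj])
    show "ideal J R" using E by (simp add: cyclic_quot_def)
    show "r e \<in> carrier (transport r E)" by (rule mod_hom_closed[OF h e])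
    show "\<exists>a\<in>carrier R. x = a \<odot>\<^bsub>transport r E\<^esub> r e" if "x \<in> carrier (transport r E)" for x
    proof -
      obtain y where y: "y \<in> carrier E" "x = r y" using \<open>x \<in> carrier (transport r E)\<close> by (auto simp: transport_carrier)
      obtain a where a: "a \<in> carrier R" "y = a \<odot>\<^bsub>E\<^esub> e" using E y(1) unfolding cyclic_quot_def by blast
      then show ?thesis using mod_hom_smult[OF h a(1) e] y(2) by auto
    qed
    show "(a \<odot>\<^bsub>transport r E\<^esub> r e = \<zero>\<^bsub>transport r E\<^esub>) = (a \<in> J)" if "a \<in> carrier R" for a
      using E that e z[of "a \<odot>\<^bsub>E\<^esub> e"]
      by (simp add: transport_zero mod_hom_smult[OF h that e, symmetric] cyclic_quot_def)
  qed
qed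

lemma zero_cx_module:
  assumes "cring R" shows "Module.module R (module_of {z} (\<lambda>_ _. z) z (\<lambda>_ _. z))"
  using assms by (intro moduleI abelian_groupI) auto

text \<open>A free resolution of \<open>A/J\<close> with \<open>A/J\<close> itself appended in degree 1, which makes it acyclic. It is carried
  by \<open>'a list\<close>, the type on which K-flatness is tested; cosets are represented there by one-letter lists.\<close>

lemma cyclic_resolution:
  fixes A :: "'a ring"
  assumes A: "cring A" and ne: "\<one>\<^bsub>A\<^esub> \<noteq> \<zero>\<^bsub>A\<^esub>" and J: "ideal J A"
  obtains N :: "('a, 'a list) cx" and e where "acyclic_cx A N" and "\<And>p. p \<le> 0 \<Longrightarrow> is_free A (obj N p)"
    and "cyclic_quot A J (obj N 1) e" and "dif N 1 e = \<zero>\<^bsub>obj N 2\<^esub>"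
proof -
  interpret A: cring A by fact
  define r where "r X = [SOME x. x \<in> X]" for X :: "'a set"
  have Js: "abelian_subgroup J A"
    by (rule abelian_subgroupI3[OF ideal.axioms(1)[OF J] A.is_abelian_group])
  have rinj: "inj_on r (carrier (quot_alg A J))"
  proof (rule inj_onI)
    fix X Y assume X: "X \<in> carrier (quot_alg A J)" and Y: "Y \<in> carrier (quot_alg A J)" and eq: "r X = r Y"
    obtain x y where xy: "x \<in> carrier A" "X = J +>\<^bsub>A\<^esub> x" "y \<in> carrier A" "Y = J +>\<^bsub>A\<^esub> y"
      using X Y by (auto simp: quot_alg_carrier[OF A J])
    have "x \<in> X" "y \<in> Y" using xy abelian_subgroup.a_rcos_self[OF Js] by auto
    then have "(SOME x. x \<in> X) \<in> X" "(SOME x. x \<in> Y) \<in> Y" by (metis someI)+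
    then have w: "(SOME x. x \<in> X) \<in> X" "(SOME x. x \<in> X) \<in> Y" using eq by (auto simp: r_def)
    then show "X = Y"
      using abelian_subgroup.a_repr_independence'[OF Js _ xy(1)] abelian_subgroup.a_repr_independence'[OF Js _ xy(3)] xy
      by metis
  qed
  let ?E = "transport r (quot_alg A J)"
  define e where "e = r \<one>\<^bsub>A Quot J\<^esub>"
  have E: "cyclic_quot A J ?E e"
    unfolding e_def by (rule cyclic_quot_transport[OF quot_alg_cyclic(1)[OF A J] rinj])
  have EM: "Module.module A ?E" and e: "e \<in> carrier ?E" using E by (auto simp: cyclic_quot_def)
  interpret E: Module.module A ?E by (rule EM)
  let ?Z = "module_of {[]} (\<lambda>_ _. []) [] (\<lambda>_ _. []) :: ('a, 'a list) module"
  note Zm = zero_cx_module[OF A, of "[] :: 'a list"]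
  define X :: "('a, 'a list) cx" where
    "X = \<lparr>obj = (\<lambda>i. if i = 0 then ?E else ?Z), dif = (\<lambda>i _. if i = -1 then \<zero>\<^bsub>?E\<^esub> else [])\<rparr>"
  have X: "cochain_complex A X"
    by (rule cochain_complexI) (auto simp: X_def EM Zm intro: mod_homI)
  have exX: "exact_at X i" if "0 < i" for i
    by (rule exact_atI) (use that in \<open>auto simp: X_def\<close>)
  have "\<exists>\<epsilon> :: ('a list \<times> 'a list \<Rightarrow> 'a) \<Rightarrow> 'a list. inj_on \<epsilon> (fin_supp A)"
    by (rule fin_supp_encoding[OF ne, of "\<lambda>a. [a]" id]) (auto simp: inj_def)
  then obtain \<epsilon> :: "('a list \<times> 'a list \<Rightarrow> 'a) \<Rightarrow> 'a list" where \<epsilon>: "inj_on \<epsilon> (fin_supp A)" by blast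
  obtain P :: "('a, 'a list) cx" and \<pi> where qi: "quasi_iso A P X \<pi>"
    and Pb: "\<And>i. 0 < i \<Longrightarrow> carrier (obj P i) = {\<zero>\<^bsub>obj P i\<^esub>}" and Pf: "\<And>i. is_free A (obj P i)"
    using free_resolution[OF X exX \<epsilon> ne] by metis
  note P = quasi_isoD(1)[OF qi] and \<pi> = quasi_isoD(3)[OF qi]
  have z: "\<zero>\<^bsub>obj P i\<^esub> \<in> carrier (obj P i)" for i
    using subgroup.one_closed[OF submodule.axioms(1)[OF Module.module.carrier_is_submodule[OF cx_module[OF P]]]] by simp
  define N :: "('a, 'a list) cx" where
    "N = \<lparr>obj = (\<lambda>i. if i = 1 then ?E else obj P i),
      dif = (\<lambda>i. if i = 0 then \<pi> 0 else if i = 1 then (\<lambda>_. \<zero>\<^bsub>obj P 2\<^esub>) else dif P i)\<rparr>"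
  have \<pi>0: "\<pi> 0 \<in> mod_hom A (obj P 0) ?E" using chain_mapD(1)[OF \<pi>, of 0] by (simp add: X_def)
  have N: "cochain_complex A N"
  proof (rule cochain_complexI)
    show "Module.module A (obj N i)" for i by (simp add: N_def EM cx_module[OF P])
    show "dif N i \<in> mod_hom A (obj N i) (obj N (i + 1))" for i
      using \<pi>0 mod_hom_const_zero[OF cx_module[OF P, of 2], of ?E] cx_dif[OF P, of i]
      by (auto simp: N_def)
    fix i x assume x: "x \<in> carrier (obj N i)"
    consider "i = -1" | "i = 0" | "i = 1" | "i \<noteq> -1" "i \<noteq> 0" "i \<noteq> 1" by blast
    then show "dif N (i + 1) (dif N i x) = \<zero>\<^bsub>obj N (i + 1 + 1)\<^esub>"
    proof cases
      case 1
      then show ?thesis using x chain_mapD(2)[OF \<pi>, of x "-1"] by (simp add: N_def X_def)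
    next
      case 3
      then show ?thesis using mod_hom_zero[OF cx_dif[OF P, of 2] cx_module[OF P] cx_module[OF P]] by (simp add: N_def)
    next
      case 4
      have "i + 1 \<noteq> 1" "i + 1 + 1 \<noteq> 1" "i + 1 \<noteq> 0" using 4 by auto
      then show ?thesis using 4 x cx_dd[OF P, of x i]
        by (cases "i + 1 = 1") (simp_all add: N_def)
    qed (simp add: N_def)
  qed
  have ex: "exact_at N i" for i
  proof (rule exact_atI)
    fix x assume x: "x \<in> carrier (obj N i)" and dx: "dif N i x = \<zero>\<^bsub>obj N (i + 1)\<^esub>"
    consider "i > 1" | "i = 1" | "i = 0" | "i < 0" by linarith
    then show "\<exists>y\<in>carrier (obj N (i - 1)). x = dif N (i - 1) y"
    proof cases
      case 1
      then have x0: "x = \<zero>\<^bsub>obj P i\<^esub>" using x Pb[of i] by (simp add: N_def)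
      show ?thesis
      proof (cases "i = 2")
        case True
        then show ?thesis using x0 e by (auto simp: N_def)
      next
        case False
        then have "x = dif P (i - 1) \<zero>\<^bsub>obj P (i - 1)\<^esub>"
          using x0 mod_hom_zero[OF cx_dif'[OF P] cx_module[OF P] cx_module[OF P]] by simp
        then show ?thesis using 1 False z by (auto simp: N_def)
      qed
    next
      case 2
      then have xE: "x \<in> carrier ?E" using x by (simp add: N_def)
      then have "x \<in> cocycles X 0" by (simp add: cocycles_def X_def)
      then obtain p where p: "p \<in> cocycles P 0" "x \<ominus>\<^bsub>obj X 0\<^esub> \<pi> 0 p \<in> coboundaries X 0"
        using quasi_isoD(5)[OF qi, of 0] unfolding cohom_surj_def by blast
      then have pc: "p \<in> carrier (obj P 0)" and "x \<ominus>\<^bsub>?E\<^esub> \<pi> 0 p = \<zero>\<^bsub>?E\<^esub>"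
        by (auto simp: cocycles_def coboundaries_def X_def)
      then have "x = \<pi> 0 p" using E.M.diff_eq_zero_iff[OF xE mod_hom_closed[OF \<pi>0 pc]] by blast
      then show ?thesis using pc 2 by (auto simp: N_def)
    next
      case 3
      have xc: "x \<in> carrier (obj P 0)" "\<pi> 0 x = \<zero>\<^bsub>?E\<^esub>" using x dx 3 by (auto simp: N_def)
      have "dif P 0 x \<in> carrier (obj P 1)" using mod_hom_closed[OF cx_dif[OF P] xc(1)] by simp
      then have "dif P 0 x = \<zero>\<^bsub>obj P 1\<^esub>" using Pb[of 1] by simp
      moreover have "\<pi> 0 x \<in> coboundaries X 0" unfolding xc(2) by (simp add: coboundaries_def X_def)
      ultimately have "x \<in> coboundaries P 0"
        using quasi_isoD(4)[OF qi, of 0] xc by (simp add: cohom_inj_def cocycles_def)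
      then show ?thesis using 3 by (auto simp: coboundaries_def N_def)
    next
      case 4
      then have xc: "x \<in> carrier (obj P i)" "dif P i x = \<zero>\<^bsub>obj P (i + 1)\<^esub>" using x dx by (auto simp: N_def)
      have "\<pi> i x \<in> carrier (obj X i)" by (rule mod_hom_closed[OF chain_mapD(1)[OF \<pi>] xc(1)])
      then have "\<pi> i x = []" using 4 by (simp add: X_def)
      moreover have "[] \<in> coboundaries X i" using 4 by (auto simp: coboundaries_def X_def)
      ultimately have "x \<in> coboundaries P i"
        using quasi_isoD(4)[OF qi, of i] xc by (simp add: cohom_inj_def cocycles_def)
      then show ?thesis using 4 by (auto simp: coboundaries_def N_def)
    qed
  qed
  show thesis
  proof (rule that[of N e])
    show "acyclic_cx A N" using N ex by (simp add: acyclic_iff)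
    show "is_free A (obj N p)" if "p \<le> 0" for p using Pf that by (simp add: N_def)
    show "cyclic_quot A J (obj N 1) e" using E by (simp add: N_def)
    show "dif N 1 e = \<zero>\<^bsub>obj N 2\<^esub>" by (simp add: N_def)
  qed
qed

text \<open>K-flatness of \<open>Q\<close>, and freeness of \<open>P\<close> together with the upper bound, make the tensor product of the cone with the
  acyclic complex of \<open>cyclic_resolution\<close> exact. The cone is exact as well, because \<open>u\<close> is a
  quasi-isomorphism, and \<open>exact_mod_cyclic\<close> transfers this to the cone modulo \<open>J\<close>. In other words,
  \<open>(A/J) \<otimes> P \<rightarrow> (A/J) \<otimes> Q\<close> is a quasi-isomorphism.\<close>

lemma cone_exact_mod:
  fixes A :: "'a ring" and P :: "('a, 'p) cx" and Q :: "('a, 'q) cx"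
  assumes ne: "\<one>\<^bsub>A\<^esub> \<noteq> \<zero>\<^bsub>A\<^esub>" and J: "ideal J A" and Qf: "K_flat A Q" and u: "quasi_iso A P Q u"
    and bd: "\<And>i. b < i \<Longrightarrow> carrier (obj P i) = {\<zero>\<^bsub>obj P i\<^esub>}" and free: "\<And>i. is_free A (obj P i)"
    and x: "x \<in> carrier (obj (cone P Q u) n)" and dx: "dif (cone P Q u) n x \<in> ideal_mult J (obj (cone P Q u) (n + 1))"
  shows "\<exists>y\<in>carrier (obj (cone P Q u) (n - 1)).
    x \<ominus>\<^bsub>obj (cone P Q u) n\<^esub> dif (cone P Q u) (n - 1) y \<in> ideal_mult J (obj (cone P Q u) n)"
proof -
  note P = quasi_isoD(1)[OF u] and Q = quasi_isoD(2)[OF u] and uc = quasi_isoD(3)[OF u]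
  have A: "cring A" by (rule module_cring[OF cx_module[OF P]])
  obtain N :: "('a, 'a list) cx" and e where N: "acyclic_cx A N" and Nf: "\<And>p. p \<le> 0 \<Longrightarrow> is_free A (obj N p)"
    and cyc: "cyclic_quot A J (obj N 1) e" and de: "dif N 1 e = \<zero>\<^bsub>obj N 2\<^esub>"
    using cyclic_resolution[OF A ne J] by blast
  have Nc: "cochain_complex A N" and Nex: "\<And>i. exact_at N i" using N by (auto simp: acyclic_iff)
  note SP = shift_complex[OF P]
  have exQ: "exact_at (tensor_cx A Q N) i" for i
    using Qf N unfolding K_flat_def acyclic_iff by blast
  have exP: "exact_at (tensor_cx A (shift P) N) i" for i
  proof (rule tensor_cx_exact_rows[OF SP Nc, of "b - 1"])
    show "carrier (obj (shift P) m) = {\<zero>\<^bsub>obj (shift P) m\<^esub>}" if "b - 1 < m" for m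
      using bd[of "m + 1"] that by simp
    fix m p t assume t: "t \<in> carrier (tensor A (obj (shift P) m) (obj N p))"
      and 0: "dv A (shift P) N m p t = \<zero>\<^bsub>tensor A (obj (shift P) m) (obj N (p + 1))\<^esub>"
    obtain B :: "'p set" and ee cc where db: "dual_basis A (obj (shift P) m) B ee cc"
      using is_free_dual_basis[OF cx_module[OF SP]] free by (metis shift_simps(1))
    have e: "p - 1 + 1 = p" by simp
    show "\<exists>s\<in>carrier (tensor A (obj (shift P) m) (obj N (p - 1))). t = dv A (shift P) N m (p - 1) s"
      unfolding dv_def e
      by (rule free_tensor_exact[OF cx_module[OF Nc] cx_module[OF Nc] cx_module[OF Nc] cx_module[OF SP]
            cx_dif'[OF Nc] cx_dif[OF Nc] exact_atD[OF Nex] db t 0[unfolded dv_def]])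
  qed
  show ?thesis
    by (rule exact_mod_cyclic[OF cone_complex[OF P Q uc] Nc cone_tensor_exact[OF P Q uc Nc exP exQ]
          cone_exact[OF P Q uc quasi_isoD(4,5)[OF u]] Nf cyc de x dx])
qed

subsection \<open>Passing to the limit\<close>

lemma ideal_mult_mono: "I \<subseteq> J \<Longrightarrow> x \<in> ideal_mult I M \<Longrightarrow> x \<in> ideal_mult J M"
  by (rotate_tac, induct rule: ideal_mult.induct) (auto intro: ideal_mult.intros)

lemma ideal_mult_diff:
  assumes M: "Module.module R M" and J: "ideal J R" and "x \<in> ideal_mult J M" "y \<in> ideal_mult J M"
  shows "x \<ominus>\<^bsub>M\<^esub> y \<in> ideal_mult J M"
  unfolding a_minus_def using assms Module.module.submoduleE(3,5)[OF M ideal_mult_submodule[OF M J]] by blast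

lemma ideal_mult_add:
  assumes M: "Module.module R M" and J: "ideal J R" and "x \<in> ideal_mult J M" "y \<in> ideal_mult J M"
  shows "x \<oplus>\<^bsub>M\<^esub> y \<in> ideal_mult J M"
  using assms Module.module.submoduleE(5)[OF M ideal_mult_submodule[OF M J]] by blast

text \<open>A complex that is exact modulo each member of a decreasing sequence of ideals has exact
  completion: a primitive modulo \<open>J (k + 1)\<close> can be corrected by a boundary so that it extends the
  primitive already chosen modulo \<open>J k\<close>.\<close>

lemma exact_mod_limit:
  assumes C: "cochain_complex A C" and J: "\<And>k. ideal (J k) A" and dec: "\<And>k. J (Suc k) \<subseteq> J k"
    and ex: "\<And>k n x. x \<in> carrier (obj C n) \<Longrightarrow> dif C n x \<in> ideal_mult (J k) (obj C (n + 1)) \<Longrightarrow>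
      \<exists>y\<in>carrier (obj C (n - 1)). x \<ominus>\<^bsub>obj C n\<^esub> dif C (n - 1) y \<in> ideal_mult (J k) (obj C n)"
    and x: "\<And>k. x k \<in> carrier (obj C n)" and xs: "\<And>k. x (Suc k) \<ominus>\<^bsub>obj C n\<^esub> x k \<in> ideal_mult (J k) (obj C n)"
    and dx: "\<And>k. dif C n (x k) \<in> ideal_mult (J k) (obj C (n + 1))"
  obtains y :: "nat \<Rightarrow> 'm" where "\<And>k. y k \<in> carrier (obj C (n - 1))"
    and "\<And>k. y (Suc k) \<ominus>\<^bsub>obj C (n - 1)\<^esub> y k \<in> ideal_mult (J k) (obj C (n - 1))"
    and "\<And>k. x k \<ominus>\<^bsub>obj C n\<^esub> dif C (n - 1) (y k) \<in> ideal_mult (J k) (obj C n)"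
proof -
  note Cm = cx_module[OF C]
  interpret C0: Module.module A "obj C n" by (rule Cm)
  interpret C1: Module.module A "obj C (n - 1)" by (rule Cm)
  define P where "P k y \<longleftrightarrow> y \<in> carrier (obj C (n - 1)) \<and> x k \<ominus>\<^bsub>obj C n\<^esub> dif C (n - 1) y \<in> ideal_mult (J k) (obj C n)" for k y
  define Q where "Q k y y' \<longleftrightarrow> y' \<ominus>\<^bsub>obj C (n - 1)\<^esub> y \<in> ideal_mult (J k) (obj C (n - 1))" for k y y'
  have "\<exists>y. \<forall>k. P k (y k) \<and> Q k (y k) (y (Suc k))"
  proof (rule dependent_nat_choice)
    show "\<exists>y. P 0 y" using ex[OF x dx, of 0] by (auto simp: P_def)
    fix y k assume "P k y"
    then have y: "y \<in> carrier (obj C (n - 1))" and xy: "x k \<ominus>\<^bsub>obj C n\<^esub> dif C (n - 1) y \<in> ideal_mult (J k) (obj C n)"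
      by (auto simp: P_def)
    obtain y' where y': "y' \<in> carrier (obj C (n - 1))"
      "x (Suc k) \<ominus>\<^bsub>obj C n\<^esub> dif C (n - 1) y' \<in> ideal_mult (J (Suc k)) (obj C n)"
      using ex[OF x dx] by blast
    have d: "dif C (n - 1) y \<in> carrier (obj C n)" "dif C (n - 1) y' \<in> carrier (obj C n)"
      by (rule mod_hom_closed[OF cx_dif'[OF C] y] mod_hom_closed[OF cx_dif'[OF C] y'(1)])+
    have "dif C (n - 1) (y' \<ominus>\<^bsub>obj C (n - 1)\<^esub> y) =
        ((x k \<ominus>\<^bsub>obj C n\<^esub> dif C (n - 1) y) \<ominus>\<^bsub>obj C n\<^esub> (x (Suc k) \<ominus>\<^bsub>obj C n\<^esub> dif C (n - 1) y')) \<oplus>\<^bsub>obj C n\<^esub>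
        (x (Suc k) \<ominus>\<^bsub>obj C n\<^esub> x k)"
      unfolding mod_hom_diff[OF cx_dif'[OF C] Cm Cm y'(1) y] using d x[of k] x[of "Suc k"] by algebra
    then have "dif C (n - 1) (y' \<ominus>\<^bsub>obj C (n - 1)\<^esub> y) \<in> ideal_mult (J k) (obj C n)"
      using ideal_mult_add[OF Cm J ideal_mult_diff[OF Cm J xy ideal_mult_mono[OF dec y'(2)]] xs] by simp
    then obtain v where v: "v \<in> carrier (obj C (n - 1 - 1))"
      "(y' \<ominus>\<^bsub>obj C (n - 1)\<^esub> y) \<ominus>\<^bsub>obj C (n - 1)\<^esub> dif C (n - 1 - 1) v \<in> ideal_mult (J k) (obj C (n - 1))"
      using ex[OF C1.M.minus_closed[OF y'(1) y], of k] by auto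
    let ?y = "y' \<ominus>\<^bsub>obj C (n - 1)\<^esub> dif C (n - 1 - 1) v"
    have dv: "dif C (n - 1 - 1) v \<in> carrier (obj C (n - 1))" by (rule mod_hom_closed[OF cx_dif'[OF C] v(1)])
    have ddv: "dif C (n - 1) (dif C (n - 1 - 1) v) = \<zero>\<^bsub>obj C n\<^esub>" using cx_dd'[OF C v(1)] by simp
    have "?y \<ominus>\<^bsub>obj C (n - 1)\<^esub> y = (y' \<ominus>\<^bsub>obj C (n - 1)\<^esub> y) \<ominus>\<^bsub>obj C (n - 1)\<^esub> dif C (n - 1 - 1) v"
      using y y'(1) dv by algebra
    moreover have "dif C (n - 1) ?y = dif C (n - 1) y'"
      unfolding mod_hom_diff[OF cx_dif'[OF C] Cm Cm y'(1) dv] ddv by (rule C0.M.diff_zero[OF d(2)])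
    ultimately have "P (Suc k) ?y \<and> Q k y ?y" using y' v dv by (simp add: P_def Q_def)
    then show "\<exists>y'. P (Suc k) y' \<and> Q k y y'" by blast
  qed
  then show thesis using that by (auto simp: P_def Q_def)
qed

section \<open>Adic completion\<close>

lemma ipow_simps:
  "ipow A I 0 = carrier A" "ipow A I (Suc k) = ideal_prod A (ipow A I k) I"
  by (simp_all add: ipow_def nat_pow_def ideals_set_def)

lemma ipow_ideal:
  assumes A: "cring A" and I: "ideal I A" shows "ideal (ipow A I k) A"
proof -
  interpret A: cring A by fact
  show ?thesis by (induct k) (simp_all add: ipow_simps A.oneideal A.ideal_prod_is_ideal I)
qed

lemma ipow_dec:
  assumes A: "cring A" and I: "ideal I A" shows "ipow A I (Suc k) \<subseteq> ipow A I k"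
proof -
  interpret A: cring A by fact
  show ?thesis using A.ideal_prod_inter[OF ipow_ideal[OF A I] I] by (auto simp: ipow_simps)
qed

text \<open>\<open>lam A I M k m\<close> is the element \<open>1 \<otimes> m\<close>, i.e. the class of \<open>m\<close> modulo \<open>I\<^sup>k\<^sup>+\<^sup>1\<close>; an element of the
  completion is a sequence of such classes.\<close>

definition lam :: "'a ring \<Rightarrow> 'a set \<Rightarrow> ('a, 'm) module \<Rightarrow> nat \<Rightarrow> 'm \<Rightarrow> ('a set \<times> 'm \<Rightarrow> 'a) set"
  where "lam A I M k = tensor_elt A (quot_alg A (ipow A I (k + 1))) M \<one>\<^bsub>A Quot ipow A I (k + 1)\<^esub>"

definition lim_trans :: "'a ring \<Rightarrow> 'a set \<Rightarrow> ('a, 'm) module \<Rightarrow> nat \<Rightarrow> ('a set \<times> 'm \<Rightarrow> 'a) set \<Rightarrow> ('a set \<times> 'm \<Rightarrow> 'a) set"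
  where "lim_trans A I M k = tensor_map A (quot_alg A (ipow A I (k + 1))) M (quot_map A (ipow A I (k + 1)) id) id"

context
  fixes A :: "'a ring" and I :: "'a set"
  assumes A: "cring A" and I: "ideal I A"
begin

interpretation A: cring A by (rule A)

private abbreviation (input) J :: "nat \<Rightarrow> 'a set" where "J k \<equiv> ipow A I (k + 1)"
private abbreviation (input) E :: "nat \<Rightarrow> ('a, 'a set) module" where "E k \<equiv> quot_alg A (ipow A I (k + 1))"
private abbreviation (input) e :: "nat \<Rightarrow> 'a set" where "e k \<equiv> \<one>\<^bsub>A Quot ipow A I (k + 1)\<^esub>"

lemma pow_ideal: "ideal (J k) A" by (rule ipow_ideal[OF A I])
lemma pow_dec: "J (Suc k) \<subseteq> J k" using ipow_dec[OF A I, of "k + 1"] by simp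

lemma pow_cyclic: "cyclic_quot A (J k) (E k) (e k)" by (rule quot_alg_cyclic(1)[OF A pow_ideal])
lemma pow_module: "Module.module A (E k)" and pow_one: "e k \<in> carrier (E k)"
  using pow_cyclic by (auto simp: cyclic_quot_def)

lemma pow_proj: "quot_map A (J k) id \<in> mod_hom A (E (Suc k)) (E k)"
  and pow_proj_one: "quot_map A (J k) id (e (Suc k)) = e k"
proof -
  have ab: "abelian_subgroup (J k) A" for k
    by (rule abelian_subgroupI3[OF ideal.axioms(1)[OF pow_ideal] A.is_abelian_group])
  have q: "quot_map A (J k) id (J (Suc k) +>\<^bsub>A\<^esub> a) = J k +>\<^bsub>A\<^esub> a" if "a \<in> carrier A" for a
    using quot_map_coset[OF ab ab, of id "Suc k" k a] pow_dec[of k] that by auto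
  have one: "e k = J k +>\<^bsub>A\<^esub> \<one>\<^bsub>A\<^esub>" for k by (simp add: FactRing_def)
  show "quot_map A (J k) id (e (Suc k)) = e k" unfolding one by (rule q) simp
  have car: "carrier (E k) = (\<lambda>r. J k +>\<^bsub>A\<^esub> r) ` carrier A" for k by (rule quot_alg_carrier[OF A pow_ideal])
  have ad: "(J k +>\<^bsub>A\<^esub> x) \<oplus>\<^bsub>E k\<^esub> (J k +>\<^bsub>A\<^esub> y) = J k +>\<^bsub>A\<^esub> (x \<oplus>\<^bsub>A\<^esub> y)"
    if "x \<in> carrier A" "y \<in> carrier A" for x y k
    unfolding quot_alg_def module_of_simps FactRing_def ring.simps by (rule abelian_subgroup.a_rcos_sum[OF ab that])
  have sm: "x \<odot>\<^bsub>E k\<^esub> (J k +>\<^bsub>A\<^esub> y) = J k +>\<^bsub>A\<^esub> (x \<otimes>\<^bsub>A\<^esub> y)"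
    if "x \<in> carrier A" "y \<in> carrier A" for x y k
    using ideal.rcoset_mult_add[OF pow_ideal[of k] that] by (simp add: quot_alg_def FactRing_def)
  show "quot_map A (J k) id \<in> mod_hom A (E (Suc k)) (E k)"
    by (rule mod_homI) (unfold car, auto simp: q ad sm simp del: One_nat_def add_Suc add_Suc_right Suc_eq_plus1[symmetric])
qed

context
  fixes M :: "('a, 'm) module"
  assumes M: "Module.module A M"
begin

interpretation M: Module.module A M by (rule M)

lemma lam_tensor_module: "Module.module A (tensor A (E k) M)" by (rule tensor_module[OF pow_module M])

lemma lam_hom: "lam A I M k \<in> mod_hom A M (tensor A (E k) M)"
  unfolding lam_def by (rule tensor_elt_hom_right[OF pow_module M pow_one])

lemma lam_surj: "t \<in> carrier (tensor A (E k) M) \<Longrightarrow> \<exists>m\<in>carrier M. t = lam A I M k m"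
  unfolding lam_def by (rule cyclic_tensor_surj[OF pow_cyclic M])

lemma lam_eq_iff: "m \<in> carrier M \<Longrightarrow> n \<in> carrier M \<Longrightarrow>
    lam A I M k m = lam A I M k n \<longleftrightarrow> m \<ominus>\<^bsub>M\<^esub> n \<in> ideal_mult (J k) M"
  unfolding lam_def by (rule cyclic_tensor_eq_iff[OF pow_cyclic M])

lemma lam_zero_iff: "m \<in> carrier M \<Longrightarrow>
    lam A I M k m = \<zero>\<^bsub>tensor A (E k) M\<^esub> \<longleftrightarrow> m \<in> ideal_mult (J k) M"
  unfolding lam_def by (rule cyclic_tensor_zero_iff[OF pow_cyclic M])

lemma lim_trans_hom: "lim_trans A I M k \<in> mod_hom A (tensor A (E (Suc k)) M) (tensor A (E k) M)"
  unfolding lim_trans_def by (rule tensor_map_hom(1)[OF pow_module M pow_module M pow_proj mod_hom_id(2)])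

lemma lim_trans_lam: "m \<in> carrier M \<Longrightarrow> lim_trans A I M k (lam A I M (Suc k) m) = lam A I M k m"
  unfolding lim_trans_def lam_def
  using tensor_map_hom(2)[OF pow_module M pow_module M pow_proj mod_hom_id(2) pow_one]
  by (simp add: pow_proj_one del: Suc_eq_plus1_left One_nat_def add_Suc add_Suc_right)

lemma Lam_simps:
  "x \<in> carrier (Lam A I M) \<longleftrightarrow> (\<forall>k. x k \<in> carrier (tensor A (E k) M)) \<and> (\<forall>k. lim_trans A I M k (x (Suc k)) = x k)"
  "x \<oplus>\<^bsub>Lam A I M\<^esub> y = (\<lambda>k. x k \<oplus>\<^bsub>tensor A (E k) M\<^esub> y k)"
  "\<zero>\<^bsub>Lam A I M\<^esub> = (\<lambda>k. \<zero>\<^bsub>tensor A (E k) M\<^esub>)"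
  "r \<odot>\<^bsub>Lam A I M\<^esub> x = (\<lambda>k. r \<odot>\<^bsub>tensor A (E k) M\<^esub> x k)"
  by (simp_all add: Lam_def inv_lim_def lim_trans_def)

lemma Lam_module: "Module.module A (Lam A I M)"
  and Lam_comp_hom: "(\<lambda>x. x k) \<in> mod_hom A (Lam A I M) (tensor A (E k) M)"
proof -
  note T = lam_tensor_module
  note t = lim_trans_hom
  have ag: "abelian_group (tensor A (E k) M)" for k by (rule moduleD(2)[OF T])
  have am: "abelian_monoid (tensor A (E k) M)" for k using ag by (simp add: abelian_group_def)
  have neg: "\<exists>y\<in>carrier (Lam A I M). \<forall>k\<in>UNIV. y k = \<ominus>\<^bsub>tensor A (E k) M\<^esub> x k" if x: "x \<in> carrier (Lam A I M)" for x
    by (rule bexI[of _ "\<lambda>k. \<ominus>\<^bsub>tensor A (E k) M\<^esub> x k"])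
      (use x in \<open>auto simp only: Lam_simps mod_hom_neg[OF t T T] intro: abelian_group.a_inv_closed[OF ag]\<close>)
  have J: "Module.module A (Lam A I M) \<and> (\<forall>k. (\<lambda>x. x k) \<in> mod_hom A (Lam A I M) (tensor A (E k) M))"
  proof (rule conjI)
    show "Module.module A (Lam A I M)"
      by (rule module_of_joint_inj(1)[OF A, of UNIV "\<lambda>k. tensor A (E k) M" "Lam A I M" "\<lambda>k x. x k", OF T _ _ _ _ neg])
        (auto simp only: Lam_simps mod_hom_add[OF t] mod_hom_smult[OF t] mod_hom_zero[OF t T T] abelian_monoid.a_closed[OF am]
         module.smult_closed[OF T] abelian_monoid.zero_closed[OF am])
    show "\<forall>k. (\<lambda>x. x k) \<in> mod_hom A (Lam A I M) (tensor A (E k) M)"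
      by (auto intro!: mod_homI simp only: Lam_simps)
  qed
  then show "Module.module A (Lam A I M)" "(\<lambda>x. x k) \<in> mod_hom A (Lam A I M) (tensor A (E k) M)" by auto
qed

lemma Lam_of_lift:
  assumes m: "\<And>k. m k \<in> carrier M" and s: "\<And>k. m (Suc k) \<ominus>\<^bsub>M\<^esub> m k \<in> ideal_mult (J k) M"
  shows "(\<lambda>k. lam A I M k (m k)) \<in> carrier (Lam A I M)"
  using m s by (simp only: Lam_simps mod_hom_closed[OF lam_hom] lim_trans_lam lam_eq_iff simp_thms)

lemma Lam_lift:
  assumes x: "x \<in> carrier (Lam A I M)"
  shows "\<exists>m. (\<forall>k. m k \<in> carrier M) \<and> x = (\<lambda>k. lam A I M k (m k)) \<and>
    (\<forall>k. m (Suc k) \<ominus>\<^bsub>M\<^esub> m k \<in> ideal_mult (J k) M)"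
proof -
  have xc: "x k \<in> carrier (tensor A (E k) M)" "lim_trans A I M k (x (Suc k)) = x k" for k
    using x unfolding Lam_simps by blast+
  have "\<exists>m. m \<in> carrier M \<and> x k = lam A I M k m" for k using lam_surj[OF xc(1)[of k]] by blast
  then obtain m where m: "\<And>k. m k \<in> carrier M" "\<And>k. x k = lam A I M k (m k)" by metis
  have "lam A I M k (m (Suc k)) = lam A I M k (m k)" for k
    using xc(2)[of k] unfolding m(2) lim_trans_lam[OF m(1)] .
  then have "\<forall>k. m (Suc k) \<ominus>\<^bsub>M\<^esub> m k \<in> ideal_mult (J k) M" using lam_eq_iff[OF m(1) m(1)] by blast
  moreover have "x = (\<lambda>k. lam A I M k (m k))" using m(2) by (rule ext)
  ultimately show ?thesis using m(1) by blast
qed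

lemma tau_eq: "tau A I M x = (\<lambda>k. lam A I M k x)"
  by (simp add: tau_def lam_def)

lemma tau_hom: "tau A I M \<in> mod_hom A M (Lam A I M)"
proof (rule mod_homI)
  show "tau A I M x \<in> carrier (Lam A I M)" if "x \<in> carrier M" for x
    unfolding tau_eq using that by (simp only: Lam_simps mod_hom_closed[OF lam_hom] lim_trans_lam simp_thms)
qed (auto simp only: tau_eq Lam_simps mod_hom_add[OF lam_hom] mod_hom_smult[OF lam_hom])

text \<open>The component \<open>k\<close> of the completion is a module over \<open>A/I\<^sup>k\<^sup>+\<^sup>1\<close>, so every homomorphism to the
  completion is continuous for the \<open>I\<close>-adic topology.\<close>

lemma Lam_comp_ideal_mult:
  assumes K: "Module.module A K" and h: "h \<in> mod_hom A K (Lam A I M)" and x: "x \<in> ideal_mult (J k) K"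
  shows "h x k = \<zero>\<^bsub>tensor A (E k) M\<^esub>"
proof -
  note T = lam_tensor_module
  have hk: "(\<lambda>x. h x k) \<in> mod_hom A K (tensor A (E k) M)" by (rule mod_hom_comp[OF h Lam_comp_hom])
  have "x \<in> {x \<in> carrier K. h x k = \<zero>\<^bsub>tensor A (E k) M\<^esub>}"
  proof (rule ideal_mult_least[OF K submodule_kernel[OF K T hk] _ x])
    fix j y assume j: "j \<in> J k" and y: "y \<in> carrier K"
    have jA: "j \<in> carrier A" by (rule ideal.Icarr[OF pow_ideal j])
    obtain m where m: "m \<in> carrier M" "h y k = lam A I M k m" using lam_surj[OF mod_hom_closed[OF hk y]] by blast
    have "h (j \<odot>\<^bsub>K\<^esub> y) k = lam A I M k (j \<odot>\<^bsub>M\<^esub> m)"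
      unfolding mod_hom_smult[OF hk jA y] m(2) mod_hom_smult[OF lam_hom jA m(1)] ..
    also have "\<dots> = \<zero>\<^bsub>tensor A (E k) M\<^esub>"
      using lam_zero_iff[OF M.smult_closed[OF jA m(1)]] ideal_mult_incl[OF M pow_ideal j m(1)] by blast
    finally show "j \<odot>\<^bsub>K\<^esub> y \<in> {x \<in> carrier K. h x k = \<zero>\<^bsub>tensor A (E k) M\<^esub>}"
      using module.smult_closed[OF K jA y] by simp
  qed
  then show ?thesis by simp
qed

end

lemma Lam_map:
  assumes M: "Module.module A M" and N: "Module.module A N" and f: "f \<in> mod_hom A M N"
  shows Lam_map_hom: "Lam_map A I N f \<in> mod_hom A (Lam A I M) (Lam A I N)"
    and Lam_map_lam: "m \<in> carrier M \<Longrightarrow> tensor_map A (E k) N id f (lam A I M k m) = lam A I N k (f m)"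
    and Lam_map_comp_hom: "tensor_map A (E k) N id f \<in> mod_hom A (tensor A (E k) M) (tensor A (E k) N)"
proof -
  note I' = mod_hom_id(2)
  note h = tensor_map_hom[OF pow_module M pow_module N I' f]
  show "tensor_map A (E k) N id f \<in> mod_hom A (tensor A (E k) M) (tensor A (E k) N)" for k by (rule h(1))
  show "m \<in> carrier M \<Longrightarrow> tensor_map A (E k) N id f (lam A I M k m) = lam A I N k (f m)"
    unfolding lam_def by (simp only: h(2)[OF pow_one] id_apply)
  have tr: "lim_trans A I N k (tensor_map A (E (Suc k)) N id f t) = tensor_map A (E k) N id f (lim_trans A I M k t)"
    if t: "t \<in> carrier (tensor A (E (Suc k)) M)" for k t
  proof -
    have "lim_trans A I N k (tensor_map A (E (Suc k)) N id f t) = tensor_map A (E k) N (quot_map A (J k) id) f t"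
      unfolding lim_trans_def
      by (rule tensor_map_comp[OF pow_module M pow_module N pow_module N I' f pow_proj I' _ _ t]) simp_all
    also have "\<dots> = tensor_map A (E k) N id f (lim_trans A I M k t)"
      unfolding lim_trans_def
      by (rule tensor_map_comp[OF pow_module M pow_module M pow_module N pow_proj I' I' f _ _ t, symmetric]) simp_all
    finally show ?thesis .
  qed
  show "Lam_map A I N f \<in> mod_hom A (Lam A I M) (Lam A I N)"
  proof (rule mod_homI)
    show "Lam_map A I N f x \<in> carrier (Lam A I N)" if x: "x \<in> carrier (Lam A I M)" for x
      using x unfolding Lam_simps[OF M] Lam_simps[OF N] Lam_map_def by (simp only: tr mod_hom_closed[OF h(1)] simp_thms)
    show "Lam_map A I N f (x \<oplus>\<^bsub>Lam A I M\<^esub> y) = Lam_map A I N f x \<oplus>\<^bsub>Lam A I N\<^esub> Lam_map A I N f y"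
      if "x \<in> carrier (Lam A I M)" "y \<in> carrier (Lam A I M)" for x y
      using that unfolding Lam_simps[OF M] Lam_simps[OF N] Lam_map_def by (simp only: mod_hom_add[OF h(1)])
    show "Lam_map A I N f (r \<odot>\<^bsub>Lam A I M\<^esub> x) = r \<odot>\<^bsub>Lam A I N\<^esub> Lam_map A I N f x"
      if "r \<in> carrier A" "x \<in> carrier (Lam A I M)" for r x
      using that unfolding Lam_simps[OF M] Lam_simps[OF N] Lam_map_def by (simp only: mod_hom_smult[OF h(1)])
  qed
qed

lemma Lam_map_lift:
  assumes "Module.module A M" "Module.module A N" "f \<in> mod_hom A M N" "\<And>k. m k \<in> carrier M"
  shows "Lam_map A I N f (\<lambda>k. lam A I M k (m k)) = (\<lambda>k. lam A I N k (f (m k)))"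
  unfolding Lam_map_def Lam_map_lam[OF assms(1-3) assms(4)] ..

lemma Lam_cx_simps: "obj (Lam_cx A I C) i = Lam A I (obj C i)"
  "dif (Lam_cx A I C) i = Lam_map A I (obj C (i + 1)) (dif C i)"
  by (simp_all add: Lam_cx_def)

lemma Lam_cx_complex:
  assumes C: "cochain_complex A C" shows "cochain_complex A (Lam_cx A I C)"
proof (rule cochain_complexI)
  note Cm = cx_module[OF C] and d = cx_dif[OF C]
  show "Module.module A (obj (Lam_cx A I C) i)" for i unfolding Lam_cx_simps by (rule Lam_module[OF Cm])
  show "dif (Lam_cx A I C) i \<in> mod_hom A (obj (Lam_cx A I C) i) (obj (Lam_cx A I C) (i + 1))" for i
    unfolding Lam_cx_simps by (rule Lam_map_hom[OF Cm Cm d])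
  fix i x assume "x \<in> carrier (obj (Lam_cx A I C) i)"
  then have x: "x \<in> carrier (Lam A I (obj C i))" by (simp only: Lam_cx_simps)
  from Lam_lift[OF Cm x] obtain m where m': "\<forall>k. m k \<in> carrier (obj C i)"
    and xe: "x = (\<lambda>k. lam A I (obj C i) k (m k))" by (elim exE conjE)
  note m = m'[rule_format]
  show "dif (Lam_cx A I C) (i + 1) (dif (Lam_cx A I C) i x) = \<zero>\<^bsub>obj (Lam_cx A I C) (i + 1 + 1)\<^esub>"
    unfolding Lam_cx_simps xe Lam_map_lift[OF Cm Cm d m] Lam_map_lift[OF Cm Cm d mod_hom_closed[OF d m]]
      cx_dd[OF C m] Lam_simps[OF Cm] mod_hom_zero[OF lam_hom[OF Cm] Cm lam_tensor_module[OF Cm]] ..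
qed

lemma tau_cx_chain:
  assumes C: "cochain_complex A C" shows "chain_map A C (Lam_cx A I C) (tau_cx A I C)"
  unfolding chain_map_def
proof (intro allI conjI ballI)
  note Cm = cx_module[OF C] and d = cx_dif[OF C]
  show "tau_cx A I C i \<in> mod_hom A (obj C i) (obj (Lam_cx A I C) i)" for i
    unfolding tau_cx_def Lam_cx_simps by (rule tau_hom[OF Cm])
  show "tau_cx A I C (i + 1) (dif C i x) = dif (Lam_cx A I C) i (tau_cx A I C i x)" if "x \<in> carrier (obj C i)" for i x
    unfolding tau_cx_def Lam_cx_simps tau_eq[OF Cm] using Lam_map_lift[OF Cm Cm d that] by simp
qed

lemma Lam_cx_map_chain:
  assumes C: "cochain_complex A C" and D: "cochain_complex A D" and f: "chain_map A C D f"
  shows "chain_map A (Lam_cx A I C) (Lam_cx A I D) (\<lambda>i. Lam_map A I (obj D i) (f i))"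
  unfolding chain_map_def
proof (intro allI conjI ballI)
  note Cm = cx_module[OF C] and Dm = cx_module[OF D] and fh = chain_mapD(1)[OF f]
  show "Lam_map A I (obj D i) (f i) \<in> mod_hom A (obj (Lam_cx A I C) i) (obj (Lam_cx A I D) i)" for i
    unfolding Lam_cx_simps by (rule Lam_map_hom[OF Cm Dm fh])
  fix i x assume "x \<in> carrier (obj (Lam_cx A I C) i)"
  then have x: "x \<in> carrier (Lam A I (obj C i))" by (simp only: Lam_cx_simps)
  from Lam_lift[OF Cm x] obtain m where m': "\<forall>k. m k \<in> carrier (obj C i)"
    and xe: "x = (\<lambda>k. lam A I (obj C i) k (m k))" by (elim exE conjE)
  note m = m'[rule_format]
  show "Lam_map A I (obj D (i + 1)) (f (i + 1)) (dif (Lam_cx A I C) i x) =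
      dif (Lam_cx A I D) i (Lam_map A I (obj D i) (f i) x)"
    unfolding Lam_cx_simps xe Lam_map_lift[OF Cm Cm cx_dif[OF C] m] Lam_map_lift[OF Cm Dm fh m]
      Lam_map_lift[OF Cm Dm fh mod_hom_closed[OF cx_dif[OF C] m]]
      Lam_map_lift[OF Dm Dm cx_dif[OF D] mod_hom_closed[OF fh m]] chain_mapD(2)[OF f m] ..
qed

text \<open>If a cocycle \<open>x\<close> of \<open>\<Lambda>(P)\<close> becomes a boundary \<open>d y\<close> in \<open>\<Lambda>(Q)\<close>, then \<open>(x, -y)\<close> is a cocycle of the completed
  cone. When the cone is exact modulo all powers of \<open>I\<close>, this cocycle is a boundary by
  \<open>exact_mod_limit\<close>, and so is its first component \<open>x\<close>.\<close>

lemma Lam_map_cohom_inj: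
  fixes P :: "('a, 'p) cx" and Q :: "('a, 'q) cx"
  assumes P: "cochain_complex A P" and Q: "cochain_complex A Q" and u: "chain_map A P Q u"
    and ex: "\<And>k n x. x \<in> carrier (obj (cone P Q u) n) \<Longrightarrow>
      dif (cone P Q u) n x \<in> ideal_mult (J k) (obj (cone P Q u) (n + 1)) \<Longrightarrow>
      \<exists>y\<in>carrier (obj (cone P Q u) (n - 1)).
        x \<ominus>\<^bsub>obj (cone P Q u) n\<^esub> dif (cone P Q u) (n - 1) y \<in> ideal_mult (J k) (obj (cone P Q u) n)"
  shows "cohom_inj (Lam_cx A I P) (Lam_cx A I Q) (\<lambda>i. Lam_map A I (obj Q i) (u i)) n"
  unfolding cohom_inj_def
proof (intro ballI impI)
  note Pm = cx_module[OF P] and Qm = cx_module[OF Q] and uh = chain_mapD(1)[OF u]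
  fix x assume x: "x \<in> cocycles (Lam_cx A I P) n"
    and "Lam_map A I (obj Q n) (u n) x \<in> coboundaries (Lam_cx A I Q) n"
  then obtain y where y: "y \<in> carrier (Lam A I (obj Q (n - 1)))"
    "Lam_map A I (obj Q n) (u n) x = Lam_map A I (obj Q n) (dif Q (n - 1)) y"
    by (auto simp: coboundaries_def Lam_cx_simps)
  have xc: "x \<in> carrier (Lam A I (obj P n))" "Lam_map A I (obj P (n + 1)) (dif P n) x = \<zero>\<^bsub>Lam A I (obj P (n + 1))\<^esub>"
    using x by (auto simp: cocycles_def Lam_cx_simps)
  from Lam_lift[OF Pm xc(1)] obtain \<xi> where \<xi>': "\<forall>k. \<xi> k \<in> carrier (obj P n)"
    and xe: "x = (\<lambda>k. lam A I (obj P n) k (\<xi> k))"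
    and \<xi>'': "\<forall>k. \<xi> (Suc k) \<ominus>\<^bsub>obj P n\<^esub> \<xi> k \<in> ideal_mult (J k) (obj P n)" by (elim exE conjE)
  from Lam_lift[OF Qm y(1)] obtain \<eta> where \<eta>': "\<forall>k. \<eta> k \<in> carrier (obj Q (n - 1))"
    and ye: "y = (\<lambda>k. lam A I (obj Q (n - 1)) k (\<eta> k))"
    and \<eta>'': "\<forall>k. \<eta> (Suc k) \<ominus>\<^bsub>obj Q (n - 1)\<^esub> \<eta> k \<in> ideal_mult (J k) (obj Q (n - 1))" by (elim exE conjE)
  note \<xi> = \<xi>'[rule_format] \<xi>''[rule_format] and \<eta> = \<eta>'[rule_format] \<eta>''[rule_format]
  interpret P0: Module.module A "obj P n" by (rule Pm)
  interpret P1: Module.module A "obj P (n + 1)" by (rule Pm)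
  interpret Q0: Module.module A "obj Q n" by (rule Qm)
  interpret Q': Module.module A "obj Q (n - 1)" by (rule Qm)
  have d\<xi>: "dif P n (\<xi> k) \<in> ideal_mult (J k) (obj P (n + 1))" for k
    using fun_cong[OF xc(2), of k] unfolding xe Lam_map_lift[OF Pm Pm cx_dif[OF P] \<xi>(1)] Lam_simps[OF Pm]
    using lam_zero_iff[OF Pm mod_hom_closed[OF cx_dif[OF P] \<xi>(1)]] by blast
  have u\<xi>: "u n (\<xi> k) \<ominus>\<^bsub>obj Q n\<^esub> dif Q (n - 1) (\<eta> k) \<in> ideal_mult (J k) (obj Q n)" for k
    using fun_cong[OF y(2), of k] unfolding xe ye Lam_map_lift[OF Pm Qm uh \<xi>(1)] Lam_map_lift[OF Qm Qm cx_dif'[OF Q] \<eta>(1)]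
    using lam_eq_iff[OF Qm mod_hom_closed[OF uh \<xi>(1)] mod_hom_closed[OF cx_dif'[OF Q] \<eta>(1)]] by blast
  let ?C = "cone P Q u"
  let ?c = "\<lambda>k. (\<xi> k, \<ominus>\<^bsub>obj Q (n - 1)\<^esub> \<eta> k)"
  have e: "n - 1 + 1 = n" "n - 1 - 1 + 1 = n - 1" by simp_all
  note im = ideal_mult_prod[OF Pm Qm pow_ideal]
  have neg: "\<ominus>\<^bsub>M\<^esub> x \<in> ideal_mult (J k) M" if "Module.module A M" "x \<in> ideal_mult (J k) M" for k x and M :: "('a, 'z) module"
    using Module.module.submoduleE(3)[OF that(1) ideal_mult_submodule[OF that(1) pow_ideal] that(2)] .
  have cc: "?c k \<in> carrier (obj ?C (n - 1))" for k using \<xi>(1) \<eta>(1) by simp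
  have cs: "?c (Suc k) \<ominus>\<^bsub>obj ?C (n - 1)\<^esub> ?c k \<in> ideal_mult (J k) (obj ?C (n - 1))" for k
  proof -
    have "\<ominus>\<^bsub>obj Q (n - 1)\<^esub> \<eta> (Suc k) \<ominus>\<^bsub>obj Q (n - 1)\<^esub> (\<ominus>\<^bsub>obj Q (n - 1)\<^esub> \<eta> k) =
        \<ominus>\<^bsub>obj Q (n - 1)\<^esub> (\<eta> (Suc k) \<ominus>\<^bsub>obj Q (n - 1)\<^esub> \<eta> k)" using \<eta>(1)[of k] \<eta>(1)[of "Suc k"] by algebra
    then have "\<ominus>\<^bsub>obj Q (n - 1)\<^esub> \<eta> (Suc k) \<ominus>\<^bsub>obj Q (n - 1)\<^esub> (\<ominus>\<^bsub>obj Q (n - 1)\<^esub> \<eta> k) \<in> ideal_mult (J k) (obj Q (n - 1))"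
      using neg[OF Qm \<eta>(2)] by simp
    then show ?thesis
      using \<xi>(2) cc[of k] cc[of "Suc k"] unfolding cone_simps e prod_module_diff[OF Pm Qm cc[unfolded cone_simps e] cc[unfolded cone_simps e]] im
      by simp
  qed
  have cd: "dif ?C (n - 1) (?c k) \<in> ideal_mult (J k) (obj ?C (n - 1 + 1))" for k
  proof -
    have "u n (\<xi> k) \<oplus>\<^bsub>obj Q n\<^esub> dif Q (n - 1) (\<ominus>\<^bsub>obj Q (n - 1)\<^esub> \<eta> k) \<in> ideal_mult (J k) (obj Q n)"
      using u\<xi>[of k] by (simp add: mod_hom_neg[OF cx_dif'[OF Q] Qm Qm \<eta>(1)] a_minus_def)
    then show ?thesis using neg[OF Pm d\<xi>[of k]] unfolding cone_simps e im by simp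
  qed
  obtain w where w: "\<And>k. w k \<in> carrier (obj ?C (n - 1 - 1))"
    "\<And>k. w (Suc k) \<ominus>\<^bsub>obj ?C (n - 1 - 1)\<^esub> w k \<in> ideal_mult (J k) (obj ?C (n - 1 - 1))"
    "\<And>k. ?c k \<ominus>\<^bsub>obj ?C (n - 1)\<^esub> dif ?C (n - 1 - 1) (w k) \<in> ideal_mult (J k) (obj ?C (n - 1))"
    using exact_mod_limit[where J = J and C = ?C and x = ?c and n = "n - 1", OF cone_complex[OF P Q u] pow_ideal pow_dec ex cc cs cd] by blast
  interpret P': Module.module A "obj P (n - 1)" by (rule Pm)
  define p where "p k = \<ominus>\<^bsub>obj P (n - 1)\<^esub> fst (w k)" for k
  have wf: "fst (w k) \<in> carrier (obj P (n - 1))" for k using w(1)[of k] unfolding cone_simps e by auto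
  have pc: "p k \<in> carrier (obj P (n - 1))" for k using wf by (simp add: p_def)
  have ps: "p (Suc k) \<ominus>\<^bsub>obj P (n - 1)\<^esub> p k \<in> ideal_mult (J k) (obj P (n - 1))" for k
  proof -
    have "fst (w (Suc k)) \<ominus>\<^bsub>obj P (n - 1)\<^esub> fst (w k) \<in> ideal_mult (J k) (obj P (n - 1))"
      using w(2)[of k] unfolding cone_simps e
        prod_module_diff[OF Pm Qm w(1)[of "Suc k", unfolded cone_simps e] w(1)[of k, unfolded cone_simps e]] im by simp
    moreover have "p (Suc k) \<ominus>\<^bsub>obj P (n - 1)\<^esub> p k = \<ominus>\<^bsub>obj P (n - 1)\<^esub> (fst (w (Suc k)) \<ominus>\<^bsub>obj P (n - 1)\<^esub> fst (w k))"
      unfolding p_def using wf[of k] wf[of "Suc k"] by algebra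
    ultimately show ?thesis using neg[OF Pm] by simp
  qed
  have \<xi>p: "\<xi> k \<ominus>\<^bsub>obj P n\<^esub> dif P (n - 1) (p k) \<in> ideal_mult (J k) (obj P n)" for k
  proof -
    have dw: "dif ?C (n - 1 - 1) (w k) \<in> carrier (obj ?C (n - 1))"
      by (rule mod_hom_closed[OF cx_dif'[OF cone_complex[OF P Q u]] w(1)])
    have "\<xi> k \<ominus>\<^bsub>obj P n\<^esub> (\<ominus>\<^bsub>obj P n\<^esub> dif P (n - 1) (fst (w k))) \<in> ideal_mult (J k) (obj P n)"
      using w(3)[of k] unfolding cone_simps e
        prod_module_diff[OF Pm Qm cc[of k, unfolded cone_simps e] dw[unfolded cone_simps e]] im by simp
    then show ?thesis by (simp add: p_def mod_hom_neg[OF cx_dif'[OF P] Pm Pm wf])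
  qed
  let ?z = "\<lambda>k. lam A I (obj P (n - 1)) k (p k)"
  have z: "?z \<in> carrier (Lam A I (obj P (n - 1)))" by (rule Lam_of_lift[OF Pm pc ps])
  have "x = Lam_map A I (obj P n) (dif P (n - 1)) ?z"
    unfolding Lam_map_lift[OF Pm Pm cx_dif'[OF P] pc] xe
    using lam_eq_iff[OF Pm \<xi>(1) mod_hom_closed[OF cx_dif'[OF P] pc]] \<xi>p by blast
  then have "x = dif (Lam_cx A I P) (n - 1) ?z" by (simp add: Lam_cx_simps)
  then show "x \<in> coboundaries (Lam_cx A I P) n"
    unfolding coboundaries_def using z by (simp add: Lam_cx_simps)
qed

text \<open>In the square \<open>\<Lambda>(u) \<tau>\<^sub>P = \<tau>\<^sub>Q u\<close> the right-hand side is a quasi-isomorphism, and injectivity of \<open>\<Lambda>(u)\<close> on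
  cohomology makes both factors on the left bijective.\<close>

lemma tau_quasi_iso:
  fixes P :: "('a, 'p) cx" and Q :: "('a, 'q) cx"
  assumes u: "quasi_iso A P Q u" and tQ: "quasi_iso A Q (Lam_cx A I Q) (tau_cx A I Q)"
    and inj: "\<And>n. cohom_inj (Lam_cx A I P) (Lam_cx A I Q) (\<lambda>i. Lam_map A I (obj Q i) (u i)) n"
  shows "quasi_iso A P (Lam_cx A I P) (tau_cx A I P)"
  unfolding quasi_iso_iff
proof (intro conjI allI)
  note P = quasi_isoD(1)[OF u] and Q = quasi_isoD(2)[OF u] and uc = quasi_isoD(3)[OF u]
  note Pm = cx_module[OF P] and Qm = cx_module[OF Q] and uh = chain_mapD(1)[OF uc]
  show "cochain_complex A P" by (rule P)
  show LP: "cochain_complex A (Lam_cx A I P)" by (rule Lam_cx_complex[OF P])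
  show tc: "chain_map A P (Lam_cx A I P) (tau_cx A I P)" by (rule tau_cx_chain[OF P])
  note LQ = Lam_cx_complex[OF Q] and tcQ = tau_cx_chain[OF Q] and Lu = Lam_cx_map_chain[OF P Q uc]
  have nat: "Lam_map A I (obj Q i) (u i) (tau_cx A I P i p) = tau_cx A I Q i (u i p)" if "p \<in> carrier (obj P i)" for i p
    unfolding tau_cx_def tau_eq[OF Pm] tau_eq[OF Qm] using Lam_map_lift[OF Pm Qm uh that] by simp
  fix n
  let ?L = "Lam_map A I (obj Q n) (u n)"
  show "cohom_inj P (Lam_cx A I P) (tau_cx A I P) n"
    unfolding cohom_inj_def
  proof (intro ballI impI)
    fix p assume p: "p \<in> cocycles P n" and "tau_cx A I P n p \<in> coboundaries (Lam_cx A I P) n"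
    then have "?L (tau_cx A I P n p) \<in> coboundaries (Lam_cx A I Q) n" by (intro chain_map_coboundaries[OF Lu])
    then have "tau_cx A I Q n (u n p) \<in> coboundaries (Lam_cx A I Q) n" using nat cocycles_closed[OF P p] by simp
    then have "u n p \<in> coboundaries Q n"
      using quasi_isoD(4)[OF tQ, of n] chain_map_cocycles[OF Q P uc p] by (simp add: cohom_inj_def)
    then show "p \<in> coboundaries P n" using quasi_isoD(4)[OF u, of n] p by (simp add: cohom_inj_def)
  qed
  show "cohom_surj P (Lam_cx A I P) (tau_cx A I P) n"
    unfolding cohom_surj_def
  proof
    fix x assume x: "x \<in> cocycles (Lam_cx A I P) n"
    interpret LP0: Module.module A "obj (Lam_cx A I P) n" by (rule cx_module[OF LP])
    interpret LQ0: Module.module A "obj (Lam_cx A I Q) n" by (rule cx_module[OF LQ])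
    interpret Q0: Module.module A "obj Q n" by (rule Qm)
    have Lx: "?L x \<in> cocycles (Lam_cx A I Q) n" by (rule chain_map_cocycles[OF LQ LP Lu x])
    obtain q where q: "q \<in> cocycles Q n" "?L x \<ominus>\<^bsub>obj (Lam_cx A I Q) n\<^esub> tau_cx A I Q n q \<in> coboundaries (Lam_cx A I Q) n"
      using quasi_isoD(5)[OF tQ, of n] Lx unfolding cohom_surj_def by blast
    obtain p where p: "p \<in> cocycles P n" "q \<ominus>\<^bsub>obj Q n\<^esub> u n p \<in> coboundaries Q n"
      using quasi_isoD(5)[OF u, of n] q(1) unfolding cohom_surj_def by blast
    have pc: "p \<in> carrier (obj P n)" and qc: "q \<in> carrier (obj Q n)" using p q cocycles_closed[OF P] cocycles_closed[OF Q] by auto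
    have upc: "u n p \<in> carrier (obj Q n)" by (rule mod_hom_closed[OF uh pc])
    note tP = chain_mapD(1)[OF tc] and tQh = chain_mapD(1)[OF tcQ] and Lh = chain_mapD(1)[OF Lu]
    have tp: "tau_cx A I P n p \<in> cocycles (Lam_cx A I P) n" by (rule chain_map_cocycles[OF LP P tc p(1)])
    let ?x = "x \<ominus>\<^bsub>obj (Lam_cx A I P) n\<^esub> tau_cx A I P n p"
    have xc: "x \<in> carrier (obj (Lam_cx A I P) n)" "tau_cx A I P n p \<in> carrier (obj (Lam_cx A I P) n)"
      using x tp cocycles_closed[OF LP] by auto
    have xz: "?x \<in> cocycles (Lam_cx A I P) n"
      using x tp LP0.submoduleE(3,5)[OF cocycles_submodule[OF LP]] by (auto simp: a_minus_def)
    have cl: "?L x \<in> carrier (obj (Lam_cx A I Q) n)" "tau_cx A I Q n q \<in> carrier (obj (Lam_cx A I Q) n)"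
      "tau_cx A I Q n (u n p) \<in> carrier (obj (Lam_cx A I Q) n)"
      by (rule mod_hom_closed[OF Lh xc(1)] mod_hom_closed[OF tQh] qc upc)+
    have "?L ?x = (?L x \<ominus>\<^bsub>obj (Lam_cx A I Q) n\<^esub> tau_cx A I Q n q) \<oplus>\<^bsub>obj (Lam_cx A I Q) n\<^esub> tau_cx A I Q n (q \<ominus>\<^bsub>obj Q n\<^esub> u n p)"
      unfolding mod_hom_diff[OF Lh cx_module[OF LP] cx_module[OF LQ] xc] nat[OF pc] mod_hom_diff[OF tQh Qm cx_module[OF LQ] qc upc]
      using cl by algebra
    also have "\<dots> \<in> coboundaries (Lam_cx A I Q) n"
      by (rule LQ0.submoduleE(5)[OF coboundaries_submodule[OF LQ] q(2) chain_map_coboundaries[OF tcQ p(2)]])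
    finally have "?x \<in> coboundaries (Lam_cx A I P) n" using inj[of n] xz by (simp add: cohom_inj_def)
    then show "\<exists>p\<in>cocycles P n. x \<ominus>\<^bsub>obj (Lam_cx A I P) n\<^esub> tau_cx A I P n p \<in> coboundaries (Lam_cx A I P) n"
      using p(1) by blast
  qed
qed

end

section \<open>Bounded complexes of free modules\<close>

lemma is_free_transfer:
  fixes M :: "('a, 'm) module" and N :: "('a, 'n) module"
  assumes M: "Module.module R M" and "is_free R M" and N: "Module.module R N" and f: "f \<in> mod_hom R M N"
    and bij: "bij_betw f (carrier M) (carrier N)" and ne: "\<one>\<^bsub>R\<^esub> \<noteq> \<zero>\<^bsub>R\<^esub>"
  shows "is_free R N"
proof -
  obtain B where "lin_ext R M (\<lambda>b. b) \<in> mod_hom R (free_module R B) M"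
    "bij_betw (lin_ext R M (\<lambda>b. b)) (carrier (free_module R B)) (carrier M)"
    using is_free_iso[OF assms(1,2)] by blast
  from mod_hom_comp[OF this(1) f] bij_betw_trans[OF this(2) bij] show ?thesis
    by (intro is_freeI[OF N _ _ ne]) (auto simp: comp_def)
qed

lemma is_free_trivial:
  assumes M: "Module.module R M" and c: "carrier M = {\<zero>\<^bsub>M\<^esub>}" and ne: "\<one>\<^bsub>R\<^esub> \<noteq> \<zero>\<^bsub>R\<^esub>"
  shows "is_free R M"
proof -
  interpret M: Module.module R M by fact
  have "carrier (free_module R ({} :: 'b set)) = {\<zero>\<^bsub>free_module R ({} :: 'b set)\<^esub>}"
    by (auto simp: free_module_simps)
  then show ?thesis
    by (intro is_freeI[OF M mod_hom_const_zero[OF M] _ ne, of "{} :: 'b set"]) (simp add: bij_betw_def c)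
qed

text \<open>The filtration step with index \<open>j\<close> consists of the degrees above \<open>b - j\<close>. The differential raises the
  degree, so it maps each step to the preceding one.\<close>

lemma bounded_free_semi_free:
  assumes P: "cochain_complex A P" and bd: "\<And>i. b < i \<Longrightarrow> carrier (obj P i) = {\<zero>\<^bsub>obj P i\<^esub>}"
    and free: "\<And>i. is_free A (obj P i)" and ne: "\<one>\<^bsub>A\<^esub> \<noteq> \<zero>\<^bsub>A\<^esub>"
  shows "semi_free A P"
proof -
  note Pm = cx_module[OF P]
  have z: "\<zero>\<^bsub>obj P i\<^esub> \<in> carrier (obj P i)" for i
    using subgroup.one_closed[OF submodule.axioms(1)[OF Module.module.carrier_is_submodule[OF Pm]]] by simp
  define F where "F j i = (if b - int j < i then carrier (obj P i) else {\<zero>\<^bsub>obj P i\<^esub>})" for j :: nat and i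
  have sub: "submodule (F j i) A (obj P i)" for j i
  proof -
    interpret M: Module.module A "obj P i" by (rule Pm)
    show ?thesis unfolding F_def
      by (cases "b - int j < i") (auto intro: M.carrier_is_submodule submoduleI'[OF Pm])
  qed
  have mono: "F j i \<subseteq> F (Suc j) i" for j i using z by (auto simp: F_def)
  have quot: "is_free A (quot_module ((obj P i)\<lparr>carrier := F (Suc j) i\<rparr>) (F j i))" for j i
  proof -
    let ?M = "(obj P i)\<lparr>carrier := F (Suc j) i\<rparr>"
    note q = submodule_restrict(2,1)[OF Pm sub sub mono, of j i]
    note Q = quot_module_module[OF q]
    interpret M: Module.module A "obj P i" by (rule Pm)
    interpret M': Module.module A ?M by (rule q)
    show ?thesis
    proof (cases "F j i = F (Suc j) i")
      case True
      have "carrier (quot_module ?M (F j i)) = {\<zero>\<^bsub>quot_module ?M (F j i)\<^esub>}"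
      proof -
        have "F j i +>\<^bsub>?M\<^esub> x = \<zero>\<^bsub>quot_module ?M (F j i)\<^esub>" if "x \<in> carrier ?M" for x
          using quot_eq_zero_iff[OF q that] that True by auto
        moreover have "\<zero>\<^bsub>?M\<^esub> \<in> carrier ?M" by (rule M'.M.zero_closed)
        ultimately show ?thesis unfolding quot_carrier[OF q] by blast
      qed
      then show ?thesis by (rule is_free_trivial[OF Q(1) _ ne])
    next
      case False
      then have F: "F j i = {\<zero>\<^bsub>obj P i\<^esub>}" "F (Suc j) i = carrier (obj P i)"
        using z by (auto simp: F_def split: if_splits)
      have M: "?M = obj P i" unfolding F by simp
      let ?f = "\<lambda>x. F j i +>\<^bsub>?M\<^esub> x"
      have "inj_on ?f (carrier ?M)"
        by (rule inj_onI) (use quot_eq_iff[OF q] F M.M.diff_eq_zero_iff in \<open>auto simp: M\<close>)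
      then have "bij_betw ?f (carrier ?M) (carrier (quot_module ?M (F j i)))"
        by (simp only: bij_betw_def quot_carrier[OF q])
      then show ?thesis
        using is_free_transfer[OF q(1) _ Q(1) Q(2) _ ne] free[of i] unfolding M by blast
    qed
  qed
  have dF: "dif P i x \<in> F j (i + 1)" if x: "x \<in> F (Suc j) i" for i j x
  proof (cases "b - int j < i + 1")
    case True
    have "x \<in> carrier (obj P i)" using x z by (auto simp: F_def split: if_splits)
    then show ?thesis using True mod_hom_closed[OF cx_dif[OF P]] by (simp add: F_def)
  next
    case False
    then have "x = \<zero>\<^bsub>obj P i\<^esub>" using x by (simp add: F_def)
    then show ?thesis using mod_hom_zero[OF cx_dif[OF P] Pm Pm] z by (simp add: F_def)
  qed
  have union: "(\<Union>j. F j i) = carrier (obj P i)" for i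
  proof
    show "(\<Union>j. F j i) \<subseteq> carrier (obj P i)" using z by (auto simp: F_def split: if_splits)
    have "F (nat (b - i + 1)) i = carrier (obj P i)" by (simp add: F_def)
    then show "carrier (obj P i) \<subseteq> (\<Union>j. F j i)" by blast
  qed
  have F0: "F 0 i = {\<zero>\<^bsub>obj P i\<^esub>}" for i using bd by (simp add: F_def)
  show ?thesis unfolding semi_free_def
  proof (intro conjI exI[of _ F] allI P F0 union sub mono quot)
    show "dif P i ` F (Suc j) i \<subseteq> F j (i + 1)" for i j using dF by blast
    show "dif P i ` F j i \<subseteq> F j (i + 1)" for i j using dF mono[of j i] by blast
  qed
qed

lemma exact_at_quasi_iso:
  assumes f: "quasi_iso A C D f" and ex: "exact_at D i" shows "exact_at C i"
  using quasi_isoD(4)[OF f, of i] chain_map_cocycles[OF quasi_isoD(2,1,3)[OF f]] ex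
  unfolding exact_at_def cohom_inj_def by blast

section \<open>Change of scalars\<close>

text \<open>Cohomology as a set depends only on the underlying groups. Therefore the cohomology of \<open>(A/J) \<otimes> Q\<close> over
  \<open>A/J\<close> and that of \<open>\<Lambda>(P)\<close> over the completed ring can be computed with scalars from \<open>A\<close>.\<close>

lemma same_groups_coset:
  assumes "ring.add M = ring.add N"
  shows "a_r_coset M = a_r_coset N" "set_add M = set_add N" "quot_map M = quot_map N"
proof -
  show c: "a_r_coset M = a_r_coset N" using assms by (simp add: a_r_coset_def r_coset_def fun_eq_iff)
  show "set_add M = set_add N" using assms by (simp add: set_add_def set_mult_def fun_eq_iff)
  show "quot_map M = quot_map N" using c by (simp add: quot_map_def fun_eq_iff)
qed

lemma subgroup_transfer:
  fixes M :: "('b, 'm) module" and N :: "('a, 'm) module"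
  assumes "carrier M = carrier N" "ring.add M = ring.add N" "\<zero>\<^bsub>M\<^esub> = \<zero>\<^bsub>N\<^esub>"
    and "subgroup H (add_monoid N)"
  shows "subgroup H (add_monoid M)"
  using assms by (simp add: subgroup_def m_inv_def)

context
  fixes C :: "('b, 'm) cx" and C' :: "('a, 'm) cx"
  assumes eq: "\<And>i. carrier (obj C i) = carrier (obj C' i)" "\<And>i. ring.add (obj C i) = ring.add (obj C' i)"
    "\<And>i. \<zero>\<^bsub>obj C i\<^esub> = \<zero>\<^bsub>obj C' i\<^esub>" "dif C = dif C'"
begin

lemma scalars_cocycles: "cocycles C i = cocycles C' i"
  and scalars_coboundaries: "coboundaries C i = coboundaries C' i"
  by (simp_all add: cocycles_def coboundaries_def eq)

lemma scalars_cohom: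
  "carrier (cohom C i) = carrier (cohom C' i)" "ring.add (cohom C i) = ring.add (cohom C' i)"
  "\<zero>\<^bsub>cohom C i\<^esub> = \<zero>\<^bsub>cohom C' i\<^esub>"
  using same_groups_coset[OF eq(2)[of i]]
  by (simp_all add: cohom_def quot_module_def a_rcosets_eq scalars_cocycles scalars_coboundaries)

lemma scalars_cohom_smult:
  assumes C': "cochain_complex A C'" and cl: "\<And>x. x \<in> carrier (obj C' i) \<Longrightarrow> b \<odot>\<^bsub>obj C i\<^esub> x \<in> carrier (obj C' i)"
    and add: "\<And>x y. x \<in> carrier (obj C' i) \<Longrightarrow> y \<in> carrier (obj C' i) \<Longrightarrow>
      b \<odot>\<^bsub>obj C i\<^esub> (x \<oplus>\<^bsub>obj C' i\<^esub> y) = (b \<odot>\<^bsub>obj C i\<^esub> x) \<oplus>\<^bsub>obj C' i\<^esub> (b \<odot>\<^bsub>obj C i\<^esub> y)"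
    and cob: "\<And>x. x \<in> coboundaries C' i \<Longrightarrow> b \<odot>\<^bsub>obj C i\<^esub> x \<in> coboundaries C' i"
    and x: "x \<in> carrier (obj C' i)"
  shows "b \<odot>\<^bsub>cohom C i\<^esub> cclass C' i x = cclass C' i (b \<odot>\<^bsub>obj C i\<^esub> x)"
proof -
  note s = submodule_abelian_subgroup[OF cx_module[OF C'] coboundaries_submodule[OF C'], of i]
  have "b \<odot>\<^bsub>cohom C i\<^esub> cclass C' i x = quot_map (obj C' i) (coboundaries C' i) (\<lambda>x. b \<odot>\<^bsub>obj C i\<^esub> x) (cclass C' i x)"
    by (simp add: cohom_def quot_module_def scalars_coboundaries same_groups_coset(3)[OF eq(2)])
  also have "\<dots> = cclass C' i (b \<odot>\<^bsub>obj C i\<^esub> x)"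
    by (rule quot_map_coset[OF s s _ add cob x]) (use cl in auto)
  finally show ?thesis .
qed

end

lemma smult_hom:
  assumes "Module.module R M" "a \<in> carrier R" shows "(\<lambda>x. a \<odot>\<^bsub>M\<^esub> x) \<in> mod_hom R M M"
proof -
  interpret M: Module.module R M by fact
  show ?thesis
    by (rule mod_homI) (use assms in \<open>auto simp: M.smult_r_distr M.smult_assoc1[symmetric] M.R.m_comm\<close>)
qed

lemma base_change_simps:
  "carrier (base_change A J M) = carrier (tensor A (quot_alg A J) M)"
  "ring.add (base_change A J M) = ring.add (tensor A (quot_alg A J) M)"
  "\<zero>\<^bsub>base_change A J M\<^esub> = \<zero>\<^bsub>tensor A (quot_alg A J) M\<^esub>"
  by (simp_all add: base_change_def Let_def)

lemma base_change_smult: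
  assumes A: "cring A" and J: "ideal J A" and M: "Module.module A M" and a: "a \<in> carrier A"
    and t: "t \<in> carrier (tensor A (quot_alg A J) M)"
  shows "(J +>\<^bsub>A\<^esub> a) \<odot>\<^bsub>base_change A J M\<^esub> t = a \<odot>\<^bsub>tensor A (quot_alg A J) M\<^esub> t"
proof -
  let ?E = "quot_alg A J"
  have E: "Module.module A ?E" using quot_alg_cyclic(1)[OF A J] by (auto simp: cyclic_quot_def)
  note T = tensor_module[OF E M]
  have sm: "(\<lambda>X. (J +>\<^bsub>A\<^esub> a) \<otimes>\<^bsub>A Quot J\<^esub> X) = (\<lambda>X. a \<odot>\<^bsub>?E\<^esub> X)" by (simp add: quot_alg_def)
  note h = tensor_map_hom[OF E M E M smult_hom[OF E a] mod_hom_id(2)]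
  have "tensor_map A ?E M (\<lambda>X. a \<odot>\<^bsub>?E\<^esub> X) id t = a \<odot>\<^bsub>tensor A ?E M\<^esub> t"
    by (rule tensor_hom_eq[OF E M T h(1) smult_hom[OF T a] _ t])
      (simp add: h(2) mod_hom_smult[OF tensor_elt_hom_left[OF E M] a])
  then show ?thesis by (simp add: base_change_def Let_def sm)
qed

section \<open>Generators modulo an ideal\<close>

lemma gen_submodule_mem:
  assumes "submodule H R M" "S \<subseteq> H" "x \<in> gen_submodule R M S" shows "x \<in> H"
  using gen_submodule_least[OF assms(1,2)] assms(3) by blast

text \<open>Every element of \<open>(A/J) \<otimes> Q\<close> has the form \<open>1 \<otimes> q\<close>, and it is zero iff \<open>q\<close> lies in \<open>J Q\<close>. Hence
  statements on the cohomology of \<open>(A/J) \<otimes> Q\<close> are congruences modulo \<open>J\<close> in \<open>Q\<close>.\<close>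

lemma base_change_generators:
  fixes Q :: "('a, 'q) cx"
  assumes A: "cring A" and J: "ideal J A" and Q: "cochain_complex A Q"
    and gen: "generated_by_le (A Quot J) (cohom (base_change_cx A J Q) i) r"
  shows "\<exists>S \<subseteq> carrier (obj Q i). finite S \<and> card S \<le> r \<and>
    (\<forall>s\<in>S. dif Q i s \<in> ideal_mult J (obj Q (i + 1))) \<and>
    (\<forall>q\<in>carrier (obj Q i). dif Q i q \<in> ideal_mult J (obj Q (i + 1)) \<longrightarrow>
      (\<exists>v\<in>gen_submodule A (obj Q i) S. \<exists>q'\<in>carrier (obj Q (i - 1)).
        (q \<ominus>\<^bsub>obj Q i\<^esub> v) \<ominus>\<^bsub>obj Q i\<^esub> dif Q (i - 1) q' \<in> ideal_mult J (obj Q i)))"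
proof -
  note Qm = cx_module[OF Q]
  let ?E = "quot_alg A J" and ?e = "\<one>\<^bsub>A Quot J\<^esub>"
  note cyc = quot_alg_cyclic(1)[OF A J]
  have E: "Module.module A ?E" and e: "?e \<in> carrier ?E" using cyc by (auto simp: cyclic_quot_def)
  let ?T = "\<lambda>i. tensor A ?E (obj Q i)"
  let ?B = "base_change_cx A J Q"
  define B where "B = \<lparr>obj = ?T, dif = dif ?B\<rparr>"
  note T = tensor_module[OF E Qm]
  let ?l = "\<lambda>i. tensor_elt A ?E (obj Q i) ?e"
  note lh = tensor_elt_hom_right[OF E Qm e]
  note dh = tensor_map_hom[OF E Qm E Qm mod_hom_id(2) cx_dif[OF Q]]
  have [simp]: "obj B i = ?T i" "dif B i = tensor_map A ?E (obj Q (i + 1)) id (dif Q i)" for i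
    by (simp_all add: B_def base_change_cx_def)
  have dl: "dif B i (?l i q) = ?l (i + 1) (dif Q i q)" if "q \<in> carrier (obj Q i)" for i q
    using dh(2)[OF e that] by simp
  have lsurj: "\<exists>q\<in>carrier (obj Q i). t = ?l i q" if "t \<in> carrier (?T i)" for i t
    by (rule cyclic_tensor_surj[OF cyc Qm that])
  have B: "cochain_complex A B"
  proof (rule cochain_complexI)
    show "Module.module A (obj B i)" for i using T by simp
    show "dif B i \<in> mod_hom A (obj B i) (obj B (i + 1))" for i using dh(1) by simp
    fix i t assume "t \<in> carrier (obj B i)"
    then obtain q where q: "q \<in> carrier (obj Q i)" "t = ?l i q" using lsurj by auto
    show "dif B (i + 1) (dif B i t) = \<zero>\<^bsub>obj B (i + 1 + 1)\<^esub>"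
      unfolding q(2) dl[OF q(1)] dl[OF mod_hom_closed[OF cx_dif[OF Q] q(1)]] cx_dd[OF Q q(1)]
      using mod_hom_zero[OF lh Qm T] by simp
  qed
  have same: "carrier (obj ?B j) = carrier (obj B j)" "ring.add (obj ?B j) = ring.add (obj B j)"
    "\<zero>\<^bsub>obj ?B j\<^esub> = \<zero>\<^bsub>obj B j\<^esub>" "dif ?B = dif B" for j
    by (simp_all add: base_change_simps base_change_cx_def B_def)
  note sc = scalars_cohom[of ?B B i, OF same]
  have zl: "?l i q \<in> cocycles B i \<longleftrightarrow> dif Q i q \<in> ideal_mult J (obj Q (i + 1))" if q: "q \<in> carrier (obj Q i)" for q
    using dl[OF q] cyclic_tensor_zero_iff[OF cyc Qm mod_hom_closed[OF cx_dif[OF Q] q]] mod_hom_closed[OF lh q]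
    by (simp add: cocycles_def)
  define Z where "Z = {q \<in> carrier (obj Q i). ?l i q \<in> cocycles B i}"
  have Zs: "submodule Z A (obj Q i)"
  proof -
    have "Z = {q \<in> carrier (obj Q i). dif B i (?l i q) = \<zero>\<^bsub>obj B (i + 1)\<^esub>}"
      using mod_hom_closed[OF lh] by (auto simp: Z_def cocycles_def)
    then show ?thesis
      using submodule_kernel[OF Qm cx_module[OF B] mod_hom_comp[OF lh, of "dif B i"]] cx_dif[OF B, of i] by simp
  qed
  obtain X where X: "X \<subseteq> carrier (cohom ?B i)" "finite X" "card X \<le> r"
    "gen_submodule (A Quot J) (cohom ?B i) X = carrier (cohom ?B i)"
    using gen unfolding generated_by_le_def by blast
  have "\<exists>q. q \<in> Z \<and> x = cclass B i (?l i q)" if "x \<in> X" for x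
  proof -
    have "x \<in> carrier (cohom B i)" using X(1) that sc(1) by auto
    then obtain t where t: "t \<in> cocycles B i" "x = cclass B i t" by (auto simp: cohom_carrier[OF B])
    obtain q where q: "q \<in> carrier (obj Q i)" "t = ?l i q" using lsurj cocycles_closed[OF B t(1)] by auto
    then show ?thesis using t by (auto simp: Z_def)
  qed
  then obtain s where s: "\<And>x. x \<in> X \<Longrightarrow> s x \<in> Z" "\<And>x. x \<in> X \<Longrightarrow> x = cclass B i (?l i (s x))" by metis
  let ?S = "s ` X" and ?V = "gen_submodule A (obj Q i) (s ` X)"
  have SZ: "?S \<subseteq> Z" using s(1) by auto
  have Zc: "Z \<subseteq> carrier (obj Q i)" by (auto simp: Z_def)
  have V: "submodule ?V A (obj Q i)" by (rule gen_submodule_submodule[OF Qm]) (use SZ Zc in blast)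
  have VZ: "?V \<subseteq> Z" by (rule gen_submodule_least[OF Zs SZ])
  let ?\<psi> = "\<lambda>q. cclass B i (?l i q)"
  note rs = submodule_restrict[OF Qm V Zs VZ]
  have \<psi>: "?\<psi> \<in> mod_hom A ((obj Q i)\<lparr>carrier := Z\<rparr>) (cohom B i)"
  proof (rule mod_homI)
    show "?\<psi> q \<in> carrier (cohom B i)" if "q \<in> carrier ((obj Q i)\<lparr>carrier := Z\<rparr>)" for q
      using that by (auto simp: Z_def cohom_carrier[OF B])
    show "?\<psi> (p \<oplus>\<^bsub>(obj Q i)\<lparr>carrier := Z\<rparr>\<^esub> q) = ?\<psi> p \<oplus>\<^bsub>cohom B i\<^esub> ?\<psi> q"
      if "p \<in> carrier ((obj Q i)\<lparr>carrier := Z\<rparr>)" "q \<in> carrier ((obj Q i)\<lparr>carrier := Z\<rparr>)" for p q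
      using that by (simp add: Z_def mod_hom_add[OF lh] cohom_add[OF B, symmetric, simplified])
    show "?\<psi> (a \<odot>\<^bsub>(obj Q i)\<lparr>carrier := Z\<rparr>\<^esub> q) = a \<odot>\<^bsub>cohom B i\<^esub> ?\<psi> q"
      if a: "a \<in> carrier A" and q: "q \<in> carrier ((obj Q i)\<lparr>carrier := Z\<rparr>)" for a q
    proof -
      have qc: "q \<in> carrier (obj Q i)" using q by (simp add: Z_def)
      have "a \<odot>\<^bsub>cohom B i\<^esub> ?\<psi> q = cclass B i (a \<odot>\<^bsub>obj B i\<^esub> ?l i q)"
      proof (rule scalars_cohom_smult[OF refl refl refl refl B])
        show "a \<odot>\<^bsub>obj B i\<^esub> x \<in> coboundaries B i" if "x \<in> coboundaries B i" for x
          by (rule submodule.smult_closed[OF coboundaries_submodule[OF B] a that])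
      qed (use mod_hom_closed[OF smult_hom[OF T a]] mod_hom_add[OF smult_hom[OF T a]] mod_hom_closed[OF lh qc] in auto)
      then show ?thesis by (simp add: mod_hom_smult[OF lh a qc])
    qed
  qed
  have H: "submodule (?\<psi> ` ?V) A (cohom B i)"
    by (rule submodule_image[OF rs(2) cohom_module[OF B] \<psi> rs(1)])
  have "submodule (?\<psi> ` ?V) (A Quot J) (cohom ?B i)"
  proof (rule submodule.intro)
    show "subgroup (?\<psi> ` ?V) (add_monoid (cohom ?B i))"
      by (rule subgroup_transfer[OF sc submodule.axioms(1)[OF H]])
    show "submodule_axioms (?\<psi> ` ?V) (A Quot J) (cohom ?B i)"
    proof
      fix b x assume b: "b \<in> carrier (A Quot J)" and "x \<in> ?\<psi> ` ?V"
      then obtain v where v: "v \<in> ?V" "x = ?\<psi> v" by blast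
      obtain a where a: "a \<in> carrier A" "b = J +>\<^bsub>A\<^esub> a" using b by (auto simp: FactRing_def a_rcosets_eq)
      have vc: "v \<in> carrier (obj Q i)" using v(1) VZ Zc by auto
      have bs: "b \<odot>\<^bsub>obj ?B i\<^esub> t = a \<odot>\<^bsub>obj B i\<^esub> t" if "t \<in> carrier (obj B i)" for t
        using base_change_smult[OF A J Qm a(1)] that a(2) by (simp add: base_change_cx_def)
      have "b \<odot>\<^bsub>cohom ?B i\<^esub> ?\<psi> v = cclass B i (b \<odot>\<^bsub>obj ?B i\<^esub> ?l i v)"
      proof (rule scalars_cohom_smult[OF same B])
        show "b \<odot>\<^bsub>obj ?B i\<^esub> x \<in> carrier (obj B i)" if "x \<in> carrier (obj B i)" for x
          unfolding bs[OF that] by (rule mod_hom_closed[OF smult_hom[OF cx_module[OF B] a(1)] that])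
        show "b \<odot>\<^bsub>obj ?B i\<^esub> (x \<oplus>\<^bsub>obj B i\<^esub> y) = (b \<odot>\<^bsub>obj ?B i\<^esub> x) \<oplus>\<^bsub>obj B i\<^esub> (b \<odot>\<^bsub>obj ?B i\<^esub> y)"
          if "x \<in> carrier (obj B i)" "y \<in> carrier (obj B i)" for x y
        proof -
          interpret TM: Module.module A "obj B i" by (rule cx_module[OF B])
          show ?thesis
            unfolding bs[OF that(1)] bs[OF that(2)] bs[OF TM.M.a_closed[OF that]]
            by (rule mod_hom_add[OF smult_hom[OF cx_module[OF B] a(1)] that])
        qed
        show "b \<odot>\<^bsub>obj ?B i\<^esub> x \<in> coboundaries B i" if "x \<in> coboundaries B i" for x
          unfolding bs[OF cocycles_closed[OF B subsetD[OF coboundaries_cocycles[OF B] that]]]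
          by (rule submodule.smult_closed[OF coboundaries_submodule[OF B] a(1) that])
        show "?l i v \<in> carrier (obj B i)" using mod_hom_closed[OF lh vc] by simp
      qed
      also have "\<dots> = ?\<psi> (a \<odot>\<^bsub>obj Q i\<^esub> v)"
        using bs[of "?l i v"] mod_hom_closed[OF lh vc] by (simp add: mod_hom_smult[OF lh a(1) vc])
      finally show "b \<odot>\<^bsub>cohom ?B i\<^esub> x \<in> ?\<psi> ` ?V"
        using submodule.smult_closed[OF V a(1) v(1)] v(2) by auto
    qed
  qed
  moreover have "X \<subseteq> ?\<psi> ` ?V"
    using s(2) gen_submodule_incl[of ?S A "obj Q i"] by blast
  ultimately have "gen_submodule (A Quot J) (cohom ?B i) X \<subseteq> ?\<psi> ` ?V" by (rule gen_submodule_least)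
  then have all: "carrier (cohom B i) \<subseteq> ?\<psi> ` ?V" using X(4) sc(1) by simp
  have main: "\<exists>v\<in>?V. \<exists>q'\<in>carrier (obj Q (i - 1)).
        (q \<ominus>\<^bsub>obj Q i\<^esub> v) \<ominus>\<^bsub>obj Q i\<^esub> dif Q (i - 1) q' \<in> ideal_mult J (obj Q i)"
    if q: "q \<in> carrier (obj Q i)" and dq: "dif Q i q \<in> ideal_mult J (obj Q (i + 1))" for q
  proof -
    interpret QM: Module.module A "obj Q i" by (rule Qm)
    have "?\<psi> q \<in> carrier (cohom B i)" using zl[OF q] dq by (simp add: cohom_carrier[OF B])
    then obtain v where v: "v \<in> ?V" "?\<psi> q = ?\<psi> v" using all by blast
    have vc: "v \<in> carrier (obj Q i)" using v(1) VZ Zc by auto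
    have "?l i q \<ominus>\<^bsub>obj B i\<^esub> ?l i v \<in> coboundaries B i"
      using v(2) cclass_eq_iff[OF B, of "?l i q" i "?l i v"] mod_hom_closed[OF lh q] mod_hom_closed[OF lh vc] by simp
    then obtain t where t: "t \<in> carrier (?T (i - 1))" "?l i (q \<ominus>\<^bsub>obj Q i\<^esub> v) = dif B (i - 1) t"
      unfolding coboundaries_def by (auto simp: mod_hom_diff[OF lh Qm T q vc])
    obtain q' where q': "q' \<in> carrier (obj Q (i - 1))" "t = ?l (i - 1) q'" using lsurj[OF t(1)] by blast
    have "?l i (q \<ominus>\<^bsub>obj Q i\<^esub> v) = ?l i (dif Q (i - 1) q')" using t(2) dl[OF q'(1)] unfolding q'(2) by simp
    then have "(q \<ominus>\<^bsub>obj Q i\<^esub> v) \<ominus>\<^bsub>obj Q i\<^esub> dif Q (i - 1) q' \<in> ideal_mult J (obj Q i)"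
      using cyclic_tensor_eq_iff[OF cyc Qm QM.M.minus_closed[OF q vc] mod_hom_closed[OF cx_dif'[OF Q] q'(1)]] by simp
    then show ?thesis using v(1) q'(1) by blast
  qed
  show ?thesis
  proof (intro exI[of _ ?S] conjI ballI impI)
    show "?S \<subseteq> carrier (obj Q i)" using SZ Zc by auto
    show "finite ?S" using X(2) by simp
    show "card ?S \<le> r" using card_image_le[OF X(2), of s] X(3) by simp
    show "dif Q i x \<in> ideal_mult J (obj Q (i + 1))" if "x \<in> ?S" for x
      using that SZ zl Zc by (auto simp: Z_def)
  qed (rule main)
qed

text \<open>Exactness of the cone modulo \<open>J\<close> lets classes modulo \<open>J\<close> be lifted from \<open>Q\<close> to \<open>P\<close> (\<open>lift\<close> in the proof)
  and compared in \<open>Q\<close> (\<open>inj\<close>). In its top degree all elements of \<open>P\<close> are cocycles, so the lifted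
  elements generate this term modulo \<open>J\<close> and boundaries.\<close>

lemma generators_lift:
  fixes P :: "('a, 'p) cx" and Q :: "('a, 'q) cx"
  assumes A: "cring A" and J: "ideal J A" and P: "cochain_complex A P" and Q: "cochain_complex A Q"
    and u: "chain_map A P Q u" and top: "carrier (obj P (i + 1)) = {\<zero>\<^bsub>obj P (i + 1)\<^esub>}"
    and ex: "\<And>n x. x \<in> carrier (obj (cone P Q u) n) \<Longrightarrow>
      dif (cone P Q u) n x \<in> ideal_mult J (obj (cone P Q u) (n + 1)) \<Longrightarrow>
      \<exists>y\<in>carrier (obj (cone P Q u) (n - 1)).
        x \<ominus>\<^bsub>obj (cone P Q u) n\<^esub> dif (cone P Q u) (n - 1) y \<in> ideal_mult J (obj (cone P Q u) n)"
    and gen: "generated_by_le (A Quot J) (cohom (base_change_cx A J Q) i) r"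
  shows "\<exists>S \<subseteq> carrier (obj P i). finite S \<and> card S \<le> r \<and>
    (\<forall>p\<in>carrier (obj P i). \<exists>v\<in>gen_submodule A (obj P i) S. \<exists>p'\<in>carrier (obj P (i - 1)).
        (p \<ominus>\<^bsub>obj P i\<^esub> v) \<ominus>\<^bsub>obj P i\<^esub> dif P (i - 1) p' \<in> ideal_mult J (obj P i))"
proof -
  note Pm = cx_module[OF P] and Qm = cx_module[OF Q] and uh = chain_mapD(1)[OF u]
  note dP = cx_dif[OF P] and dQ = cx_dif[OF Q] and dP' = cx_dif'[OF P] and dQ' = cx_dif'[OF Q]
  note im = ideal_mult_prod[OF Pm Qm J]
  let ?C = "cone P Q u"
  have e: "i - 1 + 1 = i" "i - 1 - 1 + 1 = i - 1" by simp_all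
  interpret P1: Module.module A "obj P (i + 1)" by (rule Pm)
  interpret P0: Module.module A "obj P i" by (rule Pm)
  interpret P': Module.module A "obj P (i - 1)" by (rule Pm)
  interpret Q0: Module.module A "obj Q i" by (rule Qm)
  interpret Q1: Module.module A "obj Q (i + 1)" by (rule Qm)
  interpret Q': Module.module A "obj Q (i - 1)" by (rule Qm)
  note imz = ideal_mult.zero
  have lift: "\<exists>p\<in>carrier (obj P i). \<exists>q'\<in>carrier (obj Q (i - 1)).
      (q \<ominus>\<^bsub>obj Q i\<^esub> u i p) \<ominus>\<^bsub>obj Q i\<^esub> dif Q (i - 1) q' \<in> ideal_mult J (obj Q i)"
    if q: "q \<in> carrier (obj Q i)" and dq: "dif Q i q \<in> ideal_mult J (obj Q (i + 1))" for q
  proof -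
    let ?x = "(\<zero>\<^bsub>obj P (i + 1)\<^esub>, q)"
    have x: "?x \<in> carrier (obj ?C i)" using q by simp
    have d: "dif Q i q \<in> carrier (obj Q (i + 1))" by (rule mod_hom_closed[OF dQ q])
    have "dif ?C i ?x = (\<ominus>\<^bsub>obj P (i + 1 + 1)\<^esub> \<zero>\<^bsub>obj P (i + 1 + 1)\<^esub>, dif Q i q)"
      unfolding cone_simps fst_conv snd_conv mod_hom_zero[OF dP Pm Pm] mod_hom_zero[OF uh Pm Qm] Q1.M.l_zero[OF d] ..
    moreover have "\<ominus>\<^bsub>obj P (i + 1 + 1)\<^esub> \<zero>\<^bsub>obj P (i + 1 + 1)\<^esub> = \<zero>\<^bsub>obj P (i + 1 + 1)\<^esub>"
      by (rule abelian_group.neg_zero[OF moduleD(2)[OF Pm]])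
    ultimately have "dif ?C i ?x \<in> ideal_mult J (obj ?C (i + 1))"
      unfolding cone_simps(1) im using dq imz by simp
    then obtain y where y: "y \<in> carrier (obj ?C (i - 1))" "?x \<ominus>\<^bsub>obj ?C i\<^esub> dif ?C (i - 1) y \<in> ideal_mult J (obj ?C i)"
      using ex[OF x] by blast
    obtain p q' where yy: "y = (p, q')" "p \<in> carrier (obj P i)" "q' \<in> carrier (obj Q (i - 1))" using y(1) by auto
    have dy: "dif ?C (i - 1) y \<in> carrier (obj ?C i)" by (rule mod_hom_closed[OF cx_dif'[OF cone_complex[OF P Q u]] y(1)])
    have up: "u i p \<in> carrier (obj Q i)" "dif Q (i - 1) q' \<in> carrier (obj Q i)"
      by (rule mod_hom_closed[OF uh yy(2)] mod_hom_closed[OF dQ' yy(3)])+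
    have "q \<ominus>\<^bsub>obj Q i\<^esub> (u i p \<oplus>\<^bsub>obj Q i\<^esub> dif Q (i - 1) q') \<in> ideal_mult J (obj Q i)"
      using y(2) unfolding cone_simps e prod_module_diff[OF Pm Qm x[unfolded cone_simps] dy[unfolded cone_simps e]] im
      by (simp add: yy(1))
    moreover have "q \<ominus>\<^bsub>obj Q i\<^esub> (u i p \<oplus>\<^bsub>obj Q i\<^esub> dif Q (i - 1) q') = (q \<ominus>\<^bsub>obj Q i\<^esub> u i p) \<ominus>\<^bsub>obj Q i\<^esub> dif Q (i - 1) q'"
      using q up by algebra
    ultimately show ?thesis using yy by auto
  qed
  have inj: "\<exists>p'\<in>carrier (obj P (i - 1)). p \<ominus>\<^bsub>obj P i\<^esub> dif P (i - 1) p' \<in> ideal_mult J (obj P i)"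
    if p: "p \<in> carrier (obj P i)" and q: "q \<in> carrier (obj Q (i - 1))"
      and pq: "u i p \<ominus>\<^bsub>obj Q i\<^esub> dif Q (i - 1) q \<in> ideal_mult J (obj Q i)" for p q
  proof -
    let ?x = "(p, \<ominus>\<^bsub>obj Q (i - 1)\<^esub> q)"
    have x: "?x \<in> carrier (obj ?C (i - 1))" using p q by simp
    have "dif P i p = \<zero>\<^bsub>obj P (i + 1)\<^esub>" using mod_hom_closed[OF dP p] top by simp
    then have dp: "\<ominus>\<^bsub>obj P (i + 1)\<^esub> dif P i p = \<zero>\<^bsub>obj P (i + 1)\<^esub>" by simp
    have "u i p \<oplus>\<^bsub>obj Q i\<^esub> dif Q (i - 1) (\<ominus>\<^bsub>obj Q (i - 1)\<^esub> q) \<in> ideal_mult J (obj Q i)"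
      using pq unfolding mod_hom_neg[OF dQ' Qm Qm q] a_minus_def .
    then have "dif ?C (i - 1) ?x \<in> ideal_mult J (obj ?C (i - 1 + 1))"
      unfolding cone_simps e im fst_conv snd_conv dp using imz by simp
    then obtain y where y: "y \<in> carrier (obj ?C (i - 1 - 1))"
      "?x \<ominus>\<^bsub>obj ?C (i - 1)\<^esub> dif ?C (i - 1 - 1) y \<in> ideal_mult J (obj ?C (i - 1))" using ex[OF x] by blast
    have dy: "dif ?C (i - 1 - 1) y \<in> carrier (obj ?C (i - 1))" by (rule mod_hom_closed[OF cx_dif'[OF cone_complex[OF P Q u]] y(1)])
    have yf: "fst y \<in> carrier (obj P (i - 1))" using y(1) unfolding cone_simps e by auto
    have "p \<ominus>\<^bsub>obj P i\<^esub> (\<ominus>\<^bsub>obj P i\<^esub> dif P (i - 1) (fst y)) \<in> ideal_mult J (obj P i)"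
      using y(2) unfolding cone_simps e prod_module_diff[OF Pm Qm x[unfolded cone_simps e] dy[unfolded cone_simps e]] im
      by simp
    then have "p \<ominus>\<^bsub>obj P i\<^esub> dif P (i - 1) (\<ominus>\<^bsub>obj P (i - 1)\<^esub> fst y) \<in> ideal_mult J (obj P i)"
      unfolding mod_hom_neg[OF dP' Pm Pm yf] .
    then show ?thesis using P'.M.a_inv_closed[OF yf] by blast
  qed
  obtain S where S: "S \<subseteq> carrier (obj Q i)" "finite S" "card S \<le> r"
    and Sd: "\<And>s. s \<in> S \<Longrightarrow> dif Q i s \<in> ideal_mult J (obj Q (i + 1))"
    and Sg: "\<And>q. q \<in> carrier (obj Q i) \<Longrightarrow> dif Q i q \<in> ideal_mult J (obj Q (i + 1)) \<Longrightarrow>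
      \<exists>v\<in>gen_submodule A (obj Q i) S. \<exists>q'\<in>carrier (obj Q (i - 1)).
        (q \<ominus>\<^bsub>obj Q i\<^esub> v) \<ominus>\<^bsub>obj Q i\<^esub> dif Q (i - 1) q' \<in> ideal_mult J (obj Q i)"
    using base_change_generators[OF A J Q gen] by auto
  have "\<exists>p. p \<in> carrier (obj P i) \<and> (\<exists>q'\<in>carrier (obj Q (i - 1)).
      (s \<ominus>\<^bsub>obj Q i\<^esub> u i p) \<ominus>\<^bsub>obj Q i\<^esub> dif Q (i - 1) q' \<in> ideal_mult J (obj Q i))" if "s \<in> S" for s
    using lift[OF _ Sd[OF that]] S(1) that by blast
  then obtain g where g: "\<And>s. s \<in> S \<Longrightarrow> g s \<in> carrier (obj P i)"
    "\<And>s. s \<in> S \<Longrightarrow> \<exists>q'\<in>carrier (obj Q (i - 1)). (s \<ominus>\<^bsub>obj Q i\<^esub> u i (g s)) \<ominus>\<^bsub>obj Q i\<^esub> dif Q (i - 1) q' \<in> ideal_mult J (obj Q i)"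
    by metis
  let ?V = "gen_submodule A (obj P i) (g ` S)"
  have gS: "g ` S \<subseteq> carrier (obj P i)" using g(1) by auto
  have V: "submodule ?V A (obj P i)" by (rule gen_submodule_submodule[OF Pm gS])
  have Vc: "?V \<subseteq> carrier (obj P i)" using P0.submoduleE(1)[OF V] .
  define H where "H = {v \<in> carrier (obj Q i). \<exists>w\<in>?V. \<exists>q'\<in>carrier (obj Q (i - 1)).
      (v \<ominus>\<^bsub>obj Q i\<^esub> u i w) \<ominus>\<^bsub>obj Q i\<^esub> dif Q (i - 1) q' \<in> ideal_mult J (obj Q i)}"
  have H: "submodule H A (obj Q i)"
  proof (rule submoduleI'[OF Qm])
    show "H \<subseteq> carrier (obj Q i)" by (auto simp: H_def)
    have zV: "\<zero>\<^bsub>obj P i\<^esub> \<in> ?V" using subgroup.one_closed[OF submodule.axioms(1)[OF V]] by simp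
    show "\<zero>\<^bsub>obj Q i\<^esub> \<in> H" unfolding H_def
      by (intro CollectI conjI Q0.M.zero_closed bexI[OF _ zV] bexI[OF _ Q'.M.zero_closed])
        (simp add: mod_hom_zero[OF uh Pm Qm] mod_hom_zero[OF dQ' Qm Qm] imz)
    fix x y assume "x \<in> H" "y \<in> H"
    then obtain w q w' q' where x: "x \<in> carrier (obj Q i)" "w \<in> ?V" "q \<in> carrier (obj Q (i - 1))"
      "(x \<ominus>\<^bsub>obj Q i\<^esub> u i w) \<ominus>\<^bsub>obj Q i\<^esub> dif Q (i - 1) q \<in> ideal_mult J (obj Q i)"
      and y: "y \<in> carrier (obj Q i)" "w' \<in> ?V" "q' \<in> carrier (obj Q (i - 1))"
      "(y \<ominus>\<^bsub>obj Q i\<^esub> u i w') \<ominus>\<^bsub>obj Q i\<^esub> dif Q (i - 1) q' \<in> ideal_mult J (obj Q i)" unfolding H_def by blast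
    have wc: "w \<in> carrier (obj P i)" "w' \<in> carrier (obj P i)" using x y Vc by auto
    have c: "u i w \<in> carrier (obj Q i)" "u i w' \<in> carrier (obj Q i)" "dif Q (i - 1) q \<in> carrier (obj Q i)"
      "dif Q (i - 1) q' \<in> carrier (obj Q i)"
      by (rule mod_hom_closed[OF uh] mod_hom_closed[OF dQ'] wc x y)+
    have "((x \<oplus>\<^bsub>obj Q i\<^esub> y) \<ominus>\<^bsub>obj Q i\<^esub> u i (w \<oplus>\<^bsub>obj P i\<^esub> w')) \<ominus>\<^bsub>obj Q i\<^esub> dif Q (i - 1) (q \<oplus>\<^bsub>obj Q (i - 1)\<^esub> q') =
      ((x \<ominus>\<^bsub>obj Q i\<^esub> u i w) \<ominus>\<^bsub>obj Q i\<^esub> dif Q (i - 1) q) \<oplus>\<^bsub>obj Q i\<^esub> ((y \<ominus>\<^bsub>obj Q i\<^esub> u i w') \<ominus>\<^bsub>obj Q i\<^esub> dif Q (i - 1) q')"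
      unfolding mod_hom_add[OF uh wc] mod_hom_add[OF dQ' x(3) y(3)] using x(1) y(1) c by algebra
    then have "((x \<oplus>\<^bsub>obj Q i\<^esub> y) \<ominus>\<^bsub>obj Q i\<^esub> u i (w \<oplus>\<^bsub>obj P i\<^esub> w')) \<ominus>\<^bsub>obj Q i\<^esub> dif Q (i - 1) (q \<oplus>\<^bsub>obj Q (i - 1)\<^esub> q')
      \<in> ideal_mult J (obj Q i)" using ideal_mult_add[OF Qm J x(4) y(4)] by simp
    then show "x \<oplus>\<^bsub>obj Q i\<^esub> y \<in> H" unfolding H_def
      using P0.submoduleE(5)[OF V x(2) y(2)] x y by blast
  next
    fix a x assume a: "a \<in> carrier A" and "x \<in> H"
    then obtain w q where x: "x \<in> carrier (obj Q i)" "w \<in> ?V" "q \<in> carrier (obj Q (i - 1))"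
      "(x \<ominus>\<^bsub>obj Q i\<^esub> u i w) \<ominus>\<^bsub>obj Q i\<^esub> dif Q (i - 1) q \<in> ideal_mult J (obj Q i)" unfolding H_def by blast
    have wc: "w \<in> carrier (obj P i)" using x Vc by auto
    have c: "u i w \<in> carrier (obj Q i)" "dif Q (i - 1) q \<in> carrier (obj Q i)"
      by (rule mod_hom_closed[OF uh] mod_hom_closed[OF dQ'] wc x)+
    note sm = mod_hom_diff[OF smult_hom[OF Qm a] Qm Qm]
    have "((a \<odot>\<^bsub>obj Q i\<^esub> x) \<ominus>\<^bsub>obj Q i\<^esub> u i (a \<odot>\<^bsub>obj P i\<^esub> w)) \<ominus>\<^bsub>obj Q i\<^esub> dif Q (i - 1) (a \<odot>\<^bsub>obj Q (i - 1)\<^esub> q) =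
      a \<odot>\<^bsub>obj Q i\<^esub> ((x \<ominus>\<^bsub>obj Q i\<^esub> u i w) \<ominus>\<^bsub>obj Q i\<^esub> dif Q (i - 1) q)"
      unfolding sm[OF Q0.M.minus_closed[OF x(1) c(1)] c(2)] sm[OF x(1) c(1)] mod_hom_smult[OF uh a wc] mod_hom_smult[OF dQ' a x(3)] ..
    then have "((a \<odot>\<^bsub>obj Q i\<^esub> x) \<ominus>\<^bsub>obj Q i\<^esub> u i (a \<odot>\<^bsub>obj P i\<^esub> w)) \<ominus>\<^bsub>obj Q i\<^esub> dif Q (i - 1) (a \<odot>\<^bsub>obj Q (i - 1)\<^esub> q)
      \<in> ideal_mult J (obj Q i)" using submodule.smult_closed[OF ideal_mult_submodule[OF Qm J] a x(4)] by simp
    then show "a \<odot>\<^bsub>obj Q i\<^esub> x \<in> H" unfolding H_def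
      using submodule.smult_closed[OF V a x(2)] x a by blast
  qed
  have SH: "S \<subseteq> H"
  proof
    fix s assume s: "s \<in> S"
    have "g s \<in> ?V" using s gen_submodule_incl[of "g ` S" A "obj P i"] by blast
    then show "s \<in> H" unfolding H_def using g(2)[OF s] S(1) s by blast
  qed
  have main: "\<exists>v\<in>?V. \<exists>p'\<in>carrier (obj P (i - 1)).
        (p \<ominus>\<^bsub>obj P i\<^esub> v) \<ominus>\<^bsub>obj P i\<^esub> dif P (i - 1) p' \<in> ideal_mult J (obj P i)" if p: "p \<in> carrier (obj P i)" for p
  proof -
    have up: "u i p \<in> carrier (obj Q i)" by (rule mod_hom_closed[OF uh p])
    have "dif P i p = \<zero>\<^bsub>obj P (i + 1)\<^esub>" using mod_hom_closed[OF dP p] top by simp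
    then have "dif Q i (u i p) \<in> ideal_mult J (obj Q (i + 1))"
      using chain_mapD(2)[OF u p] mod_hom_zero[OF uh Pm Qm] imz by metis
    then obtain v q where v: "v \<in> gen_submodule A (obj Q i) S" and q: "q \<in> carrier (obj Q (i - 1))"
      "(u i p \<ominus>\<^bsub>obj Q i\<^esub> v) \<ominus>\<^bsub>obj Q i\<^esub> dif Q (i - 1) q \<in> ideal_mult J (obj Q i)" using Sg[OF up] by blast
    have "v \<in> H" by (rule gen_submodule_mem[OF H SH v])
    then obtain w q' where w: "v \<in> carrier (obj Q i)" "w \<in> ?V" "q' \<in> carrier (obj Q (i - 1))"
      "(v \<ominus>\<^bsub>obj Q i\<^esub> u i w) \<ominus>\<^bsub>obj Q i\<^esub> dif Q (i - 1) q' \<in> ideal_mult J (obj Q i)" unfolding H_def by blast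
    have wc: "w \<in> carrier (obj P i)" using w Vc by auto
    have c: "u i w \<in> carrier (obj Q i)" "dif Q (i - 1) q \<in> carrier (obj Q i)" "dif Q (i - 1) q' \<in> carrier (obj Q i)"
      by (rule mod_hom_closed[OF uh] mod_hom_closed[OF dQ'] wc w q)+
    have "u i (p \<ominus>\<^bsub>obj P i\<^esub> w) \<ominus>\<^bsub>obj Q i\<^esub> dif Q (i - 1) (q \<oplus>\<^bsub>obj Q (i - 1)\<^esub> q') =
      ((u i p \<ominus>\<^bsub>obj Q i\<^esub> v) \<ominus>\<^bsub>obj Q i\<^esub> dif Q (i - 1) q) \<oplus>\<^bsub>obj Q i\<^esub> ((v \<ominus>\<^bsub>obj Q i\<^esub> u i w) \<ominus>\<^bsub>obj Q i\<^esub> dif Q (i - 1) q')"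
      unfolding mod_hom_diff[OF uh Pm Qm p wc] mod_hom_add[OF dQ' q(1) w(3)] using up w(1) c by algebra
    then have "u i (p \<ominus>\<^bsub>obj P i\<^esub> w) \<ominus>\<^bsub>obj Q i\<^esub> dif Q (i - 1) (q \<oplus>\<^bsub>obj Q (i - 1)\<^esub> q') \<in> ideal_mult J (obj Q i)"
      using ideal_mult_add[OF Qm J q(2) w(4)] by simp
    then obtain p' where "p' \<in> carrier (obj P (i - 1))" "(p \<ominus>\<^bsub>obj P i\<^esub> w) \<ominus>\<^bsub>obj P i\<^esub> dif P (i - 1) p' \<in> ideal_mult J (obj P i)"
      using inj[OF P0.M.minus_closed[OF p wc] Q'.M.a_closed[OF q(1) w(3)]] by blast
    then show ?thesis using w(2) by blast
  qed
  show ?thesis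
  proof (intro exI[of _ "g ` S"] conjI gS ballI)
    show "finite (g ` S)" using S(2) by simp
    show "card (g ` S) \<le> r" using card_image_le[OF S(2), of g] S(3) by simp
  qed (rule main)
qed

section \<open>Successive approximation\<close>

text \<open>The elements \<open>x\<close> with this property form a submodule of \<open>N\<close>, and it contains the products \<open>j m\<close> with \<open>j\<close> in
  \<open>I\<^sup>k\<close>: multiply an approximation of \<open>m\<close> by \<open>j\<close>.\<close>

lemma nakayama_step:
  assumes A: "cring A" and I: "ideal I A" and F: "Module.module A F" and N: "Module.module A N"
    and \<Phi>: "\<Phi> \<in> mod_hom A F N"
    and gen: "\<And>n. n \<in> carrier N \<Longrightarrow> \<exists>f\<in>carrier F. n \<ominus>\<^bsub>N\<^esub> \<Phi> f \<in> ideal_mult I N"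
    and x: "x \<in> ideal_mult (ipow A I k) N"
  shows "\<exists>f\<in>ideal_mult (ipow A I k) F. x \<ominus>\<^bsub>N\<^esub> \<Phi> f \<in> ideal_mult (ipow A I (Suc k)) N"
proof -
  interpret A: cring A by (rule A)
  interpret F: Module.module A F by (rule F)
  interpret N: Module.module A N by (rule N)
  note J = ipow_ideal[OF A I, of k] and J' = ipow_ideal[OF A I, of "Suc k"]
  note JF = ideal_mult_submodule[OF F J] and JN' = ideal_mult_submodule[OF N J']
  have fc: "f \<in> carrier F" if "f \<in> ideal_mult (ipow A I k) F" for f by (rule ideal_mult_carrier[OF F J that])
  define H where "H = {n \<in> carrier N. \<exists>f\<in>ideal_mult (ipow A I k) F. n \<ominus>\<^bsub>N\<^esub> \<Phi> f \<in> ideal_mult (ipow A I (Suc k)) N}"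
  have H: "submodule H A N"
  proof (rule submoduleI'[OF N])
    show "H \<subseteq> carrier N" by (auto simp: H_def)
    show "\<zero>\<^bsub>N\<^esub> \<in> H" unfolding H_def
      by (intro CollectI conjI N.M.zero_closed bexI[OF _ ideal_mult.zero])
        (simp add: mod_hom_zero[OF \<Phi> F N] ideal_mult.zero)
    fix a b assume "a \<in> H" "b \<in> H"
    then obtain f g where a: "a \<in> carrier N" "f \<in> ideal_mult (ipow A I k) F" "a \<ominus>\<^bsub>N\<^esub> \<Phi> f \<in> ideal_mult (ipow A I (Suc k)) N"
      and b: "b \<in> carrier N" "g \<in> ideal_mult (ipow A I k) F" "b \<ominus>\<^bsub>N\<^esub> \<Phi> g \<in> ideal_mult (ipow A I (Suc k)) N"
      unfolding H_def by blast
    have c: "\<Phi> f \<in> carrier N" "\<Phi> g \<in> carrier N" by (rule mod_hom_closed[OF \<Phi> fc] a b)+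
    have "(a \<oplus>\<^bsub>N\<^esub> b) \<ominus>\<^bsub>N\<^esub> \<Phi> (f \<oplus>\<^bsub>F\<^esub> g) = (a \<ominus>\<^bsub>N\<^esub> \<Phi> f) \<oplus>\<^bsub>N\<^esub> (b \<ominus>\<^bsub>N\<^esub> \<Phi> g)"
      unfolding mod_hom_add[OF \<Phi> fc[OF a(2)] fc[OF b(2)]] using a(1) b(1) c by algebra
    then have "(a \<oplus>\<^bsub>N\<^esub> b) \<ominus>\<^bsub>N\<^esub> \<Phi> (f \<oplus>\<^bsub>F\<^esub> g) \<in> ideal_mult (ipow A I (Suc k)) N"
      using ideal_mult_add[OF N J' a(3) b(3)] by simp
    then show "a \<oplus>\<^bsub>N\<^esub> b \<in> H" unfolding H_def using a b ideal_mult_add[OF F J a(2) b(2)] by blast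
  next
    fix r a assume r: "r \<in> carrier A" and "a \<in> H"
    then obtain f where a: "a \<in> carrier N" "f \<in> ideal_mult (ipow A I k) F" "a \<ominus>\<^bsub>N\<^esub> \<Phi> f \<in> ideal_mult (ipow A I (Suc k)) N"
      unfolding H_def by blast
    have c: "\<Phi> f \<in> carrier N" by (rule mod_hom_closed[OF \<Phi> fc[OF a(2)]])
    have "(r \<odot>\<^bsub>N\<^esub> a) \<ominus>\<^bsub>N\<^esub> \<Phi> (r \<odot>\<^bsub>F\<^esub> f) = r \<odot>\<^bsub>N\<^esub> (a \<ominus>\<^bsub>N\<^esub> \<Phi> f)"
      unfolding mod_hom_smult[OF \<Phi> r fc[OF a(2)]] mod_hom_diff[OF smult_hom[OF N r] N N a(1) c] ..
    then have "(r \<odot>\<^bsub>N\<^esub> a) \<ominus>\<^bsub>N\<^esub> \<Phi> (r \<odot>\<^bsub>F\<^esub> f) \<in> ideal_mult (ipow A I (Suc k)) N"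
      using submodule.smult_closed[OF JN' r a(3)] by simp
    then show "r \<odot>\<^bsub>N\<^esub> a \<in> H" unfolding H_def
      using N.smult_closed[OF r a(1)] submodule.smult_closed[OF JF r a(2)] by blast
  qed
  have "x \<in> H"
  proof (rule ideal_mult_least[OF N H _ x])
    fix j m assume j: "j \<in> ipow A I k" and m: "m \<in> carrier N"
    have jA: "j \<in> carrier A" by (rule ideal.Icarr[OF J j])
    obtain f where f: "f \<in> carrier F" "m \<ominus>\<^bsub>N\<^esub> \<Phi> f \<in> ideal_mult I N" using gen[OF m] by blast
    have c: "\<Phi> f \<in> carrier N" by (rule mod_hom_closed[OF \<Phi> f(1)])
    have jt: "j \<odot>\<^bsub>N\<^esub> t \<in> ideal_mult (ipow A I (Suc k)) N" if "t \<in> ideal_mult I N" for t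
      using that
    proof induct
      case zero then show ?case using jA by (simp add: ideal_mult.zero)
    next
      case (step i n t)
      have iA: "i \<in> carrier A" by (rule ideal.Icarr[OF I step(1)])
      have tc: "t \<in> carrier N" by (rule ideal_mult_carrier[OF N I step(3)])
      have "j \<otimes>\<^bsub>A\<^esub> i \<in> ipow A I (Suc k)" using j step(1) by (simp add: ipow_simps ideal_prod.prod)
      then have "(j \<otimes>\<^bsub>A\<^esub> i) \<odot>\<^bsub>N\<^esub> n \<oplus>\<^bsub>N\<^esub> j \<odot>\<^bsub>N\<^esub> t \<in> ideal_mult (ipow A I (Suc k)) N"
        by (rule ideal_mult.step[OF _ step(2,4)])
      then show ?case using jA iA step(2) tc by (simp add: N.smult_r_distr N.smult_assoc1)
    qed
    have "(j \<odot>\<^bsub>N\<^esub> m) \<ominus>\<^bsub>N\<^esub> \<Phi> (j \<odot>\<^bsub>F\<^esub> f) = j \<odot>\<^bsub>N\<^esub> (m \<ominus>\<^bsub>N\<^esub> \<Phi> f)"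
      unfolding mod_hom_smult[OF \<Phi> jA f(1)] mod_hom_diff[OF smult_hom[OF N jA] N N m c] ..
    then have "(j \<odot>\<^bsub>N\<^esub> m) \<ominus>\<^bsub>N\<^esub> \<Phi> (j \<odot>\<^bsub>F\<^esub> f) \<in> ideal_mult (ipow A I (Suc k)) N" using jt[OF f(2)] by simp
    then show "j \<odot>\<^bsub>N\<^esub> m \<in> H" unfolding H_def
      using N.smult_closed[OF jA m] ideal_mult_incl[OF F J j f(1)] by blast
  qed
  then show ?thesis unfolding H_def by blast
qed

text \<open>The error left by each approximation is itself approximated by \<open>nakayama_step\<close>. The corrections lie
  in \<open>I\<^sup>k F\<close> with growing \<open>k\<close>, so the preimages converge.\<close>

lemma nakayama_limit:
  assumes A: "cring A" and I: "ideal I A" and F: "Module.module A F" and N: "Module.module A N"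
    and \<Phi>: "\<Phi> \<in> mod_hom A F N"
    and gen: "\<And>n. n \<in> carrier N \<Longrightarrow> \<exists>f\<in>carrier F. n \<ominus>\<^bsub>N\<^esub> \<Phi> f \<in> ideal_mult I N"
    and n: "n \<in> carrier N"
  shows "\<exists>f. \<forall>k. f k \<in> carrier F \<and> n \<ominus>\<^bsub>N\<^esub> \<Phi> (f k) \<in> ideal_mult (ipow A I (k + 1)) N \<and>
    f (Suc k) \<ominus>\<^bsub>F\<^esub> f k \<in> ideal_mult (ipow A I (k + 1)) F"
proof -
  interpret A: cring A by (rule A)
  interpret F: Module.module A F by (rule F)
  interpret N: Module.module A N by (rule N)
  note J = ipow_ideal[OF A I]
  define P where "P k f \<longleftrightarrow> f \<in> carrier F \<and> n \<ominus>\<^bsub>N\<^esub> \<Phi> f \<in> ideal_mult (ipow A I (k + 1)) N" for k f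
  define Q where "Q k f f' \<longleftrightarrow> f' \<ominus>\<^bsub>F\<^esub> f \<in> ideal_mult (ipow A I (k + 1)) F" for k f f'
  have "\<exists>f. \<forall>k. P k (f k) \<and> Q k (f k) (f (Suc k))"
  proof (rule dependent_nat_choice)
    have "I \<subseteq> ipow A I 1"
    proof
      fix i assume i: "i \<in> I"
      have "\<one>\<^bsub>A\<^esub> \<otimes>\<^bsub>A\<^esub> i \<in> ideal_prod A (carrier A) I" by (rule ideal_prod.prod) (use i in auto)
      then show "i \<in> ipow A I 1" using ideal.Icarr[OF I i] by (simp add: ipow_simps)
    qed
    then show "\<exists>f. P 0 f" using gen[OF n] ideal_mult_mono[of I "ipow A I 1"] unfolding P_def by fastforce
    fix f k assume "P k f"
    then have f: "f \<in> carrier F" "n \<ominus>\<^bsub>N\<^esub> \<Phi> f \<in> ideal_mult (ipow A I (k + 1)) N" by (auto simp: P_def)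
    obtain g where g: "g \<in> ideal_mult (ipow A I (k + 1)) F"
      "(n \<ominus>\<^bsub>N\<^esub> \<Phi> f) \<ominus>\<^bsub>N\<^esub> \<Phi> g \<in> ideal_mult (ipow A I (Suc (k + 1))) N"
      using nakayama_step[OF A I F N \<Phi> gen f(2)] by blast
    have gc: "g \<in> carrier F" by (rule ideal_mult_carrier[OF F J g(1)])
    have c: "\<Phi> f \<in> carrier N" "\<Phi> g \<in> carrier N" by (rule mod_hom_closed[OF \<Phi>] f gc)+
    have 1: "n \<ominus>\<^bsub>N\<^esub> \<Phi> (f \<oplus>\<^bsub>F\<^esub> g) = (n \<ominus>\<^bsub>N\<^esub> \<Phi> f) \<ominus>\<^bsub>N\<^esub> \<Phi> g"
      unfolding mod_hom_add[OF \<Phi> f(1) gc] using n c by algebra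
    have 2: "(f \<oplus>\<^bsub>F\<^esub> g) \<ominus>\<^bsub>F\<^esub> f = g" using f(1) gc by algebra
    have "P (Suc k) (f \<oplus>\<^bsub>F\<^esub> g) \<and> Q k f (f \<oplus>\<^bsub>F\<^esub> g)"
      unfolding P_def Q_def 1 2 using f(1) gc g by simp
    then show "\<exists>f'. P (Suc k) f' \<and> Q k f f'" by blast
  qed
  then show ?thesis unfolding P_def Q_def by blast
qed

lemma gen_submodule_lin_ext:
  assumes M: "Module.module R M" and S: "S \<subseteq> carrier M" and v: "v \<in> gen_submodule R M S"
  shows "\<exists>f\<in>carrier (free_module R S). v = lin_ext R M (\<lambda>s. s) f"
proof -
  have R: "cring R" by (rule module_cring[OF M])
  note h = lin_ext_hom[OF M, of S "\<lambda>s. s"]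
  note F = free_module_module(1)[OF R, of S]
  have "submodule (lin_ext R M (\<lambda>s. s) ` carrier (free_module R S)) R M"
    by (rule submodule_image[OF F M h(1) Module.module.carrier_is_submodule[OF F]]) (use S in auto)
  moreover have "S \<subseteq> lin_ext R M (\<lambda>s. s) ` carrier (free_module R S)"
  proof
    fix s assume s: "s \<in> S"
    have "lin_ext R M (\<lambda>s. s) (free_gen R s) = s" by (rule h(2)) (use s S in auto)
    from this[symmetric] show "s \<in> lin_ext R M (\<lambda>s. s) ` carrier (free_module R S)" using free_gen_closed[OF R s] by (rule image_eqI)
  qed
  ultimately show ?thesis using gen_submodule_mem[OF _ _ v] by blast
qed

lemma ideal_mult_reg:
  assumes R: "cring R" and J: "ideal J R" and x: "x \<in> ideal_mult J (reg R)" shows "x \<in> J"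
proof -
  interpret J: ideal J R by fact
  show ?thesis using x by induct (auto intro: J.I_r_closed)
qed

section \<open>The module structure over the completed ring\<close>

context
  fixes A :: "'a ring" and I :: "'a set"
  assumes A: "cring A" and I: "ideal I A"
begin

interpretation A: cring A by (rule A)

private abbreviation (input) pw :: "nat \<Rightarrow> 'a set" where "pw k \<equiv> ipow A I (k + 1)"
private abbreviation (input) qa :: "nat \<Rightarrow> ('a, 'a set) module" where "qa k \<equiv> quot_alg A (ipow A I (k + 1))"

lemma hat_ring_carrier: "c \<in> carrier (hat_ring A I) \<longleftrightarrow>
    (\<forall>k. c k \<in> carrier (A Quot pw k)) \<and> (\<forall>k. quot_map A (pw k) id (c (Suc k)) = c k)"
  by (simp add: hat_ring_def Let_def)

lemma pow_abelian: "abelian_subgroup (pw k) A"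
  by (rule abelian_subgroupI3[OF ideal.axioms(1)[OF pow_ideal[OF A I]] A.is_abelian_group])

lemma pow_proj_coset: "a \<in> carrier A \<Longrightarrow> quot_map A (pw k) id (pw (Suc k) +>\<^bsub>A\<^esub> a) = pw k +>\<^bsub>A\<^esub> a"
  using quot_map_coset[OF pow_abelian pow_abelian, of id "Suc k" k a] pow_dec[OF A I, of k] by auto

lemma hat_ring_of_lift:
  assumes a: "\<And>k. a k \<in> carrier A" and s: "\<And>k. a (Suc k) \<ominus>\<^bsub>A\<^esub> a k \<in> pw k"
  shows "(\<lambda>k. pw k +>\<^bsub>A\<^esub> a k) \<in> carrier (hat_ring A I)"
proof -
  have "pw k +>\<^bsub>A\<^esub> a (Suc k) = pw k +>\<^bsub>A\<^esub> a k" for k using coset_eq_iff[OF pow_abelian a a] s by blast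
  then show ?thesis
    unfolding hat_ring_carrier using a by (simp only: pow_proj_coset[OF a]) (auto simp: FactRing_def a_rcosets_eq)
qed

lemma hat_ring_lift:
  assumes c: "c \<in> carrier (hat_ring A I)"
  shows "\<exists>a. (\<forall>k. a k \<in> carrier A) \<and> c = (\<lambda>k. pw k +>\<^bsub>A\<^esub> a k) \<and> (\<forall>k. a (Suc k) \<ominus>\<^bsub>A\<^esub> a k \<in> pw k)"
proof -
  have cc: "c k \<in> carrier (A Quot pw k)" "quot_map A (pw k) id (c (Suc k)) = c k" for k
    using c unfolding hat_ring_carrier by blast+
  have "\<exists>a. a \<in> carrier A \<and> c k = pw k +>\<^bsub>A\<^esub> a" for k using cc(1)[of k] by (auto simp: FactRing_def a_rcosets_eq)
  then obtain a where a: "\<And>k. a k \<in> carrier A" "\<And>k. c k = pw k +>\<^bsub>A\<^esub> a k" by metis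
  have "pw k +>\<^bsub>A\<^esub> a (Suc k) = pw k +>\<^bsub>A\<^esub> a k" for k
    using cc(2)[of k] unfolding a(2) pow_proj_coset[OF a(1)] .
  then have "\<forall>k. a (Suc k) \<ominus>\<^bsub>A\<^esub> a k \<in> pw k" using coset_eq_iff[OF pow_abelian a(1) a(1)] by blast
  moreover have "c = (\<lambda>k. pw k +>\<^bsub>A\<^esub> a k)" using a(2) by (rule ext)
  ultimately show ?thesis using a(1) by blast
qed

lemma pow_smult_zero:
  assumes M: "Module.module A M" and j: "j \<in> pw k" and t: "t \<in> carrier (tensor A (qa k) M)"
  shows "j \<odot>\<^bsub>tensor A (qa k) M\<^esub> t = \<zero>\<^bsub>tensor A (qa k) M\<^esub>"
proof -
  have jA: "j \<in> carrier A" by (rule ideal.Icarr[OF pow_ideal[OF A I] j])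
  obtain m where m: "m \<in> carrier M" "t = lam A I M k m" using lam_surj[OF A I M t] by blast
  have "j \<odot>\<^bsub>M\<^esub> m \<in> ideal_mult (pw k) M" by (rule ideal_mult_incl[OF M pow_ideal[OF A I] j m(1)])
  then show ?thesis
    unfolding m(2) mod_hom_smult[OF lam_hom[OF A I M] jA m(1), symmetric]
    using lam_zero_iff[OF A I M module.smult_closed[OF M jA m(1)]] by blast
qed

lemma Lam_hat_simps:
  "carrier (Lam_hat A I M) = carrier (Lam A I M)" "ring.add (Lam_hat A I M) = ring.add (Lam A I M)"
  "\<zero>\<^bsub>Lam_hat A I M\<^esub> = \<zero>\<^bsub>Lam A I M\<^esub>"
  "(c \<odot>\<^bsub>Lam_hat A I M\<^esub> x) = (\<lambda>k. c k \<odot>\<^bsub>base_change A (pw k) M\<^esub> x k)"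
  by (simp_all add: Lam_hat_def)

lemma hat_smult:
  fixes M :: "('a, 'm) module"
  assumes M: "Module.module A M" and c: "c \<in> carrier (hat_ring A I)"
  shows hat_smult_closed: "x \<in> carrier (Lam A I M) \<Longrightarrow> c \<odot>\<^bsub>Lam_hat A I M\<^esub> x \<in> carrier (Lam A I M)"
    and hat_smult_add: "x \<in> carrier (Lam A I M) \<Longrightarrow> y \<in> carrier (Lam A I M) \<Longrightarrow>
      c \<odot>\<^bsub>Lam_hat A I M\<^esub> (x \<oplus>\<^bsub>Lam A I M\<^esub> y) = (c \<odot>\<^bsub>Lam_hat A I M\<^esub> x) \<oplus>\<^bsub>Lam A I M\<^esub> (c \<odot>\<^bsub>Lam_hat A I M\<^esub> y)"
    and hat_smult_map: "Module.module A N \<Longrightarrow> f \<in> mod_hom A M N \<Longrightarrow> x \<in> carrier (Lam A I M) \<Longrightarrow>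
      Lam_map A I N f (c \<odot>\<^bsub>Lam_hat A I M\<^esub> x) = c \<odot>\<^bsub>Lam_hat A I N\<^esub> Lam_map A I N f x"
proof -
  from hat_ring_lift[OF c] obtain a where a': "\<forall>k. a k \<in> carrier A" and ce: "c = (\<lambda>k. pw k +>\<^bsub>A\<^esub> a k)"
    and as': "\<forall>k. a (Suc k) \<ominus>\<^bsub>A\<^esub> a k \<in> pw k" by (elim exE conjE)
  note a = a'[rule_format] and as = as'[rule_format]
  note L = Lam_simps[OF A I M]
  note T = lam_tensor_module[OF A I M]
  have comp: "(c \<odot>\<^bsub>Lam_hat A I N\<^esub> x) k = a k \<odot>\<^bsub>tensor A (qa k) N\<^esub> x k"
    if "Module.module A N" "x \<in> carrier (Lam A I N)" for k x and N :: "('a, 'z) module"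
  proof -
    have "x k \<in> carrier (tensor A (qa k) N)" using that(2) unfolding Lam_simps[OF A I that(1)] by blast
    then show ?thesis unfolding Lam_hat_simps ce by (rule base_change_smult[OF A pow_ideal[OF A I] that(1) a])
  qed
  show "c \<odot>\<^bsub>Lam_hat A I M\<^esub> x \<in> carrier (Lam A I M)" if x: "x \<in> carrier (Lam A I M)"
  proof -
    have xc: "x k \<in> carrier (tensor A (qa k) M)" "lim_trans A I M k (x (Suc k)) = x k" for k using x unfolding L by blast+
    have "lim_trans A I M k (a (Suc k) \<odot>\<^bsub>tensor A (qa (Suc k)) M\<^esub> x (Suc k)) = a k \<odot>\<^bsub>tensor A (qa k) M\<^esub> x k" for k
    proof -
      interpret Tk: Module.module A "tensor A (qa k) M" by (rule T)
      have "(a (Suc k) \<ominus>\<^bsub>A\<^esub> a k) \<odot>\<^bsub>tensor A (qa k) M\<^esub> x k = \<zero>\<^bsub>tensor A (qa k) M\<^esub>" by (rule pow_smult_zero[OF M as xc(1)])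
      then have "(a (Suc k) \<odot>\<^bsub>tensor A (qa k) M\<^esub> x k) \<ominus>\<^bsub>tensor A (qa k) M\<^esub> (a k \<odot>\<^bsub>tensor A (qa k) M\<^esub> x k) = \<zero>\<^bsub>tensor A (qa k) M\<^esub>"
        using a xc(1)[of k] by (simp only: a_minus_def Tk.smult_l_distr A.a_inv_closed Tk.smult_l_minus)
      then have "a (Suc k) \<odot>\<^bsub>tensor A (qa k) M\<^esub> x k = a k \<odot>\<^bsub>tensor A (qa k) M\<^esub> x k"
        using Tk.M.diff_eq_zero_iff[OF Tk.smult_closed[OF a xc(1)] Tk.smult_closed[OF a xc(1)]] by blast
      then show ?thesis unfolding mod_hom_smult[OF lim_trans_hom[OF A I M] a xc(1)] xc(2) .
    qed
    then show ?thesis unfolding L comp[OF M x] using module.smult_closed[OF T a xc(1)] by blast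
  qed
  show "c \<odot>\<^bsub>Lam_hat A I M\<^esub> (x \<oplus>\<^bsub>Lam A I M\<^esub> y) = (c \<odot>\<^bsub>Lam_hat A I M\<^esub> x) \<oplus>\<^bsub>Lam A I M\<^esub> (c \<odot>\<^bsub>Lam_hat A I M\<^esub> y)"
    if x: "x \<in> carrier (Lam A I M)" and y: "y \<in> carrier (Lam A I M)"
  proof
    fix k
    interpret LM: Module.module A "Lam A I M" by (rule Lam_module[OF A I M])
    have xc: "x k \<in> carrier (tensor A (qa k) M)" "y k \<in> carrier (tensor A (qa k) M)" using x y unfolding L by blast+
    have xy: "(x \<oplus>\<^bsub>Lam A I M\<^esub> y) k = x k \<oplus>\<^bsub>tensor A (qa k) M\<^esub> y k" by (simp only: L)
    have "((c \<odot>\<^bsub>Lam_hat A I M\<^esub> x) \<oplus>\<^bsub>Lam A I M\<^esub> (c \<odot>\<^bsub>Lam_hat A I M\<^esub> y)) k =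
        (a k \<odot>\<^bsub>tensor A (qa k) M\<^esub> x k) \<oplus>\<^bsub>tensor A (qa k) M\<^esub> (a k \<odot>\<^bsub>tensor A (qa k) M\<^esub> y k)"
      unfolding L(2) comp[OF M x] comp[OF M y] ..
    then show "(c \<odot>\<^bsub>Lam_hat A I M\<^esub> (x \<oplus>\<^bsub>Lam A I M\<^esub> y)) k =
        ((c \<odot>\<^bsub>Lam_hat A I M\<^esub> x) \<oplus>\<^bsub>Lam A I M\<^esub> (c \<odot>\<^bsub>Lam_hat A I M\<^esub> y)) k"
      unfolding comp[OF M LM.M.a_closed[OF x y]] xy module.smult_r_distr[OF T a xc] by (rule sym)
  qed
  show "Lam_map A I N f (c \<odot>\<^bsub>Lam_hat A I M\<^esub> x) = c \<odot>\<^bsub>Lam_hat A I N\<^esub> Lam_map A I N f x"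
    if N: "Module.module A N" and f: "f \<in> mod_hom A M N" and x: "x \<in> carrier (Lam A I M)" for N :: "('a, 'n) module" and f
  proof
    fix k
    have xc: "x k \<in> carrier (tensor A (qa k) M)" using x unfolding L by blast
    have "Lam_map A I N f (c \<odot>\<^bsub>Lam_hat A I M\<^esub> x) k = a k \<odot>\<^bsub>tensor A (qa k) N\<^esub> Lam_map A I N f x k"
      unfolding Lam_map_def comp[OF M x] by (rule mod_hom_smult[OF Lam_map_comp_hom[OF A I M N f] a xc])
    also have "\<dots> = (c \<odot>\<^bsub>Lam_hat A I N\<^esub> Lam_map A I N f x) k"
      by (rule comp[OF N mod_hom_closed[OF Lam_map_hom[OF A I M N f] x], symmetric])
    finally show "Lam_map A I N f (c \<odot>\<^bsub>Lam_hat A I M\<^esub> x) k = (c \<odot>\<^bsub>Lam_hat A I N\<^esub> Lam_map A I N f x) k" .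
  qed
qed

definition hat_comb :: "('a, 'm) module \<Rightarrow> ('s \<Rightarrow> nat \<Rightarrow> 'a set) \<Rightarrow> ('s \<Rightarrow> nat \<Rightarrow> ('a set \<times> 'm \<Rightarrow> 'a) set) \<Rightarrow>
    's set \<Rightarrow> nat \<Rightarrow> ('a set \<times> 'm \<Rightarrow> 'a) set"
  where "hat_comb M c x S k = (\<Oplus>\<^bsub>tensor A (qa k) M\<^esub>s\<in>S. (c s \<odot>\<^bsub>Lam_hat A I M\<^esub> x s) k)"

text \<open>Nakayama's lemma for a completed target. The map from combinations of \<open>S\<close> and elements of \<open>N'\<close> to \<open>N\<close> is
  surjective modulo \<open>I\<close>, so \<open>p\<close> has approximations with converging coefficients and converging parts in
  \<open>N'\<close>. After \<open>h\<close> they converge to an equality, because \<open>h\<close> maps \<open>I\<^sup>k\<^sup>+\<^sup>1 N\<close> to zero in the component \<open>k\<close>.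
  The limits of the coefficients lie in the completed ring, and the parts in \<open>N'\<close> have a limit only
  after \<open>h'\<close>, in the completion \<open>\<Lambda>(M')\<close>.\<close>

lemma completed_combination:
  fixes N :: "('a, 'p) module" and N' :: "('a, 'p) module" and M :: "('a, 'm) module" and M' :: "('a, 'm) module"
  assumes N: "Module.module A N" and N': "Module.module A N'" and M: "Module.module A M" and M': "Module.module A M'"
    and d: "d \<in> mod_hom A N' N" and d': "d' \<in> mod_hom A M' M"
    and h: "h \<in> mod_hom A N (Lam A I M)" and h': "h' \<in> mod_hom A N' (Lam A I M')"
    and hd: "\<forall>w\<in>carrier N'. h (d w) = Lam_map A I M d' (h' w)"
    and S: "S \<subseteq> carrier N" "finite S"
    and gen: "\<forall>p\<in>carrier N. \<exists>v\<in>gen_submodule A N S. \<exists>w\<in>carrier N'. (p \<ominus>\<^bsub>N\<^esub> v) \<ominus>\<^bsub>N\<^esub> d w \<in> ideal_mult I N"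
    and p: "p \<in> carrier N"
  shows "\<exists>c y. (\<forall>s\<in>S. c s \<in> carrier (hat_ring A I)) \<and> y \<in> carrier (Lam A I M') \<and>
    h p = (\<lambda>k. hat_comb M c h S k \<oplus>\<^bsub>tensor A (qa k) M\<^esub> Lam_map A I M d' y k)"
proof -
  interpret N: Module.module A N by (rule N)
  interpret N': Module.module A N' by (rule N')
  let ?G = "free_module A S"
  note G = free_module_module(1)[OF A, of S]
  let ?F = "prod_module ?G N'"
  note F = prod_module_module[OF G N']
  have Sc: "s \<in> S \<Longrightarrow> s \<in> carrier N" for s using S(1) by auto
  note l = lin_ext_hom[OF N Sc]
  let ?\<Phi> = "\<lambda>f. lin_ext A N (\<lambda>s. s) (fst f) \<oplus>\<^bsub>N\<^esub> d (snd f)"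
  have \<Phi>: "?\<Phi> \<in> mod_hom A ?F N"
    by (rule mod_hom_sum[OF N mod_hom_comp[OF prod_hom(1) l(1)] mod_hom_comp[OF prod_hom(2) d]]) auto
  have genF: "\<exists>f\<in>carrier ?F. n \<ominus>\<^bsub>N\<^esub> ?\<Phi> f \<in> ideal_mult I N" if n: "n \<in> carrier N" for n
  proof -
    obtain v w where v: "v \<in> gen_submodule A N S" and w: "w \<in> carrier N'" "(n \<ominus>\<^bsub>N\<^esub> v) \<ominus>\<^bsub>N\<^esub> d w \<in> ideal_mult I N"
      using bspec[OF gen n] by blast
    obtain \<alpha> where \<alpha>: "\<alpha> \<in> carrier ?G" "v = lin_ext A N (\<lambda>s. s) \<alpha>" using gen_submodule_lin_ext[OF N S(1) v] by blast
    have vc: "v \<in> carrier N" unfolding \<alpha>(2) by (rule mod_hom_closed[OF l(1) \<alpha>(1)])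
    have dw: "d w \<in> carrier N" by (rule mod_hom_closed[OF d w(1)])
    have "n \<ominus>\<^bsub>N\<^esub> (v \<oplus>\<^bsub>N\<^esub> d w) = (n \<ominus>\<^bsub>N\<^esub> v) \<ominus>\<^bsub>N\<^esub> d w" using n vc dw by algebra
    then show ?thesis using w \<alpha> by (intro bexI[of _ "(\<alpha>, w)"]) auto
  qed
  have "\<exists>f. \<forall>k. f k \<in> carrier ?F \<and> p \<ominus>\<^bsub>N\<^esub> ?\<Phi> (f k) \<in> ideal_mult (pw k) N \<and>
      f (Suc k) \<ominus>\<^bsub>?F\<^esub> f k \<in> ideal_mult (pw k) ?F"
    by (rule nakayama_limit[OF A I F N \<Phi> _ p]) (rule genF)
  then obtain f where f': "\<forall>k. f k \<in> carrier ?F \<and>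
      p \<ominus>\<^bsub>N\<^esub> ?\<Phi> (f k) \<in> ideal_mult (pw k) N \<and> f (Suc k) \<ominus>\<^bsub>?F\<^esub> f k \<in> ideal_mult (pw k) ?F" by (elim exE)
  have fc: "f k \<in> carrier ?F" and fp: "p \<ominus>\<^bsub>N\<^esub> ?\<Phi> (f k) \<in> ideal_mult (pw k) N"
    and fs: "f (Suc k) \<ominus>\<^bsub>?F\<^esub> f k \<in> ideal_mult (pw k) ?F" for k using f'[rule_format, of k] by auto
  define \<alpha> w where "\<alpha> k = fst (f k)" and "w k = snd (f k)" for k
  have \<alpha>: "\<alpha> k \<in> carrier ?G" and w: "w k \<in> carrier N'" for k using fc[of k] by (auto simp: \<alpha>_def w_def)
  have \<alpha>s: "\<alpha> (Suc k) \<ominus>\<^bsub>?G\<^esub> \<alpha> k \<in> ideal_mult (pw k) ?G" and ws: "w (Suc k) \<ominus>\<^bsub>N'\<^esub> w k \<in> ideal_mult (pw k) N'" for k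
    using fs[of k] unfolding prod_module_diff[OF G N' fc fc] ideal_mult_prod[OF G N' pow_ideal[OF A I]]
    by (simp_all add: \<alpha>_def w_def)
  have \<alpha>c: "\<alpha> k s \<in> carrier A" for k s using \<alpha> by (simp add: free_module_simps)
  have \<alpha>ss: "\<alpha> (Suc k) s \<ominus>\<^bsub>A\<^esub> \<alpha> k s \<in> pw k" for k s
  proof -
    note ev = free_module_eval_hom[OF A, of s S]
    have "(\<alpha> (Suc k) \<ominus>\<^bsub>?G\<^esub> \<alpha> k) s \<in> ideal_mult (pw k) (reg A)"
      by (rule ideal_mult_hom[OF G reg_module[OF A] ev pow_ideal[OF A I] \<alpha>s])
    then have "\<alpha> (Suc k) s \<ominus>\<^bsub>reg A\<^esub> \<alpha> k s \<in> pw k"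
      unfolding mod_hom_diff[OF ev G reg_module[OF A] \<alpha> \<alpha>] by (rule ideal_mult_reg[OF A pow_ideal[OF A I]])
    moreover have "\<alpha> (Suc k) s \<ominus>\<^bsub>reg A\<^esub> \<alpha> k s = \<alpha> (Suc k) s \<ominus>\<^bsub>A\<^esub> \<alpha> k s"
      by (simp add: a_minus_def a_inv_def m_inv_def)
    ultimately show ?thesis by simp
  qed
  define c where "c s k = pw k +>\<^bsub>A\<^esub> \<alpha> k s" for s k
  have c: "c s \<in> carrier (hat_ring A I)" for s
    using hat_ring_of_lift[of "\<lambda>k. \<alpha> k s"] \<alpha>c \<alpha>ss by (simp add: c_def[abs_def])
  define y where "y k = h' (w k) k" for k
  have T: "Module.module A (tensor A (qa k) M)" "Module.module A (tensor A (qa k) M')" for k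
    by (rule lam_tensor_module[OF A I M] lam_tensor_module[OF A I M'])+
  have hk: "(\<lambda>x. h x k) \<in> mod_hom A N (tensor A (qa k) M)" for k by (rule mod_hom_comp[OF h Lam_comp_hom[OF A I M]])
  have hk': "(\<lambda>x. h' x k) \<in> mod_hom A N' (tensor A (qa k) M')" for k by (rule mod_hom_comp[OF h' Lam_comp_hom[OF A I M']])
  have y: "y \<in> carrier (Lam A I M')"
    unfolding Lam_simps[OF A I M']
  proof (intro conjI allI)
    show "y k \<in> carrier (tensor A (qa k) M')" for k unfolding y_def by (rule mod_hom_closed[OF hk' w])
    fix k
    interpret Tk: Module.module A "tensor A (qa k) M'" by (rule T)
    have "lim_trans A I M' k (y (Suc k)) = h' (w (Suc k)) k"
      using mod_hom_closed[OF h' w[of "Suc k"]] unfolding y_def Lam_simps[OF A I M'] by blast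
    moreover have "h' (w (Suc k)) k \<ominus>\<^bsub>tensor A (qa k) M'\<^esub> h' (w k) k = \<zero>\<^bsub>tensor A (qa k) M'\<^esub>"
      using Lam_comp_ideal_mult[OF A I M' N' h' ws[of k]] unfolding mod_hom_diff[OF hk' N' T(2) w w] .
    then have "h' (w (Suc k)) k = h' (w k) k"
      using Tk.M.diff_eq_zero_iff[OF mod_hom_closed[OF hk' w] mod_hom_closed[OF hk' w]] by blast
    ultimately show "lim_trans A I M' k (y (Suc k)) = y k" by (simp only: y_def)
  qed
  have "h p k = hat_comb M c h S k \<oplus>\<^bsub>tensor A (qa k) M\<^esub> Lam_map A I M d' y k" for k
  proof -
    interpret Tk: Module.module A "tensor A (qa k) M" by (rule T)
    have lc: "lin_ext A N (\<lambda>s. s) (\<alpha> k) \<in> carrier N" by (rule mod_hom_closed[OF l(1) \<alpha>])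
    have dw: "d (w k) \<in> carrier N" by (rule mod_hom_closed[OF d w])
    have \<Phi>e: "?\<Phi> (f k) = lin_ext A N (\<lambda>s. s) (\<alpha> k) \<oplus>\<^bsub>N\<^esub> d (w k)" by (simp add: \<alpha>_def w_def)
    have \<Phi>c: "?\<Phi> (f k) \<in> carrier N" by (rule mod_hom_closed[OF \<Phi> fc])
    have "h p k \<ominus>\<^bsub>tensor A (qa k) M\<^esub> h (?\<Phi> (f k)) k = \<zero>\<^bsub>tensor A (qa k) M\<^esub>"
      using Lam_comp_ideal_mult[OF A I M N h fp[of k]] unfolding mod_hom_diff[OF hk N T(1) p \<Phi>c] .
    then have "h p k = h (?\<Phi> (f k)) k"
      using Tk.M.diff_eq_zero_iff[OF mod_hom_closed[OF hk p] mod_hom_closed[OF hk \<Phi>c]] by blast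
    also have "\<dots> = h (lin_ext A N (\<lambda>s. s) (\<alpha> k)) k \<oplus>\<^bsub>tensor A (qa k) M\<^esub> h (d (w k)) k"
      unfolding \<Phi>e by (rule mod_hom_add[OF hk lc dw])
    also have "h (d (w k)) k = Lam_map A I M d' y k" unfolding bspec[OF hd w] Lam_map_def y_def ..
    also have "h (lin_ext A N (\<lambda>s. s) (\<alpha> k)) k = hat_comb M c h S k"
    proof -
      have "lin_ext A N (\<lambda>s. s) (\<alpha> k) = (\<Oplus>\<^bsub>N\<^esub>s\<in>S. \<alpha> k s \<odot>\<^bsub>N\<^esub> s)"
        using \<alpha>[of k] by (intro lin_ext_superset[OF N \<alpha> Sc S(2)]) (auto simp: free_module_simps)
      then have "h (lin_ext A N (\<lambda>s. s) (\<alpha> k)) k = (\<Oplus>\<^bsub>tensor A (qa k) M\<^esub>s\<in>S. h (\<alpha> k s \<odot>\<^bsub>N\<^esub> s) k)"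
        using mod_hom_finsum[OF hk N T(1) S(2), of "\<lambda>s. \<alpha> k s \<odot>\<^bsub>N\<^esub> s"] \<alpha>c Sc by simp
      also have "\<dots> = (\<Oplus>\<^bsub>tensor A (qa k) M\<^esub>s\<in>S. (c s \<odot>\<^bsub>Lam_hat A I M\<^esub> h s) k)"
      proof (rule Tk.M.finsum_cong')
        fix s assume s: "s \<in> S"
        have hs: "h s k \<in> carrier (tensor A (qa k) M)" by (rule mod_hom_closed[OF hk Sc[OF s]])
        show "h (\<alpha> k s \<odot>\<^bsub>N\<^esub> s) k = (c s \<odot>\<^bsub>Lam_hat A I M\<^esub> h s) k"
          unfolding mod_hom_smult[OF hk \<alpha>c Sc[OF s]] Lam_hat_simps c_def
          by (rule base_change_smult[OF A pow_ideal[OF A I] M \<alpha>c hs, symmetric])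
      next
        show "(\<lambda>s. (c s \<odot>\<^bsub>Lam_hat A I M\<^esub> h s) k) \<in> S \<rightarrow> carrier (tensor A (qa k) M)"
          using hat_smult_closed[OF M c mod_hom_closed[OF h Sc]] unfolding Lam_simps[OF A I M] by blast
      qed simp
      finally show ?thesis by (simp only: hat_comb_def)
    qed
    finally show ?thesis .
  qed
  then show ?thesis using c y by (intro exI[of _ c] exI[of _ y]) auto
qed

end

section \<open>Generators of the cohomology over the completed ring\<close>

context
  fixes A :: "'a ring" and I :: "'a set" and C :: "('a, 'p) cx"
  assumes A: "cring A" and I: "ideal I A" and C: "cochain_complex A C"
begin

private abbreviation (input) L :: "('a, nat \<Rightarrow> ('a set \<times> 'p \<Rightarrow> 'a) set) cx" where "L \<equiv> Lam_cx A I C"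

lemma hat_comb_empty: "hat_comb A I (obj C i) c x {} = \<zero>\<^bsub>obj L i\<^esub>"
proof
  fix k
  interpret T: Module.module A "tensor A (quot_alg A (ipow A I (k + 1))) (obj C i)"
    by (rule lam_tensor_module[OF A I cx_module[OF C]])
  show "hat_comb A I (obj C i) c x {} k = \<zero>\<^bsub>obj L i\<^esub> k"
    unfolding Lam_cx_simps[OF A I] Lam_simps[OF A I cx_module[OF C]] hat_comb_def[OF A I]
    by (rule T.M.finsum_empty)
qed

lemma hat_comb_insert:
  assumes c: "\<And>s. s \<in> insert s0 S \<Longrightarrow> c s \<in> carrier (hat_ring A I)"
    and x: "\<And>s. s \<in> insert s0 S \<Longrightarrow> x s \<in> carrier (obj L i)"
    and S: "finite S" "s0 \<notin> S"
  shows "hat_comb A I (obj C i) c x (insert s0 S) =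
    (c s0 \<odot>\<^bsub>Lam_hat A I (obj C i)\<^esub> x s0) \<oplus>\<^bsub>obj L i\<^esub> hat_comb A I (obj C i) c x S"
proof
  fix k
  let ?T = "tensor A (quot_alg A (ipow A I (k + 1))) (obj C i)"
  interpret T: Module.module A ?T by (rule lam_tensor_module[OF A I cx_module[OF C]])
  have "c s \<odot>\<^bsub>Lam_hat A I (obj C i)\<^esub> x s \<in> carrier (Lam A I (obj C i))" if "s \<in> insert s0 S" for s
    by (rule hat_smult_closed[OF A I cx_module[OF C] c[OF that]]) (use x[OF that] in \<open>simp add: Lam_cx_simps[OF A I]\<close>)
  then have "(c s \<odot>\<^bsub>Lam_hat A I (obj C i)\<^esub> x s) k \<in> carrier ?T" if "s \<in> insert s0 S" for s
    using that unfolding Lam_simps[OF A I cx_module[OF C]] by blast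
  then show "hat_comb A I (obj C i) c x (insert s0 S) k =
    ((c s0 \<odot>\<^bsub>Lam_hat A I (obj C i)\<^esub> x s0) \<oplus>\<^bsub>obj L i\<^esub> hat_comb A I (obj C i) c x S) k"
    unfolding Lam_cx_simps[OF A I] Lam_simps[OF A I cx_module[OF C]] hat_comb_def[OF A I]
    by (intro T.M.finsum_insert S) auto
qed

lemma hat_comb_closed:
  assumes c: "\<And>s. s \<in> S \<Longrightarrow> c s \<in> carrier (hat_ring A I)"
    and x: "\<And>s. s \<in> S \<Longrightarrow> x s \<in> carrier (obj L i)" and S: "finite S"
  shows "hat_comb A I (obj C i) c x S \<in> carrier (obj L i)"
  using S c x
proof (induction S)
  interpret Li: Module.module A "obj L i" by (rule cx_module[OF Lam_cx_complex[OF A I C]])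
  {
    case empty
    show ?case unfolding hat_comb_empty by (rule Li.M.zero_closed)
  next
    case (insert s S)
    have "c s \<odot>\<^bsub>Lam_hat A I (obj C i)\<^esub> x s \<in> carrier (obj L i)"
      using hat_smult_closed[OF A I cx_module[OF C] insert.prems(1)] insert.prems(2) by (simp add: Lam_cx_simps[OF A I])
    moreover have "hat_comb A I (obj C i) c x S \<in> carrier (obj L i)" using insert by simp
    ultimately show ?case
      using hat_comb_insert[OF insert.prems insert.hyps] by simp
  }
qed

lemma hat_smult_cocycles:
  assumes c: "c \<in> carrier (hat_ring A I)" and x: "x \<in> cocycles L i"
  shows "c \<odot>\<^bsub>Lam_hat A I (obj C i)\<^esub> x \<in> cocycles L i"
proof -
  note M = cx_module[OF C, of i] and M' = cx_module[OF C, of "i + 1"]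
  interpret M': Module.module A "Lam A I (obj C (i + 1))" by (rule Lam_module[OF A I M'])
  let ?z = "\<zero>\<^bsub>Lam A I (obj C (i + 1))\<^esub>"
  have xc: "x \<in> carrier (Lam A I (obj C i))" and dx: "Lam_map A I (obj C (i + 1)) (dif C i) x = ?z"
    using x unfolding cocycles_def Lam_cx_simps[OF A I] by auto
  let ?cz = "c \<odot>\<^bsub>Lam_hat A I (obj C (i + 1))\<^esub> ?z"
  have cz: "?cz \<in> carrier (Lam A I (obj C (i + 1)))" by (rule hat_smult_closed[OF A I M' c M'.M.zero_closed])
  have "?cz \<oplus>\<^bsub>Lam A I (obj C (i + 1))\<^esub> ?cz = ?cz"
    using hat_smult_add[OF A I M' c M'.M.zero_closed M'.M.zero_closed] by simp
  then have "?cz = ?z" using cz by (metis M'.M.add.l_cancel_one)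
  then show ?thesis
    unfolding cocycles_def Lam_cx_simps[OF A I]
    using hat_smult_closed[OF A I M c xc] hat_smult_map[OF A I M c M' cx_dif[OF C] xc] dx by simp
qed

lemma hat_smult_class:
  assumes c: "c \<in> carrier (hat_ring A I)" and x: "x \<in> cocycles L i"
  shows "c \<odot>\<^bsub>cohom (Lam_hat_cx A I C) i\<^esub> cclass L i x = cclass L i (c \<odot>\<^bsub>Lam_hat A I (obj C i)\<^esub> x)"
proof -
  note M = cx_module[OF C]
  have o: "obj (Lam_hat_cx A I C) j = Lam_hat A I (obj C j)" for j by (simp add: Lam_hat_cx_def)
  have "c \<odot>\<^bsub>cohom (Lam_hat_cx A I C) i\<^esub> cclass L i x = cclass L i (c \<odot>\<^bsub>obj (Lam_hat_cx A I C) i\<^esub> x)"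
  proof (rule scalars_cohom_smult)
    show "c \<odot>\<^bsub>obj (Lam_hat_cx A I C) i\<^esub> y \<in> carrier (obj L i)" if "y \<in> carrier (obj L i)" for y
      using hat_smult_closed[OF A I M c] that unfolding o Lam_cx_simps[OF A I] .
    show "c \<odot>\<^bsub>obj (Lam_hat_cx A I C) i\<^esub> (y \<oplus>\<^bsub>obj L i\<^esub> y') =
        (c \<odot>\<^bsub>obj (Lam_hat_cx A I C) i\<^esub> y) \<oplus>\<^bsub>obj L i\<^esub> (c \<odot>\<^bsub>obj (Lam_hat_cx A I C) i\<^esub> y')"
      if "y \<in> carrier (obj L i)" "y' \<in> carrier (obj L i)" for y y'
      using hat_smult_add[OF A I M c] that unfolding o Lam_cx_simps[OF A I] .
    have e: "i - 1 + 1 = i" by simp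
    fix y assume "y \<in> coboundaries L i"
    then obtain w where w: "w \<in> carrier (Lam A I (obj C (i - 1)))" "y = Lam_map A I (obj C i) (dif C (i - 1)) w"
      unfolding coboundaries_def Lam_cx_simps[OF A I] e by (elim imageE)
    have "c \<odot>\<^bsub>Lam_hat A I (obj C i)\<^esub> y = Lam_map A I (obj C i) (dif C (i - 1)) (c \<odot>\<^bsub>Lam_hat A I (obj C (i - 1))\<^esub> w)"
      unfolding w(2) by (rule hat_smult_map[OF A I M c M cx_dif[OF C, of "i - 1", unfolded e] w(1), symmetric])
    then show "c \<odot>\<^bsub>obj (Lam_hat_cx A I C) i\<^esub> y \<in> coboundaries L i"
      unfolding coboundaries_def Lam_cx_simps[OF A I] e o using hat_smult_closed[OF A I M c w(1)] by (rule image_eqI)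
  qed (use Lam_cx_complex[OF A I C] cocycles_closed[OF Lam_cx_complex[OF A I C] x] in
    \<open>simp_all add: o Lam_hat_simps[OF A I] Lam_cx_simps(1)[OF A I]\<close>, simp add: Lam_hat_cx_def)
  then show ?thesis unfolding o .
qed

text \<open>The scalars act on the cohomology of \<open>M\<close> through the bijection \<open>\<theta>\<close>. A subgroup that contains the
  classes of the \<open>x s\<close> and is closed under the transported scalars therefore contains, term by term,
  the class of every combination of the \<open>x s\<close>, and every class is of this form.\<close>

lemma generated_hat:
  fixes M :: "('a, 'm) cx"
  assumes M: "cochain_complex A M"
    and \<theta>: "\<theta> \<in> mod_hom A (cohom M i) (cohom L i)" "bij_betw \<theta> (carrier (cohom M i)) (carrier (cohom L i))"
    and S: "finite S" "card S \<le> r" and x: "\<And>s. s \<in> S \<Longrightarrow> x s \<in> cocycles L i"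
    and gen: "\<And>z. z \<in> cocycles L i \<Longrightarrow> \<exists>c. (\<forall>s\<in>S. c s \<in> carrier (hat_ring A I)) \<and>
      z \<ominus>\<^bsub>obj L i\<^esub> hat_comb A I (obj C i) c x S \<in> coboundaries L i"
  shows "generated_by_le (hat_ring A I) (module_of (carrier (cohom M i)) (ring.add (cohom M i)) \<zero>\<^bsub>cohom M i\<^esub>
    (\<lambda>c X. inv_into (carrier (cohom M i)) \<theta> (c \<odot>\<^bsub>cohom (Lam_hat_cx A I C) i\<^esub> \<theta> X))) r"
    (is "generated_by_le _ ?N r")
proof -
  note Lc = Lam_cx_complex[OF A I C]
  note CM = cohom_module[OF M, of i] and CL = cohom_module[OF Lc, of i]
  interpret N: Module.module A "cohom M i" by (rule CM)
  interpret K: Module.module A "cohom L i" by (rule CL)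
  interpret Li: Module.module A "obj L i" by (rule cx_module[OF Lc])
  let ?g = "inv_into (carrier (cohom M i)) \<theta>"
  have g: "?g \<in> mod_hom A (cohom L i) (cohom M i)" by (rule mod_hom_inv[OF \<theta> CM])
  have \<theta>g: "\<theta> (?g X) = X" if "X \<in> carrier (cohom L i)" for X by (rule bij_betw_inv_into_right[OF \<theta>(2) that])
  have g\<theta>: "?g (\<theta> X) = X" if "X \<in> carrier (cohom M i)" for X by (rule bij_betw_inv_into_left[OF \<theta>(2) that])
  have cl: "cclass L i z \<in> carrier (cohom L i)" if "z \<in> cocycles L i" for z
    using that unfolding cohom_carrier[OF Lc] by blast
  have sm: "c \<odot>\<^bsub>?N\<^esub> ?g (cclass L i z) = ?g (cclass L i (c \<odot>\<^bsub>Lam_hat A I (obj C i)\<^esub> z))"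
    if "c \<in> carrier (hat_ring A I)" "z \<in> cocycles L i" for c z
    by (simp add: module_of_def \<theta>g[OF cl[OF that(2)]] hat_smult_class[OF that])
  have rep: "\<exists>z\<in>cocycles L i. Y = ?g (cclass L i z)" if Y: "Y \<in> carrier (cohom M i)" for Y
    using mod_hom_closed[OF \<theta>(1) Y] g\<theta>[OF Y] unfolding cohom_carrier[OF Lc] by force
  have Nc: "carrier ?N = carrier (cohom M i)" "ring.add ?N = ring.add (cohom M i)" "\<zero>\<^bsub>?N\<^esub> = \<zero>\<^bsub>cohom M i\<^esub>"
    by (simp_all add: module_of_def)
  let ?G = "(\<lambda>s. ?g (cclass L i (x s))) ` S"
  have Gc: "?G \<subseteq> carrier ?N" unfolding Nc using mod_hom_closed[OF g cl[OF x]] by blast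
  have top: "submodule (carrier ?N) (hat_ring A I) ?N"
  proof (rule submodule.intro)
    show "subgroup (carrier ?N) (add_monoid ?N)"
      using subgroup_transfer[OF Nc N.M.add.subgroup_self[simplified]] by (simp add: Nc)
    show "submodule_axioms (carrier ?N) (hat_ring A I) ?N"
    proof
      fix c Y assume c: "c \<in> carrier (hat_ring A I)" and "Y \<in> carrier ?N"
      then obtain z where z: "z \<in> cocycles L i" "Y = ?g (cclass L i z)" using rep unfolding Nc by blast
      show "c \<odot>\<^bsub>?N\<^esub> Y \<in> carrier ?N"
        unfolding z(2) sm[OF c z(1)] Nc by (rule mod_hom_closed[OF g cl[OF hat_smult_cocycles[OF c z(1)]]])
    qed
  qed
  have "Y \<in> H" if H: "submodule H (hat_ring A I) ?N" "?G \<subseteq> H" and Y: "Y \<in> carrier ?N" for H Y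
  proof -
    have H0: "\<zero>\<^bsub>cohom M i\<^esub> \<in> H" and Ha: "a \<in> H \<Longrightarrow> b \<in> H \<Longrightarrow> a \<oplus>\<^bsub>cohom M i\<^esub> b \<in> H" for a b
      using subgroup.one_closed[OF submodule.axioms(1)[OF H(1)]] subgroup.m_closed[OF submodule.axioms(1)[OF H(1)]]
      by (simp_all add: Nc)
    obtain z where z: "z \<in> cocycles L i" "Y = ?g (cclass L i z)" using rep Y unfolding Nc by blast
    obtain c where c: "\<And>s. s \<in> S \<Longrightarrow> c s \<in> carrier (hat_ring A I)"
      and zc: "z \<ominus>\<^bsub>obj L i\<^esub> hat_comb A I (obj C i) c x S \<in> coboundaries L i" using gen[OF z(1)] by blast
    have comb: "hat_comb A I (obj C i) c x S' \<in> cocycles L i \<and> ?g (cclass L i (hat_comb A I (obj C i) c x S')) \<in> H"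
      if "S' \<subseteq> S" for S' using finite_subset[OF that S(1)] that
    proof (induction S')
      case empty
      have "\<zero>\<^bsub>obj L i\<^esub> \<in> cocycles L i"
        by (rule subsetD[OF coboundaries_cocycles[OF Lc]])
          (use subgroup.one_closed[OF submodule.axioms(1)[OF coboundaries_submodule[OF Lc]]] in simp)
      then show ?case using mod_hom_zero[OF g CL CM] H0 by (simp add: hat_comb_empty cohom_zero[OF Lc])
    next
      case (insert s S')
      have s: "s \<in> S" and ih: "hat_comb A I (obj C i) c x S' \<in> cocycles L i"
        "?g (cclass L i (hat_comb A I (obj C i) c x S')) \<in> H" using insert by auto
      have cs: "c s \<odot>\<^bsub>Lam_hat A I (obj C i)\<^esub> x s \<in> cocycles L i" by (rule hat_smult_cocycles[OF c[OF s] x[OF s]])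
      have e: "hat_comb A I (obj C i) c x (insert s S') =
          (c s \<odot>\<^bsub>Lam_hat A I (obj C i)\<^esub> x s) \<oplus>\<^bsub>obj L i\<^esub> hat_comb A I (obj C i) c x S'"
        using insert.prems insert.hyps c x
        by (intro hat_comb_insert) (auto intro!: cocycles_closed[OF Lc])
      have "?g (cclass L i (c s \<odot>\<^bsub>Lam_hat A I (obj C i)\<^esub> x s)) \<in> H"
        unfolding sm[OF c[OF s] x[OF s], symmetric]
        by (rule submodule.smult_closed[OF H(1) c[OF s]]) (use H(2) s in blast)
      then have "?g (cclass L i (hat_comb A I (obj C i) c x (insert s S'))) \<in> H"
        unfolding e cohom_add[OF Lc cs ih(1), symmetric] mod_hom_add[OF g cl[OF cs] cl[OF ih(1)]]
        using ih(2) by (rule Ha)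
      moreover have "hat_comb A I (obj C i) c x (insert s S') \<in> cocycles L i"
        unfolding e using subgroup.m_closed[OF submodule.axioms(1)[OF cocycles_submodule[OF Lc]] cs ih(1)] by simp
      ultimately show ?case by blast
    qed
    have "cclass L i z = cclass L i (hat_comb A I (obj C i) c x S)"
      using cclass_eq_iff[OF Lc cocycles_closed[OF Lc z(1)] cocycles_closed[OF Lc conjunct1[OF comb[OF order.refl]]]] zc
      by blast
    then show "Y \<in> H" using conjunct2[OF comb[OF order.refl]] z(2) by simp
  qed
  then have "gen_submodule (hat_ring A I) ?N ?G = carrier ?N" unfolding gen_submodule_def using top Gc by blast
  moreover have "card ?G \<le> r" using card_image_le[OF S(1)] S(2) by (rule order.trans)
  ultimately show ?thesis unfolding generated_by_le_def using S(1) Gc by blast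
qed

end

section \<open>The supremum of the cohomology\<close>

lemma cohom_sup_exact:
  assumes M: "cochain_complex A M" and s: "cohom_sup M = ereal (of_int b)"
  shows "\<forall>i>b. exact_at M i"
proof (intro allI impI, rule ccontr)
  fix i assume i: "b < i"
  assume "\<not> exact_at M i"
  then have "ereal (of_int i) \<le> cohom_sup M"
    unfolding cohom_sup_def by (intro SUP_upper) (simp add: cohom_nonzero_iff[OF M])
  then show False using s i by simp
qed

text \<open>Over the zero ring every module is zero, and the supremum over the empty set of degrees would be
  \<open>-\<infinity>\<close>.\<close>

lemma cohom_sup_nonzero_ring:
  assumes M: "cochain_complex A M" and s: "cohom_sup M = ereal (of_int b)"
  shows "\<one>\<^bsub>A\<^esub> \<noteq> \<zero>\<^bsub>A\<^esub>"
proof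
  assume one: "\<one>\<^bsub>A\<^esub> = \<zero>\<^bsub>A\<^esub>"
  have "exact_at M i" for i
  proof (rule exact_atI)
    have triv: "x = \<zero>\<^bsub>obj M i\<^esub>" if "x \<in> carrier (obj M i)" for x i
    proof -
      interpret Module.module A "obj M i" by (rule cx_module[OF M])
      have "\<one>\<^bsub>A\<^esub> \<odot>\<^bsub>obj M i\<^esub> x = x" by (rule smult_one[OF that])
      then show ?thesis unfolding one using that by simp
    qed
    fix x assume x: "x \<in> carrier (obj M i)"
    interpret Mi: Module.module A "obj M (i - 1)" by (rule cx_module[OF M])
    have "dif M (i - 1) \<zero>\<^bsub>obj M (i - 1)\<^esub> \<in> carrier (obj M i)"
      by (rule mod_hom_closed[OF cx_dif'[OF M] Mi.M.zero_closed])
    then have "x = dif M (i - 1) \<zero>\<^bsub>obj M (i - 1)\<^esub>" using triv[OF x] triv by metis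
    then show "\<exists>y\<in>carrier (obj M (i - 1)). x = dif M (i - 1) y" by (rule bexI[OF _ Mi.M.zero_closed])
  qed
  then have "{i. cohom_nonzero M i} = {}" by (simp add: cohom_nonzero_iff[OF M])
  then show False using s by (simp add: cohom_sup_def bot_ereal_def)
qed

section \<open>The transported structures on the cohomology\<close>

lemma cohom_map_hom:
  assumes f: "quasi_iso A C D f"
  shows "cohom_map D f i \<in> mod_hom A (cohom C i) (cohom D i)"
    and "bij_betw (cohom_map D f i) (carrier (cohom C i)) (carrier (cohom D i))"
proof -
  note C = quasi_isoD(1)[OF f] and D = quasi_isoD(2)[OF f] and fc = quasi_isoD(3)[OF f]
  show b: "bij_betw (cohom_map D f i) (carrier (cohom C i)) (carrier (cohom D i))"
    using f by (simp add: quasi_iso_def)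
  interpret Ci: Module.module A "obj C i" by (rule cx_module[OF C])
  note cm = cohom_map_class[OF C D fc]
  have cc: "x \<in> carrier (obj C i)" if "x \<in> cocycles C i" for x by (rule cocycles_closed[OF C that])
  have sm: "r \<odot>\<^bsub>cohom E i\<^esub> cclass E i x = cclass E i (r \<odot>\<^bsub>obj E i\<^esub> x)"
    if E: "cochain_complex A E" and "r \<in> carrier A" "x \<in> cocycles E i" for E :: "('a, 'z) cx" and r x
  proof (rule scalars_cohom_smult)
    note s = smult_hom[OF cx_module[OF E] that(2)]
    show "r \<odot>\<^bsub>obj E i\<^esub> x \<in> carrier (obj E i)" if "x \<in> carrier (obj E i)" for x
      using mod_hom_closed[OF s that] .
    show "r \<odot>\<^bsub>obj E i\<^esub> (x \<oplus>\<^bsub>obj E i\<^esub> y) = (r \<odot>\<^bsub>obj E i\<^esub> x) \<oplus>\<^bsub>obj E i\<^esub> (r \<odot>\<^bsub>obj E i\<^esub> y)"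
      if "x \<in> carrier (obj E i)" "y \<in> carrier (obj E i)" for x y using mod_hom_add[OF s that] .
    show "r \<odot>\<^bsub>obj E i\<^esub> x \<in> coboundaries E i" if "x \<in> coboundaries E i" for x
      by (rule submodule.smult_closed[OF coboundaries_submodule[OF E] \<open>r \<in> carrier A\<close> that])
  qed (use E cocycles_closed[OF E that(3)] in simp_all)
  show "cohom_map D f i \<in> mod_hom A (cohom C i) (cohom D i)"
  proof (rule mod_homI)
    show "cohom_map D f i X \<in> carrier (cohom D i)" if "X \<in> carrier (cohom C i)" for X
      using b that by (rule bij_betwE[THEN bspec])
    fix X Y assume "X \<in> carrier (cohom C i)" "Y \<in> carrier (cohom C i)"
    then obtain x y where x: "x \<in> cocycles C i" "X = cclass C i x" and y: "y \<in> cocycles C i" "Y = cclass C i y"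
      unfolding cohom_carrier[OF C] by blast
    show "cohom_map D f i (X \<oplus>\<^bsub>cohom C i\<^esub> Y) = cohom_map D f i X \<oplus>\<^bsub>cohom D i\<^esub> cohom_map D f i Y"
      unfolding x(2) y(2) cohom_add[OF C x(1) y(1)] cm[OF Ci.M.a_closed[OF cc[OF x(1)] cc[OF y(1)]]] cm[OF cc[OF x(1)]]
        cm[OF cc[OF y(1)]] mod_hom_add[OF chain_mapD(1)[OF fc] cc[OF x(1)] cc[OF y(1)]]
      by (rule cohom_add[OF D chain_map_cocycles[OF D C fc x(1)] chain_map_cocycles[OF D C fc y(1)], symmetric])
  next
    fix r X assume r: "r \<in> carrier A" and "X \<in> carrier (cohom C i)"
    then obtain x where x: "x \<in> cocycles C i" "X = cclass C i x" unfolding cohom_carrier[OF C] by blast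
    show "cohom_map D f i (r \<odot>\<^bsub>cohom C i\<^esub> X) = r \<odot>\<^bsub>cohom D i\<^esub> cohom_map D f i X"
      unfolding x(2) sm[OF C r x(1)] cm[OF Ci.smult_closed[OF r cc[OF x(1)]]] cm[OF cc[OF x(1)]]
        mod_hom_smult[OF chain_mapD(1)[OF fc] r cc[OF x(1)]]
      by (rule sm[OF D r chain_map_cocycles[OF D C fc x(1)], symmetric])
  qed
qed

lemma roof_cohom_map:
  assumes f: "quasi_iso A T M f" and g: "quasi_iso A T N g"
  shows "roof_cohom_map M N T f g i \<in> mod_hom A (cohom M i) (cohom N i)"
    and "bij_betw (roof_cohom_map M N T f g i) (carrier (cohom M i)) (carrier (cohom N i))"
proof -
  note T = cohom_module[OF quasi_isoD(1)[OF f]]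
  have e: "roof_cohom_map M N T f g i = (\<lambda>X. cohom_map N g i (inv_into (carrier (cohom T i)) (cohom_map M f i) X))"
    by (rule ext) (rule roof_cohom_map_def)
  show "roof_cohom_map M N T f g i \<in> mod_hom A (cohom M i) (cohom N i)"
    unfolding e by (rule mod_hom_comp[OF mod_hom_inv[OF cohom_map_hom[OF f] T] cohom_map_hom(1)[OF g]])
  show "bij_betw (roof_cohom_map M N T f g i) (carrier (cohom M i)) (carrier (cohom N i))"
    using bij_betw_trans[OF bij_betw_inv_into[OF cohom_map_hom(2)[OF f]] cohom_map_hom(2)[OF g]]
    by (simp add: e comp_def)
qed

text \<open>A K-flat \<open>Q\<close> with \<open>\<tau>\<^sub>Q\<close> a quasi-isomorphism is given. A resolution \<open>P\<close> of \<open>Q\<close> by free modules that is zero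
  above \<open>b\<close> is semi-free, and \<open>\<tau>\<^sub>P\<close> is a quasi-isomorphism too, so \<open>M \<leftarrow> P \<rightarrow> \<Lambda>(P)\<close> is an admissible roof.\<close>

lemma hat_cohom_exists:
  fixes M :: "('a, 'm) cx"
  assumes A: "cring A" and I: "ideal I A" and ne: "\<one>\<^bsub>A\<^esub> \<noteq> \<zero>\<^bsub>A\<^esub>"
    and dc: "derived_complete A I M" and ex: "\<forall>i>b. exact_at M i"
  shows "hat_cohom A I M i \<noteq> {}"
proof -
  obtain Q :: "('a, ('a + 'm) list) cx" and \<rho> where K: "K_flat A Q" and \<rho>: "quasi_iso A Q M \<rho>"
    and tQ: "quasi_iso A Q (Lam_cx A I Q) (tau_cx A I Q)"
    using dc unfolding derived_complete_def K_flat_resolution_def by (elim exE conjE)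
  note Q = quasi_isoD(1)[OF \<rho>]
  \<comment> \<open>Any two distinct letters delimit the code words.\<close>
  obtain \<epsilon> :: "(('a + 'm) list \<times> ('a + 'm) list \<Rightarrow> 'a) \<Rightarrow> ('a + 'm) list" where \<epsilon>: "inj_on \<epsilon> (fin_supp A)"
    using fin_supp_encoding[of "Inl undefined" "Inr undefined" "\<lambda>a. [Inl a]" "\<lambda>x. x", where R = A] by (auto simp: inj_def)
  obtain P :: "('a, ('a + 'm) list) cx" and u where u: "quasi_iso A P Q u"
    and bd: "\<And>i. b < i \<Longrightarrow> carrier (obj P i) = {\<zero>\<^bsub>obj P i\<^esub>}" and free: "\<And>i. is_free A (obj P i)"
    by (rule free_resolution[where b = b, OF Q exact_at_quasi_iso[OF \<rho> ex[rule_format]] \<epsilon> ne]) (assumption, rule that, assumption, simp, simp)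
  note P = quasi_isoD(1)[OF u]
  have tP: "quasi_iso A P (Lam_cx A I P) (tau_cx A I P)"
    by (rule tau_quasi_iso[OF A I u tQ])
      (rule Lam_map_cohom_inj[OF A I P Q quasi_isoD(3)[OF u]], rule cone_exact_mod[OF ne ipow_ideal[OF A I] K u bd free])
  have sf: "semi_free A P" by (rule bounded_free_semi_free[OF P bd free ne])
  have di: "derived_iso A M (Lam_cx A I P) P (\<lambda>i x. \<rho> i (u i x)) (tau_cx A I P)"
    unfolding derived_iso_def by (rule conjI[OF quasi_iso_comp[OF u \<rho>] tP])
  show ?thesis unfolding hat_cohom_def
    by (rule iffD1[OF ex_in_conv], rule exI, rule CollectI, intro exI conjI, rule refl, rule sf, rule di)
qed

text \<open>The generators are known for \<open>(A/I) \<otimes> Q\<close>, the scalars act on \<open>\<Lambda>(C)\<close>, and the two sides are connected only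
  through \<open>Q \<rightarrow> M \<leftarrow> T \<rightarrow> \<Lambda>(C)\<close>. A free resolution \<open>P\<close> of the homotopy pullback of \<open>Q\<close> and \<open>T\<close> over \<open>M\<close> has
  quasi-isomorphisms to both: the generators lift along \<open>P \<rightarrow> Q\<close>, and \<open>H : P \<rightarrow> \<Lambda>(C)\<close> carries them to the
  completion.\<close>

lemma cocycles_generated_hat:
  fixes Q :: "('a, 'q) cx" and T :: "('a, 't) cx" and M :: "('a, 'm) cx" and C :: "('a, 'p) cx"
  assumes A: "cring A" and I: "ideal I A" and ne: "\<one>\<^bsub>A\<^esub> \<noteq> \<zero>\<^bsub>A\<^esub>" and C: "cochain_complex A C"
    and K: "K_flat A Q" and \<rho>: "quasi_iso A Q M \<rho>" and f: "quasi_iso A T M f" and g: "quasi_iso A T (Lam_cx A I C) g"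
    and ex: "\<forall>i>b. exact_at M i"
    and gen: "generated_by_le (A Quot I) (cohom (base_change_cx A I Q) b) r"
  shows "\<exists>(S :: ('a + 'q \<times> 't \<times> 'm) list set) x. finite S \<and> card S \<le> r \<and> (\<forall>s\<in>S. x s \<in> cocycles (Lam_cx A I C) b) \<and>
    (\<forall>z\<in>cocycles (Lam_cx A I C) b. \<exists>c. (\<forall>s\<in>S. c s \<in> carrier (hat_ring A I)) \<and>
      z \<ominus>\<^bsub>obj (Lam_cx A I C) b\<^esub> hat_comb A I (obj C b) c x S \<in> coboundaries (Lam_cx A I C) b)"
proof -
  let ?L = "Lam_cx A I C" and ?W = "pullback Q T M \<rho> f"
  note wQ = pullback_fst[OF \<rho> f] and wT = pullback_snd[OF \<rho> f]
  note Q = quasi_isoD(1)[OF \<rho>] and W = quasi_isoD(1)[OF wQ] and L = Lam_cx_complex[OF A I C]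
  obtain \<epsilon> :: "(('a + 'q \<times> 't \<times> 'm) list \<times> 'q \<times> 't \<times> 'm \<Rightarrow> 'a) \<Rightarrow> ('a + 'q \<times> 't \<times> 'm) list"
    where \<epsilon>: "inj_on \<epsilon> (fin_supp A)"
    using fin_supp_encoding[of "Inl undefined" "Inr undefined" "\<lambda>a. [Inl a]" "\<lambda>x. [Inr x]", where R = A] by (auto simp: inj_def)
  have exW: "exact_at ?W i" if "b < i" for i by (rule exact_at_quasi_iso[OF wQ exact_at_quasi_iso[OF \<rho> ex[rule_format, OF that]]])
  obtain P :: "('a, ('a + 'q \<times> 't \<times> 'm) list) cx" and \<pi> where \<pi>: "quasi_iso A P ?W \<pi>"
    and bd: "\<And>i. b < i \<Longrightarrow> carrier (obj P i) = {\<zero>\<^bsub>obj P i\<^esub>}" and free: "\<And>i. is_free A (obj P i)"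
    by (rule free_resolution[where b = b, OF W exW \<epsilon> ne]) (assumption, rule that, assumption, simp, simp)
  note P = quasi_isoD(1)[OF \<pi>]
  note u = quasi_iso_comp[OF \<pi> wQ] and h = quasi_iso_comp[OF quasi_iso_comp[OF \<pi> wT] g]
  have top: "carrier (obj P (b + 1)) = {\<zero>\<^bsub>obj P (b + 1)\<^esub>}" by (rule bd) simp
  have "\<exists>S \<subseteq> carrier (obj P b). finite S \<and> card S \<le> r \<and>
    (\<forall>p\<in>carrier (obj P b). \<exists>v\<in>gen_submodule A (obj P b) S. \<exists>p'\<in>carrier (obj P (b - 1)).
         (p \<ominus>\<^bsub>obj P b\<^esub> v) \<ominus>\<^bsub>obj P b\<^esub> dif P (b - 1) p' \<in> ideal_mult I (obj P b))"
    by (rule generators_lift[OF A I P Q quasi_isoD(3)[OF u] top _ gen]) (rule cone_exact_mod[OF ne I K u bd free])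
  then obtain S where S: "S \<subseteq> carrier (obj P b)" "finite S" "card S \<le> r"
    and gS: "\<forall>p\<in>carrier (obj P b). \<exists>v\<in>gen_submodule A (obj P b) S. \<exists>p'\<in>carrier (obj P (b - 1)).
         (p \<ominus>\<^bsub>obj P b\<^esub> v) \<ominus>\<^bsub>obj P b\<^esub> dif P (b - 1) p' \<in> ideal_mult I (obj P b)"
    by (elim exE conjE)
  define H where "H = (\<lambda>i x. g i (fst (snd (\<pi> i x))))"
  have H: "quasi_iso A P ?L H" unfolding H_def by (rule h)
  note Hc = quasi_isoD(3)[OF H]
  have coc: "p \<in> cocycles P b" if p: "p \<in> carrier (obj P b)" for p
    unfolding cocycles_def using p mod_hom_closed[OF cx_dif[OF P] p] unfolding top by simp
  have x: "H b s \<in> cocycles ?L b" if "s \<in> S" for s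
    by (rule chain_map_cocycles[OF L P Hc coc]) (use S(1) that in auto)
  have e: "b - 1 + 1 = b" by simp
  have "\<exists>c. (\<forall>s\<in>S. c s \<in> carrier (hat_ring A I)) \<and>
      z \<ominus>\<^bsub>obj ?L b\<^esub> hat_comb A I (obj C b) c (H b) S \<in> coboundaries ?L b" if z: "z \<in> cocycles ?L b" for z
  proof -
    obtain p where p: "p \<in> cocycles P b" "z \<ominus>\<^bsub>obj ?L b\<^esub> H b p \<in> coboundaries ?L b"
      using bspec[OF quasi_isoD(5)[OF H, of b, unfolded cohom_surj_def] z] by (elim bexE)
    have pc: "p \<in> carrier (obj P b)" by (rule cocycles_closed[OF P p(1)])
    have hd: "\<forall>w\<in>carrier (obj P (b - 1)). H b (dif P (b - 1) w) = Lam_map A I (obj C b) (dif C (b - 1)) (H (b - 1) w)"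
      by (rule ballI) (rule chain_mapD'[OF Hc, where i = b, unfolded Lam_cx_simps[OF A I] e])
    note comb = completed_combination[OF A I cx_module[OF P] cx_module[OF P] cx_module[OF C] cx_module[OF C]
        cx_dif'[OF P, of b] cx_dif'[OF C, of b] chain_mapD(1)[OF Hc, of b, unfolded Lam_cx_simps[OF A I]]
        chain_mapD(1)[OF Hc, of "b - 1", unfolded Lam_cx_simps[OF A I]]
        hd S(1,2) gS pc]
    obtain c y where c: "\<forall>s\<in>S. c s \<in> carrier (hat_ring A I)" and y: "y \<in> carrier (Lam A I (obj C (b - 1)))"
      and hp: "H b p = (\<lambda>k. hat_comb A I (obj C b) c (H b) S k
        \<oplus>\<^bsub>tensor A (quot_alg A (ipow A I (k + 1))) (obj C b)\<^esub> Lam_map A I (obj C b) (dif C (b - 1)) y k)"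
      using comb by (elim exE conjE)
    let ?s = "hat_comb A I (obj C b) c (H b) S" and ?d = "Lam_map A I (obj C b) (dif C (b - 1)) y"
    interpret Lb: Module.module A "obj ?L b" by (rule cx_module[OF L])
    have sc: "?s \<in> carrier (obj ?L b)"
      by (rule hat_comb_closed[OF A I C _ _ S(2)]) (use c cocycles_closed[OF L x] in auto)
    have db: "?d \<in> coboundaries ?L b"
      unfolding coboundaries_def Lam_cx_simps[OF A I] e by (rule imageI[OF y])
    have dc: "?d \<in> carrier (obj ?L b)"
      by (rule cocycles_closed[OF L subsetD[OF coboundaries_cocycles[OF L] db]])
    have hp': "H b p = ?s \<oplus>\<^bsub>obj ?L b\<^esub> ?d" unfolding hp Lam_cx_simps[OF A I] Lam_simps[OF A I cx_module[OF C]] ..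
    have zc: "z \<in> carrier (obj ?L b)" by (rule cocycles_closed[OF L z])
    have "z \<ominus>\<^bsub>obj ?L b\<^esub> ?s = (z \<ominus>\<^bsub>obj ?L b\<^esub> H b p) \<oplus>\<^bsub>obj ?L b\<^esub> ?d" unfolding hp' using zc sc dc by algebra
    moreover have "\<dots> \<in> coboundaries ?L b"
      using subgroup.m_closed[OF submodule.axioms(1)[OF coboundaries_submodule[OF L]] p(2) db] by simp
    ultimately show ?thesis using c by auto
  qed
  then show ?thesis using S(2,3) x by (intro exI[of _ S] exI[of _ "H b"]) auto
qed

theorem theorem0p6:
  fixes A :: "'a ring" and \<aa> :: "'a set"
    and M :: "('a, 'm) cx" and i0 :: int and r :: nat
    and A0M :: "('a set, ('a set \<times> 'q \<Rightarrow> 'a) set) cx"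
  assumes "cring A"
    and "weakly_proregular A \<aa>"
    and "derived_complete A \<aa> M"
    and "cohom_sup M = ereal (of_int i0)"
    and "A0M \<in> derived_base_change A \<aa> M"
    and "generated_by_le (A Quot \<aa>) (cohom A0M i0) r"
  shows "hat_cohom A \<aa> M i0 \<noteq> {} \<and>
    (\<forall>H\<in>hat_cohom A \<aa> M i0. generated_by_le (hat_ring A \<aa>) H r)"
proof -
  interpret A: cring A by (rule assms(1))
  obtain as where "set as \<subseteq> carrier A" "\<aa> = Idl\<^bsub>A\<^esub> (set as)"
    using assms(2) unfolding weakly_proregular_def weakly_proregular_seq_def by blast
  then have I: "ideal \<aa> A" using A.genideal_ideal by blast
  have M: "cochain_complex A M" using assms(3) unfolding derived_complete_def by (elim conjE)
  note ne = cohom_sup_nonzero_ring[OF M assms(4)] and ex = cohom_sup_exact[OF M assms(4)]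
  obtain Q :: "('a, 'q) cx" and \<rho> where A0M: "A0M = base_change_cx A \<aa> Q" and K: "K_flat A Q" and \<rho>: "quasi_iso A Q M \<rho>"
    using assms(5) unfolding derived_base_change_def K_flat_resolution_def mem_Collect_eq by (elim exE conjE)
  have "generated_by_le (hat_ring A \<aa>) H r" if "H \<in> hat_cohom A \<aa> M i0" for H
  proof -
    obtain P T :: "('a, ('a, 'm) resol_type) cx" and f g where P: "semi_free A P"
      and f: "quasi_iso A T M f" and g: "quasi_iso A T (Lam_cx A \<aa> P) g"
      and H: "H = module_of (carrier (cohom M i0)) (ring.add (cohom M i0)) \<zero>\<^bsub>cohom M i0\<^esub>
       (\<lambda>c X. inv_into (carrier (cohom M i0)) (roof_cohom_map M (Lam_cx A \<aa> P) T f g i0)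
         (c \<odot>\<^bsub>cohom (Lam_hat_cx A \<aa> P) i0\<^esub> roof_cohom_map M (Lam_cx A \<aa> P) T f g i0 X))"
      using \<open>H \<in> _\<close> unfolding hat_cohom_def derived_iso_def Let_def mem_Collect_eq by (elim exE conjE)
    have Pc: "cochain_complex A P" using P unfolding semi_free_def by blast
    obtain S :: "('a + 'q \<times> ('a, 'm) resol_type \<times> 'm) list set" and x where
      S: "finite S" "card S \<le> r" "\<forall>s\<in>S. x s \<in> cocycles (Lam_cx A \<aa> P) i0"
      and gen: "\<forall>z\<in>cocycles (Lam_cx A \<aa> P) i0. \<exists>c. (\<forall>s\<in>S. c s \<in> carrier (hat_ring A \<aa>)) \<and>
        z \<ominus>\<^bsub>obj (Lam_cx A \<aa> P) i0\<^esub> hat_comb A \<aa> (obj P i0) c x S \<in> coboundaries (Lam_cx A \<aa> P) i0"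
      using cocycles_generated_hat[OF assms(1) I ne Pc K \<rho> f g ex assms(6)[unfolded A0M]] by (elim exE conjE)
    show ?thesis unfolding H by (rule generated_hat[OF assms(1) I Pc M roof_cohom_map[OF f g] S(1,2) bspec[OF S(3)] bspec[OF gen]])
  qed
  then show ?thesis by (intro conjI ballI hat_cohom_exists[OF assms(1) I ne assms(3) ex])
qed

end
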